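(* Let $m,n\in\mathbb{N}\cup\{0\}$, let $q\in\mathbb{C}$ and assume that $$q\,P_{S_{m+1}}(q)\,P_{S_{n+1}}(q)\neq 0.$$ Then the $\mathbb{C}$-algebra homomorphism $$\bigoplus_{(\lambda,\mu)\in\Lambda_{H_q(S_{m+1})}\times\Lambda_{H_q(S_{n+1})}}\rho^{A(m,n)}_{q;\lambda,\mu}:\ H_q(A(m,n))\to\bigoplus_{(\lambda,\mu)\in\Lambda_{H_q(S_{m+1})}\times\Lambda_{H_q(S_{n+1})}}\mathrm{End}_{\mathbb{C}}(C^{A(m,n)}_{q;\lambda,\mu})$$ is an isomorphism. Further, $$\dim H_q(A(m,n))=\frac{((m+n+2)!)^2}{(m+1)!\,(n+1)!}.$$ Moreover $H_q(A(m,n))$ is a semisimple $\mathbb{C}$-algebra, and a complete set of non-equivalent irreducible representations of $H_q(A(m,n))$ is given by $\{\rho^{A(m,n)}_{q;\lambda,\mu}\mid(\lambda,\mu)\in\Lambda_{H_q(S_{m+1})}\times\Lambda_{H_q(S_{n+1})}\}$.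
   Context: Algebras and algebra homomorphisms are unital. Hecke algebra of the symmetric group: $H_q(S_{k+1})$ ($k\ge0$) is the $\mathbb{C}$-algebra generated by $T_1,\dots,T_k$ with relations $(T_i-q)(T_i+1)=0$, $T_iT_{i+1}T_i=T_{i+1}T_iT_{i+1}$, $T_iT_j=T_jT_i$ for $|i-j|\ge2$ (so $H_q(S_1)=\mathbb{C}$). $P_{S_{k+1}}(q)=\sum_{w\in S_{k+1}}q^{\ell(w)}$ is the Poincaré polynomial, $\ell$ being the Coxeter length. Fix a complete set of non-equivalent irreducible representations $\rho_{H_q(S_{k+1}),\lambda}:H_q(S_{k+1})\to\mathrm{End}_{\mathbb{C}}(V_{H_q(S_{k+1}),\lambda})$, $\lambda\in\Lambda_{H_q(S_{k+1})}$. The set $\mathcal{D}_{m+1|n+1}$: all $d=(p_1,\dots,p_{m+n+2})\in\{0,1\}^{m+n+2}$ with $\sum_i p_i=n+1$. The symmetric group $S_{m+n+2}$ acts on it by $\sigma\triangleright(p_1,\dots,p_{m+n+2})=(p_{\sigma^{-1}(1)},\dots,p_{\sigma^{-1}(m+n+2)})$; $\sigma_i=(i,i+1)$. The algebra $H_q(A(m,n))$: the $\mathbb{C}$-algebra generated by $E_d$ and $T_{i,d}$ ($d\in\mathcal{D}_{m+1|n+1}$, $1\le i\le m+n+1$) with defining relations $E_d^2=E_d$; $E_{\sigma_i\triangleright d}T_{i,d}E_d=T_{i,d}$; $\sum_dE_d=1$; $E_dE_{d'}=0$ if $d\ne d'$; $(T_{i,d}-qE_d)(T_{i,d}+E_d)=0$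 if $\sigma_i\triangleright d=d$; $T_{i,\sigma_i\triangleright d}T_{i,d}=E_d$ if $\sigma_i\triangleright d\ne d$; $T_{i,\sigma_j\sigma_i\triangleright d}T_{j,\sigma_i\triangleright d}T_{i,d}=T_{j,\sigma_i\sigma_j\triangleright d}T_{i,\sigma_j\triangleright d}T_{j,d}$ if $|i-j|=1$; $T_{i,\sigma_j\triangleright d}T_{j,d}=T_{j,\sigma_i\triangleright d}T_{i,d}$ if $|i-j|\ge2$. Permutations $\tau_{\pm,d}\in S_{m+n+2}$ for $d=(p_1,\dots,p_{m+n+2})\in\mathcal{D}_{m+1|n+1}$: $\tau_{+,d}$ is the unique permutation with $p_{\tau_{+,d}(i)}=0$ for $1\le i\le m+1$, $p_{\tau_{+,d}(i)}=1$ for $m+2\le i\le m+n+2$, and increasing on each of these two intervals; $\tau_{-,d}$ is the unique permutation with $p_{\tau_{-,d}(i)}=1$ for $1\le i\le n+1$, $p_{\tau_{-,d}(i)}=0$ for $n+2\le i\le m+n+2$, and increasing on each of these two intervals. The representations: given representations ${\bf l}:H_q(S_{m+1})\to\mathrm{End}_{\mathbb{C}}(V)$, ${\bf r}:H_q(S_{n+1})\to\mathrm{End}_{\mathbb{C}}(U)$ on finite dimensional spaces, let $C=\bigoplus_{d\in\mathcal{D}_{m+1|n+1}}C_d$ with each $C_d$ a copy of $V\otimes U$, and let $P_d:C\to C_d$, $\iota_d:C_d\to C$ be the canonical projection and inclusion; all $C_d$ are identified with $V\otimes U$, so that $\iota_{d'}\circ P_d$ makes sense as an endomorphism of $C$ for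 any $d,d'$. Then ${\bf l}\boxtimes^{A(m,n)}{\bf r}:H_q(A(m,n))\to\mathrm{End}_{\mathbb{C}}(C)$ is the algebra homomorphism with $E_d\mapsto\iota_d\circ P_d$ and, for $d=(p_1,\dots,p_{m+n+2})$, $$T_{i,d}\mapsto\begin{cases}\iota_{\sigma_i\triangleright d}\circ P_d&\text{if }p_i\ne p_{i+1},\\ \iota_d\circ({\bf l}(T_{\tau_{+,d}^{-1}(i)})\otimes\mathrm{id}_U)\circ P_d&\text{if }p_i=p_{i+1}=0,\\ \iota_d\circ(\mathrm{id}_V\otimes{\bf r}(T_{\tau_{-,d}^{-1}(i)}))\circ P_d&\text{if }p_i=p_{i+1}=1.\end{cases}$$ For $\lambda\in\Lambda_{H_q(S_{m+1})}$, $\mu\in\Lambda_{H_q(S_{n+1})}$, $\rho^{A(m,n)}_{q;\lambda,\mu}:=\rho_{H_q(S_{m+1}),\lambda}\boxtimes^{A(m,n)}\rho_{H_q(S_{n+1}),\mu}$, and $C^{A(m,n)}_{q;\lambda,\mu}$ denotes its representation space $C$ (with $V=V_{H_q(S_{m+1}),\lambda}$, $U=V_{H_q(S_{n+1}),\mu}$). *)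

theory Defs
  imports
    Complex_Main
    "Jordan_Normal_Form.VS_Connect"
    "HOL-Algebra.QuotRing"
    "HOL-Combinatorics.Permutations"
begin

text \<open>
  Vector spaces over \<open>\<complex>\<close> are HOL-Algebra module records over \<^term>\<open>class_ring :: complex ring\<close>;
  the fields \<open>mult\<close> and \<open>one\<close> of such a record carry no meaning for a mere vector space.
  The same record type is used for (non-commutative, unital) complex algebras.
\<close>

abbreviation Cx :: "complex ring" where
  "Cx \<equiv> class_ring"

type_synonym 'a cspace = "(complex, 'a) module"


section \<open>Complex algebras and their representations\<close>

definition complex_algebra :: "'a cspace \<Rightarrow> bool" where
  "complex_algebra A \<longleftrightarrow> vectorspace Cx A \<and> ring A \<and>
     (\<forall>c. \<forall>x\<in>carrier A. \<forall>y\<in>carrier A.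
        (c \<odot>\<^bsub>A\<^esub> x) \<otimes>\<^bsub>A\<^esub> y = c \<odot>\<^bsub>A\<^esub> (x \<otimes>\<^bsub>A\<^esub> y) \<and>
        x \<otimes>\<^bsub>A\<^esub> (c \<odot>\<^bsub>A\<^esub> y) = c \<odot>\<^bsub>A\<^esub> (x \<otimes>\<^bsub>A\<^esub> y))"

definition algebra_hom :: "'a cspace \<Rightarrow> 'b cspace \<Rightarrow> ('a \<Rightarrow> 'b) set" where
  "algebra_hom A B =
     {h \<in> Ring.ring_hom A B. \<forall>c. \<forall>x\<in>carrier A. h (c \<odot>\<^bsub>A\<^esub> x) = c \<odot>\<^bsub>B\<^esub> h x}"

definition algebra_iso :: "'a cspace \<Rightarrow> 'b cspace \<Rightarrow> ('a \<Rightarrow> 'b) set" where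
  "algebra_iso A B = {h \<in> algebra_hom A B. bij_betw h (carrier A) (carrier B)}"

definition End_alg :: "'v cspace \<Rightarrow> ('v \<Rightarrow> 'v) cspace" where
  "End_alg V =
     \<lparr>carrier = LinearCombinations.module_hom Cx V V \<inter> extensional (carrier V),
      mult = (\<lambda>f g. compose (carrier V) f g),
      one = (\<lambda>v\<in>carrier V. v),
      zero = (\<lambda>v\<in>carrier V. \<zero>\<^bsub>V\<^esub>),
      add = (\<lambda>f g. \<lambda>v\<in>carrier V. f v \<oplus>\<^bsub>V\<^esub> g v),
      smult = (\<lambda>c f. \<lambda>v\<in>carrier V. c \<odot>\<^bsub>V\<^esub> f v)\<rparr>"

definition representation :: "'a cspace \<Rightarrow> 'v cspace \<Rightarrow> ('a \<Rightarrow> 'v \<Rightarrow> 'v) \<Rightarrow> bool" where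
  "representation A V \<rho> \<longleftrightarrow> vectorspace Cx V \<and> \<rho> \<in> algebra_hom A (End_alg V)"

definition invariant_subspace ::
    "'a cspace \<Rightarrow> 'v cspace \<Rightarrow> ('a \<Rightarrow> 'v \<Rightarrow> 'v) \<Rightarrow> 'v set \<Rightarrow> bool" where
  "invariant_subspace A V \<rho> W \<longleftrightarrow>
     VectorSpace.subspace Cx W V \<and> (\<forall>a\<in>carrier A. \<forall>w\<in>W. \<rho> a w \<in> W)"

definition irreducible_rep :: "'a cspace \<Rightarrow> 'v cspace \<Rightarrow> ('a \<Rightarrow> 'v \<Rightarrow> 'v) \<Rightarrow> bool" where
  "irreducible_rep A V \<rho> \<longleftrightarrow>
     representation A V \<rho> \<and> carrier V \<noteq> {\<zero>\<^bsub>V\<^esub>} \<and>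
     (\<forall>W. invariant_subspace A V \<rho> W \<longrightarrow> W = {\<zero>\<^bsub>V\<^esub>} \<or> W = carrier V)"

definition equivalent_reps ::
    "'a cspace \<Rightarrow> 'v cspace \<Rightarrow> ('a \<Rightarrow> 'v \<Rightarrow> 'v) \<Rightarrow> 'w cspace \<Rightarrow> ('a \<Rightarrow> 'w \<Rightarrow> 'w) \<Rightarrow> bool" where
  "equivalent_reps A V \<rho> W \<pi> \<longleftrightarrow>
     (\<exists>\<phi>\<in>LinearCombinations.module_hom Cx V W. bij_betw \<phi> (carrier V) (carrier W) \<and>
        (\<forall>a\<in>carrier A. \<forall>v\<in>carrier V. \<phi> (\<rho> a v) = \<pi> a (\<phi> v)))"

text \<open>
  Completeness quantifies over all irreducible representations on spaces whose vectors have
  type \<open>'w\<close>; HOL cannot quantify over types, so \<open>'w\<close> is an explicit parameter. No finiteness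
  of dimension is imposed on these spaces. When every irreducible representation of \<open>A\<close> is
  finite dimensional, \<open>'w = nat \<Rightarrow> complex\<close> already accounts for all of them up to equivalence.
\<close>

definition complete_irreps ::
    "'w itself \<Rightarrow> 'a cspace \<Rightarrow> 'l set \<Rightarrow> ('l \<Rightarrow> 'v cspace) \<Rightarrow> ('l \<Rightarrow> 'a \<Rightarrow> 'v \<Rightarrow> 'v) \<Rightarrow> bool" where
  "complete_irreps _ A \<Lambda> V \<rho> \<longleftrightarrow>
     (\<forall>i\<in>\<Lambda>. irreducible_rep A (V i) (\<rho> i)) \<and>
     (\<forall>i\<in>\<Lambda>. \<forall>j\<in>\<Lambda>. i \<noteq> j \<longrightarrow> \<not> equivalent_reps A (V i) (\<rho> i) (V j) (\<rho> j)) \<and>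
     (\<forall>(W :: 'w cspace) \<pi>. irreducible_rep A W \<pi> \<longrightarrow>
        (\<exists>i\<in>\<Lambda>. equivalent_reps A (V i) (\<rho> i) W \<pi>))"

definition completely_reducible :: "'a cspace \<Rightarrow> 'v cspace \<Rightarrow> ('a \<Rightarrow> 'v \<Rightarrow> 'v) \<Rightarrow> bool" where
  "completely_reducible A V \<rho> \<longleftrightarrow>
     representation A V \<rho> \<and>
     (\<forall>W. invariant_subspace A V \<rho> W \<longrightarrow>
        (\<exists>W'. invariant_subspace A V \<rho> W' \<and> W \<inter> W' = {\<zero>\<^bsub>V\<^esub>} \<and> W <+>\<^bsub>V\<^esub> W' = carrier V))"

text \<open>Semisimplicity: the left regular module is semisimple.\<close>

definition semisimple_algebra :: "'a cspace \<Rightarrow> bool" where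
  "semisimple_algebra A \<longleftrightarrow>
     complex_algebra A \<and> completely_reducible A A (\<lambda>a. \<lambda>x\<in>carrier A. a \<otimes>\<^bsub>A\<^esub> x)"


section \<open>Direct sums, quotients, free spaces and tensor products\<close>

text \<open>For algebras, this is unital (and the product of the summands) only if \<open>I\<close> is finite.\<close>

definition dsum :: "'i set \<Rightarrow> ('i \<Rightarrow> 'a cspace) \<Rightarrow> ('i \<Rightarrow> 'a) cspace" where
  "dsum I M =
     \<lparr>carrier = {f \<in> (\<Pi>\<^sub>E i\<in>I. carrier (M i)). finite {i\<in>I. f i \<noteq> \<zero>\<^bsub>M i\<^esub>}},
      mult = (\<lambda>f g. \<lambda>i\<in>I. f i \<otimes>\<^bsub>M i\<^esub> g i),
      one = (\<lambda>i\<in>I. \<one>\<^bsub>M i\<^esub>),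
      zero = (\<lambda>i\<in>I. \<zero>\<^bsub>M i\<^esub>),
      add = (\<lambda>f g. \<lambda>i\<in>I. f i \<oplus>\<^bsub>M i\<^esub> g i),
      smult = (\<lambda>c f. \<lambda>i\<in>I. c \<odot>\<^bsub>M i\<^esub> f i)\<rparr>"

definition dsum_incl :: "'i set \<Rightarrow> ('i \<Rightarrow> 'a cspace) \<Rightarrow> 'i \<Rightarrow> 'a \<Rightarrow> ('i \<Rightarrow> 'a)" where
  "dsum_incl I M i v = (\<lambda>j\<in>I. if j = i then v else \<zero>\<^bsub>M j\<^esub>)"

definition dsum_proj :: "'i \<Rightarrow> ('i \<Rightarrow> 'a) \<Rightarrow> 'a" where
  "dsum_proj i x = x i"

text \<open>
  The quotient of an algebra by a two-sided ideal, or of a vector space by a subspace (in which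
  case the multiplication inherited from \<^const>\<open>FactRing\<close> is meaningless).
\<close>

definition quotient_space :: "'a cspace \<Rightarrow> 'a set \<Rightarrow> 'a set cspace" where
  "quotient_space M N =
     ring.extend (M Quot N) (module.fields (\<lambda>c X. \<Union>x\<in>X. N +>\<^bsub>M\<^esub> (c \<odot>\<^bsub>M\<^esub> x)))"

definition free_space :: "'s set \<Rightarrow> ('s \<Rightarrow> complex) cspace" where
  "free_space S =
     \<lparr>carrier = {f. finite {s. f s \<noteq> 0} \<and> {s. f s \<noteq> 0} \<subseteq> S},
      mult = undefined,
      one = undefined,
      zero = (\<lambda>_. 0),
      add = (\<lambda>f g s. f s + g s),
      smult = (\<lambda>c f s. c * f s)\<rparr>"

definition single :: "'s \<Rightarrow> ('s \<Rightarrow> complex)" where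
  "single s = (\<lambda>t. if t = s then 1 else 0)"

definition tensor_null :: "'v cspace \<Rightarrow> 'u cspace \<Rightarrow> ('v \<times> 'u \<Rightarrow> complex) set" where
  "tensor_null V U = (let F = free_space (carrier V \<times> carrier U) in
     LinearCombinations.module.span Cx F
       ({single (v \<oplus>\<^bsub>V\<^esub> v', u) \<ominus>\<^bsub>F\<^esub> (single (v, u) \<oplus>\<^bsub>F\<^esub> single (v', u)) | v v' u.
            v \<in> carrier V \<and> v' \<in> carrier V \<and> u \<in> carrier U} \<union>
        {single (v, u \<oplus>\<^bsub>U\<^esub> u') \<ominus>\<^bsub>F\<^esub> (single (v, u) \<oplus>\<^bsub>F\<^esub> single (v, u')) | v u u'.
            v \<in> carrier V \<and> u \<in> carrier U \<and> u' \<in> carrier U} \<union>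
        {single (c \<odot>\<^bsub>V\<^esub> v, u) \<ominus>\<^bsub>F\<^esub> c \<odot>\<^bsub>F\<^esub> single (v, u) | c v u.
            v \<in> carrier V \<and> u \<in> carrier U} \<union>
        {single (v, c \<odot>\<^bsub>U\<^esub> u) \<ominus>\<^bsub>F\<^esub> c \<odot>\<^bsub>F\<^esub> single (v, u) | c v u.
            v \<in> carrier V \<and> u \<in> carrier U}))"

definition tensor :: "'v cspace \<Rightarrow> 'u cspace \<Rightarrow> ('v \<times> 'u \<Rightarrow> complex) set cspace" where
  "tensor V U = quotient_space (free_space (carrier V \<times> carrier U)) (tensor_null V U)"

definition pure_tensor ::
    "'v cspace \<Rightarrow> 'u cspace \<Rightarrow> 'v \<Rightarrow> 'u \<Rightarrow> ('v \<times> 'u \<Rightarrow> complex) set" where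
  "pure_tensor V U v u =
     tensor_null V U +>\<^bsub>free_space (carrier V \<times> carrier U)\<^esub> single (v, u)"

definition tensor_map :: "'v cspace \<Rightarrow> 'u cspace \<Rightarrow> ('v \<Rightarrow> 'v) \<Rightarrow> ('u \<Rightarrow> 'u) \<Rightarrow>
    ('v \<times> 'u \<Rightarrow> complex) set \<Rightarrow> ('v \<times> 'u \<Rightarrow> complex) set" where
  "tensor_map V U f g =
     (THE h. h \<in> carrier (End_alg (tensor V U)) \<and>
        (\<forall>v\<in>carrier V. \<forall>u\<in>carrier U. h (pure_tensor V U v u) = pure_tensor V U (f v) (g u)))"


section \<open>Algebras given by generators and relations\<close>

text \<open>The free algebra has the words over \<open>S\<close> as basis, multiplied by concatenation.\<close>

definition free_algebra :: "'g set \<Rightarrow> ('g list \<Rightarrow> complex) cspace" where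
  "free_algebra S = (free_space (lists S))
     \<lparr>mult := (\<lambda>f g w. \<Sum>i\<le>length w. f (take i w) * g (drop i w)),
      one := single []\<rparr>"

definition free_gen :: "'g \<Rightarrow> ('g list \<Rightarrow> complex)" where
  "free_gen s = single [s]"

text \<open>A relation \<open>x = y\<close> is given as the pair \<open>(x, y)\<close> of elements of the free algebra.\<close>

type_synonym 'g relations = "(('g list \<Rightarrow> complex) \<times> ('g list \<Rightarrow> complex)) set"

definition relation_ideal :: "'g set \<Rightarrow> 'g relations \<Rightarrow> ('g list \<Rightarrow> complex) set" where
  "relation_ideal S R =
     Idl\<^bsub>free_algebra S\<^esub> {x \<ominus>\<^bsub>free_algebra S\<^esub> y | x y. (x, y) \<in> R}"

definition presented_algebra :: "'g set \<Rightarrow> 'g relations \<Rightarrow> ('g list \<Rightarrow> complex) set cspace" where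
  "presented_algebra S R = quotient_space (free_algebra S) (relation_ideal S R)"

definition presented_gen :: "'g set \<Rightarrow> 'g relations \<Rightarrow> 'g \<Rightarrow> ('g list \<Rightarrow> complex) set" where
  "presented_gen S R s = relation_ideal S R +>\<^bsub>free_algebra S\<^esub> free_gen s"


section \<open>The Hecke algebra of the symmetric group\<close>

abbreviation adj_swap :: "nat \<Rightarrow> nat \<Rightarrow> nat" where
  "adj_swap i \<equiv> Transposition.transpose i (i + 1)"

definition coxeter_length :: "nat \<Rightarrow> (nat \<Rightarrow> nat) \<Rightarrow> nat" where
  "coxeter_length k w =
     (LEAST r. \<exists>is. length is = r \<and> set is \<subseteq> {1..k} \<and> w = foldr (\<circ>) (map adj_swap is) id)"

text \<open>The Poincare polynomial of \<open>S\<^bsub>k+1\<^esub>\<close>, evaluated at \<open>q\<close>.\<close>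

definition poincare :: "nat \<Rightarrow> complex \<Rightarrow> complex" where
  "poincare k q = (\<Sum>w | w permutes {1..k+1}. q ^ coxeter_length k w)"

definition hecke_relations :: "complex \<Rightarrow> nat \<Rightarrow> nat relations" where
  "hecke_relations q k = (let F = free_algebra {1..k}; T = free_gen in
     {((T i \<ominus>\<^bsub>F\<^esub> q \<odot>\<^bsub>F\<^esub> \<one>\<^bsub>F\<^esub>) \<otimes>\<^bsub>F\<^esub> (T i \<oplus>\<^bsub>F\<^esub> \<one>\<^bsub>F\<^esub>), \<zero>\<^bsub>F\<^esub>) | i. i \<in> {1..k}} \<union>
     {(T i \<otimes>\<^bsub>F\<^esub> T (i+1) \<otimes>\<^bsub>F\<^esub> T i, T (i+1) \<otimes>\<^bsub>F\<^esub> T i \<otimes>\<^bsub>F\<^esub> T (i+1)) | i.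
         i \<in> {1..k} \<and> i + 1 \<in> {1..k}} \<union>
     {(T i \<otimes>\<^bsub>F\<^esub> T j, T j \<otimes>\<^bsub>F\<^esub> T i) | i j.
         i \<in> {1..k} \<and> j \<in> {1..k} \<and> \<bar>int i - int j\<bar> \<ge> 2})"

text \<open>\<open>hecke_algebra q k\<close> is \<open>H\<^sub>q(S\<^bsub>k+1\<^esub>)\<close>.\<close>

definition hecke_algebra :: "complex \<Rightarrow> nat \<Rightarrow> (nat list \<Rightarrow> complex) set cspace" where
  "hecke_algebra q k = presented_algebra {1..k} (hecke_relations q k)"

definition hecke_T :: "complex \<Rightarrow> nat \<Rightarrow> nat \<Rightarrow> (nat list \<Rightarrow> complex) set" where
  "hecke_T q k i = presented_gen {1..k} (hecke_relations q k) i"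


section \<open>The Hecke algebra of type \<open>A(m,n)\<close>\<close>

text \<open>Tuples \<open>(p\<^sub>1, \<dots>, p\<^bsub>m+n+2\<^esub>)\<close> are extensional functions on \<open>{1..m+n+2}\<close>.\<close>

definition Dset :: "nat \<Rightarrow> nat \<Rightarrow> (nat \<Rightarrow> nat) set" where
  "Dset m n = {d \<in> {1..m+n+2} \<rightarrow>\<^sub>E {0, 1}. (\<Sum>i\<in>{1..m+n+2}. d i) = n + 1}"

definition act :: "(nat \<Rightarrow> nat) \<Rightarrow> (nat \<Rightarrow> nat) \<Rightarrow> (nat \<Rightarrow> nat)" (infixr \<open>\<triangleright>\<close> 75) where
  "\<sigma> \<triangleright> d = d \<circ> inv_into UNIV \<sigma>"

datatype agen = GenE "nat \<Rightarrow> nat" | GenT nat "nat \<Rightarrow> nat"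

definition A_gens :: "nat \<Rightarrow> nat \<Rightarrow> agen set" where
  "A_gens m n = {GenE d | d. d \<in> Dset m n} \<union>
     {GenT i d | i d. i \<in> {1..m+n+1} \<and> d \<in> Dset m n}"

definition A_relations :: "complex \<Rightarrow> nat \<Rightarrow> nat \<Rightarrow> agen relations" where
  "A_relations q m n =
    (let F = free_algebra (A_gens m n); D = Dset m n; I = {1..m+n+1}; s = adj_swap;
         E = (\<lambda>d. free_gen (GenE d)); T = (\<lambda>i d. free_gen (GenT i d)) in
     {(E d \<otimes>\<^bsub>F\<^esub> E d, E d) | d. d \<in> D} \<union>
     {(E (s i \<triangleright> d) \<otimes>\<^bsub>F\<^esub> T i d \<otimes>\<^bsub>F\<^esub> E d, T i d) | i d. i \<in> I \<and> d \<in> D} \<union>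
     {(\<Oplus>\<^bsub>F\<^esub>d\<in>D. E d, \<one>\<^bsub>F\<^esub>)} \<union>
     {(E d \<otimes>\<^bsub>F\<^esub> E d', \<zero>\<^bsub>F\<^esub>) | d d'. d \<in> D \<and> d' \<in> D \<and> d \<noteq> d'} \<union>
     {((T i d \<ominus>\<^bsub>F\<^esub> q \<odot>\<^bsub>F\<^esub> E d) \<otimes>\<^bsub>F\<^esub> (T i d \<oplus>\<^bsub>F\<^esub> E d), \<zero>\<^bsub>F\<^esub>) | i d.
         i \<in> I \<and> d \<in> D \<and> s i \<triangleright> d = d} \<union>
     {(T i (s i \<triangleright> d) \<otimes>\<^bsub>F\<^esub> T i d, E d) | i d. i \<in> I \<and> d \<in> D \<and> s i \<triangleright> d \<noteq> d} \<union>
     {(T i (s j \<triangleright> s i \<triangleright> d) \<otimes>\<^bsub>F\<^esub> T j (s i \<triangleright> d) \<otimes>\<^bsub>F\<^esub> T i d,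
       T j (s i \<triangleright> s j \<triangleright> d) \<otimes>\<^bsub>F\<^esub> T i (s j \<triangleright> d) \<otimes>\<^bsub>F\<^esub> T j d) | i j d.
         i \<in> I \<and> j \<in> I \<and> d \<in> D \<and> \<bar>int i - int j\<bar> = 1} \<union>
     {(T i (s j \<triangleright> d) \<otimes>\<^bsub>F\<^esub> T j d, T j (s i \<triangleright> d) \<otimes>\<^bsub>F\<^esub> T i d) | i j d.
         i \<in> I \<and> j \<in> I \<and> d \<in> D \<and> \<bar>int i - int j\<bar> \<ge> 2})"

definition A_algebra :: "complex \<Rightarrow> nat \<Rightarrow> nat \<Rightarrow> (agen list \<Rightarrow> complex) set cspace" where
  "A_algebra q m n = presented_algebra (A_gens m n) (A_relations q m n)"

definition A_E :: "complex \<Rightarrow> nat \<Rightarrow> nat \<Rightarrow> (nat \<Rightarrow> nat) \<Rightarrow> (agen list \<Rightarrow> complex) set" where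
  "A_E q m n d = presented_gen (A_gens m n) (A_relations q m n) (GenE d)"

definition A_T :: "complex \<Rightarrow> nat \<Rightarrow> nat \<Rightarrow> nat \<Rightarrow> (nat \<Rightarrow> nat) \<Rightarrow> (agen list \<Rightarrow> complex) set" where
  "A_T q m n i d = presented_gen (A_gens m n) (A_relations q m n) (GenT i d)"


section \<open>The representations \<open>l \<boxtimes> r\<close>\<close>

definition tau_plus :: "nat \<Rightarrow> nat \<Rightarrow> (nat \<Rightarrow> nat) \<Rightarrow> (nat \<Rightarrow> nat)" where
  "tau_plus m n d = (THE \<tau>. \<tau> permutes {1..m+n+2} \<and>
     (\<forall>i\<in>{1..m+1}. d (\<tau> i) = 0) \<and> (\<forall>i\<in>{m+2..m+n+2}. d (\<tau> i) = 1) \<and>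
     strict_mono_on {1..m+1} \<tau> \<and> strict_mono_on {m+2..m+n+2} \<tau>)"

definition tau_minus :: "nat \<Rightarrow> nat \<Rightarrow> (nat \<Rightarrow> nat) \<Rightarrow> (nat \<Rightarrow> nat)" where
  "tau_minus m n d = (THE \<tau>. \<tau> permutes {1..m+n+2} \<and>
     (\<forall>i\<in>{1..n+1}. d (\<tau> i) = 1) \<and> (\<forall>i\<in>{n+2..m+n+2}. d (\<tau> i) = 0) \<and>
     strict_mono_on {1..n+1} \<tau> \<and> strict_mono_on {n+2..m+n+2} \<tau>)"

type_synonym ('v, 'u) boxvec = "(nat \<Rightarrow> nat) \<Rightarrow> ('v \<times> 'u \<Rightarrow> complex) set"

definition box_space :: "nat \<Rightarrow> nat \<Rightarrow> 'v cspace \<Rightarrow> 'u cspace \<Rightarrow> ('v, 'u) boxvec cspace" where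
  "box_space m n V U = dsum (Dset m n) (\<lambda>_. tensor V U)"

text \<open>\<open>box_block m n V U d' f d\<close> is \<open>\<iota>\<^bsub>d'\<^esub> \<circ> f \<circ> P\<^sub>d\<close> as an endomorphism of \<open>C\<close>.\<close>

definition box_block :: "nat \<Rightarrow> nat \<Rightarrow> 'v cspace \<Rightarrow> 'u cspace \<Rightarrow> (nat \<Rightarrow> nat) \<Rightarrow>
    (('v \<times> 'u \<Rightarrow> complex) set \<Rightarrow> ('v \<times> 'u \<Rightarrow> complex) set) \<Rightarrow> (nat \<Rightarrow> nat) \<Rightarrow>
    ('v, 'u) boxvec \<Rightarrow> ('v, 'u) boxvec" where
  "box_block m n V U d' f d =
     restrict (dsum_incl (Dset m n) (\<lambda>_. tensor V U) d' \<circ> f \<circ> dsum_proj d)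
       (carrier (box_space m n V U))"

definition box_T :: "complex \<Rightarrow> nat \<Rightarrow> nat \<Rightarrow>
    'v cspace \<Rightarrow> ((nat list \<Rightarrow> complex) set \<Rightarrow> 'v \<Rightarrow> 'v) \<Rightarrow>
    'u cspace \<Rightarrow> ((nat list \<Rightarrow> complex) set \<Rightarrow> 'u \<Rightarrow> 'u) \<Rightarrow>
    nat \<Rightarrow> (nat \<Rightarrow> nat) \<Rightarrow> ('v, 'u) boxvec \<Rightarrow> ('v, 'u) boxvec" where
  "box_T q m n V l U r i d =
     (if d i \<noteq> d (i+1) then box_block m n V U (adj_swap i \<triangleright> d) id d
      else if d i = 0 then
        box_block m n V U d
          (tensor_map V U (l (hecke_T q m (inv_into UNIV (tau_plus m n d) i))) \<one>\<^bsub>End_alg U\<^esub>) d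
      else
        box_block m n V U d
          (tensor_map V U \<one>\<^bsub>End_alg V\<^esub> (r (hecke_T q n (inv_into UNIV (tau_minus m n d) i)))) d)"

text \<open>
  The algebra homomorphism with the prescribed values on generators; extensionality outside
  the carrier makes it unique as a HOL function.
\<close>

definition box_rep :: "complex \<Rightarrow> nat \<Rightarrow> nat \<Rightarrow>
    'v cspace \<Rightarrow> ((nat list \<Rightarrow> complex) set \<Rightarrow> 'v \<Rightarrow> 'v) \<Rightarrow>
    'u cspace \<Rightarrow> ((nat list \<Rightarrow> complex) set \<Rightarrow> 'u \<Rightarrow> 'u) \<Rightarrow>
    (agen list \<Rightarrow> complex) set \<Rightarrow> ('v, 'u) boxvec \<Rightarrow> ('v, 'u) boxvec" where
  "box_rep q m n V l U r =
     (THE h. h \<in> algebra_hom (A_algebra q m n) (End_alg (box_space m n V U)) \<and>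
        h \<in> extensional (carrier (A_algebra q m n)) \<and>
        (\<forall>d\<in>Dset m n. h (A_E q m n d) = box_block m n V U d id d) \<and>
        (\<forall>d\<in>Dset m n. \<forall>i\<in>{1..m+n+1}. h (A_T q m n i d) = box_T q m n V l U r i d))"

end

theory Submission
  imports "HOL-Computational_Algebra.Fundamental_Theorem_Algebra" "Jordan_Normal_Form.Schur_Decomposition" Defs
begin

text \<open>
  The algebra \<open>A = H\<^sub>q(A(m,n))\<close> is a groupoid version of a Hecke algebra: its objects are the binary
  words \<open>d\<close>, and \<open>T i d\<close> is an invertible arrow from \<open>d\<close> to the word with letters \<open>i, i+1\<close> exchanged
  whenever these letters differ. Sorting a word by such arrows gives an arrow \<open>X d\<close> from the sorted word
  \<open>d0 = 0...01...1\<close> to \<open>d\<close>, with inverse \<open>Y d\<close>. The commutation relations make \<open>X d\<close> independent of the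
  chosen sorting, and the braid relations show that a loop generator \<open>T i d\<close> (equal letters) is carried by
  \<open>X d\<close> to a loop generator at \<open>d0\<close> (lemma \<open>T_X\<close>). The loops at \<open>d0\<close> generate commuting images of
  \<open>H\<^sub>q(S\<^bsub>m+1\<^esub>)\<close> and \<open>H\<^sub>q(S\<^bsub>n+1\<^esub>)\<close>. Hence \<open>A\<close> is spanned by the elements
  \<open>X d \<phi>(a) \<psi>(b) Y d'\<close>: it is a quotient of the algebra of matrices, indexed by words, over
  \<open>H\<^sub>q(S\<^bsub>m+1\<^esub>) \<otimes> H\<^sub>q(S\<^bsub>n+1\<^esub>)\<close>. The representations \<open>l \<box> r\<close> show that nothing more collapses.

  If both Hecke algebras are sums of matrix algebras, products of their matrix units with the \<open>X d\<close> and
  \<open>Y d'\<close> form a system of matrix units of \<open>A\<close> (lemma \<open>typeA_matrix_units\<close>), and the diagonal units act with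
  rank one on the representations \<open>l \<box> r\<close> (lemma \<open>typeA_matrix_reps\<close>). All the assertions then hold for any
  algebra with matrix units and such representations (locale \<open>matrix_reps\<close>): the joint map is bijective,
  the dimension is the sum of the squares of the block sizes, left ideals have complements, and every
  irreducible module is one of the given ones.

  It remains to see that \<open>H\<^sub>q(S\<^bsub>k+1\<^esub>)\<close> is a sum of matrix algebras when \<open>q\<close> and the Poincare polynomial do
  not vanish. By the density theorem (lemma \<open>matrix_units_exist\<close>) it suffices that no \<open>x \<noteq> 0\<close> acts as zero on
  every irreducible module. The elements that do form a left ideal \<open>J\<close>; a minimal left ideal \<open>W\<close> inside \<open>J\<close>
  is an irreducible module, so \<open>W W = 0\<close> and all \<open>x h\<close> with \<open>x\<close> in \<open>W\<close> have square zero. Hence they have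
  trace zero in every representation. The quantum traces of an element on the spaces of words over \<open>r\<close>
  letters are, up to the factor \<open>[r]\<^bsup>k+1\<^esup>\<close>, values at the points \<open>q\<^sup>r / [r]\<close> of one
  polynomial of degree at most \<open>k\<close> whose constant term
  is the symmetrizing trace \<open>\<tau>\<close> (lemma \<open>trace_polynomial\<close>); the Poincare polynomial is \<open>[1][2]...[k+1]\<close>, so
  for \<open>r = 1, ..., k+1\<close> these points exist and are distinct, and they determine the polynomial. Thus
  \<open>\<tau>(x h) = 0\<close> for all \<open>h\<close>, and \<open>x = 0\<close> because the form \<open>\<tau>(x h)\<close> is nondegenerate for \<open>q \<noteq> 0\<close>.
\<close>

text \<open>Operations of a structure \<open>A\<close> are written with a plain subscript, as in \<open>x \<otimes>_A y\<close>.\<close>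

syntax "_index" :: "logic => index" ("'__" [1000])

abbreviation sw :: "nat => (nat => nat) => nat => nat" where
  "sw i d \<equiv> adj_swap i \<triangleright> d"

section \<open>Complex vector spaces and algebras\<close>

lemma field_Cx: "field Cx"
 by (rule class_field.field_axioms)

lemma cspace_criteria:
 fixes V :: "'v cspace"
 assumes "\<zero>_V : carrier V"
  and "!!v w. v : carrier V ==> w : carrier V ==> v \<oplus>_V w : carrier V"
  and "!!c v. v : carrier V ==> c \<odot>_V v : carrier V"
  and "!!v w. v : carrier V ==> w : carrier V ==> v \<oplus>_V w = w \<oplus>_V v"
  and "!!v w x. v : carrier V ==> w : carrier V ==> x : carrier V ==>
      (v \<oplus>_V w) \<oplus>_V x = v \<oplus>_V (w \<oplus>_V x)"
  and "!!v. v : carrier V ==> v \<oplus>_V \<zero>_V = v"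
  and "!!v. v : carrier V ==> 0 \<odot>_V v = \<zero>_V"
  and "!!v. v : carrier V ==> 1 \<odot>_V v = v"
  and "!!a b v. v : carrier V ==> (a * b) \<odot>_V v = a \<odot>_V (b \<odot>_V v)"
  and "!!a b v. v : carrier V ==> (a + b) \<odot>_V v = a \<odot>_V v \<oplus>_V b \<odot>_V v"
  and "!!a v w. v : carrier V ==> w : carrier V ==>
      a \<odot>_V (v \<oplus>_V w) = a \<odot>_V v \<oplus>_V a \<odot>_V w"
 shows "vectorspace Cx V"
proof (rule vs_criteria)
 show "\<forall>v\<in>carrier V. \<exists>w\<in>carrier V. v \<oplus>_V w = \<zero>_V"
 proof
  fix v assume v: "v : carrier V"
  have "v \<oplus>_V (-1) \<odot>_V v = (1 + -1) \<odot>_V v"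
   using v by (subst assms(10)) (auto simp: assms(8))
  also have "... = \<zero>_V" using assms(7)[OF v] by simp
  finally show "\<exists>w\<in>carrier V. v \<oplus>_V w = \<zero>_V" using assms(3)[OF v] by blast
 qed
qed (use assms in \<open>auto simp: field_Cx\<close>)

lemma module_hom_Cx_iff:
 "f : LinearCombinations.module_hom Cx V W \<longleftrightarrow>
   (\<forall>v\<in>carrier V. f v : carrier W) \<and>
   (\<forall>v\<in>carrier V. \<forall>w\<in>carrier V. f (v \<oplus>_V w) = f v \<oplus>_W f w) \<and>
   (ALL c. \<forall>v\<in>carrier V. f (c \<odot>_V v) = c \<odot>_W f v)"
 by (auto simp: LinearCombinations.module_hom_def)

text \<open>The record-based vector spaces come with scalars in the carrier of a ring record; here all
  facts are restated for plain complex scalars, without membership conditions.\<close>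

locale cspace =
 fixes V :: "'v cspace"
 assumes vs: "vectorspace Cx V"
begin

lemma mod: "Module.module Cx V"
 using vs by (rule vectorspace.axioms(1))

end

sublocale cspace \<subseteq> abelian_group V
 using mod by (rule Module.module.axioms(2))

context cspace
begin

lemma smult_closed [simp, intro]: "x : carrier V ==> c \<odot>_V x : carrier V"
 using Module.module.smult_closed[OF mod] by auto

lemma smult_add: "x : carrier V ==> y : carrier V ==>
  c \<odot>_V (x \<oplus>_V y) = c \<odot>_V x \<oplus>_V c \<odot>_V y"
 using Module.module.smult_r_distr[OF mod] by auto

lemma add_smult: "x : carrier V ==> (a + b) \<odot>_V x = a \<odot>_V x \<oplus>_V b \<odot>_V x"
 using Module.module.smult_l_distr[OF mod] by auto

lemma smult_smult: "x : carrier V ==> a \<odot>_V (b \<odot>_V x) = (a * b) \<odot>_V x"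
 using Module.module.smult_assoc1[OF mod] by auto

lemma one_smult [simp]: "x : carrier V ==> 1 \<odot>_V x = x"
 using Module.module.smult_one[OF mod] by auto

lemma zero_smult [simp]: "x : carrier V ==> 0 \<odot>_V x = \<zero>_V"
 using module.lmult_0[OF mod] by auto

lemma smult_zero [simp]: "c \<odot>_V \<zero>_V = \<zero>_V"
 using module.rmult_0[OF mod] by auto

lemma neg_smult: "x : carrier V ==> (-1) \<odot>_V x = \<ominus>_V x"
 using minus_equality[of "(-1) \<odot>_V x" x] add_smult[of x "-1" 1] by auto

lemma minus_smult: "x : carrier V ==> y : carrier V ==> x \<ominus>_V y = x \<oplus>_V (-1) \<odot>_V y"
 by (simp add: neg_smult minus_eq)

lemma smult_eq_zero_iff: "x : carrier V ==> c \<odot>_V x = \<zero>_V \<longleftrightarrow> c = 0 | x = \<zero>_V"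
 using smult_smult[of x "inverse c" c] by (cases "c = 0") auto

lemma add_diff_cancel: "x : carrier V ==> y : carrier V ==> (x \<ominus>_V y) \<oplus>_V y = x"
 by (simp add: minus_eq a_assoc l_neg)

lemma minus_eq_zero_iff: "x : carrier V ==> y : carrier V ==> x \<ominus>_V y = \<zero>_V \<longleftrightarrow> x = y"
 by (metis add_diff_cancel l_zero minus_eq r_neg)

lemma finsum_smult:
 assumes "!!i. i : I ==> f i : carrier V"
 shows "c \<odot>_V (\<Oplus>_V i\<in>I. f i) = (\<Oplus>_V i\<in>I. c \<odot>_V f i)"
 using assms
proof (induction I rule: infinite_finite_induct)
 case (insert i I)
 thus ?case
  by (subst (1 2) finsum_insert) (auto simp: smult_add intro!: finsum_closed)
qed auto

lemma finsum_single:
 assumes "finite I" "i : I" "x i : carrier V" "!!j. j : I ==> j ~= i ==> x j = \<zero>_V"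
 shows "(\<Oplus>_V j\<in>I. x j) = x i"
proof -
 have "(\<Oplus>_V j\<in>I. x j) = (\<Oplus>_V j\<in>I. if i = j then x j else \<zero>_V)"
  by (rule finsum_cong') (use assms in auto)
 also have "... = x i"
 proof -
  have "(\<Oplus>_V j\<in>I. if i = j then x j else \<zero>_V)
    = x i \<oplus>_V (\<Oplus>_V j\<in>I - {i}. if i = j then x j else \<zero>_V)"
   using assms by (subst insert_Diff[OF assms(2), symmetric], subst finsum_insert) auto
  also have "(\<Oplus>_V j\<in>I - {i}. if i = j then x j else \<zero>_V) = (\<Oplus>_V j\<in>I - {i}. \<zero>_V)"
   by (rule finsum_cong') auto
  finally show ?thesis using assms by simp
 qed
 finally show ?thesis .
qed

lemma subspace_iff:
 "VectorSpace.subspace Cx W V \<longleftrightarrow> W <= carrier V & \<zero>_V : W \<and>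
   (\<forall>x\<in>W. \<forall>y\<in>W. x \<oplus>_V y : W) & (ALL c. \<forall>x\<in>W. c \<odot>_V x : W)"
 by (auto simp: VectorSpace.subspace_def submodule_def vs mod)

lemma finsum_in_subset:
 assumes "W <= carrier V" "\<zero>_V : W" "!!x y. x : W ==> y : W ==> x \<oplus>_V y : W"
  and "!!i. i : I ==> f i : W"
 shows "(\<Oplus>_V i\<in>I. f i) : W"
 using assms(4)
proof (induction I rule: infinite_finite_induct)
 case (insert i I)
 have "f : I \<rightarrow> carrier V" "f i : carrier V" using insert.prems assms(1) by auto
 hence "(\<Oplus>_V i\<in>insert i I. f i) = f i \<oplus>_V (\<Oplus>_V i\<in>I. f i)"
  using insert.hyps by (subst finsum_insert) auto
 with insert show ?case using assms(3) by auto
qed (use assms in auto)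

end

text \<open>Additive maps commute with finite sums; the map may be defined on a larger type.\<close>

lemma additive_finsum:
 assumes "cspace V" "cspace W"
  and "!!x. x : carrier V ==> f x : carrier W"
  and "!!x y. x : carrier V ==> y : carrier V ==> f (x \<oplus>_V y) = f x \<oplus>_W f y"
  and "f \<zero>_V = \<zero>_W"
  and "!!i. i : I ==> g i : carrier V"
 shows "f (\<Oplus>_V i\<in>I. g i) = (\<Oplus>_W i\<in>I. f (g i))"
proof -
 interpret V: cspace V by fact
 interpret W: cspace W by fact
 show ?thesis
  using assms(6)
 proof (induction I rule: infinite_finite_induct)
  case (insert i I)
  thus ?case
   using assms(3-5) V.finsum_insert[of I i g] W.finsum_insert[of I i "%i. f (g i)"]
   by (auto simp: Pi_def intro!: V.finsum_closed)
 qed (use assms in auto)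
qed

locale lin_map = V: cspace V + W: cspace W for V :: "'v cspace" and W :: "'w cspace" +
 fixes f :: "'v => 'w"
 assumes hom: "f : LinearCombinations.module_hom Cx V W"
begin

lemma closed [simp, intro]: "x : carrier V ==> f x : carrier W"
 and add [simp]: "x : carrier V ==> y : carrier V ==> f (x \<oplus>_V y) = f x \<oplus>_W f y"
 and smult [simp]: "x : carrier V ==> f (c \<odot>_V x) = c \<odot>_W f x"
 using hom by (auto simp: module_hom_Cx_iff)

lemma zero [simp]: "f \<zero>_V = \<zero>_W"
 using smult[of "\<zero>_V" 0] by simp

lemma diff [simp]: "x : carrier V ==> y : carrier V ==> f (x \<ominus>_V y) = f x \<ominus>_W f y"
 by (simp add: V.minus_smult W.minus_smult)

lemma finsum: "(!!i. i : I ==> g i : carrier V) ==> f (\<Oplus>_V i\<in>I. g i) = (\<Oplus>_W i\<in>I. f (g i))"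
 by (rule additive_finsum) (auto intro: V.cspace_axioms W.cspace_axioms)

end

text \<open>The image of a vector space under a map compatible with the operations is a vector space:
 all axioms are equations. This covers quotients as well as transport along bijections.\<close>

lemma vectorspace_image:
 assumes "cspace V" and onto: "f ` carrier V = carrier W"
  and add: "!!x y. x : carrier V ==> y : carrier V ==> f (x \<oplus>_V y) = f x \<oplus>_W f y"
  and smult: "!!c x. x : carrier V ==> f (c \<odot>_V x) = c \<odot>_W f x"
  and zero: "f \<zero>_V = \<zero>_W"
 shows "cspace W"
proof -
 interpret V: cspace V by fact
 have ex: "!!w. w : carrier W ==> \<exists>x\<in>carrier V. w = f x" using onto by auto
 have cl: "!!x. x : carrier V ==> f x : carrier W" using onto by auto
 show ?thesis
 proof (rule cspace.intro, rule cspace_criteria)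
  show "\<zero>_W : carrier W" using cl[OF V.zero_closed] zero by simp
 next
  fix v w assume "v : carrier W" "w : carrier W"
  then obtain x y where "x : carrier V" "y : carrier V" "v = f x" "w = f y" using ex by metis
  thus "v \<oplus>_W w : carrier W" "v \<oplus>_W w = w \<oplus>_W v"
    "!!a. a \<odot>_W (v \<oplus>_W w) = a \<odot>_W v \<oplus>_W a \<odot>_W w"
   by (simp_all flip: add smult add: V.smult_add V.a_comm cl)
 next
  fix v assume "v : carrier W"
  then obtain x where "x : carrier V" "v = f x" using ex by metis
  thus "!!c. c \<odot>_W v : carrier W" "v \<oplus>_W \<zero>_W = v" "0 \<odot>_W v = \<zero>_W" "1 \<odot>_W v = v"
    "!!a b. (a * b) \<odot>_W v = a \<odot>_W (b \<odot>_W v)"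
    "!!a b. (a + b) \<odot>_W v = a \<odot>_W v \<oplus>_W b \<odot>_W v"
   by (auto simp flip: add smult zero simp: V.smult_smult V.add_smult intro: cl)
 next
  fix u v w assume "u : carrier W" "v : carrier W" "w : carrier W"
  then obtain x y z where "x : carrier V" "y : carrier V" "z : carrier V"
   "u = f x" "v = f y" "w = f z" using ex by metis
  thus "u \<oplus>_W v \<oplus>_W w = u \<oplus>_W (v \<oplus>_W w)"
   by (auto simp flip: add simp: V.a_assoc)
 qed
qed

locale calg =
 fixes A :: "'a cspace"
 assumes alg: "complex_algebra A"

sublocale calg \<subseteq> cspace A
 using alg by (simp add: cspace_def complex_algebra_def)

sublocale calg \<subseteq> ring A
 using alg by (simp add: complex_algebra_def)

context calg
begin

lemma smult_mult: "x : carrier A ==> y : carrier A ==> (c \<odot>_A x) \<otimes>_A y = c \<odot>_A (x \<otimes>_A y)"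
 and mult_smult: "x : carrier A ==> y : carrier A ==> x \<otimes>_A (c \<odot>_A y) = c \<odot>_A (x \<otimes>_A y)"
 using alg by (auto simp: complex_algebra_def)

lemma mult_finsum:
 assumes "x : carrier A" "!!i. i : I ==> g i : carrier A"
 shows "x \<otimes>_A (\<Oplus>_A i\<in>I. g i) = (\<Oplus>_A i\<in>I. x \<otimes>_A g i)"
 by (rule additive_finsum[where f = "%y. x \<otimes>_A y"])
   (use assms in \<open>auto simp: r_distr intro: cspace_axioms\<close>)

lemma finsum_mult:
 assumes "x : carrier A" "!!i. i : I ==> g i : carrier A"
 shows "(\<Oplus>_A i\<in>I. g i) \<otimes>_A x = (\<Oplus>_A i\<in>I. g i \<otimes>_A x)"
 by (rule additive_finsum[where f = "%y. y \<otimes>_A x"])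
   (use assms in \<open>auto simp: l_distr intro: cspace_axioms\<close>)

end

lemma calg_criteria:
 fixes A :: "'a cspace"
 assumes "cspace A"
  and "\<one>_A : carrier A"
  and "!!x y. x : carrier A ==> y : carrier A ==> x \<otimes>_A y : carrier A"
  and "!!x y z. x : carrier A ==> y : carrier A ==> z : carrier A ==>
      (x \<otimes>_A y) \<otimes>_A z = x \<otimes>_A (y \<otimes>_A z)"
  and "!!x. x : carrier A ==> \<one>_A \<otimes>_A x = x"
  and "!!x. x : carrier A ==> x \<otimes>_A \<one>_A = x"
  and "!!x y z. x : carrier A ==> y : carrier A ==> z : carrier A ==>
      (x \<oplus>_A y) \<otimes>_A z = x \<otimes>_A z \<oplus>_A y \<otimes>_A z"
  and "!!x y z. x : carrier A ==> y : carrier A ==> z : carrier A ==>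
      z \<otimes>_A (x \<oplus>_A y) = z \<otimes>_A x \<oplus>_A z \<otimes>_A y"
  and "!!c x y. x : carrier A ==> y : carrier A ==> (c \<odot>_A x) \<otimes>_A y = c \<odot>_A (x \<otimes>_A y)"
  and "!!c x y. x : carrier A ==> y : carrier A ==> x \<otimes>_A (c \<odot>_A y) = c \<odot>_A (x \<otimes>_A y)"
 shows "calg A"
proof -
 interpret cspace A by fact
 have "ring A"
  by (rule ringI) (use assms in \<open>auto intro: monoidI abelian_group_axioms\<close>)
 thus ?thesis
  using assms(9,10) vs by (simp add: calg_def complex_algebra_def)
qed

text \<open>As for vector spaces, all axioms are equations between values of the surjection.\<close>

lemma calg_image:
 assumes "calg A" and onto: "f ` carrier A = carrier B"
  and "!!x y. x : carrier A ==> y : carrier A ==> f (x \<oplus>_A y) = f x \<oplus>_B f y"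
  and smult: "!!c x. x : carrier A ==> f (c \<odot>_A x) = c \<odot>_B f x"
  and "f \<zero>_A = \<zero>_B"
  and mult: "!!x y. x : carrier A ==> y : carrier A ==> f (x \<otimes>_A y) = f x \<otimes>_B f y"
  and one: "f \<one>_A = \<one>_B"
 shows "calg B"
proof -
 interpret A: calg A by fact
 have ex: "!!w. w : carrier B ==> \<exists>x\<in>carrier A. w = f x" using onto by auto
 have cl: "!!x. x : carrier A ==> f x : carrier B" using onto by auto
 show ?thesis
 proof (rule calg_criteria)
  show "cspace B" by (rule vectorspace_image[OF A.cspace_axioms]) fact+
  show "\<one>_B : carrier B" using cl[OF A.one_closed] one by simp
 next
  fix u v assume "u : carrier B" "v : carrier B"
  then obtain x y where "x : carrier A" "y : carrier A" "u = f x" "v = f y" using ex by metis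
  thus "u \<otimes>_B v : carrier B" 
   "!!c. (c \<odot>_B u) \<otimes>_B v = c \<odot>_B (u \<otimes>_B v)"
   "!!c. u \<otimes>_B (c \<odot>_B v) = c \<odot>_B (u \<otimes>_B v)"
   by (auto simp flip: smult mult simp: A.smult_mult A.mult_smult intro: cl)
 next
  fix v assume "v : carrier B"
  then obtain x where "x : carrier A" "v = f x" using ex by metis
  thus "\<one>_B \<otimes>_B v = v" "v \<otimes>_B \<one>_B = v"
   by (auto simp flip: one mult)
 next
  fix u v w assume "u : carrier B" "v : carrier B" "w : carrier B"
  then obtain x y z where "x : carrier A" "y : carrier A" "z : carrier A"
   "u = f x" "v = f y" "w = f z" using ex by metis
  thus "u \<otimes>_B v \<otimes>_B w = u \<otimes>_B (v \<otimes>_B w)"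
   "(u \<oplus>_B v) \<otimes>_B w = u \<otimes>_B w \<oplus>_B v \<otimes>_B w"
   "w \<otimes>_B (u \<oplus>_B v) = w \<otimes>_B u \<oplus>_B w \<otimes>_B v"
   by (auto simp flip: assms(3) mult simp: A.m_assoc A.l_distr A.r_distr)
 qed
qed

locale alg_map = A: calg A + B: calg B for A :: "'a cspace" and B :: "'b cspace" +
 fixes h :: "'a => 'b"
 assumes ahom: "h : algebra_hom A B"
begin

lemma mult [simp]: "x : carrier A ==> y : carrier A ==> h (x \<otimes>_A y) = h x \<otimes>_B h y"
 and one [simp]: "h \<one>_A = \<one>_B"
 using ahom by (auto simp: algebra_hom_def Ring.ring_hom_def)

lemma is_lin: "h : LinearCombinations.module_hom Cx A B"
 using ahom by (auto simp: algebra_hom_def Ring.ring_hom_def module_hom_Cx_iff)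

end

sublocale alg_map \<subseteq> lin_map A B h
 by unfold_locales (rule is_lin)

lemma algebra_homI:
 assumes "!!x. x : carrier A ==> h x : carrier B"
  and "!!x y. x : carrier A ==> y : carrier A ==> h (x \<oplus>_A y) = h x \<oplus>_B h y"
  and "!!x y. x : carrier A ==> y : carrier A ==> h (x \<otimes>_A y) = h x \<otimes>_B h y"
  and "!!c x. x : carrier A ==> h (c \<odot>_A x) = c \<odot>_B h x"
  and "h \<one>_A = \<one>_B"
 shows "h : algebra_hom A B"
 using assms by (auto simp: algebra_hom_def Ring.ring_hom_def)

section \<open>Endomorphism algebras, representations and direct sums\<close>

lemma End_alg_simps [simp]:
 "\<one>_(End_alg V) = (\<lambda>v\<in>carrier V. v)"
 "\<zero>_(End_alg V) = (\<lambda>v\<in>carrier V. \<zero>_V)"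
 "f \<oplus>_(End_alg V) g = (\<lambda>v\<in>carrier V. f v \<oplus>_V g v)"
 "f \<otimes>_(End_alg V) g = compose (carrier V) f g"
 "c \<odot>_(End_alg V) f = (\<lambda>v\<in>carrier V. c \<odot>_V f v)"
 by (simp_all add: End_alg_def)

lemma End_carrier_iff:
 "f : carrier (End_alg V) \<longleftrightarrow> f : extensional (carrier V) \<and>
   (\<forall>v\<in>carrier V. f v : carrier V) \<and>
   (\<forall>v\<in>carrier V. \<forall>w\<in>carrier V. f (v \<oplus>_V w) = f v \<oplus>_V f w) \<and>
   (ALL c. \<forall>v\<in>carrier V. f (c \<odot>_V v) = c \<odot>_V f v)"
 by (auto simp: End_alg_def module_hom_Cx_iff)

lemma End_eqI:
 assumes "f : carrier (End_alg V)" "g : carrier (End_alg V)"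
  and "!!v. v : carrier V ==> f v = g v"
 shows "f = g"
 using assms by (intro extensionalityI[of f "carrier V" g]) (auto simp: End_carrier_iff)

lemma (in cspace) calg_End: "calg (End_alg V)"
proof (rule calg_criteria)
 show "cspace (End_alg V)"
 proof (rule cspace.intro, rule cspace_criteria)
 qed (auto simp: End_carrier_iff smult_add add_smult smult_smult a_ac mult.commute fun_eq_iff
    extensional_def restrict_def)
qed (auto simp: End_carrier_iff smult_add add_smult smult_smult a_ac mult.commute fun_eq_iff
    extensional_def restrict_def compose_def)

locale arep = A: calg A + V: cspace V for A :: "'a cspace" and V :: "'v cspace" +
 fixes rho :: "'a => 'v => 'v"
 assumes rep: "rho : algebra_hom A (End_alg V)"
begin

sublocale alg_map A "End_alg V" rho
 using V.calg_End rep by (simp add: alg_map_def alg_map_axioms_def A.calg_axioms)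

lemma act_closed [simp, intro]: "x : carrier A ==> v : carrier V ==> rho x v : carrier V"
 and act_add: "x : carrier A ==> v : carrier V ==> w : carrier V ==>
    rho x (v \<oplus>_V w) = rho x v \<oplus>_V rho x w"
 and act_smult: "x : carrier A ==> v : carrier V ==> rho x (c \<odot>_V v) = c \<odot>_V rho x v"
 using closed[of x] by (auto simp: End_carrier_iff)

lemma add_act: "x : carrier A ==> y : carrier A ==> v : carrier V ==>
    rho (x \<oplus>_A y) v = rho x v \<oplus>_V rho y v"
 and smult_act: "x : carrier A ==> v : carrier V ==> rho (c \<odot>_A x) v = c \<odot>_V rho x v"
 and mult_act: "x : carrier A ==> y : carrier A ==> v : carrier V ==>
    rho (x \<otimes>_A y) v = rho x (rho y v)"
 and one_act: "v : carrier V ==> rho \<one>_A v = v"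
 and zero_act: "v : carrier V ==> rho \<zero>_A v = \<zero>_V"
 by (auto simp: compose_def)

lemma act_zero: "x : carrier A ==> rho x \<zero>_V = \<zero>_V"
 using act_smult[of x "\<zero>_V" 0] by simp

lemma lin_act: "x : carrier A ==> lin_map V V (rho x)"
 by unfold_locales (auto simp: module_hom_Cx_iff act_add act_smult)

lemma act_finsum:
 assumes "x : carrier A" "!!i. i : I ==> v i : carrier V"
 shows "rho x (\<Oplus>_V i\<in>I. v i) = (\<Oplus>_V i\<in>I. rho x (v i))"
 by (rule lin_map.finsum[OF lin_act]) (use assms in auto)

lemma finsum_act:
 assumes "v : carrier V" "!!i. i : I ==> x i : carrier A"
 shows "rho (\<Oplus>_A i\<in>I. x i) v = (\<Oplus>_V i\<in>I. rho (x i) v)"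
 by (rule additive_finsum[where f = "%x. rho x v"])
   (use assms in \<open>auto simp: add_act zero_act intro: A.cspace_axioms V.cspace_axioms\<close>)

lemma act_diff: "x : carrier A ==> v : carrier V ==> w : carrier V ==>
  rho x (v \<ominus>_V w) = rho x v \<ominus>_V rho x w"
 using lin_map.diff[OF lin_act] .

lemma diff_act: "x : carrier A ==> y : carrier A ==> v : carrier V ==>
  rho (x \<ominus>_A y) v = rho x v \<ominus>_V rho y v"
 using add_act[of x "(-1) \<odot>_A y" v] smult_act[of y v "-1"]
 by (simp only: A.minus_smult V.minus_smult A.smult_closed act_closed)

end

lemma representation_iff: "calg A ==> representation A V rho \<longleftrightarrow> arep A V rho"
 by (auto simp: representation_def arep_def arep_axioms_def cspace_def)

lemma arepI:
 assumes "calg A" "cspace V"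
  and ext: "!!x. x : carrier A ==> rho x : extensional (carrier V)"
  and "!!x v. x : carrier A ==> v : carrier V ==> rho x v : carrier V"
  and "!!x v w. x : carrier A ==> v : carrier V ==> w : carrier V ==>
    rho x (v \<oplus>_V w) = rho x v \<oplus>_V rho x w"
  and "!!x c v. x : carrier A ==> v : carrier V ==> rho x (c \<odot>_V v) = c \<odot>_V rho x v"
  and "!!x y v. x : carrier A ==> y : carrier A ==> v : carrier V ==>
    rho (x \<oplus>_A y) v = rho x v \<oplus>_V rho y v"
  and "!!x c v. x : carrier A ==> v : carrier V ==> rho (c \<odot>_A x) v = c \<odot>_V rho x v"
  and "!!x y v. x : carrier A ==> y : carrier A ==> v : carrier V ==>
    rho (x \<otimes>_A y) v = rho x (rho y v)"
  and "!!v. v : carrier V ==> rho \<one>_A v = v"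
 shows "arep A V rho"
proof -
 interpret A: calg A by fact
 interpret V: cspace V by fact
 have E: "rho x : carrier (End_alg V)" if "x : carrier A" for x
  using that assms by (auto simp: End_carrier_iff)
 interpret E: calg "End_alg V" by (rule V.calg_End)
 have "rho : algebra_hom A (End_alg V)"
 proof (rule algebra_homI)
  show "rho x : carrier (End_alg V)" if "x : carrier A" for x using E that .
  show "rho \<one>_A = \<one>_(End_alg V)"
   by (rule End_eqI[of _ V]) (use E assms E.one_closed in auto)
 next
  fix x y assume xy: "x : carrier A" "y : carrier A"
  show "rho (x \<oplus>_A y) = rho x \<oplus>_(End_alg V) rho y"
   by (rule End_eqI[of _ V]) (use E assms xy E.a_closed[of "rho x" "rho y"] in auto)
  show "rho (x \<otimes>_A y) = rho x \<otimes>_(End_alg V) rho y"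
   by (rule End_eqI[of _ V]) (use E assms xy E.m_closed[of "rho x" "rho y"] in \<open>auto simp: compose_def\<close>)
 next
  fix c x assume x: "x : carrier A"
  show "rho (c \<odot>_A x) = c \<odot>_(End_alg V) rho x"
   by (rule End_eqI[of _ V]) (use E assms x E.smult_closed[of "rho x" c] in auto)
 qed
 thus ?thesis by unfold_locales
qed

lemma cspace_abelian: "cspace V ==> abelian_group V"
 using cspace.mod Module.module.axioms(2) by blast

lemma calg_ring: "calg A ==> ring A"
 by (auto simp: calg_def complex_algebra_def)

lemma dsum_simps [simp]:
 "\<one>_(dsum I M) = (\<lambda>i\<in>I. \<one>_(M i))"
 "\<zero>_(dsum I M) = (\<lambda>i\<in>I. \<zero>_(M i))"
 "f \<oplus>_(dsum I M) g = (\<lambda>i\<in>I. f i \<oplus>_(M i) g i)"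
 "f \<otimes>_(dsum I M) g = (\<lambda>i\<in>I. f i \<otimes>_(M i) g i)"
 "c \<odot>_(dsum I M) f = (\<lambda>i\<in>I. c \<odot>_(M i) f i)"
 by (simp_all add: dsum_def)

lemma dsum_carrier: "finite I ==> carrier (dsum I M) = (\<Pi>\<^sub>E i\<in>I. carrier (M i))"
 by (auto simp: dsum_def)

lemma cspace_dsum:
 assumes I: "finite I" and M: "!!i. i : I ==> cspace (M i)"
 shows "cspace (dsum I M)"
proof (rule cspace.intro, rule cspace_criteria)
 fix c v assume v: "v : carrier (dsum I M)"
 thus "c \<odot>_(dsum I M) v : carrier (dsum I M)"
  using I cspace.smult_closed[OF M] by (auto simp: dsum_carrier)
qed (use I in \<open>auto simp: dsum_carrier fun_eq_iff PiE_iff extensional_def 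
  abelian_groupE[OF cspace_abelian[OF M]]
  abelian_monoid.r_zero[OF abelian_group.axioms(1)[OF cspace_abelian[OF M]]]
  abelian_monoid.a_lcomm[OF abelian_group.axioms(1)[OF cspace_abelian[OF M]]]
  cspace.smult_add[OF M] cspace.add_smult[OF M] cspace.smult_smult[OF M] cspace.zero_smult[OF M]
  cspace.one_smult[OF M]\<close>)

lemma calg_dsum:
 assumes I: "finite I" and M: "!!i. i : I ==> calg (M i)"
 shows "calg (dsum I M)"
proof (rule calg_criteria)
 show "cspace (dsum I M)"
  using I M by (intro cspace_dsum) (auto simp: calg_def cspace_def complex_algebra_def)
qed (use I in \<open>auto simp: dsum_carrier fun_eq_iff PiE_iff extensional_def 
  ringE[OF calg_ring[OF M]] monoid.m_closed[OF ringE(2)[OF calg_ring[OF M]]]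
  monoid.m_assoc[OF ringE(2)[OF calg_ring[OF M]]]
  monoid.l_one[OF ringE(2)[OF calg_ring[OF M]]]
  monoid.r_one[OF ringE(2)[OF calg_ring[OF M]]]
  monoid.one_closed[OF ringE(2)[OF calg_ring[OF M]]]
  calg.smult_mult[OF M] calg.mult_smult[OF M]\<close>)

section \<open>Quotients, free spaces and presented algebras\<close>

lemma quotient_space_simps:
 "carrier (quotient_space M N) = a_rcosets\<^bsub>M\<^esub> N"
 "X \<oplus>_(quotient_space M N) Y = X <+>_M Y"
 "X \<otimes>_(quotient_space M N) Y = rcoset_mult M N X Y"
 "\<zero>_(quotient_space M N) = N"
 "\<one>_(quotient_space M N) = N +>_M \<one>_M"
 "c \<odot>_(quotient_space M N) X = (\<Union>x\<in>X. N +>_M (c \<odot>_M x))"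
 by (simp_all add: quotient_space_def FactRing_def ring.defs module.defs)

locale quotient_by = cspace M for M :: "'a cspace" +
 fixes N :: "'a set"
 assumes sub: "VectorSpace.subspace Cx N M"
begin

lemma N_sub: "N <= carrier M" and N_zero: "\<zero>_M : N"
 and N_add: "x : N ==> y : N ==> x \<oplus>_M y : N"
 and N_smult: "x : N ==> c \<odot>_M x : N"
 using sub by (auto simp: subspace_iff)

lemma N_minus: "x : N ==> \<ominus>_M x : N"
 using N_smult[of x "-1"] N_sub by (auto simp: neg_smult)

lemma ab_subgroup: "abelian_subgroup N M"
proof (rule abelian_subgroupI3)
 show "additive_subgroup N M"
  by (rule additive_subgroup.intro, rule add.subgroupI)
    (use N_sub N_zero N_add N_minus in \<open>auto simp: a_inv_def\<close>)
qed (rule abelian_group_axioms)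

lemma proj_eq_iff:
 assumes "x : carrier M" "y : carrier M"
 shows "N +>_M x = N +>_M y \<longleftrightarrow> x \<ominus>_M y : N"
proof
 assume "N +>_M x = N +>_M y"
 moreover have "x : N +>_M x" using assms N_zero by (force simp: a_r_coset_def')
 ultimately obtain h where h: "h : N" "x = h \<oplus>_M y" by (auto simp: a_r_coset_def')
 hence "x \<ominus>_M y = h" using assms N_sub by (auto simp: minus_eq a_assoc r_neg)
 with h show "x \<ominus>_M y : N" by simp
next
 assume d: "x \<ominus>_M y : N"
 have "x = (x \<ominus>_M y) \<oplus>_M y" using assms by (simp add: add_diff_cancel)
 hence "x : N +>_M y" using d by (auto simp: a_r_coset_def')
 thus "N +>_M x = N +>_M y"
  using abelian_subgroup.a_repr_independence'[OF ab_subgroup] assms by metis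
qed

lemma proj_carrier: "(%x. N +>_M x) ` carrier M = carrier (quotient_space M N)"
 by (auto simp: quotient_space_simps A_RCOSETS_def')

lemma proj_add: "x : carrier M ==> y : carrier M ==>
  N +>_M (x \<oplus>_M y) = (N +>_M x) \<oplus>_(quotient_space M N) (N +>_M y)"
 using abelian_subgroup.a_rcos_sum[OF ab_subgroup] by (simp add: quotient_space_simps)

lemma proj_smult:
 assumes x: "x : carrier M"
 shows "N +>_M (c \<odot>_M x) = c \<odot>_(quotient_space M N) (N +>_M x)"
proof -
 have "N +>_M (c \<odot>_M z) = N +>_M (c \<odot>_M x)" if z: "z : N +>_M x" for z
 proof -
  obtain h where h: "h : N" "z = h \<oplus>_M x" using z by (auto simp: a_r_coset_def')
  hence hc: "h : carrier M" using N_sub by auto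
  have d: "c \<odot>_M z \<ominus>_M c \<odot>_M x = c \<odot>_M h"
   using h hc x by (simp add: smult_add minus_eq a_assoc r_neg)
  have zc: "z : carrier M" using h hc x by simp
  show ?thesis
   unfolding proj_eq_iff[OF smult_closed[OF zc] smult_closed[OF x]] d by (rule N_smult[OF h(1)])
 qed
 moreover have "x : N +>_M x" using x N_zero by (force simp: a_r_coset_def')
 ultimately show ?thesis unfolding quotient_space_simps by blast
qed

lemma proj_zero: "N +>_M \<zero>_M = \<zero>_(quotient_space M N)"
proof -
 have "h \<oplus>_M \<zero>_M = h" if "h : N" for h using that N_sub by auto
 thus ?thesis by (simp add: quotient_space_simps a_r_coset_def')
qed

lemma cspace_quotient: "cspace (quotient_space M N)"
 by (rule vectorspace_image[OF cspace_axioms proj_carrier])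
   (auto simp: proj_add proj_smult proj_zero)

lemma factor:
 assumes "!!x y. x : carrier M ==> y : carrier M ==> x \<ominus>_M y : N ==> g x = g y"
 obtains h where "!!x. x : carrier M ==> h (N +>_M x) = g x"
proof
 let ?h = "%X. g (SOME x. x : carrier M & N +>_M x = X)"
 fix x assume x: "x : carrier M"
 have "EX y. y : carrier M & N +>_M y = N +>_M x" using x by blast
 from someI_ex[OF this] show "?h (N +>_M x) = g x"
  using x assms proj_eq_iff by blast
qed

lemma quotient_cases:
 assumes "X : carrier (quotient_space M N)"
 obtains x where "x : carrier M" "X = N +>_M x"
 using assms proj_carrier by (metis imageE)

lemma proj_closed: "x : carrier M ==> N +>_M x : carrier (quotient_space M N)"
 using proj_carrier by blast

lemma linear_factor:
 assumes "lin_map M W g" "!!x. x : N ==> g x = \<zero>_W"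
 obtains h where "lin_map (quotient_space M N) W h" "!!x. x : carrier M ==> h (N +>_M x) = g x"
proof -
 interpret g: lin_map M W g by fact
 have eq: "g x = g y" if "x : carrier M" "y : carrier M" "x \<ominus>_M y : N" for x y
  using assms(2)[OF that(3)] that by (simp add: g.W.minus_eq_zero_iff)
 obtain h where h: "!!x. x : carrier M ==> h (N +>_M x) = g x" using factor[of g] eq by metis
 have "h : LinearCombinations.module_hom Cx (quotient_space M N) W"
  by (auto simp: module_hom_Cx_iff h simp flip: proj_add proj_smult elim!: quotient_cases)
 thus thesis
  using that h cspace_quotient g.W.cspace_axioms by (simp add: lin_map_def lin_map_axioms_def)
qed

end

locale algebra_quotient = calg M for M :: "'a cspace" +
 fixes N :: "'a set"
 assumes idl: "ideal N M"
begin

lemma subspace_ideal: "VectorSpace.subspace Cx N M"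
proof -
 interpret ideal N M by (rule idl)
 have "c \<odot>_M x : N" if "x : N" for c x
 proof -
  have x: "x : carrier M" using that a_subset by auto
  have "c \<odot>_M x = (c \<odot>_M \<one>_M) \<otimes>_M x" using x by (simp add: smult_mult)
  also have "... : N" using that I_l_closed by auto
  finally show ?thesis .
 qed
 thus ?thesis using a_subset by (auto simp: subspace_iff)
qed

end

sublocale algebra_quotient \<subseteq> quotient_by M N
 using subspace_ideal by (simp add: quotient_by_def quotient_by_axioms_def cspace_axioms)

context algebra_quotient
begin

lemma proj_mult: "x : carrier M ==> y : carrier M ==>
  N +>_M (x \<otimes>_M y) = (N +>_M x) \<otimes>_(quotient_space M N) (N +>_M y)"
 using ideal.rcoset_mult_add[OF idl] by (simp add: quotient_space_simps)

lemma calg_quotient: "calg (quotient_space M N)"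
 by (rule calg_image[OF calg_axioms proj_carrier])
   (auto simp: proj_add proj_smult proj_zero proj_mult quotient_space_simps)

lemma proj_hom: "(%x. N +>_M x) : algebra_hom M (quotient_space M N)"
 by (rule algebra_homI) (auto simp: proj_closed proj_add proj_smult proj_mult quotient_space_simps(5))

end

lemma free_space_simps:
 "f : carrier (free_space S) \<longleftrightarrow> finite {s. f s ~= 0} & {s. f s ~= 0} <= S"
 "f \<oplus>_(free_space S) g = (%s. f s + g s)"
 "\<zero>_(free_space S) = (%_. 0)"
 "c \<odot>_(free_space S) f = (%s. c * f s)"
 by (simp_all add: free_space_def)

lemma single_in_free: "s : S ==> single s : carrier (free_space S)"
 by (auto simp: free_space_simps single_def)

lemma cspace_free: "cspace (free_space S)"
proof (rule cspace.intro, rule cspace_criteria)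
 fix v w assume "v : carrier (free_space S)" "w : carrier (free_space S)"
 hence "finite ({s. v s ~= 0} \<union> {s. w s ~= 0})" "{s. v s ~= 0} \<union> {s. w s ~= 0} <= S"
  by (auto simp: free_space_simps)
 moreover have "{s. v s + w s ~= 0} <= {s. v s ~= 0} \<union> {s. w s ~= 0}" by auto
 ultimately show "v \<oplus>_(free_space S) w : carrier (free_space S)"
  unfolding free_space_simps by (meson finite_subset order.trans)
next
 fix c v assume "v : carrier (free_space S)"
 moreover have "{s. c * v s ~= 0} <= {s. v s ~= 0}" by auto
 ultimately show "c \<odot>_(free_space S) v : carrier (free_space S)"
  unfolding free_space_simps by (meson finite_subset order.trans)
qed (auto simp: free_space_simps algebra_simps)

lemma free_space_induct [consumes 1, case_names zero add]:
 assumes f: "f : carrier (free_space S)"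
  and zero: "P (%_. 0)"
  and add: "!!f s c. f : carrier (free_space S) ==> s : S ==> P f ==> P (%t. f t + c * single s t)"
 shows "P f"
proof -
 have "P f" if "finite T" "{s. f s ~= 0} = T" "T <= S" for T f
  using that
 proof (induction T arbitrary: f)
  case empty
  hence "f = (%_. 0)" by auto
  thus ?case using zero by simp
 next
  case (insert s T)
  define g where "g = f(s := 0)"
  have g: "{s. g s ~= 0} = T" using insert by (auto simp: g_def)
  have "g : carrier (free_space S)" using g insert by (auto simp: free_space_simps)
  moreover have "P g" using insert g by auto
  ultimately have "P (%t. g t + f s * single s t)" using add insert by auto
  moreover have "(%t. g t + f s * single s t) = f" by (auto simp: g_def single_def)
  ultimately show ?case by simp
 qed
 thus ?thesis using f by (auto simp: free_space_simps)
qed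

definition lin_ext :: "'w cspace => ('s => 'w) => ('s => complex) => 'w" where
 "lin_ext W g f = (\<Oplus>_W s\<in>{s. f s ~= 0}. f s \<odot>_W g s)"

context
 fixes W :: "'w cspace" and S :: "'s set" and g :: "'s => 'w"
 assumes W: "cspace W" and g: "!!s. s : S ==> g s : carrier W"
begin

interpretation W: cspace W by (rule W)

lemma lin_ext_superset:
 assumes "finite T" "{s. f s ~= 0} <= T" "T <= S"
 shows "lin_ext W g f = (\<Oplus>_W s\<in>T. f s \<odot>_W g s)"
 unfolding lin_ext_def
 by (rule W.add.finprod_mono_neutral_cong_left) (use assms g in auto)

lemma lin_ext_single: "s : S ==> lin_ext W g (single s) = g s"
 using lin_ext_superset[of "{s}" "single s"] g by (auto simp: single_def)

lemma lin_map_lin_ext: "lin_map (free_space S) W (lin_ext W g)"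
proof -
 have "lin_ext W g f : carrier W" if "f : carrier (free_space S)" for f
  using that g unfolding lin_ext_def by (intro W.finsum_closed) (auto simp: free_space_simps)
 moreover have "lin_ext W g (f \<oplus>_(free_space S) f') = lin_ext W g f \<oplus>_W lin_ext W g f'"
  if f: "f : carrier (free_space S)" "f' : carrier (free_space S)" for f f'
 proof -
  define T where "T = {s. f s ~= 0} \<union> {s. f' s ~= 0}"
  have T: "finite T" "T <= S" using f by (auto simp: T_def free_space_simps)
  have "lin_ext W g (f \<oplus>_(free_space S) f') = (\<Oplus>_W s\<in>T. (f s + f' s) \<odot>_W g s)"
   using T by (subst lin_ext_superset[of T]) (auto simp: T_def free_space_simps)
  also have "... = (\<Oplus>_W s\<in>T. f s \<odot>_W g s \<oplus>_W f' s \<odot>_W g s)"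
   using T g by (intro W.finsum_cong') (auto simp: W.add_smult)
  also have "... = lin_ext W g f \<oplus>_W lin_ext W g f'"
   using T g lin_ext_superset[of T f] lin_ext_superset[of T f']
   by (subst W.finsum_addf) (auto simp: T_def)
  finally show ?thesis .
 qed
 moreover have "lin_ext W g (c \<odot>_(free_space S) f) = c \<odot>_W lin_ext W g f"
  if f: "f : carrier (free_space S)" for c f
 proof -
  define T where "T = {s. f s ~= 0}"
  have T: "finite T" "T <= S" using f by (auto simp: T_def free_space_simps)
  have "lin_ext W g (c \<odot>_(free_space S) f) = (\<Oplus>_W s\<in>T. (c * f s) \<odot>_W g s)"
   using T by (subst lin_ext_superset[of T]) (auto simp: T_def free_space_simps)
  also have "... = (\<Oplus>_W s\<in>T. c \<odot>_W (f s \<odot>_W g s))"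
   using T g by (intro W.finsum_cong') (auto simp: W.smult_smult)
  also have "... = c \<odot>_W lin_ext W g f"
   using T g lin_ext_superset[of T f] by (subst W.finsum_smult[symmetric]) (auto simp: T_def)
  finally show ?thesis .
 qed
 ultimately show ?thesis
  using cspace_free W by (auto simp: lin_map_def lin_map_axioms_def module_hom_Cx_iff)
qed

end

definition conv :: "('g list => complex) => ('g list => complex) => 'g list => complex" where
 "conv f g = (%w. \<Sum>i\<le>length w. f (take i w) * g (drop i w))"

lemma free_algebra_simps:
 "carrier (free_algebra S) = carrier (free_space (lists S))"
 "f \<oplus>_(free_algebra S) g = (%s. f s + g s)"
 "\<zero>_(free_algebra S) = (%_. 0)"
 "c \<odot>_(free_algebra S) f = (%s. c * f s)"
 "\<one>_(free_algebra S) = single []"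
 "f \<otimes>_(free_algebra S) g = conv f g"
 by (simp_all add: free_algebra_def free_space_def conv_def)

lemma free_space_as_algebra:
 "carrier (free_space (lists S)) = carrier (free_algebra S)"
 "add (free_space (lists S)) = add (free_algebra S)"
 "module.smult (free_space (lists S)) = module.smult (free_algebra S)"
 "zero (free_space (lists S)) = zero (free_algebra S)"
 by (simp_all add: free_algebra_def)

lemma cspace_free_algebra: "cspace (free_algebra S)"
 by (rule vectorspace_image[OF cspace_free[of "lists S"], where f = "%x. x"])
   (simp_all add: free_algebra_simps free_space_simps)

lemma conv_single: "conv (single u) (single v) = single (u @ v)"
proof
 fix w
 have "conv (single u) (single v) w = (\<Sum>i\<le>length w. if i = length u then (if w = u @ v then 1 else 0) else 0)"
  unfolding conv_def
 proof (rule sum.cong)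
  fix i assume "i : {..length w}"
  hence "take i w = u & drop i w = v \<longleftrightarrow> i = length u & w = u @ v"
   by (metis append_eq_conv_conj append_take_drop_id atMost_iff length_take min.absorb2)
  moreover have "single u a * single v b = (if a = u & b = v then 1 else 0)" for a b
   by (simp add: single_def)
  ultimately show "single u (take i w) * single v (drop i w)
    = (if i = length u then (if w = u @ v then 1 else 0) else 0)"
   by simp
 qed simp
 also have "... = single (u @ v) w" by (simp add: single_def)
 finally show "conv (single u) (single v) w = single (u @ v) w" .
qed

lemma conv_add_left: "conv (%t. f t + c * f' t) g = (%t. conv f g t + c * conv f' g t)"
 and conv_add_right: "conv f (%t. g t + c * g' t) = (%t. conv f g t + c * conv f g' t)"
 and conv_zero: "conv (%_. 0) g = (%_. 0)" "conv f (%_. 0) = (%_. 0)"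
 by (auto simp: conv_def fun_eq_iff sum.distrib sum_distrib_left algebra_simps)

lemma add_single_closed:
 assumes "f : carrier (free_algebra S)" "g : carrier (free_algebra S)"
 shows "(%t. f t + c * g t) : carrier (free_algebra S)"
proof -
 interpret cspace "free_algebra S" by (rule cspace_free_algebra)
 show ?thesis using a_closed[OF assms(1) smult_closed[OF assms(2), of c]] by (simp add: free_algebra_simps)
qed

lemma single_in_free_algebra: "w : lists S ==> single w : carrier (free_algebra S)"
 by (simp add: free_algebra_simps single_in_free)

lemma free_algebra_induct [consumes 1, case_names zero add]:
 assumes f: "f : carrier (free_algebra S)"
  and zero: "P (%_. 0)"
  and add: "!!f w c. f : carrier (free_algebra S) ==> w : lists S ==> P f ==>
        P (%t. f t + c * single w t)"
 shows "P f"
 using f unfolding free_algebra_simps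
 by (rule free_space_induct) (use zero add in \<open>auto simp: free_algebra_simps\<close>)

lemma conv_closed:
 assumes "f : carrier (free_algebra S)" "g : carrier (free_algebra S)"
 shows "conv f g : carrier (free_algebra S)"
proof -
 have z: "(%_. 0) : carrier (free_algebra S)" by (simp add: free_algebra_simps free_space_simps)
 have 1: "conv (single u) g : carrier (free_algebra S)" if "u : lists S" for u
  using assms(2)
 proof (induction rule: free_algebra_induct)
  case (add g w c)
  thus ?case unfolding conv_add_right conv_single using that
   by (intro add_single_closed single_in_free_algebra) auto
 qed (simp only: conv_zero z)
 show ?thesis
  using assms(1)
 proof (induction rule: free_algebra_induct)
  case (add g w c)
  thus ?case unfolding conv_add_left by (intro add_single_closed 1)
 qed (simp only: conv_zero z)
qed

lemma conv_assoc:
 assumes "f : carrier (free_algebra S)" "g : carrier (free_algebra S)" "h : carrier (free_algebra S)"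
 shows "conv (conv f g) h = conv f (conv g h)"
proof -
 have 1: "conv (conv (single u) (single v)) h = conv (single u) (conv (single v) h)" for u v
  using assms(3) by (induction rule: free_algebra_induct)
   (simp_all only: conv_add_right conv_add_left conv_zero conv_single append_assoc)
 have 2: "conv (conv (single u) g) h = conv (single u) (conv g h)" for u
  using assms(2) by (induction rule: free_algebra_induct)
   (simp_all only: conv_add_right conv_add_left conv_zero 1)
 show ?thesis
  using assms(1) by (induction rule: free_algebra_induct)
   (simp_all only: conv_add_right conv_add_left conv_zero 2)
qed

lemma conv_one:
 assumes "f : carrier (free_algebra S)"
 shows "conv (single []) f = f" "conv f (single []) = f"
 using assms by (induction rule: free_algebra_induct)
  (simp_all only: conv_add_right conv_add_left conv_zero conv_single append_Nil append_Nil2)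

lemma calg_free_algebra: "calg (free_algebra S)"
proof (rule calg_criteria)
 show "cspace (free_algebra S)" by (rule cspace_free_algebra)
 show "\<one>_(free_algebra S) : carrier (free_algebra S)"
  by (simp add: free_algebra_simps single_in_free)
qed (simp_all only: free_algebra_simps(2-) conv_closed conv_assoc conv_one,
   auto simp: conv_def fun_eq_iff sum.distrib sum_distrib_left algebra_simps)

lemma free_gen_closed: "s : S ==> free_gen s : carrier (free_algebra S)"
 by (simp add: free_gen_def single_in_free_algebra)

definition word_eval :: "'b cspace => ('g => 'b) => 'g list => 'b" where
 "word_eval B g w = foldr (%s x. g s \<otimes>_B x) w \<one>_B"

lemma word_eval_simps [simp]:
 "word_eval B g [] = \<one>_B"
 "word_eval B g (s # w) = g s \<otimes>_B word_eval B g w"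
 by (simp_all add: word_eval_def)

context calg
begin

lemma word_eval_closed [simp, intro]:
 assumes "!!s. s : set w ==> g s : carrier A"
 shows "word_eval A g w : carrier A"
 using assms by (induction w) auto

lemma word_eval_append:
 assumes "!!s. s : set u \<union> set w ==> g s : carrier A"
 shows "word_eval A g (u @ w) = word_eval A g u \<otimes>_A word_eval A g w"
 using assms by (induction u) (auto simp: m_assoc)

end

text \<open>Words are evaluated letter by letter, and the value is extended linearly; concatenation of
  words makes this multiplicative.\<close>

lemma free_algebra_hom_exists:
 assumes B: "calg B" and g: "!!s. s : S ==> g s : carrier B"
 obtains h where "h : algebra_hom (free_algebra S) B" "!!s. s : S ==> h (free_gen s) = g s"
proof -
 interpret B: calg B by (rule B)
 let ?g = "word_eval B g"
 have g': "?g w : carrier B" if "w : lists S" for w using that g by (intro B.word_eval_closed) auto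
 interpret h: lin_map "free_space (lists S)" B "lin_ext B ?g"
  using lin_map_lin_ext[OF B.cspace_axioms] g' by blast
 let ?h = "lin_ext B ?g"
 have hs: "?h (single w) = ?g w" if "w : lists S" for w
  by (rule lin_ext_single[OF B.cspace_axioms g' that])
 have addh: "?h (%t. f t + c * f' t) = ?h f \<oplus>_B c \<odot>_B ?h f'"
  if "f : carrier (free_algebra S)" "f' : carrier (free_algebra S)" for f f' c
 proof -
  have "(%t. f t + c * f' t) = f \<oplus>_(free_space (lists S)) c \<odot>_(free_space (lists S)) f'"
   by (simp add: free_space_simps)
  thus ?thesis using that by (simp only: free_algebra_simps(1) h.add h.smult h.V.smult_closed)
 qed
 have zeroh: "?h (%_. 0) = \<zero>_B" using h.zero by (simp only: free_space_simps(3))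
 have cl: "?h f : carrier B" if "f : carrier (free_algebra S)" for f
  using that h.closed by (simp only: free_algebra_simps(1))
 have 1: "?h (conv (single u) f) = ?g u \<otimes>_B ?h f"
  if u: "u : lists S" and f: "f : carrier (free_algebra S)" for u f
  using f
 proof (induction rule: free_algebra_induct)
  case zero
  thus ?case using u g' unfolding conv_zero zeroh by simp
 next
  case (add f w c)
  have "?h (conv (single u) (%t. f t + c * single w t))
    = ?h (conv (single u) f) \<oplus>_B c \<odot>_B ?h (single (u @ w))"
   unfolding conv_add_right conv_single
   using \<open>f : _\<close> \<open>w : _\<close> u by (intro addh)
    (auto intro!: conv_closed single_in_free_algebra)
  also have "... = ?g u \<otimes>_B ?h f \<oplus>_B c \<odot>_B (?g u \<otimes>_B ?g w)"
  proof -
   have "?g (u @ w) = ?g u \<otimes>_B ?g w"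
    using u \<open>w : _\<close> g by (intro B.word_eval_append) auto
   thus ?thesis using add.IH u \<open>w : _\<close> by (subst hs) auto
  qed
  also have "... = ?g u \<otimes>_B ?h (%t. f t + c * single w t)"
   using \<open>f : _\<close> \<open>w : _\<close> u g' cl
   by (subst addh)
     (auto simp: hs B.r_distr B.mult_smult intro!: single_in_free_algebra)
  finally show ?case .
 qed
 have 2: "?h (conv f f') = ?h f \<otimes>_B ?h f'"
  if f: "f : carrier (free_algebra S)" and f': "f' : carrier (free_algebra S)" for f f'
  using f
 proof (induction rule: free_algebra_induct)
  case zero
  thus ?case using f' cl unfolding conv_zero zeroh by simp
 next
  case (add f w c)
  have "?h (conv (%t. f t + c * single w t) f')
    = ?h (conv f f') \<oplus>_B c \<odot>_B ?h (conv (single w) f')"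
   unfolding conv_add_left
   using \<open>f : _\<close> \<open>w : _\<close> f' by (intro addh)
    (auto intro!: conv_closed single_in_free_algebra)
  also have "... = ?h f \<otimes>_B ?h f' \<oplus>_B c \<odot>_B (?g w \<otimes>_B ?h f')"
   using add.IH f' \<open>w : _\<close> by (simp only: 1)
  also have "... = ?h (%t. f t + c * single w t) \<otimes>_B ?h f'"
   using \<open>f : _\<close> \<open>w : _\<close> f' g' cl
   by (subst addh)
     (auto simp: hs B.l_distr B.smult_mult intro!: single_in_free_algebra)
  finally show ?case .
 qed
 have "?h : algebra_hom (free_algebra S) B"
 proof (rule algebra_homI)
  show "?h \<one>_(free_algebra S) = \<one>_B" using hs[of "[]"] by (simp add: free_algebra_simps)
 next
  fix x y assume "x : carrier (free_algebra S)" "y : carrier (free_algebra S)"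
  thus "?h (x \<otimes>_(free_algebra S) y) = ?h x \<otimes>_B ?h y"
   "?h (x \<oplus>_(free_algebra S) y) = ?h x \<oplus>_B ?h y"
   using 2[of x y] h.add[of x y] by (simp_all add: free_algebra_simps(2-) free_space_simps(2-) free_space_as_algebra(1))
 next
  fix c x assume "x : carrier (free_algebra S)"
  thus "?h (c \<odot>_(free_algebra S) x) = c \<odot>_B ?h x"
   using h.smult[of x c] by (simp_all add: free_algebra_simps(2-) free_space_simps(2-) free_space_as_algebra(1))
 qed (rule cl)
 moreover have "?h (free_gen s) = g s" if "s : S" for s
  using hs[of "[s]"] that g by (simp add: free_gen_def)
 ultimately show thesis using that by blast
qed

locale presentation =
 fixes S :: "'g set" and R :: "'g relations"
 assumes rel_closed: "!!x y. (x, y) : R ==> x : carrier (free_algebra S) & y : carrier (free_algebra S)"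
begin

abbreviation "F \<equiv> free_algebra S"
abbreviation "P \<equiv> presented_algebra S R"
abbreviation "N \<equiv> relation_ideal S R"
abbreviation "proj x \<equiv> N +>_F x"

sublocale F: calg F by (rule calg_free_algebra)

lemma rels_sub: "{x \<ominus>_F y | x y. (x, y) : R} <= carrier F"
 using rel_closed by auto

sublocale Q: algebra_quotient F N
 by (rule algebra_quotient.intro[OF F.calg_axioms], rule algebra_quotient_axioms.intro)
   (simp add: relation_ideal_def F.genideal_ideal[OF rels_sub])

lemma calg_presented: "calg P"
 using Q.calg_quotient by (simp add: presented_algebra_def)

lemma proj_hom: "(%x. proj x) : algebra_hom F P"
 using Q.proj_hom by (simp add: presented_algebra_def)

sublocale pr: alg_map F P "%x. proj x"
 using proj_hom calg_presented by (simp add: alg_map_def alg_map_axioms_def F.calg_axioms)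

lemma proj_gen: "proj (free_gen s) = presented_gen S R s"
 by (simp add: presented_gen_def)

lemma gen_closed: "s : S ==> presented_gen S R s : carrier P"
 using pr.closed[OF free_gen_closed] by (simp add: presented_gen_def)

lemma proj_rel: "(x, y) : R ==> proj x = proj y"
 using rel_closed[of x y] F.genideal_self[OF rels_sub]
 by (subst Q.proj_eq_iff) (auto simp: relation_ideal_def)

lemma presented_cases:
 assumes "X : carrier P"
 obtains x where "x : carrier F" "X = proj x"
 using Q.quotient_cases assms by (auto simp: presented_algebra_def)

text \<open>Words are built by adding letters on the left, so it suffices to treat left multiplication by
  a generator.\<close>

lemma presented_induct:
 assumes x: "x : carrier P"
  and one: "Pr \<one>_P"
  and add: "!!x y. x : carrier P ==> y : carrier P ==> Pr x ==> Pr y ==> Pr (x \<oplus>_P y)"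
  and smult: "!!c x. x : carrier P ==> Pr x ==> Pr (c \<odot>_P x)"
  and gen: "!!s x. s : S ==> x : carrier P ==> Pr x ==> Pr (presented_gen S R s \<otimes>_P x)"
 shows "Pr x"
proof -
 have words: "Pr (proj (single w))" if "w : lists S" for w
  using that
 proof (induction w)
  case Nil
  thus ?case using one pr.one by (simp add: free_algebra_simps)
 next
  case (Cons s w)
  have "single (s # w) = free_gen s \<otimes>_F single w"
   using conv_single[of "[s]" w] by (simp add: free_gen_def free_algebra_simps)
  hence "proj (single (s # w)) = presented_gen S R s \<otimes>_P proj (single w)"
   using Cons by (simp add: free_gen_closed single_in_free_algebra proj_gen)
  thus ?case using Cons gen pr.closed[OF single_in_free_algebra[of w S]] by auto
 qed
 have "Pr (proj f)" if "f : carrier F" for f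
  using that
 proof (induction rule: free_algebra_induct)
  case zero
  have "Pr (0 \<odot>_P \<one>_P)" using smult one by blast
  moreover have "proj (%_. 0) = 0 \<odot>_P \<one>_P"
   using pr.zero by (simp add: free_algebra_simps(3))
  ultimately show ?case by simp
 next
  case (add f w c)
  have "(%t. f t + c * single w t) = f \<oplus>_F c \<odot>_F single w" by (simp add: free_algebra_simps)
  hence "proj (%t. f t + c * single w t) = proj f \<oplus>_P c \<odot>_P proj (single w)"
   using add by (simp add: single_in_free_algebra)
  thus ?case
   using add words[of w] pr.closed[OF single_in_free_algebra[of w S]]
   by (auto intro!: assms(3) smult)
 qed
 thus ?thesis using presented_cases[OF x] by metis
qed

lemma presented_hom_unique:
 assumes "h : algebra_hom P B" "h' : algebra_hom P B" "calg B"
  and "!!s. s : S ==> h (presented_gen S R s) = h' (presented_gen S R s)"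
  and "x : carrier P"
 shows "h x = h' x"
proof -
 interpret h: alg_map P B h
  using assms calg_presented by (simp add: alg_map_def alg_map_axioms_def)
 interpret h': alg_map P B h'
  using assms calg_presented by (simp add: alg_map_def alg_map_axioms_def)
 show ?thesis
  using assms(5) by (rule presented_induct) (auto simp: assms(4) gen_closed)
qed

text \<open>The kernel of the map from the free algebra is an ideal which contains the differences of the
  relations, hence the whole relation ideal.\<close>

lemma presented_hom_exists:
 assumes B: "calg B" and g: "!!s. s : S ==> g s : carrier B"
  and rel: "!!h x y. alg_map F B h ==> (!!s. s : S ==> h (free_gen s) = g s) ==> (x, y) : R ==> h x = h y"
 obtains h where "h : algebra_hom P B" "!!s. s : S ==> h (presented_gen S R s) = g s"
proof -
 obtain k where k: "k : algebra_hom F B" "!!s. s : S ==> k (free_gen s) = g s"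
  using free_algebra_hom_exists[OF B, of S g] g by metis
 interpret B: calg B by (rule B)
 interpret k: alg_map F B k
  using k by (simp add: alg_map_def alg_map_axioms_def B F.calg_axioms)
 have ker: "ideal {x : carrier F. k x = \<zero>_B} F"
 proof (rule idealI[OF F.ring_axioms])
  show "subgroup {x : carrier F. k x = \<zero>_B} (add_monoid F)"
  proof (rule F.add.subgroupI)
   fix a assume "a : {x : carrier F. k x = \<zero>_B}"
   hence "a : carrier F" "k ((-1) \<odot>_F a) = \<zero>_B" by auto
   thus "\<ominus>_F a : {x : carrier F. k x = \<zero>_B}"
    by (simp add: F.neg_smult)
  qed auto
 qed auto
 have "N <= {x : carrier F. k x = \<zero>_B}"
  unfolding relation_ideal_def
 proof (rule F.genideal_minimal[OF ker], safe)
  fix x y assume xy: "(x, y) : R"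
  thus "x \<ominus>_F y : carrier F" using rel_closed by auto
  have "k x = k y" using rel[OF k.alg_map_axioms k(2) xy] by blast
  thus "k (x \<ominus>_F y) = \<zero>_B" using rel_closed[OF xy] by (simp add: B.minus_eq_zero_iff)
 qed
 hence kz: "k x = \<zero>_B" if "x : N" for x using that by auto
 obtain h where h: "lin_map P B h" "!!x. x : carrier F ==> h (proj x) = k x"
  using Q.linear_factor[OF k.lin_map_axioms kz] by (auto simp: presented_algebra_def)
 interpret h: lin_map P B h by (rule h)
 have "h : algebra_hom P B"
 proof (rule algebra_homI)
  fix x y assume "x : carrier P" "y : carrier P"
  then obtain x' y' where "x' : carrier F" "y' : carrier F" "x = proj x'" "y = proj y'"
   by (metis presented_cases)
  thus "h (x \<otimes>_P y) = h x \<otimes>_B h y" by (simp add: h(2) flip: pr.mult)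
 next
  show "h \<one>_P = \<one>_B" using h(2)[OF F.one_closed] by (simp flip: pr.one)
 qed auto
 moreover have "h (presented_gen S R s) = g s" if "s : S" for s
  using h(2)[OF free_gen_closed[OF that]] k(2)[OF that] by (simp add: proj_gen)
 ultimately show thesis using that by blast
qed

end

section \<open>Tensor products\<close>

locale tensor_pair = V: cspace V + U: cspace U for V :: "'v cspace" and U :: "'u cspace"
begin

abbreviation "FS \<equiv> free_space (carrier V \<times> carrier U)"
abbreviation "N \<equiv> tensor_null V U"
abbreviation "pt \<equiv> pure_tensor V U"

definition null_gens :: "('v \<times> 'u => complex) set" where
 "null_gens =
    {single (v \<oplus>_V v', u) \<ominus>_FS (single (v, u) \<oplus>_FS single (v', u)) | v v' u.
      v : carrier V & v' : carrier V & u : carrier U} \<union>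
    {single (v, u \<oplus>_U u') \<ominus>_FS (single (v, u) \<oplus>_FS single (v, u')) | v u u'.
      v : carrier V & u : carrier U & u' : carrier U} \<union>
    {single (c \<odot>_V v, u) \<ominus>_FS c \<odot>_FS single (v, u) | c v u.
      v : carrier V & u : carrier U} \<union>
    {single (v, c \<odot>_U u) \<ominus>_FS c \<odot>_FS single (v, u) | c v u.
      v : carrier V & u : carrier U}"

lemma N_eq: "N = LinearCombinations.module.span Cx FS null_gens"
 by (simp add: tensor_null_def null_gens_def Let_def)

sublocale FS: cspace FS by (rule cspace_free)

lemma null_gens_sub: "null_gens <= carrier FS"
 unfolding null_gens_def
 by (auto intro!: FS.minus_closed FS.a_closed FS.smult_closed single_in_free)

sublocale Q: quotient_by FS N
proof (rule quotient_by.intro[OF FS.cspace_axioms], rule quotient_by_axioms.intro)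
 interpret vectorspace Cx FS by (rule FS.vs)
 show "VectorSpace.subspace Cx N FS"
  unfolding N_eq by (rule span_is_subspace[OF null_gens_sub])
qed

lemma null_gens_N: "null_gens <= N"
 unfolding N_eq by (rule module.in_own_span[OF FS.mod null_gens_sub])

lemma cspace_tensor: "cspace (tensor V U)"
 using Q.cspace_quotient by (simp add: tensor_def)

sublocale T: cspace "tensor V U" by (rule cspace_tensor)

lemma pt_def: "pt v u = N +>_FS single (v, u)"
 by (simp add: pure_tensor_def)

lemma pt_closed [simp, intro]: "v : carrier V ==> u : carrier U ==> pt v u : carrier (tensor V U)"
 using Q.proj_closed by (simp add: pt_def tensor_def single_in_free)

lemma proj_add: "x : carrier FS ==> y : carrier FS ==>
  N +>_FS (x \<oplus>_FS y) = (N +>_FS x) \<oplus>_(tensor V U) (N +>_FS y)"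
 using Q.proj_add by (simp add: tensor_def)

lemma proj_smult: "x : carrier FS ==>
  N +>_FS (c \<odot>_FS x) = c \<odot>_(tensor V U) (N +>_FS x)"
 using Q.proj_smult by (simp add: tensor_def)

lemma proj_null_gen: "x : carrier FS ==> y : carrier FS ==> x \<ominus>_FS y : null_gens ==>
  N +>_FS x = N +>_FS y"
 using null_gens_N by (auto simp: Q.proj_eq_iff)

lemma pt_add_left: "v : carrier V ==> v' : carrier V ==> u : carrier U ==>
  pt (v \<oplus>_V v') u = pt v u \<oplus>_(tensor V U) pt v' u"
 unfolding pt_def
 by (subst proj_add[symmetric]; (intro proj_null_gen)?)
   (auto intro!: single_in_free FS.a_closed simp: null_gens_def)

lemma pt_add_right: "v : carrier V ==> u : carrier U ==> u' : carrier U ==>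
  pt v (u \<oplus>_U u') = pt v u \<oplus>_(tensor V U) pt v u'"
 unfolding pt_def
 by (subst proj_add[symmetric]; (intro proj_null_gen)?)
   (auto intro!: single_in_free FS.a_closed simp: null_gens_def)

lemma pt_smult_left: "v : carrier V ==> u : carrier U ==>
  pt (c \<odot>_V v) u = c \<odot>_(tensor V U) pt v u"
 unfolding pt_def
 by (subst proj_smult[symmetric]; (intro proj_null_gen)?)
   (auto intro!: single_in_free FS.smult_closed simp: null_gens_def)

lemma pt_smult_right: "v : carrier V ==> u : carrier U ==>
  pt v (c \<odot>_U u) = c \<odot>_(tensor V U) pt v u"
 unfolding pt_def
 by (subst proj_smult[symmetric]; (intro proj_null_gen)?)
   (auto intro!: single_in_free FS.smult_closed simp: null_gens_def)

text \<open>Scalars can be absorbed in the first factor, so sums of pure tensors exhaust the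
  space.\<close>

lemma tensor_induct [consumes 1, case_names pure add]:
 assumes x: "x : carrier (tensor V U)"
  and pure: "!!v u. v : carrier V ==> u : carrier U ==> Pr (pt v u)"
  and add: "!!x y. x : carrier (tensor V U) ==> y : carrier (tensor V U) ==> Pr x ==> Pr y ==>
        Pr (x \<oplus>_(tensor V U) y)"
 shows "Pr x"
proof -
 have "Pr (N +>_FS f)" if "f : carrier FS" for f
  using that
 proof (induction rule: free_space_induct)
  case zero
  have "Pr (pt (0 \<odot>_V \<zero>_V) \<zero>_U)" by (rule pure) auto
  hence "Pr (0 \<odot>_(tensor V U) pt \<zero>_V \<zero>_U)" by (subst (asm) pt_smult_left) auto
  thus ?case using Q.proj_zero by (simp add: free_space_simps(3) tensor_def[symmetric])
 next
  case (add f s c)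
  obtain v u where s: "s = (v, u)" "v : carrier V" "u : carrier U" using add by auto
  have "(%t. f t + c * single s t) = f \<oplus>_FS c \<odot>_FS single s" by (simp add: free_space_simps)
  hence "N +>_FS (%t. f t + c * single s t) = (N +>_FS f) \<oplus>_(tensor V U) pt (c \<odot>_V v) u"
   using add s by (simp add: proj_add proj_smult pt_smult_left single_in_free) (simp add: pt_def)
  thus ?case
   using add s Q.proj_closed[OF add(1)] by (auto intro!: assms(3) pure simp: tensor_def[symmetric])
 qed
 thus ?thesis using Q.quotient_cases x by (metis tensor_def)
qed

text \<open>The linear extension of \<open>b\<close> to the free space kills the defining relations by
  bilinearity.\<close>

lemma tensor_universal:
 assumes W: "cspace W"
  and cl: "!!v u. v : carrier V ==> u : carrier U ==> b v u : carrier W"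
  and "!!v v' u. v : carrier V ==> v' : carrier V ==> u : carrier U ==>
      b (v \<oplus>_V v') u = b v u \<oplus>_W b v' u"
  and "!!v u u'. v : carrier V ==> u : carrier U ==> u' : carrier U ==>
      b v (u \<oplus>_U u') = b v u \<oplus>_W b v u'"
  and "!!c v u. v : carrier V ==> u : carrier U ==> b (c \<odot>_V v) u = c \<odot>_W b v u"
  and "!!c v u. v : carrier V ==> u : carrier U ==> b v (c \<odot>_U u) = c \<odot>_W b v u"
 obtains h where "lin_map (tensor V U) W h"
  "!!v u. v : carrier V ==> u : carrier U ==> h (pt v u) = b v u"
proof -
 interpret W: cspace W by (rule W)
 let ?b = "%(v, u). b v u"
 have b: "?b s : carrier W" if "s : carrier V \<times> carrier U" for s using that cl by auto
 interpret k: lin_map FS W "lin_ext W ?b"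
  by (rule lin_map_lin_ext[OF W]) (rule b)
 have ks: "lin_ext W ?b (single (v, u)) = b v u" if "v : carrier V" "u : carrier U" for v u
  using lin_ext_single[where S = "carrier V \<times> carrier U" and s = "(v, u)" and g = ?b, OF W b] that
  by auto
 have "null_gens <= {x : carrier FS. lin_ext W ?b x = \<zero>_W}"
  using null_gens_sub unfolding null_gens_def
  by (auto simp: single_in_free ks assms W.minus_eq_zero_iff)
 moreover have "submodule Cx {x : carrier FS. lin_ext W ?b x = \<zero>_W} FS"
  using FS.mod by (auto simp: submodule_def)
 ultimately have "N <= {x : carrier FS. lin_ext W ?b x = \<zero>_W}"
  unfolding N_eq by (rule module.span_is_subset[OF FS.mod])
 hence z: "!!x. x : N ==> lin_ext W ?b x = \<zero>_W" by blast
 obtain h where "lin_map (tensor V U) W h" "!!x. x : carrier FS ==> h (N +>_FS x) = lin_ext W ?b x"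
  using Q.linear_factor[OF k.lin_map_axioms z, folded tensor_def] by metis
 thus thesis using that ks by (auto simp: pt_def single_in_free)
qed

lemma tensor_map_unique:
 assumes "h : carrier (End_alg (tensor V U))" "h' : carrier (End_alg (tensor V U))"
  and "!!v u. v : carrier V ==> u : carrier U ==> h (pt v u) = h' (pt v u)"
 shows "h = h'"
proof (rule End_eqI[OF assms(1,2)])
 fix x assume "x : carrier (tensor V U)"
 thus "h x = h' x"
  by (induction rule: tensor_induct) (use assms in \<open>auto simp: End_carrier_iff\<close>)
qed

lemma tensor_map_spec:
 assumes f: "f : carrier (End_alg V)" and g: "g : carrier (End_alg U)"
 shows "tensor_map V U f g : carrier (End_alg (tensor V U))"
  and "!!v u. v : carrier V ==> u : carrier U ==> tensor_map V U f g (pt v u) = pt (f v) (g u)"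
proof -
 have f': "!!v. v : carrier V ==> f v : carrier V"
  "!!v w. v : carrier V ==> w : carrier V ==> f (v \<oplus>_V w) = f v \<oplus>_V f w"
  "!!c v. v : carrier V ==> f (c \<odot>_V v) = c \<odot>_V f v"
  using f by (auto simp: End_carrier_iff)
 have g': "!!v. v : carrier U ==> g v : carrier U"
  "!!v w. v : carrier U ==> w : carrier U ==> g (v \<oplus>_U w) = g v \<oplus>_U g w"
  "!!c v. v : carrier U ==> g (c \<odot>_U v) = c \<odot>_U g v"
  using g by (auto simp: End_carrier_iff)
 obtain h where h: "lin_map (tensor V U) (tensor V U) h"
  "!!v u. v : carrier V ==> u : carrier U ==> h (pt v u) = pt (f v) (g u)"
  by (rule tensor_universal[OF cspace_tensor, of "%v u. pt (f v) (g u)"])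
    (auto simp: f' g' pt_add_left pt_add_right pt_smult_left pt_smult_right)
 interpret h: lin_map "tensor V U" "tensor V U" h by (rule h)
 have "restrict h (carrier (tensor V U)) : carrier (End_alg (tensor V U))"
  by (auto simp: End_carrier_iff)
 hence ex: "EX h. h : carrier (End_alg (tensor V U)) \<and>
  (\<forall>v\<in>carrier V. \<forall>u\<in>carrier U. h (pt v u) = pt (f v) (g u))"
  using h(2) by (intro exI[of _ "restrict h (carrier (tensor V U))"]) auto
 have "\<exists>!h. h : carrier (End_alg (tensor V U)) \<and>
  (\<forall>v\<in>carrier V. \<forall>u\<in>carrier U. h (pt v u) = pt (f v) (g u))"
  by (rule ex_ex1I[OF ex], rule tensor_map_unique) auto
 from theI'[OF this] show "tensor_map V U f g : carrier (End_alg (tensor V U))"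
  "!!v u. v : carrier V ==> u : carrier U ==> tensor_map V U f g (pt v u) = pt (f v) (g u)"
  by (auto simp: tensor_map_def)
qed

lemma tensor_map_mult:
 assumes "f : carrier (End_alg V)" "g : carrier (End_alg U)"
  "f' : carrier (End_alg V)" "g' : carrier (End_alg U)"
 shows "tensor_map V U f g \<otimes>_(End_alg (tensor V U)) tensor_map V U f' g' =
  tensor_map V U (f \<otimes>_(End_alg V) f') (g \<otimes>_(End_alg U) g')"
proof -
 interpret EV: calg "End_alg V" by (rule V.calg_End)
 interpret EU: calg "End_alg U" by (rule U.calg_End)
 interpret ET: calg "End_alg (tensor V U)" by (rule T.calg_End)
 have c: "f' v : carrier V" if "v : carrier V" for v using that assms by (auto simp: End_carrier_iff)
 have c': "g' v : carrier U" if "v : carrier U" for v using that assms by (auto simp: End_carrier_iff)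
 note m = EV.m_closed[OF assms(1,3)] EU.m_closed[OF assms(2,4)]
 show ?thesis
  by (rule tensor_map_unique)
    (use assms m c c' in \<open>auto simp: tensor_map_spec compose_def simp del: End_alg_simps
     intro!: ET.m_closed tensor_map_spec\<close>,
    use assms m c c' tensor_map_spec[OF m] in \<open>auto simp: tensor_map_spec compose_def\<close>)
qed

lemma tensor_map_one: "tensor_map V U \<one>_(End_alg V) \<one>_(End_alg U) = \<one>_(End_alg (tensor V U))"
proof -
 interpret EV: calg "End_alg V" by (rule V.calg_End)
 interpret EU: calg "End_alg U" by (rule U.calg_End)
 interpret ET: calg "End_alg (tensor V U)" by (rule T.calg_End)
 show ?thesis
  by (rule tensor_map_unique)
    (use tensor_map_spec[OF EV.one_closed EU.one_closed] ET.one_closed in auto)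
qed

lemma tensor_map_bilinear:
 assumes "f : carrier (End_alg V)" "g : carrier (End_alg U)"
  "f' : carrier (End_alg V)" "g' : carrier (End_alg U)"
 shows "tensor_map V U (f \<oplus>_(End_alg V) f') g =
   tensor_map V U f g \<oplus>_(End_alg (tensor V U)) tensor_map V U f' g" (is ?add1)
  and "tensor_map V U f (g \<oplus>_(End_alg U) g') =
   tensor_map V U f g \<oplus>_(End_alg (tensor V U)) tensor_map V U f g'" (is ?add2)
  and "tensor_map V U (c \<odot>_(End_alg V) f) g = c \<odot>_(End_alg (tensor V U)) tensor_map V U f g" (is ?sm1)
  and "tensor_map V U f (c \<odot>_(End_alg U) g) = c \<odot>_(End_alg (tensor V U)) tensor_map V U f g" (is ?sm2)
proof -
 interpret EV: calg "End_alg V" by (rule V.calg_End)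
 interpret EU: calg "End_alg U" by (rule U.calg_End)
 interpret ET: calg "End_alg (tensor V U)" by (rule T.calg_End)
 have c: "f v : carrier V" "f' v : carrier V" if "v : carrier V" for v
  using that assms by (auto simp: End_carrier_iff)
 have c': "g v : carrier U" "g' v : carrier U" if "v : carrier U" for v
  using that assms by (auto simp: End_carrier_iff)
 note cl = EV.a_closed[OF assms(1,3)] EU.a_closed[OF assms(2,4)] EV.smult_closed[OF assms(1), of c]
  EU.smult_closed[OF assms(2), of c]
 note tm = tensor_map_spec[OF assms(1,2)] tensor_map_spec[OF assms(3,2)]
  tensor_map_spec[OF assms(1,4)]
 show ?add1
  by (rule tensor_map_unique)
    (use tm c c' tensor_map_spec[OF cl(1) assms(2)] ET.a_closed[OF tm(1,3)] in
     \<open>auto simp: pt_add_left\<close>)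
 show ?add2
  by (rule tensor_map_unique)
    (use tm c c' tensor_map_spec[OF assms(1) cl(2)] ET.a_closed[OF tm(1,5)] in
     \<open>auto simp: pt_add_right\<close>)
 show ?sm1
  by (rule tensor_map_unique)
    (use tm c c' tensor_map_spec[OF cl(3) assms(2)] ET.smult_closed[OF tm(1), of c] in
     \<open>auto simp: pt_smult_left\<close>)
 show ?sm2
  by (rule tensor_map_unique)
    (use tm c c' tensor_map_spec[OF assms(1) cl(4)] ET.smult_closed[OF tm(1), of c] in
     \<open>auto simp: pt_smult_right\<close>)
qed

end

section \<open>Irreducible representations\<close>

lemma alg_map_lin: "alg_map A B h ==> lin_map A B h"
 by (simp add: alg_map_def alg_map.is_lin lin_map_def lin_map_axioms_def calg_def cspace_def
   complex_algebra_def alg_map_axioms_def)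

definition stable_subset :: "'a cspace => 'v cspace => ('a => 'v => 'v) => 'v set => bool" where
 "stable_subset A V rho W \<longleftrightarrow> W <= carrier V & \<zero>_V : W & (\<forall>x\<in>W. \<forall>y\<in>W. x \<oplus>_V y : W) \<and>
   (ALL c. \<forall>x\<in>W. c \<odot>_V x : W) & (\<forall>a\<in>carrier A. \<forall>w\<in>W. rho a w : W)"

lemma invariant_subspace_iff:
 "cspace V ==> invariant_subspace A V rho W \<longleftrightarrow> stable_subset A V rho W"
 by (auto simp: invariant_subspace_def stable_subset_def cspace.subspace_iff)

locale irrep = arep +
 assumes nontrivial: "carrier V ~= {\<zero>_V}"
  and irred: "stable_subset A V rho W ==> W = {\<zero>_V} | W = carrier V"

lemma irreducible_rep_iff: "calg A ==> irreducible_rep A V rho \<longleftrightarrow> irrep A V rho"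
 unfolding irreducible_rep_def representation_iff irrep_def irrep_axioms_def
 by (metis arep.axioms(2) invariant_subspace_iff)

definition left_ideal :: "'a cspace => 'a set => bool" where
 "left_ideal A K \<longleftrightarrow> stable_subset A A (%a x. a \<otimes>_A x) K"

text \<open>The orbit is a nonzero invariant subspace.\<close>

lemma (in irrep) orbit:
 assumes K: "left_ideal A K" and w: "w : carrier V" and x: "x : K" "rho x w ~= \<zero>_V"
 shows "(%x. rho x w) ` K = carrier V"
proof -
 have sub: "K <= carrier A" and K': "\<zero>_A : K" "!!x y. x : K ==> y : K ==> x \<oplus>_A y : K"
  "!!c x. x : K ==> c \<odot>_A x : K" "!!a x. a : carrier A ==> x : K ==> a \<otimes>_A x : K"
  using K by (auto simp: left_ideal_def stable_subset_def)
 have "stable_subset A V rho ((%x. rho x w) ` K)"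
  unfolding stable_subset_def
 proof (intro conjI ballI allI)
  show "(%x. rho x w) ` K <= carrier V" using sub w by auto
  show "\<zero>_V : (%x. rho x w) ` K" using K'(1) zero_act[OF w] by (metis imageI)
 next
  fix x y assume "x : (%x. rho x w) ` K" "y : (%x. rho x w) ` K"
  then obtain a b where "a : K" "b : K" "x = rho a w" "y = rho b w" by auto
  thus "x \<oplus>_V y : (%x. rho x w) ` K"
   using K'(2) add_act[of a b w] sub w by (metis imageI subsetD)
 next
  fix c x assume "x : (%x. rho x w) ` K"
  then obtain a where "a : K" "x = rho a w" by auto
  thus "c \<odot>_V x : (%x. rho x w) ` K"
   using K'(3) smult_act[of a w c] sub w by (metis imageI subsetD)
 next
  fix a x assume "a : carrier A" "x : (%x. rho x w) ` K"
  then obtain b where "a : carrier A" "b : K" "x = rho b w" by auto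
  thus "rho a x : (%x. rho x w) ` K"
   using K'(4) mult_act[of a b w] sub w by (metis imageI subsetD)
 qed
 thus ?thesis using irred x by blast
qed

lemma left_ideal_carrier: "calg A ==> left_ideal A (carrier A)"
proof -
 assume "calg A"
 then interpret calg A .
 show ?thesis by (auto simp: left_ideal_def stable_subset_def)
qed

definition intertwiner ::
  "'a cspace => 'v cspace => ('a => 'v => 'v) => 'w cspace => ('a => 'w => 'w) => ('v => 'w) => bool" where
 "intertwiner A V rho W \<pi> phi \<longleftrightarrow> phi : LinearCombinations.module_hom Cx V W \<and>
   (\<forall>a\<in>carrier A. \<forall>v\<in>carrier V. phi (rho a v) = \<pi> a (phi v))"

lemma equivalent_reps_iff:
 "equivalent_reps A V rho W \<pi> \<longleftrightarrow> (\<exists>phi. intertwiner A V rho W \<pi> phi & bij_betw phi (carrier V) (carrier W))"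
 by (auto simp: equivalent_reps_def intertwiner_def)

text \<open>Kernel and image are invariant subspaces.\<close>

lemma schur_bijective:
 assumes V: "irrep A V rho" and W: "irrep A W \<pi>" and phi: "intertwiner A V rho W \<pi> phi"
  and v: "v : carrier V" "phi v ~= \<zero>_W"
 shows "bij_betw phi (carrier V) (carrier W)"
proof -
 interpret V: irrep A V rho by (rule V)
 interpret W: irrep A W \<pi> by (rule W)
 interpret f: lin_map V W phi
  using phi by unfold_locales (auto simp: intertwiner_def)
 have it: "phi (rho a v) = \<pi> a (phi v)" if "a : carrier A" "v : carrier V" for a v
  using phi that by (auto simp: intertwiner_def)
 have "stable_subset A V rho {v : carrier V. phi v = \<zero>_W}"
  by (auto simp: stable_subset_def it W.act_zero)
 hence ker: "{v : carrier V. phi v = \<zero>_W} = {\<zero>_V}"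
  using V.irred v by blast
 have "inj_on phi (carrier V)"
 proof (rule inj_onI)
  fix x y assume xy: "x : carrier V" "y : carrier V" "phi x = phi y"
  hence "phi (x \<ominus>_V y) = \<zero>_W" by (simp add: W.V.minus_eq_zero_iff)
  hence "x \<ominus>_V y = \<zero>_V" using ker V.V.minus_closed[OF xy(1,2)] by blast
  thus "x = y" using V.V.minus_eq_zero_iff[OF xy(1,2)] by blast
 qed
 moreover have "stable_subset A W \<pi> (phi ` carrier V)"
  unfolding stable_subset_def
  by (auto simp flip: it f.add f.smult intro!: imageI) (metis f.zero V.V.zero_closed imageI)
 hence "phi ` carrier V = carrier W"
  using W.irred v by blast
 ultimately show ?thesis by (simp add: bij_betw_def)
qed

text \<open>An irreducible representation is a quotient \<open>K / Ann(w)\<close> of any left ideal \<open>K\<close> that does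
 not kill the vector \<open>w\<close>; this gives a way to compare two irreducible representations.\<close>

lemma cyclic_intertwiner:
 assumes V: "irrep A V rho" and W: "irrep A W \<pi>" and K: "left_ideal A K"
  and w: "w : carrier V" and t: "t : carrier W"
  and kill: "!!x. x : K ==> rho x w = \<zero>_V ==> \<pi> x t = \<zero>_W"
  and x0: "x0 : K" "\<pi> x0 t ~= \<zero>_W"
 obtains phi where "intertwiner A V rho W \<pi> phi" "bij_betw phi (carrier V) (carrier W)"
  "!!x. x : K ==> phi (rho x w) = \<pi> x t"
proof -
 interpret V: irrep A V rho by (rule V)
 interpret W: irrep A W \<pi> by (rule W)
 have sub: "K <= carrier A" and K': "!!x y. x : K ==> y : K ==> x \<oplus>_A y : K"
  "!!c x. x : K ==> c \<odot>_A x : K" "!!a x. a : carrier A ==> x : K ==> a \<otimes>_A x : K"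
  using K by (auto simp: left_ideal_def stable_subset_def)
 have KA: "!!x. x : K ==> x : carrier A" using sub by auto
 have x0': "rho x0 w ~= \<zero>_V" using kill x0 by auto
 have onto: "(%x. rho x w) ` K = carrier V" by (rule V.orbit[OF K w x0(1) x0'])
 define phi where "phi v = \<pi> (SOME x. x : K & rho x w = v) t" for v
 have phi: "phi (rho x w) = \<pi> x t" if x: "x : K" for x
 proof -
  define y where "y = (SOME y. y : K & rho y w = rho x w)"
  have y: "y : K" "rho y w = rho x w"
   using someI_ex[of "%y. y : K & rho y w = rho x w"] x unfolding y_def by blast+
  have d: "y \<ominus>_A x : K"
   using K'(1)[OF y(1) K'(2)[OF x, of "-1"]] KA[OF x] KA[OF y(1)] by (simp add: V.A.minus_smult)
  have "rho (y \<ominus>_A x) w = \<zero>_V"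
   unfolding V.diff_act[OF KA[OF y(1)] KA[OF x] w] y(2)
   using w KA[OF x] by (simp add: V.V.minus_eq_zero_iff)
  hence "\<pi> (y \<ominus>_A x) t = \<zero>_W" by (rule kill[OF d])
  hence "\<pi> y t = \<pi> x t"
   unfolding W.diff_act[OF KA[OF y(1)] KA[OF x] t]
   using t KA[OF x] KA[OF y(1)] by (simp add: W.V.minus_eq_zero_iff)
  thus ?thesis by (simp add: phi_def y_def)
 qed
 have ex: "\<exists>x\<in>K. v = rho x w" if "v : carrier V" for v using onto that by auto
 have "phi : LinearCombinations.module_hom Cx V W"
  unfolding module_hom_Cx_iff
 proof (intro conjI ballI allI)
  fix v assume "v : carrier V"
  then obtain x where x: "x : K" "v = rho x w" using ex by blast
  thus "phi v : carrier W" using phi KA t by simp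
  show "phi (c \<odot>_V v) = c \<odot>_W phi v" for c
   using phi[OF K'(2)[OF x(1), of c]] phi[OF x(1)] V.smult_act[OF KA[OF x(1)] w, of c]
    W.smult_act[OF KA[OF x(1)] t, of c] x(2) by metis
 next
  fix v v' assume "v : carrier V" "v' : carrier V"
  then obtain x y where x: "x : K" "v = rho x w" and y: "y : K" "v' = rho y w" using ex by metis
  thus "phi (v \<oplus>_V v') = phi v \<oplus>_W phi v'"
   using phi[OF K'(1)[OF x(1) y(1)]] phi[OF x(1)] phi[OF y(1)] V.add_act[OF KA[OF x(1)] KA[OF y(1)] w]
    W.add_act[OF KA[OF x(1)] KA[OF y(1)] t] by metis
 qed
 moreover have "phi (rho a v) = \<pi> a (phi v)" if a: "a : carrier A" and v: "v : carrier V" for a v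
 proof -
  obtain x where x: "x : K" "v = rho x w" using ex v by blast
  thus ?thesis
   using phi[OF K'(3)[OF a x(1)]] phi[OF x(1)] V.mult_act[OF a KA[OF x(1)] w]
    W.mult_act[OF a KA[OF x(1)] t] by metis
 qed
 ultimately have i: "intertwiner A V rho W \<pi> phi" by (auto simp: intertwiner_def)
 have "bij_betw phi (carrier V) (carrier W)"
  by (rule schur_bijective[OF V W i V.act_closed[OF KA[OF x0(1)] w]]) (use phi x0 in auto)
 thus thesis using that i phi by blast
qed

section \<open>Algebras with a system of matrix units\<close>

text \<open>Elements that multiply like elementary matrices of a sum of full matrix algebras. Spanning is
  stated as an induction principle; linear independence is not assumed and holds as soon as each block
  acts on a nonzero vector.\<close>

locale matrix_units = calg A for A :: "'a cspace" +
 fixes L :: "'l set" and I :: "'l => 'i set" and u :: "'l => 'i => 'i => 'a"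
 assumes fin: "finite L" "!!l. l : L ==> finite (I l)"
  and u_closed [simp, intro]: "!!l a b. l : L ==> a : I l ==> b : I l ==> u l a b : carrier A"
  and u_mult: "!!l m a b c d. l : L ==> m : L ==> a : I l ==> b : I l ==> c : I m ==> d : I m ==>
      u l a b \<otimes>_A u m c d = (if l = m & b = c then u l a d else \<zero>_A)"
  and u_one: "(\<Oplus>_A l\<in>L. \<Oplus>_A a\<in>I l. u l a a) = \<one>_A"
  and u_span: "!!W. W <= carrier A ==> \<zero>_A : W ==> (!!x y. x : W ==> y : W ==> x \<oplus>_A y : W) ==>
      (!!c x. x : W ==> c \<odot>_A x : W) ==>
      (!!l a b. l : L ==> a : I l ==> b : I l ==> u l a b : W) ==> carrier A <= W"
begin

text \<open>Since \<open>u l a a x u m b b\<close> is a combination of the products \<open>u l a a u j c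
  d u m b b\<close>, only the unit \<open>u l a b\<close> survives.\<close>

lemma compress:
 assumes "x : carrier A" "l : L" "m : L" "a : I l" "b : I m"
 shows "EX c. u l a a \<otimes>_A x \<otimes>_A u m b b = (if l = m then c \<odot>_A u l a b else \<zero>_A)"
  (is "?Q x")
proof -
 have "carrier A <= {x : carrier A. ?Q x}"
 proof (rule u_span)
  show "\<zero>_A : {x : carrier A. ?Q x}" using assms by (auto intro!: exI[of _ 0])
 next
  fix x y assume xy: "x : {x : carrier A. ?Q x}" "y : {x : carrier A. ?Q x}"
  then obtain c d where "x : carrier A" "y : carrier A"
   "u l a a \<otimes>_A x \<otimes>_A u m b b = (if l = m then c \<odot>_A u l a b else \<zero>_A)"
   "u l a a \<otimes>_A y \<otimes>_A u m b b = (if l = m then d \<odot>_A u l a b else \<zero>_A)" by auto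
  hence "u l a a \<otimes>_A (x \<oplus>_A y) \<otimes>_A u m b b = (if l = m then (c + d) \<odot>_A u l a b else \<zero>_A)"
   using assms by (auto simp: r_distr l_distr add_smult)
  thus "x \<oplus>_A y : {x : carrier A. ?Q x}" using xy by blast
 next
  fix k x assume x: "x : {x : carrier A. ?Q x}"
  then obtain c where "x : carrier A"
   "u l a a \<otimes>_A x \<otimes>_A u m b b = (if l = m then c \<odot>_A u l a b else \<zero>_A)" by auto
  hence "u l a a \<otimes>_A (k \<odot>_A x) \<otimes>_A u m b b = (if l = m then (k * c) \<odot>_A u l a b else \<zero>_A)"
   using assms by (auto simp: mult_smult smult_mult smult_smult)
  thus "k \<odot>_A x : {x : carrier A. ?Q x}" using x by blast
 next
  fix k c d assume k: "k : L" "c : I k" "d : I k"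
  have "u l a a \<otimes>_A u k c d \<otimes>_A u m b b =
    (if l = m then (if k = l & c = a & d = b then 1 else 0) \<odot>_A u l a b else \<zero>_A)"
   using assms k by (auto simp: u_mult)
  thus "u k c d : {x : carrier A. ?Q x}" using k by blast
 qed auto
 thus ?thesis using assms(1) by blast
qed

lemma inner_one_closed: "l : L ==> (\<Oplus>_A a\<in>I l. u l a a) : carrier A"
 by (rule finsum_closed) auto

lemma expand_left:
 assumes x: "x : carrier A"
 shows "x = (\<Oplus>_A l\<in>L. \<Oplus>_A a\<in>I l. u l a a \<otimes>_A x)"
proof -
 have "x = (\<Oplus>_A l\<in>L. \<Oplus>_A a\<in>I l. u l a a) \<otimes>_A x" using x by (simp add: u_one)
 also have "... = (\<Oplus>_A l\<in>L. (\<Oplus>_A a\<in>I l. u l a a) \<otimes>_A x)"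
  by (rule finsum_mult) (use x inner_one_closed in auto)
 also have "... = (\<Oplus>_A l\<in>L. \<Oplus>_A a\<in>I l. u l a a \<otimes>_A x)"
  by (rule finsum_cong') (use x in \<open>auto intro!: finsum_mult finsum_closed\<close>)
 finally show ?thesis .
qed

lemma expand_right:
 assumes x: "x : carrier A"
 shows "x = (\<Oplus>_A l\<in>L. \<Oplus>_A a\<in>I l. x \<otimes>_A u l a a)"
proof -
 have "x = x \<otimes>_A (\<Oplus>_A l\<in>L. \<Oplus>_A a\<in>I l. u l a a)" using x by (simp add: u_one)
 also have "... = (\<Oplus>_A l\<in>L. x \<otimes>_A (\<Oplus>_A a\<in>I l. u l a a))"
  by (rule mult_finsum) (use x inner_one_closed in auto)
 also have "... = (\<Oplus>_A l\<in>L. \<Oplus>_A a\<in>I l. x \<otimes>_A u l a a)"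
  by (rule finsum_cong') (use x in \<open>auto intro!: mult_finsum finsum_closed\<close>)
 finally show ?thesis .
qed

lemma all_zero_right:
 assumes x: "x : carrier A" and z: "!!l a. l : L ==> a : I l ==> x \<otimes>_A u l a a = \<zero>_A"
 shows "x = \<zero>_A"
proof -
 have "(\<Oplus>_A l\<in>L. \<Oplus>_A a\<in>I l. x \<otimes>_A u l a a) = (\<Oplus>_A l\<in>L. \<zero>_A)"
  by (rule finsum_cong') (use z in \<open>auto intro!: add.finprod_one_eqI\<close>)
 thus ?thesis using expand_right[OF x] by simp
qed

lemma all_zero_left:
 assumes x: "x : carrier A" and z: "!!l a. l : L ==> a : I l ==> u l a a \<otimes>_A x = \<zero>_A"
 shows "x = \<zero>_A"
proof -
 have "(\<Oplus>_A l\<in>L. \<Oplus>_A a\<in>I l. u l a a \<otimes>_A x) = (\<Oplus>_A l\<in>L. \<zero>_A)"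
  by (rule finsum_cong') (use z in \<open>auto intro!: add.finprod_one_eqI\<close>)
 thus ?thesis using expand_left[OF x] by simp
qed

text \<open>A left ideal meeting \<open>A u\<^bsub>aa\<^esub>\<close> contains \<open>u\<^bsub>aa\<^esub>\<close>: the left ideals \<open>A u\<^bsub>aa\<^esub>\<close> are minimal.\<close>

lemma unit_in_left_ideal:
 assumes K: "left_ideal A K" and x: "x : carrier A" "l : L" "a : I l"
  and xK: "x \<otimes>_A u l a a : K" "x \<otimes>_A u l a a ~= \<zero>_A"
 shows "u l a a : K"
proof -
 have K': "!!c x. x : K ==> c \<odot>_A x : K" "!!a x. a : carrier A ==> x : K ==> a \<otimes>_A x : K"
  using K by (auto simp: left_ideal_def stable_subset_def)
 obtain m b where mb: "m : L" "b : I m" "u m b b \<otimes>_A (x \<otimes>_A u l a a) ~= \<zero>_A"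
  using all_zero_left[of "x \<otimes>_A u l a a"] xK x by auto
 obtain c where c: "u m b b \<otimes>_A x \<otimes>_A u l a a = (if m = l then c \<odot>_A u m b a else \<zero>_A)"
  using compress[OF x(1) mb(1) x(2) mb(2) x(3)] by blast
 have ml: "m = l" "c ~= 0" and c': "u l b b \<otimes>_A (x \<otimes>_A u l a a) = c \<odot>_A u l b a"
  using c mb x by (auto simp: m_assoc split: if_splits)
 have "c \<odot>_A u l b a : K" using K'(2)[OF _ xK(1), of "u l b b"] c' mb ml by auto
 hence "u l a b \<otimes>_A (inverse c \<odot>_A (c \<odot>_A u l b a)) : K"
  using K' mb ml x by auto
 thus ?thesis using mb ml x by (simp add: smult_smult u_mult)
qed

lemma left_ideal_carrier_if_units:
 assumes K: "left_ideal A K" and u: "!!l a. l : L ==> a : I l ==> u l a a : K"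
 shows "K = carrier A"
proof -
 have K': "K <= carrier A" "\<zero>_A : K" "!!x y. x : K ==> y : K ==> x \<oplus>_A y : K"
   "!!a x. a : carrier A ==> x : K ==> a \<otimes>_A x : K"
  using K by (auto simp: left_ideal_def stable_subset_def)
 have "x : K" if x: "x : carrier A" for x
 proof -
  have "(\<Oplus>_A l\<in>L. \<Oplus>_A a\<in>I l. x \<otimes>_A u l a a) : K"
   by (intro finsum_in_subset[OF K'(1,2,3)]) (use K' u x in auto)
  thus ?thesis using expand_right[OF x] by simp
 qed
 thus ?thesis using K' by auto
qed

text \<open>A complement to a left ideal \<open>W\<close> is \<open>A e\<close>, for \<open>e\<close> the sum of a maximal set of diagonal
 units with \<open>A e \<inter> W = 0\<close>.\<close>

lemma semisimple: "semisimple_algebra A"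
proof -
 let ?reg = "%a. \<lambda>x\<in>carrier A. a \<otimes>_A x"
 have rep: "arep A A ?reg"
  by (rule arepI) (auto simp: calg_axioms cspace_axioms r_distr l_distr mult_smult smult_mult m_assoc)
 have inv_iff: "invariant_subspace A A ?reg W \<longleftrightarrow> left_ideal A W" for W
  unfolding invariant_subspace_iff[OF cspace_axioms] left_ideal_def stable_subset_def
  by auto
 have "EX W'. left_ideal A W' & W \<inter> W' = {\<zero>_A} & W <+>_A W' = carrier A"
  if W: "left_ideal A W" for W
 proof -
  have W': "W <= carrier A" "\<zero>_A : W" "!!x y. x : W ==> y : W ==> x \<oplus>_A y : W"
   "!!c x. x : W ==> c \<odot>_A x : W" "!!a x. a : carrier A ==> x : W ==> a \<otimes>_A x : W"
   using W by (auto simp: left_ideal_def stable_subset_def)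
  define S where "S = Sigma L I"
  have S: "finite S" using fin by (auto simp: S_def)
  define J where "J T = {x : carrier A. \<forall>l\<in>L. \<forall>a\<in>I l. (l, a) ~: T --> x \<otimes>_A u l a a = \<zero>_A}" for T
  have J: "left_ideal A (J T)" for T
   unfolding left_ideal_def stable_subset_def J_def S_def
   by (auto simp: l_distr smult_mult m_assoc)
  define \<T> where "\<T> = {T. T <= S & W \<inter> J T = {\<zero>_A}}"
  have "J {} = {\<zero>_A}"
   using all_zero_right by (auto simp: J_def S_def)
  hence "{} : \<T>" using W' by (auto simp: \<T>_def)
  moreover have "finite \<T>" using S by (auto simp: \<T>_def)
  ultimately obtain T where T: "T : \<T>" and max: "!!T'. T' : \<T> ==> T <= T' ==> T' = T"
   using finite_has_maximal[of \<T>] by blast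
  have sum: "left_ideal A (W <+>_A J T)"
   unfolding left_ideal_def stable_subset_def set_add_def'
  proof (intro conjI ballI allI)
   have J': "J T <= carrier A" "\<zero>_A : J T" "!!x y. x : J T ==> y : J T ==> x \<oplus>_A y : J T"
    "!!c x. x : J T ==> c \<odot>_A x : J T" "!!a x. a : carrier A ==> x : J T ==> a \<otimes>_A x : J T"
    using J[of T] by (auto simp: left_ideal_def stable_subset_def)
   show "(\<Union>h\<in>W. \<Union>k\<in>J T. {h \<oplus>_A k}) <= carrier A" using W' J' by auto
   show "\<zero>_A : (\<Union>h\<in>W. \<Union>k\<in>J T. {h \<oplus>_A k})"
    using W' J' by (auto intro!: bexI[of _ "\<zero>_A"])
  next
   have J': "J T <= carrier A" "\<zero>_A : J T" "!!x y. x : J T ==> y : J T ==> x \<oplus>_A y : J T"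
    "!!c x. x : J T ==> c \<odot>_A x : J T" "!!a x. a : carrier A ==> x : J T ==> a \<otimes>_A x : J T"
    using J[of T] by (auto simp: left_ideal_def stable_subset_def)
   {
    fix x y assume "x : (\<Union>h\<in>W. \<Union>k\<in>J T. {h \<oplus>_A k})" "y : (\<Union>h\<in>W. \<Union>k\<in>J T. {h \<oplus>_A k})"
    then obtain h k h' k' where hk: "h : W" "k : J T" "h' : W" "k' : J T"
     "x = h \<oplus>_A k" "y = h' \<oplus>_A k'" by auto
    hence c: "h : carrier A" "k : carrier A" "h' : carrier A" "k' : carrier A" using W' J' by auto
    have "x \<oplus>_A y = (h \<oplus>_A h') \<oplus>_A (k \<oplus>_A k')" using c hk by (simp add: a_ac)
    thus "x \<oplus>_A y : (\<Union>h\<in>W. \<Union>k\<in>J T. {h \<oplus>_A k})"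
     using W'(3)[OF hk(1,3)] J'(3)[OF hk(2,4)] by blast
   next
    fix c x assume "x : (\<Union>h\<in>W. \<Union>k\<in>J T. {h \<oplus>_A k})"
    then obtain h k where hk: "h : W" "k : J T" "x = h \<oplus>_A k" by auto
    hence cl: "h : carrier A" "k : carrier A" using W' J' by auto
    have "c \<odot>_A x = (c \<odot>_A h) \<oplus>_A (c \<odot>_A k)" using cl hk by (simp add: smult_add)
    thus "c \<odot>_A x : (\<Union>h\<in>W. \<Union>k\<in>J T. {h \<oplus>_A k})"
     using W'(4)[OF hk(1)] J'(4)[OF hk(2)] by blast
   next
    fix a x assume a: "a : carrier A" and "x : (\<Union>h\<in>W. \<Union>k\<in>J T. {h \<oplus>_A k})"
    then obtain h k where hk: "h : W" "k : J T" "x = h \<oplus>_A k" by auto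
    hence cl: "h : carrier A" "k : carrier A" using W' J' by auto
    have "a \<otimes>_A x = (a \<otimes>_A h) \<oplus>_A (a \<otimes>_A k)" using cl hk a by (simp add: r_distr)
    thus "a \<otimes>_A x : (\<Union>h\<in>W. \<Union>k\<in>J T. {h \<oplus>_A k})"
     using W'(5)[OF a hk(1)] J'(5)[OF a hk(2)] by blast
   }
  qed
  have "u l a a : W <+>_A J T" if la: "l : L" "a : I l" for l a
  proof (cases "(l, a) : T")
   case True
   hence "u l a a : J T" using la by (auto simp: J_def S_def u_mult)
   hence "\<zero>_A \<oplus>_A u l a a : W <+>_A J T" using W' unfolding set_add_def' by blast
   thus ?thesis using la by simp
  next
   case False
   hence "insert (l, a) T ~: \<T>" using max[of "insert (l, a) T"] by blast
   moreover have "insert (l, a) T <= S" using T la by (auto simp: \<T>_def S_def)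
   moreover have "\<zero>_A : W \<inter> J (insert (l, a) T)"
    using W' J by (auto simp: left_ideal_def stable_subset_def)
   ultimately obtain y where y: "y : W" "y : J (insert (l, a) T)" "y ~= \<zero>_A"
    unfolding \<T>_def by blast
   have yc: "y : carrier A" using y W' by auto
   define z where "z = y \<otimes>_A u l a a"
   have zc: "z : carrier A" using yc la by (auto simp: z_def)
   have z0: "z ~= \<zero>_A"
   proof
    assume "z = \<zero>_A"
    hence "y : J T" using y(2) by (auto simp: J_def z_def)
    thus False using y T by (auto simp: \<T>_def)
   qed
   have "z \<ominus>_A y : J T"
   proof -
    have d: "(z \<ominus>_A y) \<otimes>_A u m b b = z \<otimes>_A u m b b \<ominus>_A y \<otimes>_A u m b b"
     if "m : L" "b : I m" for m b
     using that yc zc by (simp add: minus_smult l_distr smult_mult)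
    have "(z \<ominus>_A y) \<otimes>_A u m b b = \<zero>_A" if mb: "m : L" "b : I m" "(m, b) ~: T" for m b
    proof (cases "(m, b) = (l, a)")
     case True
     thus ?thesis
      using d[OF mb(1,2)] yc la by (simp add: z_def m_assoc u_mult minus_eq r_neg)
    next
     case False
     hence "y \<otimes>_A u m b b = \<zero>_A" using y(2) mb by (auto simp: J_def)
     moreover have "z \<otimes>_A u m b b = \<zero>_A"
      using False yc la mb by (auto simp: z_def m_assoc u_mult)
     ultimately show ?thesis using d[OF mb(1,2)] by (simp add: minus_eq)
    qed
    thus ?thesis using yc zc by (simp add: J_def)
   qed
   hence "y \<oplus>_A (z \<ominus>_A y) : W <+>_A J T" using y(1) unfolding set_add_def' by blast
   moreover have "y \<oplus>_A (z \<ominus>_A y) = z" using yc zc a_comm[of y "z \<ominus>_A y"] add_diff_cancel[of z y] by simp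
   ultimately have "z : W <+>_A J T" by simp
   thus ?thesis
    using unit_in_left_ideal[OF sum yc la] z0 unfolding z_def by blast
  qed
  hence "W <+>_A J T = carrier A" by (rule left_ideal_carrier_if_units[OF sum])
  thus ?thesis using J[of T] T by (auto simp: \<T>_def)
 qed
 thus ?thesis
  using rep alg unfolding semisimple_algebra_def completely_reducible_def inv_iff
   representation_iff[OF calg_axioms] by blast
qed

end

text \<open>The diagonal unit at \<open>z l\<close> projects onto the line of \<open>w l\<close>, so
  \<open>C l\<close> is the natural module of the block \<open>l\<close>.\<close>

locale matrix_reps = matrix_units A L I u for A :: "'a cspace" and L :: "'l set" and I :: "'l => 'i set" and u +
 fixes C :: "'l => 'v cspace" and rho :: "'l => 'a => 'v => 'v" and w :: "'l => 'v" and z :: "'l => 'i"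
 assumes reps: "!!l. l : L ==> arep A (C l) (rho l)"
  and z: "!!l. l : L ==> z l : I l"
  and w: "!!l. l : L ==> w l : carrier (C l)" "!!l. l : L ==> w l ~= \<zero>_(C l)"
  and fix_w: "!!l. l : L ==> rho l (u l (z l) (z l)) (w l) = w l"
  and rank_one: "!!l v. l : L ==> v : carrier (C l) ==> EX c. rho l (u l (z l) (z l)) v = c \<odot>_(C l) w l"
  and other: "!!l m a v. l : L ==> m : L ==> l ~= m ==> a : I m ==> v : carrier (C l) ==>
    rho l (u m a a) v = \<zero>_(C l)"
begin

lemma cspace_C: "l : L ==> cspace (C l)"
 using reps by (auto simp: arep_def)

definition e :: "'l => 'i => 'v" where
 "e l a = rho l (u l a (z l)) (w l)"

lemma e_closed [simp, intro]: "l : L ==> a : I l ==> e l a : carrier (C l)"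
 unfolding e_def by (rule arep.act_closed[OF reps]) (use w z in auto)

lemma act_e:
 assumes "l : L" "a : I l" "b : I l" "c : I l"
 shows "rho l (u l a b) (e l c) = (if b = c then e l a else \<zero>_(C l))"
proof -
 interpret arep A "C l" "rho l" by (rule reps[OF assms(1)])
 have "rho l (u l a b) (e l c) = rho l (u l a b \<otimes>_A u l c (z l)) (w l)"
  unfolding e_def by (rule mult_act[symmetric]) (use assms w z in auto)
 also have "... = (if b = c then e l a else \<zero>_(C l))"
  using assms z w by (simp only: u_mult) (auto simp: e_def zero_act)
 finally show ?thesis .
qed

lemma e_z: "l : L ==> e l (z l) = w l"
 by (simp add: e_def fix_w)

lemma e_nonzero: "l : L ==> a : I l ==> e l a ~= \<zero>_(C l)"
proof
 assume la: "l : L" "a : I l" and e: "e l a = \<zero>_(C l)"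
 have "rho l (u l (z l) a) (e l a) = w l" using act_e[of l "z l" a a] la z e_z by simp
 moreover have "rho l (u l (z l) a) (e l a) = \<zero>_(C l)"
  unfolding e by (rule arep.act_zero[OF reps]) (use la z in auto)
 ultimately show False using w(2)[OF la(1)] by simp
qed

lemma unit_nonzero: "l : L ==> a : I l ==> b : I l ==> u l a b ~= \<zero>_A"
 using act_e[of l a b b] e_nonzero[of l a] arep.zero_act[OF reps, of l "e l b"] by auto

lemma other_block:
 assumes "l : L" "m : L" "l ~= m" "a : I m" "b : I m" "v : carrier (C l)"
 shows "rho l (u m a b) v = \<zero>_(C l)"
proof -
 interpret arep A "C l" "rho l" by (rule reps[OF assms(1)])
 have "rho l (u m a b) v = rho l (u m a a \<otimes>_A u m a b) v" using assms by (simp only: u_mult) simp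
 also have "... = rho l (u m a a) (rho l (u m a b) v)" by (rule mult_act) (use assms in auto)
 also have "... = \<zero>_(C l)" by (rule other) (use assms in auto)
 finally show ?thesis .
qed

lemma diag_act:
 assumes "l : L" "a : I l" "v : carrier (C l)"
 shows "EX c. rho l (u l a a) v = c \<odot>_(C l) e l a"
proof -
 interpret arep A "C l" "rho l" by (rule reps[OF assms(1)])
 note [simp] = z[OF assms(1)] w[OF assms(1)] assms
 obtain c where c: "rho l (u l (z l) (z l)) (rho l (u l (z l) a) v) = c \<odot>_(C l) w l"
  using rank_one[of l "rho l (u l (z l) a) v"] by auto
 have "u l a a = u l a (z l) \<otimes>_A (u l (z l) (z l) \<otimes>_A u l (z l) a)" by (simp add: u_mult)
 hence "rho l (u l a a) v = rho l (u l a (z l)) (rho l (u l (z l) (z l)) (rho l (u l (z l) a) v))"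
  by (simp only: mult_act u_closed m_closed act_closed assms z)
 also have "... = c \<odot>_(C l) e l a" unfolding c e_def by (rule act_smult) auto
 finally show ?thesis by blast
qed

lemma vector_expansion:
 assumes l: "l : L" and v: "v : carrier (C l)"
 shows "v = (\<Oplus>_(C l)a\<in>I l. rho l (u l a a) v)"
proof -
 interpret arep A "C l" "rho l" by (rule reps[OF l])
 have "v = rho l (\<Oplus>_A m\<in>L. \<Oplus>_A a\<in>I m. u m a a) v" using v by (simp only: u_one one_act)
 also have "... = (\<Oplus>_(C l)m\<in>L. rho l (\<Oplus>_A a\<in>I m. u m a a) v)"
  by (rule finsum_act) (use v inner_one_closed in auto)
 also have "... = (\<Oplus>_(C l)m\<in>L. \<Oplus>_(C l)a\<in>I m. rho l (u m a a) v)"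
  by (rule V.finsum_cong') (use v in \<open>auto intro!: finsum_act V.finsum_closed\<close>)
 also have "... = (\<Oplus>_(C l)a\<in>I l. rho l (u l a a) v)"
  by (rule V.finsum_single)
    (use l v fin other in \<open>auto intro!: V.finsum_closed V.add.finprod_one_eqI\<close>)
 finally show ?thesis .
qed

lemma vector_coords:
 assumes l: "l : L" and v: "v : carrier (C l)"
 obtains k where "v = (\<Oplus>_(C l)a\<in>I l. k a \<odot>_(C l) e l a)"
proof -
 interpret CC: cspace "C l" by (rule cspace_C[OF l])
 obtain k where "!!a. a : I l ==> rho l (u l a a) v = k a \<odot>_(C l) e l a"
  using diag_act[OF l _ v] by metis
 hence "v = (\<Oplus>_(C l)a\<in>I l. k a \<odot>_(C l) e l a)"
  using l by (subst vector_expansion[OF l v], intro CC.finsum_cong') auto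
 thus thesis using that by blast
qed

lemma linear_eqI:
 assumes l: "l : L" and f: "lin_map (C l) W f" and g: "lin_map (C l) W g"
  and eq: "!!a. a : I l ==> f (e l a) = g (e l a)" and v: "v : carrier (C l)"
 shows "f v = g v"
proof -
 interpret f: lin_map "C l" W f by (rule f)
 interpret g: lin_map "C l" W g by (rule g)
 obtain k where k: "v = (\<Oplus>_(C l)a\<in>I l. k a \<odot>_(C l) e l a)" using vector_coords[OF l v] .
 have "f v = (\<Oplus>_W a\<in>I l. f (k a \<odot>_(C l) e l a))" unfolding k using l by (intro f.finsum) auto
 also have "... = (\<Oplus>_W a\<in>I l. g (k a \<odot>_(C l) e l a))"
  using l eq by (intro f.W.finsum_cong') auto
 also have "... = g v" unfolding k using l by (intro g.finsum[symmetric]) auto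
 finally show ?thesis .
qed

text \<open>From any nonzero vector some \<open>u l (z l) a\<close> produces a nonzero multiple of
  \<open>w l\<close>, and \<open>w l\<close> generates \<open>C l\<close>.\<close>

lemma irrep_C:
 assumes l: "l : L" shows "irrep A (C l) (rho l)"
proof -
 interpret arep A "C l" "rho l" by (rule reps[OF l])
 show ?thesis
 proof unfold_locales
  show "carrier (C l) ~= {\<zero>_(C l)}" using w[OF l] by auto
 next
  fix W assume W: "stable_subset A (C l) (rho l) W"
  hence W': "W <= carrier (C l)" "\<zero>_(C l) : W"
   "!!x y. x : W ==> y : W ==> x \<oplus>_(C l) y : W"
   "!!c x. x : W ==> c \<odot>_(C l) x : W" "!!a x. a : carrier A ==> x : W ==> rho l a x : W"
   by (auto simp: stable_subset_def)
  show "W = {\<zero>_(C l)} | W = carrier (C l)"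
  proof (rule disjCI)
   assume "W ~= carrier (C l)"
   have "v = \<zero>_(C l)" if v: "v : W" for v
   proof (rule ccontr)
    assume nz: "v ~= \<zero>_(C l)"
    have vc: "v : carrier (C l)" using v W' by auto
    obtain a where a: "a : I l" "rho l (u l a a) v ~= \<zero>_(C l)"
     using vector_expansion[OF l vc] nz V.add.finprod_one_eqI[of "I l" "%a. rho l (u l a a) v"]
     by auto
    obtain c where c: "rho l (u l a a) v = c \<odot>_(C l) e l a" using diag_act[OF l a(1) vc] by blast
    hence "c ~= 0" using a l by auto
    moreover have "inverse c \<odot>_(C l) (c \<odot>_(C l) e l a) : W"
     using W'(4)[OF W'(5)[OF u_closed[OF l a(1) a(1)] v]] c by simp
    ultimately have ea: "e l a : W" using l a by (simp add: V.smult_smult)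
    have eb: "e l b : W" if b: "b : I l" for b
     using W'(5)[OF u_closed[OF l b a(1)] ea] act_e[OF l b a(1) a(1)] by simp
    have "x : W" if x: "x : carrier (C l)" for x
    proof -
     obtain k where k: "x = (\<Oplus>_(C l)a\<in>I l. k a \<odot>_(C l) e l a)" using vector_coords[OF l x] .
     show ?thesis unfolding k by (rule V.finsum_in_subset) (use W' eb in auto)
    qed
    thus False using W'(1) \<open>W ~= _\<close> by blast
   qed
   thus "W = {\<zero>_(C l)}" using W'(2) by blast
  qed
 qed
qed

lemma inequivalent:
 assumes "l : L" "m : L" "l ~= m"
 shows "\<not> equivalent_reps A (C l) (rho l) (C m) (rho m)"
proof
 assume "equivalent_reps A (C l) (rho l) (C m) (rho m)"
 then obtain phi where phi: "intertwiner A (C l) (rho l) (C m) (rho m) phi"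
  "bij_betw phi (carrier (C l)) (carrier (C m))" by (auto simp: equivalent_reps_iff)
 interpret f: lin_map "C l" "C m" phi
  using phi cspace_C assms by (simp add: lin_map_def lin_map_axioms_def intertwiner_def)
 have "phi (w l) = phi (rho l (u l (z l) (z l)) (w l))" using fix_w assms by simp
 also have "... = rho m (u l (z l) (z l)) (phi (w l))" using phi w z assms by (auto simp: intertwiner_def)
 also have "... = \<zero>_(C m)" by (rule other) (use assms z w in auto)
 finally have "phi (w l) = phi \<zero>_(C l)" by simp
 hence "w l = \<zero>_(C l)"
  using inj_onD[OF bij_betw_imp_inj_on[OF phi(2)]] w(1)[OF assms(1)] f.V.zero_closed by blast
 thus False using w assms by blast
qed

text \<open>The units \<open>u l a a\<close> sum to one, so one of them moves some vector
  \<open>t\<close>; the left ideal that it generates compares the given module with \<open>C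
  l\<close>.\<close>

lemma exhaust:
 assumes W: "irrep A W \<pi>"
 shows "\<exists>l\<in>L. equivalent_reps A (C l) (rho l) W \<pi>"
proof -
 interpret W: irrep A W \<pi> by (rule W)
 obtain v where v: "v : carrier W" "v ~= \<zero>_W" using W.nontrivial W.V.zero_closed by blast
 have "\<exists>l\<in>L. \<exists>a\<in>I l. \<pi> (u l a a) v ~= \<zero>_W"
 proof (rule ccontr)
  assume n: "\<not> ?thesis"
  have "v = \<pi> (\<Oplus>_A m\<in>L. \<Oplus>_A a\<in>I m. u m a a) v" using v by (simp only: u_one W.one_act)
  also have "... = (\<Oplus>_W m\<in>L. \<pi> (\<Oplus>_A a\<in>I m. u m a a) v)"
   by (rule W.finsum_act) (use v inner_one_closed in auto)
  also have "... = (\<Oplus>_W m\<in>L. \<Oplus>_W a\<in>I m. \<pi> (u m a a) v)"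
   by (rule W.V.finsum_cong') (use v in \<open>auto intro!: W.finsum_act W.V.finsum_closed\<close>)
  also have "... = \<zero>_W"
   using n by (auto intro!: W.V.add.finprod_one_eqI)
  finally show False using v by simp
 qed
 then obtain l a where la: "l : L" "a : I l" "\<pi> (u l a a) v ~= \<zero>_W" by blast
 note [simp] = z[OF la(1)] la(1,2)
 interpret C: arep A "C l" "rho l" by (rule reps) fact
 let ?u = "u l (z l) (z l)"
 define t where "t = \<pi> (u l (z l) a) v"
 have tc: "t : carrier W" using v by (simp add: t_def)
 have ut: "\<pi> ?u t = t"
 proof -
  have "\<pi> ?u t = \<pi> (?u \<otimes>_A u l (z l) a) v"
   unfolding t_def by (rule W.mult_act[symmetric]) (use v in auto)
  thus ?thesis by (simp only: u_mult la z t_def) simp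
 qed
 have t0: "t ~= \<zero>_W"
 proof
  assume t: "t = \<zero>_W"
  have "\<pi> (u l a a) v = \<pi> (u l a (z l) \<otimes>_A u l (z l) a) v" by (simp only: u_mult la z) simp
  also have "... = \<pi> (u l a (z l)) t" unfolding t_def by (rule W.mult_act) (use v in auto)
  also have "... = \<zero>_W" unfolding t by (rule W.act_zero) auto
  finally show False using la by blast
 qed
 have "\<pi> x t = \<zero>_W" if x: "x : carrier A" "rho l x (w l) = \<zero>_(C l)" for x
 proof -
  have "x \<otimes>_A ?u = \<zero>_A"
  proof (rule all_zero_left)
   fix m b assume mb: "m : L" "b : I m"
   obtain c where c: "u m b b \<otimes>_A x \<otimes>_A ?u = (if m = l then c \<odot>_A u m b (z l) else \<zero>_A)"
    using compress[OF x(1) mb(1) la(1) mb(2) z[OF la(1)]] by blast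
   show "u m b b \<otimes>_A (x \<otimes>_A ?u) = \<zero>_A"
   proof (cases "m = l")
    case True
    have b: "b : I l" using mb True by simp
    have "c \<odot>_(C l) e l b = rho l (c \<odot>_A u l b (z l)) (w l)"
     unfolding e_def by (rule C.smult_act[symmetric]) (use w b in auto)
    also have "... = rho l (u l b b \<otimes>_A x \<otimes>_A ?u) (w l)" using c True by simp
    also have "... = rho l (u l b b) (rho l x (rho l ?u (w l)))"
     using x b w by (simp only: C.mult_act u_closed m_closed C.act_closed la z)
    also have "... = \<zero>_(C l)" using b by (simp only: fix_w la x(2) C.act_zero u_closed)
    finally have "c = 0" using e_nonzero b C.V.smult_eq_zero_iff by auto
    thus ?thesis using c True mb x b by (simp add: m_assoc)
   qed (use c mb x in \<open>simp add: m_assoc\<close>)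
  qed (use x in auto)
  hence "\<pi> x (\<pi> ?u t) = \<zero>_W" using W.mult_act[of x ?u t] W.zero_act[OF tc] x tc by auto
  thus ?thesis by (simp add: ut)
 qed
 moreover have "\<pi> ?u t ~= \<zero>_W" using ut t0 by simp
 ultimately obtain phi where "intertwiner A (C l) (rho l) W \<pi> phi" "bij_betw phi (carrier (C l)) (carrier W)"
  using cyclic_intertwiner[OF irrep_C[OF la(1)] W left_ideal_carrier[OF calg_axioms] w(1)[OF la(1)] tc]
   u_closed[OF la(1) z[OF la(1)] z[OF la(1)]] by metis
 thus ?thesis using la by (auto simp: equivalent_reps_iff)
qed

lemma complete: "complete_irreps TYPE('w) A L C rho"
 unfolding complete_irreps_def irreducible_rep_iff[OF calg_axioms]
 using irrep_C inequivalent exhaust by blast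

lemma joint_injective:
 assumes x: "x : carrier A" and z0: "!!l v. l : L ==> v : carrier (C l) ==> rho l x v = \<zero>_(C l)"
 shows "x = \<zero>_A"
proof (rule all_zero_left[OF x])
 fix l a assume la: "l : L" "a : I l"
 show "u l a a \<otimes>_A x = \<zero>_A"
 proof (rule all_zero_right)
  fix m b assume mb: "m : L" "b : I m"
  obtain c where c: "u l a a \<otimes>_A x \<otimes>_A u m b b = (if l = m then c \<odot>_A u l a b else \<zero>_A)"
   using compress[OF x la(1) mb(1) la(2) mb(2)] by blast
  show "u l a a \<otimes>_A x \<otimes>_A u m b b = \<zero>_A"
  proof (cases "l = m")
   case True
   interpret C: arep A "C l" "rho l" by (rule reps) fact
   have b: "b : I l" using mb True by simp
   have "c \<odot>_(C l) e l a = rho l (c \<odot>_A u l a b) (e l b)"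
    using la b by (simp only: C.smult_act u_closed e_closed act_e) simp
   also have "... = rho l (u l a a \<otimes>_A x \<otimes>_A u l b b) (e l b)" using c True by simp
   also have "... = rho l (u l a a) (rho l x (e l b))"
    using x b la by (simp only: C.mult_act u_closed m_closed C.act_closed e_closed act_e simp_thms if_True)
   also have "... = \<zero>_(C l)" using b la by (simp only: z0 e_closed C.act_zero u_closed)
   finally have "c = 0" using e_nonzero la C.V.smult_eq_zero_iff by auto
   thus ?thesis using c True la b by simp
  qed (use c in simp)
 qed (use la x in auto)
qed

text \<open>The vectors \<open>e l a\<close> form a basis of \<open>C l\<close>, and \<open>u l a
  b\<close> acts on it as an elementary matrix.\<close>

lemma joint_iso: "(%x. \<lambda>p\<in>L. rho p x) : algebra_iso A (dsum L (%p. End_alg (C p)))"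
proof -
 let ?D = "dsum L (%p. End_alg (C p))"
 let ?h = "%x. \<lambda>p\<in>L. rho p x"
 interpret D: calg ?D
  by (rule calg_dsum[OF fin(1)], rule cspace.calg_End, rule cspace_C)
 have am: "alg_map A (End_alg (C l)) (rho l)" if "l : L" for l
 proof -
  interpret C: arep A "C l" "rho l" by (rule reps) fact
  show ?thesis by (rule C.alg_map_axioms)
 qed
 have D: "carrier ?D = (\<Pi>\<^sub>E i\<in>L. carrier (End_alg (C i)))" by (rule dsum_carrier[OF fin(1)])
 have h: "?h : algebra_hom A ?D"
 proof (rule algebra_homI)
  fix x assume x: "x : carrier A"
  show "?h x : carrier ?D"
   unfolding D by (rule restrict_PiE_iff[THEN iffD2]) (use x lin_map.closed[OF alg_map_lin[OF am]] in blast)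
  show "?h (c \<odot>_A x) = c \<odot>_?D ?h x" for c
   unfolding dsum_simps
   by (rule restrict_ext) (simp only: lin_map.smult[OF alg_map_lin[OF am]] x restrict_apply' simp_thms if_True)
 next
  fix x y assume xy: "x : carrier A" "y : carrier A"
  show "?h (x \<oplus>_A y) = ?h x \<oplus>_?D ?h y"
   unfolding dsum_simps
   by (rule restrict_ext) (simp only: lin_map.add[OF alg_map_lin[OF am]] xy restrict_apply')
  show "?h (x \<otimes>_A y) = ?h x \<otimes>_?D ?h y"
   unfolding dsum_simps
   by (rule restrict_ext) (simp only: alg_map.mult[OF am] xy restrict_apply')
 next
  show "?h \<one>_A = \<one>_?D"
   unfolding dsum_simps by (rule restrict_ext) (simp only: alg_map.one[OF am])
 qed
 interpret h: alg_map A ?D ?h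
  by (simp add: alg_map_def alg_map_axioms_def h calg_axioms D.calg_axioms)
 have "inj_on ?h (carrier A)"
 proof (rule inj_onI)
  fix x y assume xy: "x : carrier A" "y : carrier A" "?h x = ?h y"
  have "x \<ominus>_A y = \<zero>_A"
  proof (rule joint_injective)
   fix l v assume lv: "l : L" "v : carrier (C l)"
   interpret C: arep A "C l" "rho l" by (rule reps) fact
   have "rho l x = rho l y" using fun_cong[OF xy(3), of l] lv by simp
   thus "rho l (x \<ominus>_A y) v = \<zero>_(C l)"
    using C.diff_act[OF xy(1,2) lv(2)] lv xy by (simp add: C.V.minus_eq_zero_iff)
  qed (use xy in auto)
  thus "x = y" using minus_eq_zero_iff[OF xy(1,2)] by blast
 qed
 moreover have "F : ?h ` carrier A" if F: "F : carrier ?D" for F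
 proof -
  have FE: "F l : carrier (End_alg (C l))" if "l : L" for l
   using F that fin by (auto simp: dsum_carrier)
  have Fl: "lin_map (C l) (C l) (F l)" if "l : L" for l
   using FE[OF that] cspace_C[OF that]
   by (simp add: lin_map_def lin_map_axioms_def End_carrier_iff module_hom_Cx_iff)
  have "EX k. F l (e l b) = (\<Oplus>_(C l)a\<in>I l. k a \<odot>_(C l) e l a)" if "l : L" "b : I l" for l b
   using vector_coords[OF that(1) lin_map.closed[OF Fl[OF that(1)] e_closed[OF that]]] by metis
  then obtain k where k: "!!l b. l : L ==> b : I l ==>
    F l (e l b) = (\<Oplus>_(C l)a\<in>I l. k l b a \<odot>_(C l) e l a)" by metis
  define y where "y m a = (\<Oplus>_A b\<in>I m. k m b a \<odot>_A u m a b)" for m a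
  define x where "x = (\<Oplus>_A m\<in>L. \<Oplus>_A a\<in>I m. y m a)"
  have yc: "y m a : carrier A" if "m : L" "a : I m" for m a
   unfolding y_def by (rule finsum_closed) (use that in auto)
  have yc': "(\<Oplus>_A a\<in>I m. y m a) : carrier A" if "m : L" for m
   by (rule finsum_closed) (use that yc in auto)
  have xc: "x : carrier A" unfolding x_def by (rule finsum_closed) (use yc' in auto)
  have "rho l x = F l" if l: "l : L" for l
  proof -
   interpret C: arep A "C l" "rho l" by (rule reps) fact
   have y1: "rho l (y m a) (e l b) = (if m = l then k l b a \<odot>_(C l) e l a else \<zero>_(C l))"
    if b: "b : I l" and m: "m : L" "a : I m" for m a b
   proof -
    have "rho l (y m a) (e l b) = (\<Oplus>_(C l)b'\<in>I m. rho l (k m b' a \<odot>_A u m a b') (e l b))"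
     unfolding y_def by (rule C.finsum_act) (use l b m in auto)
    also have "... = (\<Oplus>_(C l)b'\<in>I m. if m = l & b' = b then k l b a \<odot>_(C l) e l a else \<zero>_(C l))"
    proof (rule C.V.finsum_cong')
     fix b' assume b': "b' : I m"
     have "rho l (k m b' a \<odot>_A u m a b') (e l b) = k m b' a \<odot>_(C l) rho l (u m a b') (e l b)"
      by (rule C.smult_act) (use l b b' m in auto)
     thus "rho l (k m b' a \<odot>_A u m a b') (e l b) =
       (if m = l & b' = b then k l b a \<odot>_(C l) e l a else \<zero>_(C l))"
      using l b b' m other_block[of l m a b' "e l b"] act_e[of l a b' b]
       by (cases "m = l") auto
    qed (use l m in auto)
    also have "... = (if m = l then k l b a \<odot>_(C l) e l a else \<zero>_(C l))"
    proof (cases "m = l")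
     case True
     thus ?thesis
      using C.V.finsum_single[of "I l" b "%b'. if b' = b then k l b a \<odot>_(C l) e l a else \<zero>_(C l)"]
       b m fin by auto
    qed simp
    finally show ?thesis .
   qed
   have "rho l x (e l b) = F l (e l b)" if b: "b : I l" for b
   proof -
    have "rho l x (e l b) = (\<Oplus>_(C l)m\<in>L. rho l (\<Oplus>_A a\<in>I m. y m a) (e l b))"
     unfolding x_def by (rule C.finsum_act) (use l b yc' in auto)
    also have "... = (\<Oplus>_(C l)m\<in>L. \<Oplus>_(C l)a\<in>I m. rho l (y m a) (e l b))"
     by (rule C.V.finsum_cong') (use l b yc in \<open>auto intro!: C.finsum_act C.V.finsum_closed\<close>)
    also have "... = (\<Oplus>_(C l)a\<in>I l. rho l (y l a) (e l b))"
     by (rule C.V.finsum_single)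
       (use l b yc fin y1 in \<open>auto intro!: C.V.finsum_closed C.V.add.finprod_one_eqI\<close>)
    also have "... = F l (e l b)"
     unfolding k[OF l b] by (rule C.V.finsum_cong') (use l b y1 in auto)
    finally show ?thesis .
   qed
   hence "rho l x v = F l v" if "v : carrier (C l)" for v
    by (rule linear_eqI[OF l C.lin_act[OF xc] Fl[OF l] _ that])
   thus ?thesis by (rule End_eqI[OF C.closed[OF xc] FE[OF l]])
  qed
  hence "?h x = F" using F fin by (auto simp: dsum_carrier fun_eq_iff PiE_iff extensional_def)
  thus ?thesis using xc by blast
 qed
 ultimately show ?thesis
  using h h.closed by (auto simp: algebra_iso_def bij_betw_def)
qed

abbreviation "units \<equiv> (%(l, a, b). u l a b) ` (SIGMA l:L. I l \<times> I l)"

lemma units_inj: "inj_on (%(l, a, b). u l a b) (SIGMA l:L. I l \<times> I l)"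
proof (rule inj_onI, clarsimp)
 fix l a b m c d
 assume h: "l : L" "a : I l" "b : I l" "m : L" "c : I m" "d : I m" "u l a b = u m c d"
 have "u l a a \<otimes>_A u m c d = u l a b" "u m c d \<otimes>_A u l b b = u l a b"
  using h(1-6) by (simp_all add: h(7)[symmetric] u_mult)
 thus "l = m & a = c & b = d"
  using h(1-6) unit_nonzero[OF h(1-3)] by (auto simp: u_mult split: if_splits)
qed

lemma units_finite: "finite units"
 using fin by auto

lemma units_card: "card units = (\<Sum>l\<in>L. (card (I l))\<^sup>2)"
proof -
 have "card units = card (SIGMA l:L. I l \<times> I l)" by (rule card_image[OF units_inj])
 also have "... = (\<Sum>l\<in>L. (card (I l))\<^sup>2)"
  using fin by (subst card_SigmaI) (auto simp: card_cartesian_product power2_eq_square)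
 finally show ?thesis .
qed

text \<open>A vanishing combination of units is compressed by two diagonal units to a single coefficient
  times a nonzero unit.\<close>

lemma units_basis: "vectorspace.basis Cx A units"
proof -
 interpret VS: vectorspace Cx A by (rule vs)
 have sub: "units <= carrier A" by auto
 have "VS.lin_indpt units"
 proof (rule VS.finite_lin_indpt2[OF units_finite sub])
  fix k assume k: "k : units \<rightarrow> carrier Cx" and zero: "VS.lincomb k units = \<zero>_A"
  show "\<forall>v\<in>units. k v = \<zero>_Cx"
  proof
   fix v assume "v : units"
   then obtain l a b where lab: "l : L" "a : I l" "b : I l" and v: "v = u l a b" by auto
   define T where "T = (SIGMA l:L. I l \<times> I l)"
   have eq: "(\<Oplus>_A v'\<in>units. k v' \<odot>_A v') = \<zero>_A" using zero by (simp add: VS.lincomb_def)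
   have "u l a a \<otimes>_A (\<Oplus>_A v'\<in>units. k v' \<odot>_A v') \<otimes>_A u l b b
     = (\<Oplus>_A v'\<in>units. u l a a \<otimes>_A (k v' \<odot>_A v')) \<otimes>_A u l b b"
    by (subst mult_finsum) (use lab in auto)
   also have "... = (\<Oplus>_A v'\<in>units. u l a a \<otimes>_A (k v' \<odot>_A v') \<otimes>_A u l b b)"
    by (subst finsum_mult) (use lab in auto)
   also have "... = u l a a \<otimes>_A (k v \<odot>_A v) \<otimes>_A u l b b"
   proof (rule finsum_single[OF units_finite \<open>v : units\<close>])
    fix v' assume "v' : units" "v' ~= v"
    then obtain m c d where "m : L" "c : I m" "d : I m" "v' = u m c d" "(m, c, d) ~= (l, a, b)"
     using v by auto
    thus "u l a a \<otimes>_A (k v' \<odot>_A v') \<otimes>_A u l b b = \<zero>_A"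
     using lab by (auto simp: mult_smult smult_mult u_mult)
   qed (use lab v in auto)
   also have "... = k v \<odot>_A v" using lab v by (simp add: mult_smult smult_mult u_mult)
   finally have "k v \<odot>_A v = \<zero>_A" using eq lab by simp
   thus "k v = \<zero>_Cx" using unit_nonzero[OF lab] lab v by (simp add: smult_eq_zero_iff)
  qed
 qed
 moreover have "VS.span units = carrier A"
 proof
  show "VS.span units <= carrier A" using VS.span_closed[OF sub] by blast
  have s: "VectorSpace.subspace Cx (VS.span units) A" by (rule VS.span_is_subspace[OF sub])
  show "carrier A <= VS.span units"
  proof (rule u_span)
   fix l a b assume "l : L" "a : I l" "b : I l"
   hence "u l a b : units" by force
   thus "u l a b : VS.span units" using VS.in_own_span[OF sub] by blast
  qed (use s in \<open>auto simp: subspace_iff\<close>)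
 qed
 ultimately show ?thesis unfolding VS.basis_def using sub by blast
qed

lemma fin_dim: "vectorspace.fin_dim Cx A"
proof -
 interpret VS: vectorspace Cx A by (rule vs)
 show ?thesis using units_basis units_finite unfolding VS.fin_dim_def VS.basis_def by blast
qed

lemma dimension: "vectorspace.dim Cx A = (\<Sum>l\<in>L. (card (I l))\<^sup>2)"
 using vectorspace.dim_basis[OF vs units_finite units_basis] units_card by simp

end

section \<open>Linear spans and eigenvectors\<close>

definition lspan :: "'v cspace => 'v set => 'v set" where
 "lspan V T = \<Inter>{W. VectorSpace.subspace Cx W V & T <= W}"

context cspace
begin

lemma subspace_carrier: "VectorSpace.subspace Cx (carrier V) V"
 by (simp add: subspace_iff)

lemma subspace_lspan: "T <= carrier V ==> VectorSpace.subspace Cx (lspan V T) V"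
 using subspace_carrier unfolding lspan_def by (auto simp: subspace_iff)

lemma lspan_least: "VectorSpace.subspace Cx W V ==> T <= W ==> lspan V T <= W"
 by (auto simp: lspan_def)

lemma lspan_incl: "T <= lspan V T"
 by (auto simp: lspan_def)

lemma lspan_mono: "T <= T' ==> lspan V T <= lspan V T'"
 by (auto simp: lspan_def)

lemma lspan_carrier: "T <= carrier V ==> lspan V T <= carrier V"
 by (rule lspan_least[OF subspace_carrier])

lemma lspan_eq_span:
 assumes T: "T <= carrier V"
 shows "lspan V T = LinearCombinations.module.span Cx V T"
proof
 interpret VS: vectorspace Cx V by (rule vs)
 show "lspan V T <= VS.span T"
  by (rule lspan_least[OF VS.span_is_subspace[OF T] VS.in_own_span[OF T]])
 have "submodule Cx (lspan V T) V" using subspace_lspan[OF T] by (rule VS.is_module)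
 thus "VS.span T <= lspan V T" using VS.span_is_subset lspan_incl by metis
qed

lemma lspan_empty: "lspan V {} = {\<zero>_V}"
proof -
 have "VectorSpace.subspace Cx {\<zero>_V} V" by (auto simp: subspace_iff)
 thus ?thesis using lspan_least[of "{\<zero>_V}" "{}"] subspace_lspan[of "{}"]
  by (auto simp: subspace_iff)
qed

lemma finite_basis:
 assumes "vectorspace.fin_dim Cx V"
 obtains B where "finite B" "B <= carrier V" "lspan V B = carrier V"
  "!!b. b : B ==> b ~: lspan V (B - {b})"
proof -
 interpret VS: vectorspace Cx V by (rule vs)
 obtain B where B: "finite B" "VS.basis B" using VS.finite_basis_exists assms by auto
 hence sub: "B <= carrier V" and gen: "VS.span B = carrier V" and ind: "VS.lin_indpt B"
  by (auto simp: VS.basis_def)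
 have "b ~: lspan V (B - {b})" if b: "b : B" for b
 proof -
  have s: "B - {b} <= carrier V" using sub by auto
  have i: "VS.lin_indpt (B - {b})" by (rule VS.subset_li_is_li[OF ind]) auto
  have e: "B - {b} \<union> {b} = B" "insert b B = B" using b by auto
  have "b : VS.span (B - {b}) \<longleftrightarrow> VS.lin_dep (B - {b} \<union> {b})"
   using VS.lin_dep_iff_in_span[OF s i, of b] b sub by auto
  thus ?thesis using ind lspan_eq_span[OF s] by (simp add: e)
 qed
 thus thesis using that B sub gen lspan_eq_span[OF sub] by metis
qed

lemma coords:
 assumes "finite B" "B <= carrier V" "lspan V B = carrier V" "v : carrier V"
 obtains k where "v = (\<Oplus>_V b\<in>B. k b \<odot>_V b)"
proof -
 interpret VS: vectorspace Cx V by (rule vs)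
 have "v : VS.span B" using assms lspan_eq_span by metis
 then obtain k where "v = VS.lincomb k B" using VS.finite_in_span[OF assms(1,2)] by metis
 thus thesis using that by (simp add: VS.lincomb_def)
qed

end

text \<open>Evaluation of polynomials in an endomorphism \<open>f\<close> at a vector \<open>v\<close>; a polynomial of least
 degree killing \<open>v\<close> splits off a linear factor, which yields an eigenvector.\<close>

locale endo = lin_map V V f for V :: "'v cspace" and f
begin

definition ev :: "'v => complex poly => 'v" where
 "ev v p = lin_ext V (%i. (f ^^ i) v) (coeff p)"

lemma pow_closed [simp, intro]: "v : carrier V ==> (f ^^ i) v : carrier V"
 by (induction i) auto

lemma coeff_free: "coeff p : carrier (free_space (UNIV :: nat set))"
 using MOST_coeff_eq_0[of p] by (simp add: free_space_simps eventually_cofinite)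

context
 fixes v assumes v: "v : carrier V"
begin

interpretation E: lin_map "free_space (UNIV :: nat set)" V "lin_ext V (%i. (f ^^ i) v)"
 by (rule lin_map_lin_ext[OF V.cspace_axioms]) (use v in auto)

lemma ev_closed [simp, intro]: "ev v p : carrier V"
 unfolding ev_def by (rule E.closed[OF coeff_free])

lemma ev_add: "ev v (p + q) = ev v p \<oplus>_V ev v q"
 using E.add[OF coeff_free[of p] coeff_free[of q]]
 by (simp add: ev_def free_space_simps(2) plus_poly.rep_eq)

lemma ev_smult: "ev v (Polynomial.smult c p) = c \<odot>_V ev v p"
 using E.smult[OF coeff_free[of p], of c]
 by (simp add: ev_def free_space_simps(4) smult.rep_eq)

lemma ev_superset:
 assumes "degree p <= N"
 shows "ev v p = (\<Oplus>_V i\<in>{..N}. coeff p i \<odot>_V (f ^^ i) v)"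
 unfolding ev_def
 by (rule lin_ext_superset[where S = UNIV, OF V.cspace_axioms])
   (use v assms le_degree[of p] in \<open>auto intro: order.trans\<close>)

lemma ev_shift: "ev v (pCons 0 p) = f (ev v p)"
proof -
 have "ev v (pCons 0 p) = (\<Oplus>_V i\<in>{..Suc (degree p)}. coeff (pCons 0 p) i \<odot>_V (f ^^ i) v)"
  by (rule ev_superset) (simp add: degree_pCons_le)
 also have "... = (\<Oplus>_V i\<in>{..degree p}. coeff p i \<odot>_V (f ^^ Suc i) v) \<oplus>_V 0 \<odot>_V v"
  using v pow_closed[OF v] by (subst V.finsum_Suc2) (auto simp del: funpow.simps simp: funpow_0)
 also have "... = (\<Oplus>_V i\<in>{..degree p}. f (coeff p i \<odot>_V (f ^^ i) v))"
  using v by (subst V.zero_smult) (auto intro!: V.finsum_cong' V.finsum_closed simp: Pi_def)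
 also have "... = f (ev v p)"
  unfolding ev_superset[OF order.refl] by (rule finsum[symmetric]) (use v in auto)
 finally show ?thesis .
qed

lemma ev_linear_factor: "ev v ([:-c, 1:] * q) = f (ev v q) \<ominus>_V c \<odot>_V ev v q"
proof -
 have "[:-c, 1:] * q = pCons 0 q + Polynomial.smult (-c) q" by simp
 hence "ev v ([:-c, 1:] * q) = f (ev v q) \<oplus>_V (-c) \<odot>_V ev v q"
  by (simp only: ev_add ev_shift ev_smult)
 thus ?thesis by (simp add: V.minus_smult V.smult_smult)
qed

lemma ev_const: "ev v [:a:] = a \<odot>_V v"
 using v by (subst ev_superset[of _ 0]) auto

lemma eigenvector_from_poly:
 assumes nz: "v ~= \<zero>_V"
 shows "p ~= 0 ==> ev v p = \<zero>_V ==> EX c x. x : carrier V & x ~= \<zero>_V & f x = c \<odot>_V x"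
proof (induction "degree p" arbitrary: p rule: less_induct)
 case less
 show ?case
 proof (cases "degree p = 0")
  case True
  then obtain a where "p = [:a:]" using degree_eq_zeroE by blast
  thus ?thesis using less.prems nz v by (simp add: ev_const V.smult_eq_zero_iff)
 next
  case False
  hence "\<not> constant (poly p)" by (simp add: constant_degree)
  then obtain c where "poly p c = 0" using fundamental_theorem_of_algebra by blast
  then obtain q where q: "p = [:-c, 1:] * q" by (auto simp: poly_eq_0_iff_dvd elim: dvdE)
  hence q0: "q ~= 0" using less.prems by auto
  have deg: "degree q < degree p" using q0 unfolding q by (subst degree_mult_eq) auto
  show ?thesis
  proof (cases "ev v q = \<zero>_V")
   case True
   thus ?thesis using less.hyps[OF deg q0] by blast
  next
   case False
   have "f (ev v q) \<ominus>_V c \<odot>_V ev v q = \<zero>_V"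
    using less.prems(2) unfolding q ev_linear_factor .
   hence "f (ev v q) = c \<odot>_V ev v q" by (subst (asm) V.minus_eq_zero_iff) auto
   thus ?thesis using False by blast
  qed
 qed
qed

lemma annihilating_poly:
 assumes fd: "vectorspace.fin_dim Cx V"
 shows "EX p. p ~= 0 & ev v p = \<zero>_V"
proof -
 interpret VS: vectorspace Cx V by (rule V.vs)
 define n where "n = VS.dim"
 show ?thesis
 proof (cases "inj_on (%i. (f ^^ i) v) {..n}")
  case False
  then obtain i j where ij: "i ~= j" "(f ^^ i) v = (f ^^ j) v" by (auto simp: inj_on_def)
  have m: "ev v (monom a k) = a \<odot>_V (f ^^ k) v" for a k
  proof -
   have "ev v (monom a k) = (\<Oplus>_V i\<in>{..k}. coeff (monom a k) i \<odot>_V (f ^^ i) v)"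
    by (rule ev_superset) (rule degree_monom_le)
   also have "... = coeff (monom a k) k \<odot>_V (f ^^ k) v"
    by (rule V.finsum_single) (use v in auto)
   finally show ?thesis by simp
  qed
  have "ev v (monom 1 i + monom (-1) j) = \<zero>_V"
   using ij v by (simp add: ev_add m V.neg_smult V.r_neg)
  moreover have "coeff (monom 1 i + monom (-1::complex) j) i ~= 0" using ij by simp
  hence "monom 1 i + monom (-1::complex) j ~= 0" by (metis coeff_0)
  ultimately show ?thesis by blast
 next
  case True
  let ?S = "(%i. (f ^^ i) v) ` {..n}"
  have "card ?S = Suc n" using True by (simp add: card_image)
  moreover have sub: "?S <= carrier V" using v by auto
  ultimately have "VS.lin_dep ?S" using VS.li_le_dim(2)[OF fd sub] n_def by fastforce
  then obtain X a x where X: "finite X" "X <= ?S" "VS.lincomb a X = \<zero>_V" "x : X" "a x ~= 0"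
   unfolding VS.lin_dep_def by auto
  define T where "T = {i. i <= n & (f ^^ i) v : X}"
  have T: "finite T" "T <= {..n}" by (auto simp: T_def)
  have img: "(%i. (f ^^ i) v) ` T = X" using X(2) by (auto simp: T_def)
  have inj: "inj_on (%i. (f ^^ i) v) T" using True T(2) by (rule inj_on_subset)
  define p where "p = (\<Sum>i\<in>T. monom (a ((f ^^ i) v)) i)"
  have cp: "coeff p i = (if i : T then a ((f ^^ i) v) else 0)" for i
   using T by (simp add: p_def coeff_sum)
  have "ev v p = (\<Oplus>_V i\<in>T. coeff p i \<odot>_V (f ^^ i) v)"
   unfolding ev_def
   by (rule lin_ext_superset[where S = UNIV, OF V.cspace_axioms]) (use v T cp in auto)
  also have "... = (\<Oplus>_V i\<in>T. a ((f ^^ i) v) \<odot>_V (f ^^ i) v)"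
   by (rule V.finsum_cong') (use v cp in auto)
  also have "... = (\<Oplus>_V y\<in>X. a y \<odot>_V y)"
   unfolding img[symmetric] by (rule V.add.finprod_reindex[symmetric]) (use inj v in auto)
  also have "... = \<zero>_V" using X(3) by (simp add: VS.lincomb_def)
  finally have "ev v p = \<zero>_V" .
  moreover obtain i where "i : T" "x = (f ^^ i) v" using X(4) img by auto
  hence "coeff p i ~= 0" using cp X(5) by simp
  hence "p ~= 0" by auto
  ultimately show ?thesis by blast
 qed
qed

end

lemma eigenvector_exists:
 assumes "vectorspace.fin_dim Cx V" "carrier V ~= {\<zero>_V}"
 shows "EX c x. x : carrier V & x ~= \<zero>_V & f x = c \<odot>_V x"
proof -
 obtain v where "v : carrier V" "v ~= \<zero>_V" using assms(2) V.zero_closed by blast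
 thus ?thesis using annihilating_poly eigenvector_from_poly assms(1) by blast
qed

end

text \<open>Subtracting an eigenvalue from an endomorphism of an irreducible module gives one that is not
  injective, hence zero.\<close>

lemma schur_scalar:
 assumes V: "irrep A V rho" and fd: "vectorspace.fin_dim Cx V" and phi: "intertwiner A V rho V rho phi"
 obtains c where "!!v. v : carrier V ==> phi v = c \<odot>_V v"
proof -
 interpret V: irrep A V rho by (rule V)
 interpret f: endo V phi
  using phi by (simp add: endo_def lin_map_def lin_map_axioms_def intertwiner_def V.V.cspace_axioms)
 obtain c x where x: "x : carrier V" "x ~= \<zero>_V" "phi x = c \<odot>_V x"
  using f.eigenvector_exists[OF fd V.nontrivial] by blast
 have it: "phi (rho a v) = rho a (phi v)" if "a : carrier A" "v : carrier V" for a v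
  using phi that by (auto simp: intertwiner_def)
 have "stable_subset A V rho {v : carrier V. phi v = c \<odot>_V v}"
  by (auto simp: stable_subset_def it V.V.smult_add V.V.smult_smult V.act_smult mult.commute)
 hence "{v : carrier V. phi v = c \<odot>_V v} = carrier V" using V.irred x by blast
 thus thesis using that by blast
qed

section \<open>The density theorem\<close>

locale irrep_family = calg A for A :: "'a cspace" +
 fixes L :: "'l set" and V :: "'l => 'v cspace" and rho :: "'l => 'a => 'v => 'v"
 assumes irreps: "!!i. i : L ==> irrep A (V i) (rho i)"
  and ineq: "!!i j. i : L ==> j : L ==> i ~= j ==> \<not> equivalent_reps A (V i) (rho i) (V j) (rho j)"
  and fd: "vectorspace.fin_dim Cx A"
begin

lemma arep_V: "i : L ==> arep A (V i) (rho i)"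
 using irreps by (simp add: irrep_def)

lemma cspace_V: "i : L ==> cspace (V i)"
 using arep_V by (simp add: arep_def)

text \<open>An irreducible module is a quotient of the algebra.\<close>

lemma fd_V:
 assumes i: "i : L"
 shows "vectorspace.fin_dim Cx (V i)"
proof -
 interpret R: irrep A "V i" "rho i" by (rule irreps[OF i])
 interpret VA: vectorspace Cx A by (rule vs)
 interpret VV: vectorspace Cx "V i" by (rule R.V.vs)
 obtain v where v: "v : carrier (V i)" "v ~= \<zero>_(V i)" using R.nontrivial R.V.zero_closed by blast
 obtain X where X: "finite X" "X <= carrier A" "VA.span X = carrier A"
  using fd by (auto simp: VA.fin_dim_def)
 let ?Y = "(%x. rho i x v) ` X"
 have Y: "?Y <= carrier (V i)" using X v by auto
 have s: "VectorSpace.subspace Cx (lspan (V i) ?Y) (V i)" by (rule R.V.subspace_lspan[OF Y])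
 have "VectorSpace.subspace Cx {x : carrier A. rho i x v : lspan (V i) ?Y} A"
  using s v unfolding subspace_iff R.V.subspace_iff by (auto simp: R.add_act R.smult_act R.zero_act)
 moreover have "X <= {x : carrier A. rho i x v : lspan (V i) ?Y}"
  using X R.V.lspan_incl[of ?Y] by auto
 ultimately have "lspan A X <= {x : carrier A. rho i x v : lspan (V i) ?Y}"
  by (rule lspan_least)
 hence A: "carrier A <= {x : carrier A. rho i x v : lspan (V i) ?Y}"
  using lspan_eq_span[OF X(2)] X(3) by simp
 have "rho i \<one>_A v ~= \<zero>_(V i)" using v by (simp only: R.one_act) simp
 hence im: "(%x. rho i x v) ` carrier A = carrier (V i)"
  by (rule R.orbit[OF left_ideal_carrier[OF calg_axioms] v(1) one_closed])
 have "(%x. rho i x v) ` carrier A <= lspan (V i) ?Y"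
  by (rule image_subsetI) (drule subsetD[OF A], simp)
 hence "carrier (V i) <= lspan (V i) ?Y" unfolding im .
 hence "VV.span ?Y = carrier (V i)" using R.V.lspan_carrier[OF Y] R.V.lspan_eq_span[OF Y] by auto
 thus ?thesis using X Y unfolding VV.fin_dim_def by blast
qed

text \<open>Induction on the set \<open>S\<close> of vectors to be killed. If no element killing \<open>S \<union> {w}\<close> moves
 \<open>v\<close>, then \<open>h w \<mapsto> h v\<close> (for \<open>h\<close> killing \<open>S\<close>) is an isomorphism of irreducible representations,
 hence a scalar \<open>c\<close>, and \<open>v - c w\<close> contradicts the induction hypothesis.\<close>

lemma density:
 assumes "finite S" "!!i v. (i, v) : S ==> i : L & v : carrier (V i)"
  and "i0 : L" "v0 : carrier (V i0)" "v0 ~: lspan (V i0) {v. (i0, v) : S}"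
 shows "\<exists>h\<in>carrier A. rho i0 h v0 ~= \<zero>_(V i0) & (\<forall>(i, v)\<in>S. rho i h v = \<zero>_(V i))"
 using assms
proof (induction S arbitrary: i0 v0)
 case empty
 interpret R: irrep A "V i0" "rho i0" by (rule irreps[OF empty(2)])
 have "rho i0 \<one>_A v0 ~= \<zero>_(V i0)" using empty by (simp only: R.one_act) (simp add: R.V.lspan_empty)
 thus ?case by blast
next
 case (insert s S)
 obtain j w where s: "s = (j, w)" by (cases s)
 have j: "j : L" and w: "w : carrier (V j)" using insert.prems(1)[of j w] s by auto
 note i0 = \<open>i0 : L\<close> and v0 = \<open>v0 : carrier (V i0)\<close>
 interpret R0: irrep A "V i0" "rho i0" by (rule irreps[OF i0])
 interpret Rj: irrep A "V j" "rho j" by (rule irreps[OF j])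
 have S: "!!i v. (i, v) : S ==> i : L & v : carrier (V i)" using insert.prems(1) by blast
 have S0: "{v. (i0, v) : S} <= carrier (V i0)" and Sj: "{v. (j, v) : S} <= carrier (V j)" using S by auto
 have v0S: "v0 ~: lspan (V i0) {v. (i0, v) : S}"
  using insert.prems(4) R0.V.lspan_mono[of "{v. (i0, v) : S}" "{v. (i0, v) : insert s S}"] by auto
 show ?case
 proof (rule ccontr)
  assume neg: "\<not> ?case"
  define K where "K = {h : carrier A. \<forall>(i, v)\<in>S. rho i h v = \<zero>_(V i)}"
  have K: "left_ideal A K"
  proof -
   have z: "rho i \<zero>_A v = \<zero>_(V i)" if "(i, v) : S" for i v
    using arep.zero_act[OF arep_V] S[OF that] by blast
   have a: "rho i (x \<oplus>_A y) v = \<zero>_(V i)" if "(i, v) : S" "x : K" "y : K" for i v x y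
   proof -
    interpret R: arep A "V i" "rho i" by (rule arep_V) (use S that in auto)
    have "rho i x v = \<zero>_(V i)" "rho i y v = \<zero>_(V i)" using that by (auto simp: K_def)
    thus ?thesis using that S[OF that(1)] R.add_act[of x y v] by (simp add: K_def)
   qed
   have c: "rho i (k \<odot>_A x) v = \<zero>_(V i)" if "(i, v) : S" "x : K" for i v x k
   proof -
    interpret R: arep A "V i" "rho i" by (rule arep_V) (use S that in auto)
    have "rho i x v = \<zero>_(V i)" using that by (auto simp: K_def)
    thus ?thesis using that S[OF that(1)] R.smult_act[of x v k] by (simp add: K_def)
   qed
   have m: "rho i (y \<otimes>_A x) v = \<zero>_(V i)" if "(i, v) : S" "x : K" "y : carrier A" for i v x y
   proof -
    interpret R: arep A "V i" "rho i" by (rule arep_V) (use S that in auto)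
    have "rho i x v = \<zero>_(V i)" using that by (auto simp: K_def)
    thus ?thesis using that S[OF that(1)] R.mult_act[of y x v] R.act_zero[of y] by (simp add: K_def)
   qed
   have KA: "K <= carrier A" by (auto simp: K_def)
   have Ki: "h : K" if "h : carrier A" "!!i v. (i, v) : S ==> rho i h v = \<zero>_(V i)" for h
    using that by (auto simp: K_def)
   show ?thesis
    unfolding left_ideal_def stable_subset_def
    using KA by (intro conjI ballI allI Ki) (auto intro: z a c m)
  qed
  have KA: "K <= carrier A" by (auto simp: K_def)
  have kill: "rho i0 h v0 = \<zero>_(V i0)" if "h : K" "rho j h w = \<zero>_(V j)" for h
   using neg that s by (auto simp: K_def)
  have ih0: "\<exists>h\<in>K. rho i0 h v ~= \<zero>_(V i0)"
   if "v : carrier (V i0)" "v ~: lspan (V i0) {v. (i0, v) : S}" for v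
   using insert.IH[OF S i0 that] by (auto simp: K_def)
  obtain h0 where h0: "h0 : K" "rho i0 h0 v0 ~= \<zero>_(V i0)" using ih0[OF v0 v0S] by blast
  obtain phi where phi: "intertwiner A (V j) (rho j) (V i0) (rho i0) phi"
   "bij_betw phi (carrier (V j)) (carrier (V i0))" "!!x. x : K ==> phi (rho j x w) = rho i0 x v0"
   using cyclic_intertwiner[OF irreps[OF j] irreps[OF i0] K w v0 kill h0] by blast
  hence "equivalent_reps A (V j) (rho j) (V i0) (rho i0)" by (auto simp: equivalent_reps_iff)
  hence ji: "j = i0" using ineq j i0 by blast
  obtain c where c: "!!v. v : carrier (V i0) ==> phi v = c \<odot>_(V i0) v"
   using schur_scalar[OF irreps[OF i0] fd_V[OF i0]] phi(1) ji by metis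
  have w0: "w : carrier (V i0)" using w ji by simp
  define x where "x = v0 \<ominus>_(V i0) c \<odot>_(V i0) w"
  have xc: "x : carrier (V i0)" using v0 w0 by (simp add: x_def)
  have "x ~: lspan (V i0) {v. (i0, v) : S}"
  proof
   let ?T = "{v. (i0, v) : insert s S}"
   assume "x : lspan (V i0) {v. (i0, v) : S}"
   hence "x : lspan (V i0) ?T"
    using R0.V.lspan_mono[of "{v. (i0, v) : S}" ?T] by auto
   moreover have "w : lspan (V i0) ?T" using R0.V.lspan_incl[of ?T] s ji by auto
   moreover have "?T <= carrier (V i0)" using insert.prems(1) by auto
   ultimately have "x \<oplus>_(V i0) c \<odot>_(V i0) w : lspan (V i0) ?T"
    using R0.V.subspace_lspan[of ?T] unfolding R0.V.subspace_iff by blast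
   thus False using insert.prems(4) v0 w0 by (simp add: x_def R0.V.add_diff_cancel)
  qed
  then obtain h where h: "h : K" "rho i0 h x ~= \<zero>_(V i0)" using ih0[OF xc] by blast
  have hA: "h : carrier A" using h KA by auto
  have "rho i0 h v0 = c \<odot>_(V i0) rho i0 h w"
   using phi(3)[OF h(1)] c[OF R0.act_closed[OF hA w0]] ji by simp
  hence "rho i0 h x = \<zero>_(V i0)"
   unfolding x_def using hA v0 w0
   by (simp only: R0.act_diff R0.V.smult_closed R0.act_smult) (simp add: R0.V.minus_eq_zero_iff)
  thus False using h by blast
 qed
qed

lemma kills_span:
 assumes i: "i : L" and h: "h : carrier A" and B: "lspan (V i) B = carrier (V i)" "B <= carrier (V i)"
  and k: "!!b. b : B ==> rho i h b = \<zero>_(V i)" and v: "v : carrier (V i)"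
 shows "rho i h v = \<zero>_(V i)"
proof -
 interpret R: arep A "V i" "rho i" by (rule arep_V[OF i])
 have "VectorSpace.subspace Cx {v : carrier (V i). rho i h v = \<zero>_(V i)} (V i)"
  unfolding R.V.subspace_iff using h by (auto simp: R.act_add R.act_smult R.act_zero)
 hence "lspan (V i) B <= {v : carrier (V i). rho i h v = \<zero>_(V i)}"
  by (rule R.V.lspan_least) (use B k in auto)
 thus ?thesis using B v by auto
qed

text \<open>Density yields \<open>h\<close> that kills all chosen basis vectors but \<open>b\<close>;
  irreducibility moves \<open>h b\<close> to \<open>a\<close>.\<close>

lemma separating_elements:
 assumes F: "finite F" "F <= L"
  and B: "!!i. i : F ==> finite (B i) & B i <= carrier (V i) & lspan (V i) (B i) = carrier (V i)"
  and ind: "!!i b. i : F ==> b : B i ==> b ~: lspan (V i) (B i - {b})"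
  and i: "i : F" and ab: "a : carrier (V i)" "b : B i"
 shows "\<exists>h\<in>carrier A. (\<forall>c\<in>B i. rho i h c = (if c = b then a else \<zero>_(V i))) \<and>
      (\<forall>j\<in>F. j ~= i --> (\<forall>v\<in>carrier (V j). rho j h v = \<zero>_(V j)))"
proof -
 have iL: "i : L" using i F by auto
 interpret R: irrep A "V i" "rho i" by (rule irreps[OF iL])
 define S where "S = Sigma F B - {(i, b)}"
 have bc: "b : carrier (V i)" using B[OF i] ab by auto
 have "{v. (i, v) : S} = B i - {b}" using i by (auto simp: S_def)
 moreover have "finite S" using F B by (auto simp: S_def)
 moreover have "!!j v. (j, v) : S ==> j : L & v : carrier (V j)" using F B by (auto simp: S_def)
 ultimately obtain h where h: "h : carrier A" "rho i h b ~= \<zero>_(V i)" "!!j v. (j, v) : S ==> rho j h v = \<zero>_(V j)"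
  using density[of S i b] iL bc ind[OF i ab(2)] by fastforce
 have "rho i \<one>_A (rho i h b) ~= \<zero>_(V i)"
  using h bc by (simp only: R.one_act R.act_closed) simp
 hence "a : (%x. rho i x (rho i h b)) ` carrier A"
  using R.orbit[OF left_ideal_carrier[OF calg_axioms] R.act_closed[OF h(1) bc] one_closed] ab by blast
 then obtain g where g: "g : carrier A" "rho i g (rho i h b) = a" by auto
 have gh: "rho j (g \<otimes>_A h) v = rho j g (rho j h v)" if "j : F" "v : carrier (V j)" for j v
  by (rule arep.mult_act[OF arep_V]) (use that F g h in auto)
 have g0: "rho j g \<zero>_(V j) = \<zero>_(V j)" if "j : F" for j
  by (rule arep.act_zero[OF arep_V]) (use that F g in auto)
 have "\<forall>c\<in>B i. rho i (g \<otimes>_A h) c = (if c = b then a else \<zero>_(V i))"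
 proof
  fix c assume c: "c : B i"
  hence "c : carrier (V i)" using B[OF i] by auto
  thus "rho i (g \<otimes>_A h) c = (if c = b then a else \<zero>_(V i))"
   using gh[OF i] g(2) h(3)[of i c] g0[OF i] c i by (auto simp: S_def)
 qed
 moreover have "rho j (g \<otimes>_A h) v = \<zero>_(V j)" if j: "j : F" "j ~= i" "v : carrier (V j)" for j v
 proof -
  have "rho j h v = \<zero>_(V j)"
   by (rule kills_span[where B = "B j"]) (use j F B[OF j(1)] h S_def in auto)
  thus ?thesis using gh[OF j(1,3)] g0[OF j(1)] by simp
 qed
 ultimately show ?thesis using g h by (intro bexI[of _ "g \<otimes>_A h"]) auto
qed

lemma basis_choice:
 "EX B. \<forall>i\<in>L. finite (B i) & B i <= carrier (V i) & lspan (V i) (B i) = carrier (V i) \<and>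
   (\<forall>b\<in>B i. b ~: lspan (V i) (B i - {b})) & B i ~= {}"
proof -
 have "EX B. finite B & B <= carrier (V i) & lspan (V i) B = carrier (V i) \<and>
   (\<forall>b\<in>B. b ~: lspan (V i) (B - {b})) & B ~= {}" if i: "i : L" for i
 proof -
  interpret R: irrep A "V i" "rho i" by (rule irreps[OF i])
  obtain B where B: "finite B" "B <= carrier (V i)" "lspan (V i) B = carrier (V i)"
   "!!b. b : B ==> b ~: lspan (V i) (B - {b})" using R.V.finite_basis[OF fd_V[OF i]] by metis
  moreover have "B ~= {}" using B(3) R.nontrivial R.V.lspan_empty by auto
  ultimately show ?thesis by blast
 qed
 thus ?thesis by (intro bchoice) blast
qed

text \<open>Elements that fix a vector of one module and kill the others are linearly independent, so
  there are at most \<open>dim A\<close> of them.\<close>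

lemma finite_L: "finite L"
proof (rule ccontr)
 assume inf: "infinite L"
 interpret VA: vectorspace Cx A by (rule vs)
 obtain F where F: "finite F" "F <= L" "card F = Suc VA.dim"
  using infinite_arbitrarily_large[OF inf] by blast
 obtain B where BB: "\<forall>i\<in>L. finite (B i) & B i <= carrier (V i) & lspan (V i) (B i) = carrier (V i) \<and>
   (\<forall>b\<in>B i. b ~: lspan (V i) (B i - {b})) & B i ~= {}" using basis_choice ..
 have B: "!!i. i : L ==> finite (B i) & B i <= carrier (V i) & lspan (V i) (B i) = carrier (V i)"
  "!!i b. i : L ==> b : B i ==> b ~: lspan (V i) (B i - {b})"
  "!!i. i : L ==> B i ~= {}" using BB by blast+
 have b0: "b ~= \<zero>_(V i)" if "i : L" "b : B i" for i b
 proof -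
  interpret R: arep A "V i" "rho i" by (rule arep_V[OF that(1)])
  have "\<zero>_(V i) : lspan (V i) (B i - {b})"
   using R.V.subspace_lspan[of "B i - {b}"] B(1)[OF that(1)] unfolding R.V.subspace_iff by blast
  thus ?thesis using B(2)[OF that] by blast
 qed
 have B1: "finite (B i) & B i <= carrier (V i) & lspan (V i) (B i) = carrier (V i)" if "i : F" for i
  using B(1) F that by blast
 have B2: "b ~: lspan (V i) (B i - {b})" if "i : F" "b : B i" for i b
  using B(2) F that by blast
 define b where "b i = (SOME b. b : B i)" for i
 have bB: "b i : B i" if "i : F" for i
  unfolding b_def by (rule someI_ex) (use B(3) F that in blast)
 define Q where "Q i h \<longleftrightarrow> h : carrier A & rho i h (b i) = b i \<and>
   (\<forall>j\<in>F. j ~= i --> (\<forall>v\<in>carrier (V j). rho j h v = \<zero>_(V j)))" for i h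
 define h where "h i = (SOME h. Q i h)" for i
 have bc: "b i : carrier (V i)" if "i : F" for i using bB[OF that] B1[OF that] by blast
 have hQ: "Q i (h i)" if i: "i : F" for i
  unfolding h_def
 proof (rule someI_ex)
  have "\<exists>h\<in>carrier A. (\<forall>c\<in>B i. rho i h c = (if c = b i then b i else \<zero>_(V i))) \<and>
      (\<forall>j\<in>F. j ~= i --> (\<forall>v\<in>carrier (V j). rho j h v = \<zero>_(V j)))"
   by (rule separating_elements[where B = B, OF F(1,2) B1 B2 i bc[OF i] bB[OF i]])
  then obtain h where h: "h : carrier A" "\<forall>c\<in>B i. rho i h c = (if c = b i then b i else \<zero>_(V i))"
   "\<forall>j\<in>F. j ~= i --> (\<forall>v\<in>carrier (V j). rho j h v = \<zero>_(V j))" by blast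
  have "rho i h (b i) = b i" using h(2) bB[OF i] by simp
  thus "EX h. Q i h" unfolding Q_def using h(1,3) by blast
 qed
 have hb: "!!i. i : F ==> h i : carrier A" "!!i. i : F ==> b i : carrier (V i)"
  "!!i. i : F ==> b i ~= \<zero>_(V i)" "!!i. i : F ==> rho i (h i) (b i) = b i"
  "!!i j v. i : F ==> j : F ==> j ~= i ==> v : carrier (V j) ==> rho j (h i) v = \<zero>_(V j)"
  subgoal using hQ unfolding Q_def by blast
  subgoal by (rule bc)
  subgoal using b0 bB F by blast
  subgoal using hQ unfolding Q_def by blast
  subgoal using hQ unfolding Q_def by blast
  done
 have inj: "inj_on h F"
 proof (rule inj_onI, rule ccontr)
  fix i j assume ij: "i : F" "j : F" "h i = h j" "i ~= j"
  hence "rho j (h j) (b j) = \<zero>_(V j)" using hb(5)[of i j "b j"] hb(2) by simp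
  thus False using hb(3,4)[OF ij(2)] by simp
 qed
 have sub: "h ` F <= carrier A" using hb by auto
 have "VA.lin_indpt (h ` F)"
 proof (rule VA.finite_lin_indpt2[OF finite_imageI[OF F(1)] sub])
  fix k assume z: "VA.lincomb k (h ` F) = \<zero>_A"
  show "\<forall>v\<in>h ` F. k v = \<zero>_Cx"
  proof
   fix v assume "v : h ` F"
   then obtain i where i: "i : F" "v = h i" by auto
   interpret R: arep A "V i" "rho i" by (rule arep_V) (use i F in auto)
   have "rho i (\<Oplus>_A x\<in>h ` F. k x \<odot>_A x) (b i) = (\<Oplus>_(V i)x\<in>h ` F. rho i (k x \<odot>_A x) (b i))"
    by (rule R.finsum_act) (use hb i in auto)
   also have "... = rho i (k v \<odot>_A v) (b i)"
   proof (rule R.V.finsum_single)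
    fix x assume "x : h ` F" "x ~= v"
    then obtain j where j: "j : F" "x = h j" "i ~= j" using i by auto
    have "rho i (k x \<odot>_A x) (b i) = k x \<odot>_(V i) rho i x (b i)"
     by (rule R.smult_act) (use j hb i in auto)
    thus "rho i (k x \<odot>_A x) (b i) = \<zero>_(V i)"
     using hb(5)[OF j(1) i(1) j(3) hb(2)[OF i(1)]] j by simp
   qed (use F i hb in auto)
   also have "... = k v \<odot>_(V i) b i" using i hb by (simp only: R.smult_act)
   finally have "k v \<odot>_(V i) b i = \<zero>_(V i)"
    using z R.zero_act[OF hb(2)[OF i(1)]] by (simp add: VA.lincomb_def)
   thus "k v = \<zero>_Cx" using hb(2,3)[OF i(1)] by (simp add: R.V.smult_eq_zero_iff)
  qed
 qed
 hence "card (h ` F) <= VA.dim" by (rule VA.li_le_dim(2)[OF fd sub])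
 thus False using F inj by (simp add: card_image)
qed

text \<open>Density provides elements of \<open>A\<close> acting as the elementary matrices on the chosen
  bases, and faithfulness turns the identities between these matrices into identities in
  \<open>A\<close>.\<close>

lemma matrix_units_exist:
 assumes faithful: "!!x. x : carrier A ==>
   (!!i v. i : L ==> v : carrier (V i) ==> rho i x v = \<zero>_(V i)) ==> x = \<zero>_A"
 obtains B u b where "matrix_reps A L B u V rho b b"
proof -
 obtain B where BB: "\<forall>i\<in>L. finite (B i) & B i <= carrier (V i) & lspan (V i) (B i) = carrier (V i) \<and>
   (\<forall>b\<in>B i. b ~: lspan (V i) (B i - {b})) & B i ~= {}" using basis_choice ..
 have B: "!!i. i : L ==> finite (B i) & B i <= carrier (V i) & lspan (V i) (B i) = carrier (V i)"
  "!!i b. i : L ==> b : B i ==> b ~: lspan (V i) (B i - {b})"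
  "!!i. i : L ==> B i ~= {}" using BB by blast+
 have Bc: "b : carrier (V i)" if "i : L" "b : B i" for i b using B(1)[OF that(1)] that(2) by auto
 have b0: "b ~= \<zero>_(V i)" if "i : L" "b : B i" for i b
 proof -
  interpret R: arep A "V i" "rho i" by (rule arep_V[OF that(1)])
  have "\<zero>_(V i) : lspan (V i) (B i - {b})"
   using R.V.subspace_lspan[of "B i - {b}"] B(1)[OF that(1)] unfolding R.V.subspace_iff by blast
  thus ?thesis using B(2)[OF that] by blast
 qed
 define Q where "Q i a b h \<longleftrightarrow> h : carrier A & (\<forall>c\<in>B i. rho i h c = (if c = b then a else \<zero>_(V i))) \<and>
   (\<forall>j\<in>L. j ~= i --> (\<forall>v\<in>carrier (V j). rho j h v = \<zero>_(V j)))" for i a b h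
 define u where "u i a b = (SOME h. Q i a b h)" for i a b
 have uQ: "Q i a b (u i a b)" if "i : L" "a : B i" "b : B i" for i a b
  unfolding u_def
 proof (rule someI_ex)
  have "\<exists>h\<in>carrier A. (\<forall>c\<in>B i. rho i h c = (if c = b then a else \<zero>_(V i))) \<and>
   (\<forall>j\<in>L. j ~= i --> (\<forall>v\<in>carrier (V j). rho j h v = \<zero>_(V j)))"
   by (rule separating_elements[OF finite_L order.refl B(1,2) that(1) Bc[OF that(1,2)] that(3)])
  thus "EX h. Q i a b h" unfolding Q_def by (elim bexE) (intro exI conjI, assumption, blast, blast)
 qed
 have u: "!!i a b. i : L ==> a : B i ==> b : B i ==> u i a b : carrier A"
  "!!i a b c. i : L ==> a : B i ==> b : B i ==> c : B i ==>
    rho i (u i a b) c = (if c = b then a else \<zero>_(V i))"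
  "!!i a b j v. i : L ==> a : B i ==> b : B i ==> j : L ==> j ~= i ==> v : carrier (V j) ==>
    rho j (u i a b) v = \<zero>_(V j)"
  using uQ unfolding Q_def by blast+
 have eqI: "x = y" if x: "x : carrier A" and y: "y : carrier A"
  and eq: "!!i b. i : L ==> b : B i ==> rho i x b = rho i y b" for x y
 proof -
  have "x \<ominus>_A y = \<zero>_A"
  proof (rule faithful)
   fix i v assume iv: "i : L" "v : carrier (V i)"
   interpret R: arep A "V i" "rho i" by (rule arep_V[OF iv(1)])
   show "rho i (x \<ominus>_A y) v = \<zero>_(V i)"
   proof (rule kills_span[OF iv(1) _ _ _ _ iv(2), where B = "B i"])
    fix b assume b: "b : B i"
    have bc: "b : carrier (V i)" by (rule Bc[OF iv(1) b])
    show "rho i (x \<ominus>_A y) b = \<zero>_(V i)"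
     unfolding R.diff_act[OF x y bc] eq[OF iv(1) b]
     using R.act_closed[OF y bc] by (simp add: R.V.minus_eq_zero_iff)
   qed (use B(1)[OF iv(1)] x y in auto)
  qed (use x y in auto)
  thus ?thesis using minus_eq_zero_iff[OF x y] by blast
 qed
 have uc: "rho j (u i a b) c = (if j = i & c = b then a else \<zero>_(V j))"
  if "i : L" "a : B i" "b : B i" "j : L" "c : B j" for i a b j c
  using u(2)[of i a b c] u(3)[of i a b j c] Bc that by (cases "j = i") auto
 have mu: "matrix_units A L B u"
 proof
  show "finite L" by (rule finite_L)
  show "finite (B l)" if "l : L" for l using B(1)[OF that] by blast
  show "u l a b : carrier A" if "l : L" "a : B l" "b : B l" for l a b using u(1) that .
 next
  fix l m a b c d
  assume h: "l : L" "m : L" "a : B l" "b : B l" "c : B m" "d : B m"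
  show "u l a b \<otimes>_A u m c d = (if l = m & b = c then u l a d else \<zero>_A)"
  proof (rule eqI)
   fix i e assume ie: "i : L" "e : B i"
   interpret R: arep A "V i" "rho i" by (rule arep_V[OF ie(1)])
   have ec: "e : carrier (V i)" by (rule Bc[OF ie])
   have "rho i (u l a b \<otimes>_A u m c d) e = rho i (u l a b) (rho i (u m c d) e)"
    by (rule R.mult_act) (use u h ec in auto)
   also have "... = rho i (if l = m & b = c then u l a d else \<zero>_A) e"
    using h ie ec R.act_zero[OF u(1)[OF h(1,3,4)]] R.zero_act[OF ec]
    by (auto simp: uc simp del: End_alg_simps)
   finally show "rho i (u l a b \<otimes>_A u m c d) e = rho i (if l = m & b = c then u l a d else \<zero>_A) e" .
  qed (use u h in auto)
 next
  have inner: "(\<Oplus>_A a\<in>B l. u l a a) : carrier A" if "l : L" for l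
   by (rule finsum_closed) (use that u in auto)
  show "(\<Oplus>_A l\<in>L. \<Oplus>_A a\<in>B l. u l a a) = \<one>_A"
  proof (rule eqI)
   fix i e assume ie: "i : L" "e : B i"
   interpret R: arep A "V i" "rho i" by (rule arep_V[OF ie(1)])
   have ec: "e : carrier (V i)" by (rule Bc[OF ie])
   have "rho i (\<Oplus>_A l\<in>L. \<Oplus>_A a\<in>B l. u l a a) e = (\<Oplus>_(V i)l\<in>L. rho i (\<Oplus>_A a\<in>B l. u l a a) e)"
    by (rule R.finsum_act) (use ec inner in auto)
   also have "... = (\<Oplus>_(V i)l\<in>L. \<Oplus>_(V i)a\<in>B l. rho i (u l a a) e)"
    by (rule R.V.finsum_cong') (use ec u in \<open>auto intro!: R.finsum_act R.V.finsum_closed\<close>)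
   also have "... = (\<Oplus>_(V i)a\<in>B i. rho i (u i a a) e)"
    by (rule R.V.finsum_single)
      (use ie ec finite_L uc u in \<open>auto intro!: R.V.finsum_closed R.V.add.finprod_one_eqI\<close>)
   also have "... = rho i (u i e e) e"
    by (rule R.V.finsum_single) (use ie ec B(1)[OF ie(1)] uc u in auto)
   also have "... = rho i \<one>_A e" unfolding R.one_act[OF ec] using uc ie by simp
   finally show "rho i (\<Oplus>_A l\<in>L. \<Oplus>_A a\<in>B l. u l a a) e = rho i \<one>_A e" .
  qed (use inner in \<open>auto intro!: finsum_closed\<close>)
 next
  fix W assume W: "W <= carrier A" "\<zero>_A : W" "!!x y. x : W ==> y : W ==> x \<oplus>_A y : W"
   "!!c x. x : W ==> c \<odot>_A x : W"
   "!!l a b. l : L ==> a : B l ==> b : B l ==> u l a b : W"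
  have Wc: "!!x. x : W ==> x : carrier A" using W(1) by blast
  show "carrier A <= W"
  proof
   fix x assume x: "x : carrier A"
   have "EX k. rho i x b = (\<Oplus>_(V i)a\<in>B i. k a \<odot>_(V i) a)" if "i : L" "b : B i" for i b
   proof -
    interpret R: arep A "V i" "rho i" by (rule arep_V[OF that(1)])
    show ?thesis
     using R.V.coords[of "B i" "rho i x b"] B(1)[OF that(1)] R.act_closed[OF x Bc[OF that]] by metis
   qed
   then obtain k where k: "!!i b. i : L ==> b : B i ==>
     rho i x b = (\<Oplus>_(V i)a\<in>B i. k i b a \<odot>_(V i) a)" by metis
   define y where "y m b = (\<Oplus>_A a\<in>B m. k m b a \<odot>_A u m a b)" for m b
   define x' where "x' = (\<Oplus>_A m\<in>L. \<Oplus>_A b\<in>B m. y m b)"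
   have yW: "y m b : W" if "m : L" "b : B m" for m b
    unfolding y_def by (rule finsum_in_subset[OF W(1-3)]) (use that W in auto)
   have yW': "(\<Oplus>_A b\<in>B m. y m b) : W" if "m : L" for m
    by (rule finsum_in_subset[OF W(1-3)]) (use that yW in auto)
   have xW: "x' : W" unfolding x'_def by (rule finsum_in_subset[OF W(1-3)]) (use yW' in auto)
   have "x = x'"
   proof (rule eqI[OF x Wc[OF xW]])
    fix i e assume ie: "i : L" "e : B i"
    interpret R: arep A "V i" "rho i" by (rule arep_V[OF ie(1)])
    have ec: "e : carrier (V i)" by (rule Bc[OF ie])
    have t: "rho i (k m b a \<odot>_A u m a b) e = (if m = i & b = e then k i e a \<odot>_(V i) a else \<zero>_(V i))"
     if "m : L" "a : B m" "b : B m" for m a b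
    proof -
     have "rho i (k m b a \<odot>_A u m a b) e = k m b a \<odot>_(V i) rho i (u m a b) e"
      by (rule R.smult_act) (use u that ec in auto)
     thus ?thesis using uc[OF that(1,2,3) ie] by auto
    qed
    have ye: "rho i (y m b) e = (if m = i & b = e then rho i x e else \<zero>_(V i))"
     if "m : L" "b : B m" for m b
    proof -
     have "rho i (y m b) e = (\<Oplus>_(V i)a\<in>B m. rho i (k m b a \<odot>_A u m a b) e)"
      unfolding y_def by (rule R.finsum_act) (use ec u that in auto)
     also have "... = (\<Oplus>_(V i)a\<in>B m. if m = i & b = e then k i e a \<odot>_(V i) a else \<zero>_(V i))"
      by (rule R.V.finsum_cong') (use t that ie Bc in auto)
     also have "... = (if m = i & b = e then rho i x e else \<zero>_(V i))"
      using k[OF ie] by auto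
     finally show ?thesis .
    qed
    have xe: "rho i x e : carrier (V i)" by (rule R.act_closed[OF x ec])
    have "rho i x' e = (\<Oplus>_(V i)m\<in>L. rho i (\<Oplus>_A b\<in>B m. y m b) e)"
     unfolding x'_def by (rule R.finsum_act) (use ec yW' Wc in auto)
    also have "... = (\<Oplus>_(V i)m\<in>L. \<Oplus>_(V i)b\<in>B m. rho i (y m b) e)"
     by (rule R.V.finsum_cong') (use ec yW Wc in \<open>auto intro!: R.finsum_act R.V.finsum_closed\<close>)
    also have "... = (\<Oplus>_(V i)b\<in>B i. rho i (y i b) e)"
     by (rule R.V.finsum_single)
       (use ie xe finite_L ye in \<open>auto intro!: R.V.finsum_closed R.V.add.finprod_one_eqI\<close>)
    also have "... = rho i (y i e) e"
     by (rule R.V.finsum_single) (use ie xe B(1)[OF ie(1)] ye in auto)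
    also have "... = rho i x e" using ye[OF ie] by simp
    finally show "rho i x e = rho i x' e" by simp
   qed
   thus "x : W" using xW by simp
  qed
 qed
 interpret M: matrix_units A L B u by (rule mu)
 define b where "b i = (SOME b. b : B i)" for i
 have b: "b i : B i" if "i : L" for i using B(3)[OF that] some_in_eq by (auto simp: b_def)
 have "matrix_reps A L B u V rho b b"
 proof (rule matrix_reps.intro[OF mu], rule matrix_reps_axioms.intro)
  fix l v assume lv: "l : L" "v : carrier (V l)"
  interpret R: arep A "V l" "rho l" by (rule arep_V[OF lv(1)])
  obtain k where k: "v = (\<Oplus>_(V l)a\<in>B l. k a \<odot>_(V l) a)"
   using R.V.coords[of "B l" v] B(1)[OF lv(1)] lv by metis
  have "rho l (u l (b l) (b l)) v = (\<Oplus>_(V l)a\<in>B l. rho l (u l (b l) (b l)) (k a \<odot>_(V l) a))"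
   unfolding k by (rule R.act_finsum) (use u b lv Bc in auto)
  also have "... = rho l (u l (b l) (b l)) (k (b l) \<odot>_(V l) b l)"
  proof (rule R.V.finsum_single)
   fix a assume a: "a : B l" "a ~= b l"
   have "rho l (u l (b l) (b l)) (k a \<odot>_(V l) a) = k a \<odot>_(V l) rho l (u l (b l) (b l)) a"
    by (rule R.act_smult) (use a u b lv Bc in auto)
   thus "rho l (u l (b l) (b l)) (k a \<odot>_(V l) a) = \<zero>_(V l)"
    using uc[OF lv(1) b[OF lv(1)] b[OF lv(1)] lv(1) a(1)] a by simp
  qed (use B(1)[OF lv(1)] b u lv Bc in auto)
  also have "... = k (b l) \<odot>_(V l) rho l (u l (b l) (b l)) (b l)"
   by (rule R.act_smult) (use u b lv Bc in auto)
  also have "... = k (b l) \<odot>_(V l) b l"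
   using uc[OF lv(1) b[OF lv(1)] b[OF lv(1)] lv(1) b[OF lv(1)]] by simp
  finally show "EX c. rho l (u l (b l) (b l)) v = c \<odot>_(V l) b l" by blast
 next
  show "b l : B l" if "l : L" for l by (rule b[OF that])
  show "b l : carrier (V l)" if "l : L" for l by (rule Bc[OF that b[OF that]])
  show "b l ~= \<zero>_(V l)" if "l : L" for l by (rule b0[OF that b[OF that]])
  show "rho l (u l (b l) (b l)) (b l) = b l" if "l : L" for l
   using uc[OF that b[OF that] b[OF that] that b[OF that]] by simp
  show "rho l (u m a a) v = \<zero>_(V l)"
   if "l : L" "m : L" "l ~= m" "a : B m" "v : carrier (V l)" for l m a v
   by (rule u(3)[OF that(2,4,4,1,3,5)])
 qed (rule arep_V)
 thus thesis using that by blast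
qed

end

(* The letter positions and generators are numbered from 1. *)
declare One_nat_def [simp del]

section \<open>Endomorphisms of square zero have trace zero\<close>

text \<open>In a triangular form the diagonal entries have square zero.\<close>

lemma mat_square_zero_trace:
 fixes A :: "complex mat"
 assumes A: "A : carrier_mat n n" and sq: "A * A = 0\<^sub>m n n"
 shows "(\<Sum>i<n. A $$ (i, i)) = 0"
proof -
 obtain es where "char_poly A = (\<Prod>a\<leftarrow>es. [:- a, 1:])" using char_poly_factorized[OF A] by blast
 then obtain B where B: "B : carrier_mat n n" "upper_triangular B" "similar_mat A B"
  using schur_decomposition_exists[OF A] by blast
 then obtain P Q where "similar_mat_wit A B P Q" by (auto simp: similar_mat_def)
 from similar_mat_witD2[OF A this] have PQ: "P * Q = 1\<^sub>m n" "Q * P = 1\<^sub>m n" "A = P * B * Q"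
  and P: "P : carrier_mat n n" and Q: "Q : carrier_mat n n" by auto
 have "B = Q * A * P"
 proof -
  have "Q * A * P = (Q * P) * B * (Q * P)"
   unfolding PQ(3) using P Q B(1) by (simp add: assoc_mult_mat[of _ n n _ n _ n])
  thus ?thesis using B(1) by (simp add: PQ(2))
 qed
 hence "B * B = Q * A * (P * Q) * A * P"
  using P Q A by (simp add: assoc_mult_mat[of _ n n _ n _ n])
 also have "... = Q * (A * A) * P"
  using P Q A by (simp add: PQ(1) assoc_mult_mat[of _ n n _ n _ n])
 also have "... = 0\<^sub>m n n" using P Q by (simp add: sq)
 finally have BB: "B * B = 0\<^sub>m n n" .
 have diag: "B $$ (i, i) = 0" if i: "i < n" for i
 proof -
  have "0 = (B * B) $$ (i, i)" using i by (simp add: BB)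
  also have "... = (\<Sum>k<n. B $$ (i, k) * B $$ (k, i))"
   using i B(1) by (simp add: scalar_prod_def atLeast0LessThan)
  also have "... = (\<Sum>k<n. if k = i then B $$ (i, i) * B $$ (i, i) else 0)"
  proof (rule sum.cong)
   fix k assume k: "k : {..<n}"
   show "B $$ (i, k) * B $$ (k, i) = (if k = i then B $$ (i, i) * B $$ (i, i) else 0)"
    using upper_triangularD[OF B(2), of i k] upper_triangularD[OF B(2), of k i] i k B(1)
    by (cases i k rule: linorder_cases) auto
  qed simp
  also have "... = B $$ (i, i) * B $$ (i, i)" using i by simp
  finally show ?thesis by simp
 qed
 have "(\<Sum>i<n. A $$ (i, i)) = (\<Sum>i<n. \<Sum>j<n. \<Sum>k<n. P $$ (i, j) * B $$ (j, k) * Q $$ (k, i))"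
 proof (rule sum.cong)
  fix i assume "i : {..<n}"
  hence i: "i < n" by simp
  have "A $$ (i, i) = (P * (B * Q)) $$ (i, i)" unfolding PQ(3) using P Q B(1) by simp
  thus "A $$ (i, i) = (\<Sum>j<n. \<Sum>k<n. P $$ (i, j) * B $$ (j, k) * Q $$ (k, i))"
   using P Q B(1) i by (simp add: scalar_prod_def atLeast0LessThan sum_distrib_left mult.assoc)
 qed simp
 also have "... = (\<Sum>j<n. \<Sum>k<n. \<Sum>i<n. P $$ (i, j) * B $$ (j, k) * Q $$ (k, i))"
  by (subst sum.swap, rule sum.cong, simp, rule sum.swap)
 also have "... = (\<Sum>j<n. \<Sum>k<n. B $$ (j, k) * (Q * P) $$ (k, j))"
  using P Q by (intro sum.cong) (auto simp: scalar_prod_def atLeast0LessThan sum_distrib_left mult_ac)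
 also have "... = (\<Sum>j<n. \<Sum>k<n. if k = j then B $$ (j, j) else 0)"
  by (intro sum.cong) (auto simp: PQ(2))
 also have "... = 0" by (simp add: diag)
 finally show ?thesis .
qed

lemma free_space_matrix:
 assumes W: "finite W" and f: "lin_map (free_space W) (free_space W) f" and F: "F : carrier (free_space W)"
 shows "f F v = (\<Sum>w\<in>W. F w * f (single w) v)"
proof -
 interpret f: lin_map "free_space W" "free_space W" f by (rule f)
 show ?thesis using F
 proof (induction rule: free_space_induct)
  case zero
  thus ?case using f.zero by (simp add: free_space_simps(3))
 next
  case (add F s c)
  have "f (%t. F t + c * single s t) = f (F \<oplus>_(free_space W) c \<odot>_(free_space W) single s)"
   by (simp add: free_space_simps)
  also have "... = f F \<oplus>_(free_space W) c \<odot>_(free_space W) f (single s)"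
   using add by (simp only: f.add f.smult single_in_free f.V.smult_closed)
  also have "... = (%t. f F t + c * f (single s) t)" by (simp only: free_space_simps)
  finally have "f (%t. F t + c * single s t) v = f F v + c * f (single s) v" by simp
  moreover have "(\<Sum>w\<in>W. c * single s w * f (single w) v) = (\<Sum>w\<in>W. if w = s then c * f (single s) v else 0)"
   by (rule sum.cong) (auto simp: single_def)
  ultimately show ?case using add W by (simp add: algebra_simps sum.distrib)
 qed
qed

lemma square_zero_trace:
 assumes W: "finite W" and f: "lin_map (free_space W) (free_space W) f"
  and sq: "!!F. F : carrier (free_space W) ==> f (f F) = (%_. 0)"
 shows "(\<Sum>w\<in>W. f (single w) w) = 0"
proof -
 interpret f: lin_map "free_space W" "free_space W" f by (rule f)
 define n where "n = card W"
 obtain h where h: "bij_betw h {..<n} W"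
  using ex_bij_betw_nat_finite[OF W] by (auto simp: n_def atLeast0LessThan)
 have hW: "h i : W" if "i < n" for i using h that by (auto simp: bij_betw_def)
 define A where "A = mat n n (%(i, j). f (single (h j)) (h i))"
 have "(A * A) $$ (i, j) = 0" if ij: "i < n" "j < n" for i j
 proof -
  have "(A * A) $$ (i, j) = (\<Sum>k<n. f (single (h k)) (h i) * f (single (h j)) (h k))"
   using ij by (simp add: A_def scalar_prod_def atLeast0LessThan)
  also have "... = (\<Sum>w\<in>W. f (single (h j)) w * f (single w) (h i))"
   by (subst sum.reindex_bij_betw[OF h, symmetric]) (simp add: mult.commute)
  also have "... = f (f (single (h j))) (h i)"
   by (rule free_space_matrix[OF W f, symmetric]) (use hW ij in \<open>auto simp: single_in_free\<close>)
  also have "... = 0" using sq[OF single_in_free[OF hW[OF ij(2)]]] by simp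
  finally show ?thesis .
 qed
 hence "A * A = 0\<^sub>m n n" by (intro eq_matI) (auto simp: A_def)
 hence "(\<Sum>i<n. A $$ (i, i)) = 0" by (intro mat_square_zero_trace) (auto simp: A_def)
 hence "(\<Sum>i<n. f (single (h i)) (h i)) = 0" by (simp add: A_def)
 thus ?thesis by (subst sum.reindex_bij_betw[OF h, symmetric])
qed

section \<open>The Hecke algebra: universal property\<close>

text \<open>Both forms of the quadratic relation are needed: the factored one is the definition, the
  expanded one is used for computing.\<close>

lemma (in calg) quadratic_form:
 assumes "x : carrier A" "e : carrier A" "x \<otimes>_A e = x" "e \<otimes>_A x = x" "e \<otimes>_A e = e"
 shows "(x \<ominus>_A q \<odot>_A e) \<otimes>_A (x \<oplus>_A e)
   = (x \<otimes>_A x) \<ominus>_A ((q - 1) \<odot>_A x \<oplus>_A q \<odot>_A e)"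
proof -
 have "(x \<ominus>_A q \<odot>_A e) \<otimes>_A (x \<oplus>_A e)
   = x \<otimes>_A x \<oplus>_A (1 \<odot>_A x \<oplus>_A (-q) \<odot>_A x) \<oplus>_A (-q) \<odot>_A e"
  using assms by (simp add: minus_smult l_distr r_distr smult_mult smult_smult a_ac)
 also have "1 \<odot>_A x \<oplus>_A (-q) \<odot>_A x = (1 + - q) \<odot>_A x" by (rule add_smult[symmetric]) fact
 also have "x \<otimes>_A x \<oplus>_A (1 + - q) \<odot>_A x \<oplus>_A (-q) \<odot>_A e
   = (x \<otimes>_A x) \<ominus>_A ((q - 1) \<odot>_A x \<oplus>_A q \<odot>_A e)"
  using assms by (simp add: minus_smult smult_add smult_smult a_ac)
 finally show ?thesis .
qed

lemma hecke_presentation: "presentation {1..k} (hecke_relations q k)"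
proof
 fix x y :: "nat list => complex"
 interpret F: calg "free_algebra {1..k}" by (rule calg_free_algebra)
 assume "(x, y) : hecke_relations q k"
 thus "x : carrier (free_algebra {1..k}) & y : carrier (free_algebra {1..k})"
  unfolding hecke_relations_def Let_def
  by (auto intro!: F.m_closed F.a_closed F.minus_closed F.smult_closed free_gen_closed)
qed

locale hecke =
 fixes q :: complex and k :: nat
begin

abbreviation "H \<equiv> hecke_algebra q k"
abbreviation "T \<equiv> hecke_T q k"

sublocale Pr: presentation "{1..k}" "hecke_relations q k" by (rule hecke_presentation)

lemma H_eq: "H = presented_algebra {1..k} (hecke_relations q k)" by (simp add: hecke_algebra_def)

sublocale H: calg H using Pr.calg_presented by (simp add: H_eq)

lemma T_closed [simp, intro]: "i : {1..k} ==> T i : carrier H"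
 using Pr.gen_closed by (simp add: hecke_T_def H_eq)

lemma proj_T: "Pr.proj (free_gen i) = T i"
 by (simp add: hecke_T_def presented_gen_def)

lemma proj_map: "alg_map Pr.F H (%x. Pr.proj x)"
 using Pr.pr.alg_map_axioms by (simp add: H_eq)

lemma T_quadratic:
 assumes i: "i : {1..k}"
 shows "T i \<otimes>_H T i = (q - 1) \<odot>_H T i \<oplus>_H q \<odot>_H \<one>_H"
proof -
 interpret pr: alg_map Pr.F H "%x. Pr.proj x" by (rule proj_map)
 let ?g = "free_gen :: nat => _"
 have g: "?g i : carrier Pr.F" using i by (rule free_gen_closed)
 have "((?g i \<ominus>_Pr.F q \<odot>_Pr.F \<one>_Pr.F) \<otimes>_Pr.F (?g i \<oplus>_Pr.F \<one>_Pr.F), \<zero>_Pr.F) : hecke_relations q k"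
  unfolding hecke_relations_def Let_def
  by (rule UnI1, rule UnI1, rule CollectI, rule exI[of _ i], simp only: i simp_thms)
 from Pr.proj_rel[OF this] have "(T i \<ominus>_H q \<odot>_H \<one>_H) \<otimes>_H (T i \<oplus>_H \<one>_H) = \<zero>_H"
  using g by (simp add: proj_T H_eq)
 hence "T i \<otimes>_H T i \<ominus>_H ((q - 1) \<odot>_H T i \<oplus>_H q \<odot>_H \<one>_H) = \<zero>_H"
  using H.quadratic_form[of "T i" "\<one>_H" q] i by simp
 thus ?thesis using i by (subst (asm) H.minus_eq_zero_iff) auto
qed

lemma T_braid:
 assumes i: "i : {1..k}" "i + 1 : {1..k}"
 shows "T i \<otimes>_H T (i + 1) \<otimes>_H T i = T (i + 1) \<otimes>_H T i \<otimes>_H T (i + 1)"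
proof -
 interpret pr: alg_map Pr.F H "%x. Pr.proj x" by (rule proj_map)
 let ?g = "free_gen :: nat => _"
 have g: "?g i : carrier Pr.F" "?g (i + 1) : carrier Pr.F" by (rule free_gen_closed[OF i(1)], rule free_gen_closed[OF i(2)])
 have "(?g i \<otimes>_Pr.F ?g (i+1) \<otimes>_Pr.F ?g i, ?g (i+1) \<otimes>_Pr.F ?g i \<otimes>_Pr.F ?g (i+1)) : hecke_relations q k"
  unfolding hecke_relations_def Let_def
  by (rule UnI1, rule UnI2, rule CollectI, rule exI[of _ i], simp only: i simp_thms)
 from Pr.proj_rel[OF this] show ?thesis
  using g by (simp only: pr.mult Pr.F.m_closed proj_T)
qed

lemma T_commute:
 assumes i: "i : {1..k}" "j : {1..k}" "i + 2 <= j | j + 2 <= i"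
 shows "T i \<otimes>_H T j = T j \<otimes>_H T i"
proof -
 interpret pr: alg_map Pr.F H "%x. Pr.proj x" by (rule proj_map)
 let ?g = "free_gen :: nat => _"
 have g: "?g i : carrier Pr.F" "?g j : carrier Pr.F" by (rule free_gen_closed[OF i(1)], rule free_gen_closed[OF i(2)])
 have "\<bar>int i - int j\<bar> \<ge> 2" using i(3) by auto
 note d = this
 have "(?g i \<otimes>_Pr.F ?g j, ?g j \<otimes>_Pr.F ?g i) : hecke_relations q k"
  unfolding hecke_relations_def Let_def
  by (rule UnI2, rule CollectI, rule exI[of _ i], rule exI[of _ j], simp only: i(1,2) d simp_thms)
 from Pr.proj_rel[OF this] show ?thesis
  using g by (simp only: pr.mult Pr.F.m_closed proj_T)
qed

lemma hecke_hom_exists: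
 assumes B: "calg B" and t: "!!i. i : {1..k} ==> t i : carrier B"
  and quad: "!!i. i : {1..k} ==> t i \<otimes>_B t i = (q - 1) \<odot>_B t i \<oplus>_B q \<odot>_B \<one>_B"
  and braid: "!!i. i : {1..k} ==> i + 1 : {1..k} ==>
    t i \<otimes>_B t (i + 1) \<otimes>_B t i = t (i + 1) \<otimes>_B t i \<otimes>_B t (i + 1)"
  and comm: "!!i j. i : {1..k} ==> j : {1..k} ==> i + 2 <= j ==> t i \<otimes>_B t j = t j \<otimes>_B t i"
 obtains h where "h : algebra_hom H B" "!!i. i : {1..k} ==> h (T i) = t i"
proof -
 interpret B: calg B by (rule B)
 have rel: "h x = h y" if "alg_map Pr.F B h" "!!s. s : {1..k} ==> h (free_gen s) = t s"
  "(x, y) : hecke_relations q k" for h x y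
 proof -
  interpret h: alg_map Pr.F B h by (rule that(1))
  note g = free_gen_closed[of _ "{1..k}"]
  have quad': "(t i \<ominus>_B q \<odot>_B \<one>_B) \<otimes>_B (t i \<oplus>_B \<one>_B) = \<zero>_B" if "i : {1..k}" for i
   using B.quadratic_form[of "t i" "\<one>_B" q] quad[OF that] t[OF that] by (simp add: B.minus_eq_zero_iff)
  from that(3) consider
   (a) i where "i : {1..k}" "x = (free_gen i \<ominus>_Pr.F q \<odot>_Pr.F \<one>_Pr.F) \<otimes>_Pr.F (free_gen i \<oplus>_Pr.F \<one>_Pr.F)" "y = \<zero>_Pr.F"
   | (b) i where "i : {1..k}" "i + 1 : {1..k}" "x = free_gen i \<otimes>_Pr.F free_gen (i+1) \<otimes>_Pr.F free_gen i"
      "y = free_gen (i+1) \<otimes>_Pr.F free_gen i \<otimes>_Pr.F free_gen (i+1)"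
   | (c) i j where "i : {1..k}" "j : {1..k}" "\<bar>int i - int j\<bar> \<ge> 2" "x = free_gen i \<otimes>_Pr.F free_gen j"
      "y = free_gen j \<otimes>_Pr.F free_gen i"
   unfolding hecke_relations_def Let_def
   by (elim UnE CollectE exE conjE Pair_inject) (rule that; assumption)+
  thus ?thesis
  proof cases
   case a
   have "h x = (t i \<ominus>_B q \<odot>_B \<one>_B) \<otimes>_B (t i \<oplus>_B \<one>_B)"
    unfolding a(2) using g[OF a(1)] that(2)[OF a(1)] by simp
   thus ?thesis using quad'[OF a(1)] a(3) by simp
  next
   case b
   show ?thesis
    unfolding b(3,4) using g[OF b(1)] g[OF b(2)] that(2)[OF b(1)] that(2)[OF b(2)] braid[OF b(1,2)]
    by (simp only: h.mult Pr.F.m_closed)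
  next
   case c
   hence "i + 2 <= j | j + 2 <= i" by auto
   hence "t i \<otimes>_B t j = t j \<otimes>_B t i" using comm c(1,2) by metis
   thus ?thesis
    unfolding c(4,5) using g[OF c(1)] g[OF c(2)] that(2)[OF c(1)] that(2)[OF c(2)]
    by (simp only: h.mult)
  qed
 qed
 obtain h where "h : algebra_hom Pr.P B" "!!s. s : {1..k} ==> h (presented_gen {1..k} (hecke_relations q k) s) = t s"
 proof (rule Pr.presented_hom_exists[where g = t, OF B t rel])
  fix h assume "h : algebra_hom Pr.P B" "!!s. s : {1..k} ==> h (presented_gen {1..k} (hecke_relations q k) s) = t s"
  thus thesis by (rule that)
 qed
 thus thesis by (intro that) (simp_all add: H_eq hecke_T_def)
qed

lemma hecke_induct:
 assumes "x : carrier H" "Q \<one>_H"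
  and "!!x y. x : carrier H ==> y : carrier H ==> Q x ==> Q y ==> Q (x \<oplus>_H y)"
  and "!!c x. x : carrier H ==> Q x ==> Q (c \<odot>_H x)"
  and "!!i x. i : {1..k} ==> x : carrier H ==> Q x ==> Q (T i \<otimes>_H x)"
 shows "Q x"
 using Pr.presented_induct[of x Q] assms unfolding H_eq hecke_T_def by blast

definition hw :: "nat list => (nat list => complex) set" where
 "hw w = word_eval H T w"

lemma hw_closed [simp, intro]: "set w <= {1..k} ==> hw w : carrier H"
 unfolding hw_def by (rule H.word_eval_closed) auto

lemma hw_simps: "hw [] = \<one>_H" "hw (i # w) = T i \<otimes>_H hw w"
 by (simp_all add: hw_def)

lemma hw_append: "set u <= {1..k} ==> set w <= {1..k} ==> hw (u @ w) = hw u \<otimes>_H hw w"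
 unfolding hw_def by (rule H.word_eval_append) auto

lemma hw_single: "i : {1..k} ==> hw [i] = T i"
 by (simp add: hw_simps)

lemma words_span: "carrier H = lspan H (hw ` lists {1..k})"
proof
 have sub: "hw ` lists {1..k} <= carrier H" by auto
 have s: "VectorSpace.subspace Cx (lspan H (hw ` lists {1..k})) H" by (rule H.subspace_lspan[OF sub])
 show "lspan H (hw ` lists {1..k}) <= carrier H" by (rule H.lspan_carrier[OF sub])
 have mult: "T i \<otimes>_H x : lspan H (hw ` lists {1..k})"
  if i: "i : {1..k}" and x: "x : lspan H (hw ` lists {1..k})" for i x
 proof -
  have "VectorSpace.subspace Cx {x : carrier H. T i \<otimes>_H x : lspan H (hw ` lists {1..k})} H"
   using s i unfolding H.subspace_iff by (auto simp: H.r_distr H.mult_smult)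
  moreover have "T i \<otimes>_H hw w : lspan H (hw ` lists {1..k})" if "w : lists {1..k}" for w
   using H.lspan_incl[of "hw ` lists {1..k}"] i that hw_simps(2)[of i w] by force
  hence "hw ` lists {1..k} <= {x : carrier H. T i \<otimes>_H x : lspan H (hw ` lists {1..k})}" by auto
  ultimately have "lspan H (hw ` lists {1..k}) <= {x : carrier H. T i \<otimes>_H x : lspan H (hw ` lists {1..k})}"
   by (rule H.lspan_least)
  thus ?thesis using x by blast
 qed
 have one: "\<one>_H : lspan H (hw ` lists {1..k})"
  using H.lspan_incl[of "hw ` lists {1..k}"] hw_simps(1) by force
 show "carrier H <= lspan H (hw ` lists {1..k})"
 proof
  fix x assume "x : carrier H"
  thus "x : lspan H (hw ` lists {1..k})"
   by (rule hecke_induct) (use one mult s in \<open>auto simp: H.subspace_iff\<close>)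
 qed
qed

end

section \<open>The action on words\<close>

definition swp :: "nat => nat list => nat list" where
 "swp i w = w[i - 1 := w ! i, i := w ! (i - 1)]"

text \<open>The action of \<open>T\<^sub>i\<close> on functions of words, that is, on the dual of the
  \<open>(k+1)\<close>-st tensor power of an \<open>r\<close>-dimensional space; it involves the letters
  in positions \<open>i\<close> and \<open>i+1\<close> (counted from 1).\<close>

definition hop :: "complex => nat => (nat list => complex) => nat list => complex" where
 "hop q i F w = (let a = w ! (i - 1); b = w ! i in
   if a = b then q * F w else if a < b then q * F (swp i w) else (q - 1) * F w + F (swp i w))"

definition hops :: "complex => nat list => (nat list => complex) => nat list => complex" where
 "hops q is F = foldr (hop q) is F"

lemma hops_simps [simp]: "hops q [] F = F" "hops q (i # is) F = hop q i (hops q is F)"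
 and hops_append: "hops q (is @ js) F = hops q is (hops q js F)"
 by (simp_all add: hops_def)

lemma swp_split: "swp (Suc (length xs)) (xs @ a # b # ys) = xs @ b # a # ys"
 by (simp add: swp_def list_update_append nth_append)

lemma hop_split: "hop q (Suc (length xs)) F (xs @ a # b # ys) =
  (if a = b then q * F (xs @ a # b # ys) else if a < b then q * F (xs @ b # a # ys)
   else (q - 1) * F (xs @ a # b # ys) + F (xs @ b # a # ys))"
 by (simp add: hop_def swp_split nth_append)

lemma hop_split2: "hop q (Suc (Suc (length xs))) F (xs @ a # b # c # ys) =
  (if b = c then q * F (xs @ a # b # c # ys) else if b < c then q * F (xs @ a # c # b # ys)
   else (q - 1) * F (xs @ a # b # c # ys) + F (xs @ a # c # b # ys))"
 using hop_split[of q "xs @ [a]" F b c ys] by simp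

lemma list_split2:
 assumes "1 <= i" "i < length w"
 obtains xs a b ys where "w = xs @ a # b # ys" "i = Suc (length xs)"
proof -
 have "w = take (i - 1) w @ w ! (i - 1) # w ! i # drop (Suc i) w"
  using assms by (metis Cons_nth_drop_Suc Suc_diff_1 append_take_drop_id less_eq_Suc_le
    less_imp_diff_less not_less_eq_eq One_nat_def Suc_pred)
 moreover have "i = Suc (length (take (i - 1) w))" using assms by simp
 ultimately show thesis using that by blast
qed

lemma hop_quadratic:
 assumes "1 <= i" "i < length w"
 shows "hop q i (hop q i F) w = (q - 1) * hop q i F w + q * F w"
proof -
 obtain xs a b ys where w: "w = xs @ a # b # ys" "i = Suc (length xs)" using list_split2[OF assms] .
 show ?thesis unfolding w by (auto simp: hop_split algebra_simps)
qed

lemma hop_braid: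
 assumes "1 <= i" "Suc i < length w"
 shows "hop q i (hop q (Suc i) (hop q i F)) w = hop q (Suc i) (hop q i (hop q (Suc i) F)) w"
proof -
 have "1 <= i" "i < length w" using assms by auto
 then obtain xs a b ys' where w: "w = xs @ a # b # ys'" "i = Suc (length xs)" by (rule list_split2)
 then obtain c ys where ys: "ys' = c # ys" using assms by (cases ys') auto
 show ?thesis unfolding w ys
  by (cases a b rule: linorder_cases; cases b c rule: linorder_cases; cases a c rule: linorder_cases)
    (simp_all add: hop_split hop_split2 algebra_simps)
qed

lemma hop_commute:
 assumes "1 <= i" "i + 2 <= j" "j < length w"
 shows "hop q i (hop q j F) w = hop q j (hop q i F) w"
proof -
 have "1 <= i" "i < length w" using assms by auto
 then obtain xs a b zs where w: "w = xs @ a # b # zs" "i = Suc (length xs)" by (rule list_split2)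
 have "1 <= j - i - 1" "j - i - 1 < length zs" using assms w by auto
 then obtain ys c d us where zs: "zs = ys @ c # d # us" "j - i - 1 = Suc (length ys)" by (rule list_split2)
 have j: "j = Suc (length (xs @ a # b # ys))" using zs(2) w(2) assms by simp
 have j1: "hop q j G (xs @ x # y # ys @ c # d # us) =
  (if c = d then q * G (xs @ x # y # ys @ c # d # us) else if c < d then q * G (xs @ x # y # ys @ d # c # us)
   else (q - 1) * G (xs @ x # y # ys @ c # d # us) + G (xs @ x # y # ys @ d # c # us))" for G x y c d
  using hop_split[of q "xs @ x # y # ys" G c d us] j by simp
 show ?thesis unfolding w zs(1)
  by (simp only: j1 hop_split) (simp add: algebra_simps)
qed

definition words :: "nat => nat => nat list set" where
 "words n r = {w. length w = n & set w <= {..<r}}"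

lemma finite_words: "finite (words n r)"
 using finite_lists_length_eq[of "{..<r}" n] by (simp add: words_def conj_commute)

lemma swp_words:
 assumes "1 <= i" "i < length w"
 shows "swp i w : words n r \<longleftrightarrow> w : words n r"
proof -
 obtain xs a b ys where w: "w = xs @ a # b # ys" "i = Suc (length xs)" using list_split2[OF assms] .
 show ?thesis unfolding w by (auto simp: swp_split words_def)
qed

lemma swp_length [simp]: "length (swp i w) = length w"
 by (simp add: swp_def)

lemma word_functions: "finite W ==> F : carrier (free_space W) \<longleftrightarrow> (ALL w. w ~: W --> F w = 0)"
 by (auto simp: free_space_simps intro: finite_subset)

lemma hop_closed:
 assumes "1 <= i" "i < n" "F : carrier (free_space (words n r))"
 shows "hop q i F : carrier (free_space (words n r))"
proof -
 have z: "F w = 0" if "w ~: words n r" for w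
  using assms(3) that by (simp add: word_functions finite_words)
 have "hop q i F w = 0" if w: "w ~: words n r" for w
 proof -
  have "swp i w ~: words n r"
  proof (cases "length w = n")
   case True
   thus ?thesis using swp_words[of i w n r] assms w by auto
  qed (simp add: words_def)
  thus ?thesis using w z by (simp add: hop_def Let_def)
 qed
 thus ?thesis by (simp add: word_functions finite_words)
qed

lemma hop_linear: "hop q i (%w. F w + G w) w = hop q i F w + hop q i G w"
 "hop q i (%w. c * F w) w = c * hop q i F w" "hop q i (%_. 0) w = 0"
 by (auto simp: hop_def Let_def algebra_simps)

context hecke
begin

lemma word_rep_exists:
 "\<exists>\<theta>. arep H (free_space (words (Suc k) r)) \<theta> \<and>
   (\<forall>i\<in>{1..k}. \<forall>F\<in>carrier (free_space (words (Suc k) r)). \<theta> (T i) F = hop q i F)"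
proof -
 let ?M = "free_space (words (Suc k) r)"
 interpret M: cspace ?M by (rule cspace_free)
 interpret E: calg "End_alg ?M" by (rule M.calg_End)
 define t where "t i = restrict (hop q i) (carrier ?M)" for i
 have cl: "hop q i F : carrier ?M" if "i : {1..k}" "F : carrier ?M" for i F
  using hop_closed[of i "Suc k" F r q] that by auto
 have t: "t i : carrier (End_alg ?M)" if i: "i : {1..k}" for i
  using i cl M.a_closed M.smult_closed
  by (auto simp: End_carrier_iff t_def hop_linear fun_eq_iff free_space_simps(2-))
 have tF: "t i F = hop q i F" if "F : carrier ?M" for i F using that by (simp add: t_def)
 have fe: "F = G" if "F : carrier ?M" "G : carrier ?M" "!!w. length w = Suc k ==> F w = G w" for F G
 proof
  fix w show "F w = G w"
  proof (cases "length w = Suc k")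
   case False
   hence "w ~: words (Suc k) r" by (auto simp: words_def)
   thus ?thesis using that by (simp add: word_functions finite_words)
  qed (use that in auto)
 qed
 obtain h where h: "h : algebra_hom H (End_alg ?M)" "!!i. i : {1..k} ==> h (T i) = t i"
 proof (rule hecke_hom_exists[OF M.calg_End t])
  fix i assume i: "i : {1..k}"
  show "t i \<otimes>_(End_alg ?M) t i = (q - 1) \<odot>_(End_alg ?M) t i \<oplus>_(End_alg ?M) q \<odot>_(End_alg ?M) \<one>_(End_alg ?M)"
  proof (rule End_eqI[of _ ?M])
   fix F assume F: "F : carrier ?M"
   have c: "hop q i F : carrier ?M" by (rule cl[OF i F])
   have "hop q i (hop q i F) = ((q - 1) \<odot>_?M hop q i F \<oplus>_?M q \<odot>_?M F)"
   proof (rule fe)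
    show "hop q i (hop q i F) : carrier ?M" by (rule cl[OF i c])
    show "(q - 1) \<odot>_?M hop q i F \<oplus>_?M q \<odot>_?M F : carrier ?M"
     by (rule M.a_closed[OF M.smult_closed[OF c] M.smult_closed[OF F]])
    show "hop q i (hop q i F) w = ((q - 1) \<odot>_?M hop q i F \<oplus>_?M q \<odot>_?M F) w"
     if "length w = Suc k" for w
     using hop_quadratic[of i w q F] that i by (simp add: free_space_simps(2-))
   qed
   thus "(t i \<otimes>_(End_alg ?M) t i) F = ((q - 1) \<odot>_(End_alg ?M) t i \<oplus>_(End_alg ?M) q \<odot>_(End_alg ?M) \<one>_(End_alg ?M)) F"
    using F c by (simp add: compose_def tF)
  qed (use t[OF i] E.one_closed in \<open>auto intro!: E.m_closed E.a_closed E.smult_closed simp del: End_alg_simps\<close>)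
 next
  fix i assume i: "i : {1..k}" "i + 1 : {1..k}"
  show "t i \<otimes>_(End_alg ?M) t (i + 1) \<otimes>_(End_alg ?M) t i = t (i + 1) \<otimes>_(End_alg ?M) t i \<otimes>_(End_alg ?M) t (i + 1)"
  proof (rule End_eqI[of _ ?M])
   fix F assume F: "F : carrier ?M"
   have "hop q i (hop q (i + 1) (hop q i F)) = hop q (i + 1) (hop q i (hop q (i + 1) F))"
    by (rule fe) (use i F cl hop_braid[of i _ q F, unfolded Suc_eq_plus1] in auto)
   thus "(t i \<otimes>_(End_alg ?M) t (i + 1) \<otimes>_(End_alg ?M) t i) F = (t (i + 1) \<otimes>_(End_alg ?M) t i \<otimes>_(End_alg ?M) t (i + 1)) F"
    using F i cl by (simp add: compose_def tF)
  qed (use t[OF i(1)] t[OF i(2)] in \<open>auto intro!: E.m_closed simp del: End_alg_simps\<close>)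
 next
  fix i j assume i: "i : {1..k}" "j : {1..k}" "i + 2 <= j"
  show "t i \<otimes>_(End_alg ?M) t j = t j \<otimes>_(End_alg ?M) t i"
  proof (rule End_eqI[of _ ?M])
   fix F assume F: "F : carrier ?M"
   have "hop q i (hop q j F) = hop q j (hop q i F)"
    by (rule fe) (use i F cl hop_commute[of i j _ q F] in auto)
   thus "(t i \<otimes>_(End_alg ?M) t j) F = (t j \<otimes>_(End_alg ?M) t i) F"
    using F i cl by (simp add: compose_def tF)
  qed (use t[OF i(1)] t[OF i(2)] in \<open>auto intro!: E.m_closed simp del: End_alg_simps\<close>)
 next
  fix h assume "h : algebra_hom H (End_alg ?M)" "!!i. i : {1..k} ==> h (T i) = t i"
  thus thesis by (rule that)
 qed
 have "arep H ?M h"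
  by (rule arep.intro[OF H.calg_axioms M.cspace_axioms], rule arep_axioms.intro, rule h(1))
 thus ?thesis using h(2) tF by auto
qed

definition \<theta> :: "nat => (nat list => complex) set => (nat list => complex) => nat list => complex" where
 "\<theta> r = (SOME \<theta>. arep H (free_space (words (Suc k) r)) \<theta> \<and>
   (\<forall>i\<in>{1..k}. \<forall>F\<in>carrier (free_space (words (Suc k) r)). \<theta> (T i) F = hop q i F))"

lemma arep_\<theta>: "arep H (free_space (words (Suc k) r)) (\<theta> r)"
 and \<theta>_T: "!!i F. i : {1..k} ==> F : carrier (free_space (words (Suc k) r)) ==> \<theta> r (T i) F = hop q i F"
 using someI_ex[OF word_rep_exists[of r]] unfolding \<theta>_def[symmetric] by auto

lemma \<theta>_hw:
 assumes "set u <= {1..k}" "F : carrier (free_space (words (Suc k) r))"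
 shows "\<theta> r (hw u) F = hops q u F"
 using assms(1)
proof (induction u)
 interpret R: arep H "free_space (words (Suc k) r)" "\<theta> r" by (rule arep_\<theta>)
 case Nil
 thus ?case using R.one_act[OF assms(2)] by (simp add: hw_simps)
next
 interpret R: arep H "free_space (words (Suc k) r)" "\<theta> r" by (rule arep_\<theta>)
 case (Cons i u)
 have hc: "hw u : carrier H" using Cons by auto
 have i: "i : {1..k}" using Cons by auto
 have "\<theta> r (hw (i # u)) F = \<theta> r (T i) (\<theta> r (hw u) F)"
  unfolding hw_simps by (rule R.mult_act) (use i hc assms in auto)
 also have "... = hop q i (hops q u F)"
  using Cons \<theta>_T[OF i R.act_closed[OF hc assms(2)]] by simp
 finally show ?case by simp
qed

end

section \<open>Traces on words\<close>

lemma hop_cong: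
 assumes "!!v. length v = length w ==> F v = G v"
 shows "hop q i F w = hop q i G w"
 using assms by (simp add: hop_def Let_def)

lemma hops_cong:
 assumes "!!v. length v = length w ==> F v = G v"
 shows "hops q is F w = hops q is G w"
 using assms
proof (induction "is" arbitrary: w)
 case (Cons i "is")
 thus ?case by (auto intro!: hop_cong)
qed simp

lemma hop_append:
 assumes "1 <= i" "i < length w"
 shows "hop q i F (w @ v) = hop q i (%u. F (u @ v)) w"
proof -
 obtain xs a b ys where w: "w = xs @ a # b # ys" "i = Suc (length xs)" using list_split2[OF assms] .
 show ?thesis using hop_split[of q xs F a b "ys @ v"] unfolding w by (simp add: hop_split)
qed

lemma hops_append_word:
 assumes "set is <= {1..<n}" "length w = n"
 shows "hops q is F (w @ v) = hops q is (%u. F (u @ v)) w"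
 using assms
proof (induction "is" arbitrary: w)
 case (Cons i "is")
 have "hops q (i # is) F (w @ v) = hop q i (%u. hops q is F (u @ v)) w"
  using Cons.prems by (simp add: hop_append)
 also have "... = hop q i (hops q is (%u. F (u @ v))) w"
  by (rule hop_cong) (use Cons in auto)
 finally show ?case by simp
qed simp

lemma hop_sum:
 "hop q i (%u. \<Sum>a\<in>S. c a * G a u) w = (\<Sum>a\<in>S. c a * hop q i (G a) w)"
 by (simp add: hop_def Let_def sum_distrib_left sum.distrib sum_subtractf algebra_simps)

lemma hops_sum: "hops q is (%u. \<Sum>a\<in>S. c a * G a u) w = (\<Sum>a\<in>S. c a * hops q is (G a) w)"
proof (induction "is" arbitrary: w)
 case (Cons i "is")
 have "hops q (i # is) (%u. \<Sum>a\<in>S. c a * G a u) w = hop q i (%u. \<Sum>a\<in>S. c a * hops q is (G a) u) w"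
  unfolding hops_simps by (rule hop_cong) (rule Cons.IH)
 thus ?case by (simp add: hop_sum)
qed simp

lemma hops_scale: "hops q is (%u. c * G u) w = c * hops q is G w"
 using hops_sum[of q "is" "%_. c" "%_. G" "{0 :: nat}" w] by simp

lemma hops_zero: "hops q is (%_. 0) w = 0"
 using hops_scale[of q "is" 0 "%_. 0" w] by simp

lemma hops_closed:
 assumes "set is <= {1..<n}" "F : carrier (free_space (words n r))"
 shows "hops q is F : carrier (free_space (words n r))"
 using assms by (induction "is") (auto intro!: hop_closed)

lemma single_snoc: "(%u. single (w @ [a]) (u @ [b])) = (if a = b then single w else (%_. 0))"
 by (auto simp: single_def fun_eq_iff)

lemma hops_single_snoc:
 assumes "set is <= {1..<n}" "length u = n"
 shows "hops q is (single (w @ [a])) (u @ [b]) = (if a = b then hops q is (single w) u else 0)"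
 using hops_append_word[OF assms, of q "single (w @ [a])" "[b]"] by (simp add: single_snoc hops_zero)

text \<open>The weights of the quantum trace.\<close>

definition wt :: "complex => nat => nat list => complex" where
 "wt q r w = (\<Prod>a\<leftarrow>w. q ^ (r - Suc a))"

definition q_int :: "complex => nat => complex" where
 "q_int q r = (\<Sum>a<r. q ^ a)"

definition word_trace :: "complex => nat => nat => nat list => complex" where
 "word_trace q n r is = (\<Sum>w\<in>words n r. wt q r w * hops q is (single w) w)"

lemma sum_words_snoc: "(\<Sum>w\<in>words (Suc n) r. g w) = (\<Sum>w\<in>words n r. \<Sum>a<r. g (w @ [a]))"
proof -
 have "words (Suc n) r = (%(w, a). w @ [a]) ` (words n r \<times> {..<r})"
 proof
  show "words (Suc n) r <= (%(w, a). w @ [a]) ` (words n r \<times> {..<r})"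
  proof
   fix w assume w: "w : words (Suc n) r"
   then obtain v a where "w = v @ [a]" by (auto simp: words_def length_Suc_conv_rev)
   thus "w : (%(w, a). w @ [a]) ` (words n r \<times> {..<r})" using w by (force simp: words_def)
  qed
 qed (auto simp: words_def)
 moreover have "inj_on (%(w, a). w @ [a]) (words n r \<times> {..<r})" by (auto simp: inj_on_def)
 ultimately show ?thesis by (simp add: sum.reindex sum.cartesian_product split_def)
qed

lemma wt_snoc: "wt q r (w @ [a]) = wt q r w * q ^ (r - Suc a)"
 by (simp add: wt_def)

lemma q_int_rev: "(\<Sum>a<r. q ^ (r - Suc a)) = q_int q r"
 unfolding q_int_def by (rule sum.nat_diff_reindex)

lemma word_trace_embed:
 assumes "set is <= {1..<n}"
 shows "word_trace q (Suc n) r is = q_int q r * word_trace q n r is"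
proof -
 have "word_trace q (Suc n) r is
   = (\<Sum>w\<in>words n r. \<Sum>a<r. wt q r w * q ^ (r - Suc a) * hops q is (single w) w)"
  unfolding word_trace_def sum_words_snoc
  by (intro sum.cong refl) (simp add: wt_snoc hops_single_snoc[OF assms] words_def)
 also have "... = q_int q r * word_trace q n r is"
  by (simp add: word_trace_def sum_distrib_left sum_distrib_right mult_ac flip: q_int_rev)
 finally show ?thesis .
qed

definition corner_coeff :: "complex => nat => nat => complex" where
 "corner_coeff q a c = (if c = a then q else if a < c then q - 1 else 0)"

lemma hop_last:
 assumes bs: "set bs <= {1..<n}" and u: "length u = n" "1 <= n"
 shows "hop q n (hops q bs (single (w @ [a]))) (u @ [a]) = corner_coeff q a (last u) * hops q bs (single w) u"
proof -
 obtain v c where v: "u = v @ [c]" using u by (cases u rule: rev_cases) auto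
 have n: "n = Suc (length v)" using u v by simp
 have a: "hops q bs (single (w @ [a])) (v @ [x, y]) = (if a = y then hops q bs (single w) (v @ [x]) else 0)" for x y
  using hops_single_snoc[OF bs, of "v @ [x]" q w a y] n by simp
 show ?thesis
  unfolding v using hop_split[of q v "hops q bs (single (w @ [a]))" c a "[]"] n
  by (simp add: a corner_coeff_def)
qed

lemma corner_sum_aux: "c <= r ==> (q - 1) * (\<Sum>a<c. q ^ (r - Suc a)) = q ^ r - q ^ (r - c)" for q :: complex
proof (induction c)
 case (Suc c)
 have "q ^ (r - c) = q * q ^ (r - Suc c)" using Suc.prems by (metis Suc_diff_Suc Suc_le_lessD power_Suc)
 thus ?case using Suc by (simp add: algebra_simps)
qed simp

lemma corner_sum:
 assumes "c < r"
 shows "(\<Sum>a<r. q ^ (r - Suc a) * corner_coeff q a c) = q ^ r"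
proof -
 have "(\<Sum>a<r. q ^ (r - Suc a) * corner_coeff q a c)
   = (\<Sum>a<r. (if a = c then q * q ^ (r - Suc c) else 0) + (if a : {..<c} then (q - 1) * q ^ (r - Suc a) else 0))"
  by (rule sum.cong) (auto simp: corner_coeff_def)
 also have "... = q * q ^ (r - Suc c) + (q - 1) * (\<Sum>a<c. q ^ (r - Suc a))"
 proof -
  have i: "{..<r} \<inter> {..<c} = {..<c}" using assms by auto
  have "(\<Sum>a<r. if a : {..<c} then (q - 1) * q ^ (r - Suc a) else 0) = (\<Sum>a<c. (q - 1) * q ^ (r - Suc a))"
   unfolding sum.inter_restrict[OF finite_lessThan, symmetric] i ..
  thus ?thesis using assms unfolding sum.distrib sum_distrib_left by simp
 qed
 also have "q * q ^ (r - Suc c) = q ^ (r - c)" using assms by (metis Suc_diff_Suc power_Suc)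
 finally show ?thesis using corner_sum_aux[of c r q] assms by simp
qed

text \<open>The Markov property: the weights are chosen such that the partial trace over the last letter
 turns \<open>T\<^sub>n\<close> into the scalar \<open>q\<^sup>r\<close>.\<close>

lemma word_trace_markov:
 assumes as: "set as <= {1..<n}" and bs: "set bs <= {1..<n}" and n: "1 <= n"
 shows "word_trace q (Suc n) r (as @ n # bs) = q ^ r * word_trace q n r (as @ bs)"
proof -
 have key: "(\<Sum>a<r. q ^ (r - Suc a) * hops q (as @ n # bs) (single (w @ [a])) (w @ [a]))
   = q ^ r * hops q (as @ bs) (single w) w" if w: "w : words n r" for w
 proof -
  let ?B = "hops q bs (single w)"
  have B: "?B : carrier (free_space (words n r))"
   by (rule hops_closed[OF bs]) (use w in \<open>simp add: single_in_free\<close>)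
  have lw: "length w = n" using w by (simp add: words_def)
  have "hops q (as @ n # bs) (single (w @ [a])) (w @ [a]) = hops q as (%u. corner_coeff q a (last u) * ?B u) w" for a
  proof -
   have "hops q (as @ n # bs) (single (w @ [a])) (w @ [a])
     = hops q as (%u. hop q n (hops q bs (single (w @ [a]))) (u @ [a])) w"
    by (simp add: hops_append hops_append_word[OF as lw])
   also have "... = hops q as (%u. corner_coeff q a (last u) * ?B u) w"
    by (rule hops_cong) (use hop_last[OF bs _ n] lw in auto)
   finally show ?thesis .
  qed
  hence "(\<Sum>a<r. q ^ (r - Suc a) * hops q (as @ n # bs) (single (w @ [a])) (w @ [a]))
    = hops q as (%u. \<Sum>a<r. q ^ (r - Suc a) * (corner_coeff q a (last u) * ?B u)) w"
   by (simp add: hops_sum)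
  also have "... = hops q as (%u. q ^ r * ?B u) w"
  proof (rule hops_cong)
   fix u :: "nat list" assume u: "length u = length w"
   have "(\<Sum>a<r. q ^ (r - Suc a) * (corner_coeff q a (last u) * ?B u))
     = (\<Sum>a<r. q ^ (r - Suc a) * corner_coeff q a (last u)) * ?B u"
    by (simp add: sum_distrib_right mult.assoc)
   also have "... = q ^ r * ?B u"
   proof (cases "u : words n r")
    case True
    have "u ~= []" using u lw n by auto
    hence "last u : set u" by (rule last_in_set)
    hence "last u < r" using True by (auto simp: words_def)
    thus ?thesis by (simp add: corner_sum)
   next
    case False
    hence "?B u = 0" using B by (simp add: word_functions finite_words)
    thus ?thesis by simp
   qed
   finally show "(\<Sum>a<r. q ^ (r - Suc a) * (corner_coeff q a (last u) * ?B u)) = q ^ r * ?B u" .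
  qed
  finally show ?thesis by (simp add: hops_scale hops_append)
 qed
 have "word_trace q (Suc n) r (as @ n # bs)
   = (\<Sum>w\<in>words n r. wt q r w * (\<Sum>a<r. q ^ (r - Suc a) * hops q (as @ n # bs) (single (w @ [a])) (w @ [a])))"
  unfolding word_trace_def sum_words_snoc
  by (simp add: wt_snoc sum_distrib_left mult.assoc)
 also have "... = q ^ r * word_trace q n r (as @ bs)"
  by (simp add: key word_trace_def sum_distrib_left mult_ac)
 finally show ?thesis .
qed

definition ident_coeff :: "complex => nat => nat list => complex" where
 "ident_coeff q n is = hops q is (single [0..<n]) [0..<n]"

lemma ident_coeff_embed:
 assumes "set is <= {1..<n}"
 shows "ident_coeff q (Suc n) is = ident_coeff q n is"
 using hops_single_snoc[OF assms, of "[0..<n]"] by (simp add: ident_coeff_def)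

lemma ident_coeff_markov:
 assumes as: "set as <= {1..<n}" and bs: "set bs <= {1..<n}" and n: "1 <= n"
 shows "ident_coeff q (Suc n) (as @ n # bs) = 0"
proof -
 let ?e = "[0..<n]"
 let ?B = "hops q bs (single ?e)"
 have B: "?B : carrier (free_space (words n n))"
  by (rule hops_closed[OF bs]) (auto intro!: single_in_free simp: words_def)
 have "ident_coeff q (Suc n) (as @ n # bs)
   = hops q as (%u. hop q n (hops q bs (single (?e @ [n]))) (u @ [n])) ?e"
  by (simp add: ident_coeff_def hops_append hops_append_word[OF as])
 also have "... = hops q as (%_. 0) ?e"
 proof (rule hops_cong)
  fix u :: "nat list" assume u: "length u = length ?e"
  show "hop q n (hops q bs (single (?e @ [n]))) (u @ [n]) = 0"
  proof (cases "u : words n n")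
   case True
   have "u ~= []" using u n by auto
   hence "last u : set u" by (rule last_in_set)
   hence "last u < n" using True by (auto simp: words_def)
   thus ?thesis using hop_last[OF bs _ n, of u q ?e n] u by (simp add: corner_coeff_def)
  next
   case False
   hence "?B u = 0" using B by (simp add: word_functions finite_words)
   thus ?thesis using hop_last[OF bs _ n, of u q ?e n] u by simp
  qed
 qed
 finally show ?thesis by (simp add: hops_zero)
qed

section \<open>Normal words in the Hecke algebra\<close>

lemma (in cspace) lspan_image_subset:
 assumes f: "lin_map V V f" and S: "S <= carrier V" and im: "f ` S <= lspan V S" and x: "x : lspan V S"
 shows "f x : lspan V S"
proof -
 interpret f: lin_map V V f by (rule f)
 have "VectorSpace.subspace Cx {x : carrier V. f x : lspan V S} V"
  using subspace_lspan[OF S] unfolding subspace_iff by auto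
 hence "lspan V S <= {x : carrier V. f x : lspan V S}"
  by (rule lspan_least) (use S im in auto)
 thus ?thesis using x by blast
qed

context hecke
begin

definition cw :: "nat => (nat list => complex) set" where
 "cw j = hw (rev [j..<Suc k])"

lemma cw_letters: "1 <= j ==> set (rev [j..<Suc k]) <= {1..k}"
 by auto

lemma cw_closed [simp, intro]: "1 <= j ==> cw j : carrier H"
 unfolding cw_def using cw_letters by blast

lemma cw_top: "cw (Suc k) = \<one>_H"
 by (simp add: cw_def hw_simps)

lemma cw_step:
 assumes "1 <= j" "j <= k"
 shows "cw j = cw (Suc j) \<otimes>_H T j"
proof -
 have "rev [j..<Suc k] = rev [Suc j..<Suc k] @ [j]"
  using assms by (simp add: upt_conv_Cons del: upt_Suc)
 moreover have "set (rev [Suc j..<Suc k]) <= {1..k}" "set [j] <= {1..k}" "j : {1..k}" using assms by auto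
 ultimately show ?thesis unfolding cw_def by (simp only: hw_append hw_single)
qed

lemma cw_commute:
 assumes "i + 2 <= j" "j <= Suc k" "1 <= i"
 shows "T i \<otimes>_H cw j = cw j \<otimes>_H T i"
 using assms(2,1)
proof (induction j rule: inc_induct)
 case base
 thus ?case using assms by (simp add: cw_top)
next
 case (step j)
 hence j: "j : {1..k}" "1 <= j" "j <= k" and i: "i : {1..k}" using assms by auto
 have c: "cw (Suc j) : carrier H" by auto
 have "T i \<otimes>_H cw j = (T i \<otimes>_H cw (Suc j)) \<otimes>_H T j"
  using i j c by (simp add: cw_step H.m_assoc)
 also have "... = cw (Suc j) \<otimes>_H (T i \<otimes>_H T j)" using step i j c by (simp add: H.m_assoc)
 also have "... = cw (Suc j) \<otimes>_H (T j \<otimes>_H T i)" using T_commute[OF i j(1)] step by simp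
 also have "... = cw j \<otimes>_H T i" using i j c by (simp add: cw_step H.m_assoc)
 finally show ?case .
qed

lemma cw_shift:
 assumes "1 <= j" "j < i" "i <= k"
 shows "cw j \<otimes>_H T i = T (i - 1) \<otimes>_H cw j"
proof -
 have "!!j. 1 <= j ==> i = Suc j + d ==> cw j \<otimes>_H T i = T (i - 1) \<otimes>_H cw j" for d
 proof (induction d)
  case 0
  hence j: "j : {1..k}" "j + 1 : {1..k}" "i = j + 1" "1 <= j" "j <= k" "Suc j <= k" using assms by auto
  have c: "cw (j + 2) : carrier H" by auto
  have cj: "cw j = cw (j + 2) \<otimes>_H (T (j + 1) \<otimes>_H T j)"
   using j(1,2,4,5,6) c cw_step[of j] cw_step[of "Suc j"] by (simp add: H.m_assoc flip: Suc_eq_plus1)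
  have "cw j \<otimes>_H T i = cw (j + 2) \<otimes>_H (T (j + 1) \<otimes>_H T j \<otimes>_H T (j + 1))"
   unfolding cj j(3) using j(1,2) c by (simp only: H.m_assoc T_closed H.m_closed)
  also have "... = cw (j + 2) \<otimes>_H (T j \<otimes>_H T (j + 1) \<otimes>_H T j)" by (simp only: T_braid[OF j(1,2)])
  also have "... = (cw (j + 2) \<otimes>_H T j) \<otimes>_H (T (j + 1) \<otimes>_H T j)"
   using j(1,2) c by (simp only: H.m_assoc T_closed H.m_closed)
  also have "cw (j + 2) \<otimes>_H T j = T j \<otimes>_H cw (j + 2)" using cw_commute[of j "j + 2"] j by simp
  also have "(T j \<otimes>_H cw (j + 2)) \<otimes>_H (T (j + 1) \<otimes>_H T j) = T j \<otimes>_H cw j"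
   unfolding cj using j(1,2) c by (simp only: H.m_assoc T_closed H.m_closed)
  finally show ?case using j(3) by simp
 next
  case (Suc d)
  have j: "j : {1..k}" "1 <= j" "j <= k" and i: "i : {1..k}" "i - 1 : {1..k}" "j + 2 <= i" using assms Suc.prems by auto
  have c: "cw (Suc j) : carrier H" by auto
  have "cw j \<otimes>_H T i = cw (Suc j) \<otimes>_H (T j \<otimes>_H T i)"
   using i j c by (simp add: cw_step H.m_assoc)
  also have "T j \<otimes>_H T i = T i \<otimes>_H T j" using T_commute[OF j(1) i(1)] i by simp
  also have "cw (Suc j) \<otimes>_H (T i \<otimes>_H T j) = (cw (Suc j) \<otimes>_H T i) \<otimes>_H T j"
   using i j c by (simp add: H.m_assoc)
  also have "cw (Suc j) \<otimes>_H T i = T (i - 1) \<otimes>_H cw (Suc j)" by (rule Suc.IH) (use Suc.prems in auto)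
  also have "(T (i - 1) \<otimes>_H cw (Suc j)) \<otimes>_H T j = T (i - 1) \<otimes>_H cw j"
   using i j c by (simp add: cw_step H.m_assoc)
  finally show ?case .
 qed
 from this[of j "i - Suc j"] show ?thesis using assms by simp
qed

definition step_words :: "nat list set" where
 "step_words = {as @ rev [j..<Suc k] | as j. set as <= {1..<k} & j : {1..Suc k}}"

lemma letters_mono: "set as <= {1..<k} ==> set as <= {1..k}"
 by (erule subset_trans) auto

lemma step_words_letters: "w : step_words ==> set w <= {1..k}"
proof -
 assume "w : step_words"
 then obtain as j where w: "w = as @ rev [j..<Suc k]" "set as <= {1..<k}" "j : {1..Suc k}"
  unfolding step_words_def by (elim CollectE exE conjE)
 have "set (rev [j..<Suc k]) <= {1..k}" using w(3) by auto
 thus ?thesis using letters_mono[OF w(2)] unfolding w(1) set_append by (rule Un_least[rotated])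
qed

lemma hw_step_word: "set as <= {1..<k} ==> j : {1..Suc k} ==> hw (as @ rev [j..<Suc k]) = hw as \<otimes>_H cw j"
 unfolding cw_def by (rule hw_append[OF letters_mono]) auto

text \<open>Every element is a combination of products of a word in the first \<open>k - 1\<close>
  generators and a descending word \<open>T\<^sub>k T\<^bsub>k-1\<^esub> ... T\<^sub>j\<close>, because
  the braid and quadratic relations make the span of these products stable under left
  multiplication.\<close>

lemma step_words_span: "carrier H = lspan H (hw ` step_words)"
proof
 let ?S = "hw ` step_words"
 have S: "?S <= carrier H" using step_words_letters by auto
 show "lspan H ?S <= carrier H" by (rule H.lspan_carrier[OF S])
 have s: "VectorSpace.subspace Cx (lspan H ?S) H" by (rule H.subspace_lspan[OF S])
 have gen: "hw as \<otimes>_H cw j : lspan H ?S" if "set as <= {1..<k}" "j : {1..Suc k}" for as j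
 proof -
  have "as @ rev [j..<Suc k] : step_words"
   unfolding step_words_def by (intro CollectI exI[of _ as] exI[of _ j] conjI refl that)
  hence "hw (as @ rev [j..<Suc k]) : ?S" by (rule imageI)
  thus ?thesis unfolding hw_step_word[OF that] by (rule subsetD[OF H.lspan_incl])
 qed
 have mult: "x \<otimes>_H T i : lspan H ?S" if i: "i : {1..k}" and x: "x : lspan H ?S" for i x
 proof (rule H.lspan_image_subset[of "%x. x \<otimes>_H T i", OF _ S _ x])
  show "lin_map H H (%x. x \<otimes>_H T i)"
   using i by unfold_locales (auto simp: module_hom_Cx_iff H.l_distr H.smult_mult)
  show "(%x. x \<otimes>_H T i) ` ?S <= lspan H ?S"
  proof (clarify)
   fix w assume "w : step_words"
   then obtain as j where w: "w = as @ rev [j..<Suc k]" "set as <= {1..<k}" "j : {1..Suc k}"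
    unfolding step_words_def by (elim CollectE exE conjE)
   have ac: "hw as : carrier H" by (rule hw_closed[OF letters_mono[OF w(2)]])
   have cc: "cw j : carrier H" using w(3) by auto
   have ext: "set (as @ [b]) <= {1..<k}" if "b : {1..<k}" for b using w(2) that by auto
   have hext: "hw (as @ [b]) = hw as \<otimes>_H T b" if "b : {1..<k}" for b
    using hw_append[of as "[b]"] hw_single[of b] letters_mono[OF w(2)] that by auto
   have e: "hw w \<otimes>_H T i = hw as \<otimes>_H (cw j \<otimes>_H T i)"
    unfolding w(1) hw_step_word[OF w(2,3)] using ac cc i by (simp add: H.m_assoc)
   consider "i + 1 = j" | "i = j" | "i + 2 <= j" | "j < i" by linarith
   thus "hw w \<otimes>_H T i : lspan H ?S"
   proof cases
    case 1
    hence "j = Suc i" by simp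
    hence "cw j \<otimes>_H T i = cw i" using cw_step[of i] i by simp
    thus ?thesis unfolding e using gen[OF w(2), of i] i by simp
   next
    case 2
    have c: "cw (Suc i) : carrier H" by auto
    have "cw j \<otimes>_H T i = cw (Suc i) \<otimes>_H (T i \<otimes>_H T i)"
     using 2 i c cw_step[of i] by (simp add: H.m_assoc)
    also have "... = (q - 1) \<odot>_H cw i \<oplus>_H q \<odot>_H cw (Suc i)"
     using i c cw_step[of i] by (simp add: T_quadratic H.r_distr H.mult_smult)
    finally have "hw w \<otimes>_H T i = (q - 1) \<odot>_H (hw as \<otimes>_H cw i) \<oplus>_H q \<odot>_H (hw as \<otimes>_H cw (Suc i))"
     unfolding e using ac i c by (simp add: H.r_distr H.mult_smult)
    thus ?thesis using s gen[OF w(2), of i] gen[OF w(2), of "Suc i"] i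
     unfolding H.subspace_iff by auto
   next
    case 3
    hence b: "i : {1..<k}" using i w(3) by auto
    have "cw j \<otimes>_H T i = T i \<otimes>_H cw j" using cw_commute[of i j] 3 i w(3) by simp
    hence "hw w \<otimes>_H T i = hw (as @ [i]) \<otimes>_H cw j"
     unfolding e hext[OF b] using ac cc i by (simp add: H.m_assoc)
    thus ?thesis using gen[OF ext[OF b] w(3)] by simp
   next
    case 4
    hence b: "i - 1 : {1..<k}" "i - 1 : {1..k}" using i w(3) by auto
    have "cw j \<otimes>_H T i = T (i - 1) \<otimes>_H cw j" using cw_shift[of j i] 4 i w(3) by simp
    hence "hw w \<otimes>_H T i = hw (as @ [i - 1]) \<otimes>_H cw j"
     unfolding e hext[OF b(1)] using ac cc b by (simp add: H.m_assoc)
    thus ?thesis using gen[OF ext[OF b(1)] w(3)] by simp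
   qed
  qed
 qed
 have words: "hw w : lspan H ?S" if "set w <= {1..k}" for w
  using that
 proof (induction w rule: rev_induct)
  case Nil
  show ?case using gen[of "[]" "Suc k"] by (simp add: hw_simps cw_top)
 next
  case (snoc i w)
  hence "hw (w @ [i]) = hw w \<otimes>_H T i" using hw_append[of w "[i]"] by (simp add: hw_single)
  thus ?case using mult snoc by auto
 qed
 show "carrier H <= lspan H ?S"
  unfolding words_span by (rule H.lspan_least[OF s]) (use words in auto)
qed

end

text \<open>Words that send \<open>[0..k]\<close> to a permutation by length-increasing moves; the first
  component is a reduced word, the second the one-line notation of the permutation.\<close>

primrec nws :: "nat => (nat list \<times> nat list) set" where
 "nws 0 = {([], [0])}"
| "nws (Suc k) = (%((u, v), j). (u @ rev [j..<Suc (Suc k)], take (j - 1) v @ Suc k # drop (j - 1) v)) `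
   (nws k \<times> {1..Suc (Suc k)})"

lemma nws_props:
 "(u, v) : nws k ==> set u <= {1..k} & length v = Suc k & set v = {..k} & distinct v"
proof (induction k arbitrary: u v)
 case (Suc k)
 then obtain u' v' j where h: "(u', v') : nws k" "j : {1..Suc (Suc k)}"
  "u = u' @ rev [j..<Suc (Suc k)]" "v = take (j - 1) v' @ Suc k # drop (j - 1) v'" by auto
 have p: "set u' <= {1..k}" "length v' = Suc k" "set v' = {..k}" "distinct v'" using Suc.IH[OF h(1)] by auto
 define a b where "a = take (j - 1) v'" and "b = drop (j - 1) v'"
 have ab: "v' = a @ b" by (simp add: a_def b_def)
 have v: "v = a @ Suc k # b" unfolding h(4) a_def b_def by simp
 have sab: "set a \<union> set b = {..k}" using p(3) unfolding ab by simp
 have "set v = {..Suc k}" unfolding v atMost_Suc sab[symmetric] by auto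
 moreover have "length v = Suc (Suc k)" using p(2) unfolding ab v by simp
 moreover have "Suc k ~: set a \<union> set b" unfolding sab by simp
 hence "distinct v" using p(4) unfolding ab v by auto
 moreover have "set u <= {1..Suc k}" using p(1) h(2) unfolding h(3) by auto
 ultimately show ?case by blast
qed auto

lemma take_drop_insert_eq:
 assumes "take i v @ m # drop i v = take j v' @ m # drop j v'" "m ~: set v" "m ~: set v'"
  "i <= length v" "j <= length v'"
 shows "v = v' & i = j"
proof -
 have "m ~: set (take i v)" "m ~: set (take j v')" using assms by (auto dest: in_set_takeD)
 hence "take i v = take j v'" "drop i v = drop j v'"
  using assms(1) by (metis append_Cons_eq_iff assms(2,3) in_set_dropD)+
 thus ?thesis using assms(4,5) by (metis append_take_drop_id length_take min.absorb2)
qed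

lemma nws_map_inj: "inj_on (%((u, v), j). (u @ rev [j..<Suc (Suc k)], take (j - 1) v @ Suc k # drop (j - 1) v))
  (nws k \<times> {1..Suc (Suc k)})"
proof (rule inj_onI, clarsimp simp del: upt_Suc)
 fix u v j u' v' j'
 assume h: "(u, v) : nws k" "1 <= j" "j <= Suc (Suc k)" "(u', v') : nws k" "1 <= j'" "j' <= Suc (Suc k)"
  "u @ rev [j..<Suc (Suc k)] = u' @ rev [j'..<Suc (Suc k)]"
  "take (j - 1) v @ Suc k # drop (j - 1) v = take (j' - 1) v' @ Suc k # drop (j' - 1) v'"
 have "v = v' & j - 1 = j' - 1"
  by (rule take_drop_insert_eq[OF h(8)]) (use nws_props[OF h(1)] nws_props[OF h(4)] h in auto)
 moreover hence j: "j = j'" using h by linarith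
 moreover have "u = u'" using h(7) unfolding j by simp
 ultimately show "u = u' & v = v' & j = j'" by blast
qed

lemma nws_inj: "inj_on snd (nws k)"
proof (induction k)
 case (Suc k)
 show ?case
 proof (rule inj_onI)
  fix p p' assume p: "p : nws (Suc k)" "p' : nws (Suc k)" "snd p = snd p'"
  obtain u v j where h: "(u, v) : nws k" "j : {1..Suc (Suc k)}"
   "p = (u @ rev [j..<Suc (Suc k)], take (j - 1) v @ Suc k # drop (j - 1) v)" using p(1) by auto
  obtain u' v' j' where h': "(u', v') : nws k" "j' : {1..Suc (Suc k)}"
   "p' = (u' @ rev [j'..<Suc (Suc k)], take (j' - 1) v' @ Suc k # drop (j' - 1) v')" using p(2) by auto
  have v: "v = v' & j - 1 = j' - 1"
   by (rule take_drop_insert_eq[of _ _ "Suc k"])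
     (use p(3) h h' nws_props[OF h(1)] nws_props[OF h'(1)] in auto)
  have "(u, v) = (u', v')" by (rule inj_onD[OF Suc _ h(1) h'(1)]) (use v in simp)
  moreover have "j = j'" using v h(2) h'(2) by auto
  ultimately show "p = p'" using h h' by simp
 qed
qed simp

lemma nws_finite: "finite (nws k)"
 by (induction k) auto

lemma nws_card: "card (nws k) = fact (Suc k)"
proof (induction k)
 case (Suc k)
 have "card (nws (Suc k)) = card (nws k \<times> {1..Suc (Suc k)})"
  unfolding nws.simps by (rule card_image[OF nws_map_inj])
 thus ?case using Suc by (simp add: card_cartesian_product algebra_simps)
qed simp

lemma row_move:
 assumes "length v = n" "\<forall>x\<in>set v. x < m" "1 <= j" "j <= Suc n"
 shows "hops q (rev [j..<Suc n]) F (v @ [m]) = q ^ (Suc n - j) * F (take (j - 1) v @ m # drop (j - 1) v)"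
 using assms
proof (induction v arbitrary: n F rule: rev_induct)
 case Nil
 thus ?case by (simp add: One_nat_def)
next
 case (snoc x v)
 show ?case
 proof (cases "j = Suc n")
  case True
  thus ?thesis using snoc by simp
 next
  case False
  hence j: "j <= n" "1 <= j" using snoc by auto
  obtain n' where n: "n = Suc n'" "length v = n'" using snoc by auto
  have r: "rev [j..<Suc n] = n # rev [j..<n]" using j by simp
  have "hops q (rev [j..<Suc n]) F (v @ [x] @ [m]) = hop q n (hops q (rev [j..<n]) F) (v @ [x, m])"
   using r by simp
  also have "... = q * hops q (rev [j..<n]) F ((v @ [m]) @ [x])"
   using hop_split[of q v "hops q (rev [j..<n]) F" x m "[]"] n snoc.prems(2) by auto
  also have "... = q * hops q (rev [j..<n]) (%w. F (w @ [x])) (v @ [m])"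
   by (subst hops_append_word[where n = n]) (use n j in auto)
  also have "... = q * (q ^ (n - j) * F ((take (j - 1) v @ m # drop (j - 1) v) @ [x]))"
   using snoc.IH[of n' "%w. F (w @ [x])"] n j snoc.prems by simp
  also have "... = q ^ (Suc n - j) * F (take (j - 1) (v @ [x]) @ m # drop (j - 1) (v @ [x]))"
   using j n by (simp add: Suc_diff_le)
  finally show ?thesis by simp
 qed
qed

lemma hop_single_ascent:
 assumes "x < m" "length w = length v + 2 + length ys"
 shows "hop q (Suc (length v)) (single (v @ x # m # ys)) w = single (v @ m # x # ys) w"
proof -
 obtain xs a b zs where w: "w = xs @ a # b # zs" "Suc (length v) = Suc (length xs)"
 proof (rule list_split2)
  show "1 <= Suc (length v)" "Suc (length v) < length w" using assms by auto
 qed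
 thus ?thesis
  using assms hop_split[of q xs "single (v @ x # m # ys)" a b zs] by (auto simp: single_def)
qed

lemma column_move:
 assumes "length v = n" "\<forall>x\<in>set v. x < m" "1 <= j" "j <= Suc n" "length w = Suc n"
 shows "hops q [j..<Suc n] (single (v @ [m])) w = single (take (j - 1) v @ m # drop (j - 1) v) w"
 using assms
proof (induction v arbitrary: n w rule: rev_induct)
 case Nil
 thus ?case by (simp add: One_nat_def)
next
 case (snoc x v)
 show ?case
 proof (cases "j = Suc n")
  case True
  thus ?thesis using snoc by simp
 next
  case False
  hence j: "j <= n" "1 <= j" using snoc by auto
  obtain n' where n: "n = Suc n'" "length v = n'" using snoc by auto
  obtain w' b where w: "w = w' @ [b]" "length w' = n" using snoc.prems(5) by (auto simp: length_Suc_conv_rev)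
  have "hops q [j..<Suc n] (single ((v @ [x]) @ [m])) w
    = hops q [j..<n] (hop q n (single (v @ [x, m]))) w"
   using j by (simp add: hops_append)
  also have "... = hops q [j..<n] (single ((v @ [m]) @ [x])) w"
   by (rule hops_cong) (use hop_single_ascent[of x m _ v "[]"] n w snoc.prems(2) in auto)
  also have "... = (if x = b then hops q [j..<n] (single (v @ [m])) w' else 0)"
   unfolding w(1) by (rule hops_single_snoc[where n = n]) (use n j w in auto)
  also have "... = (if x = b then single (take (j - 1) v @ m # drop (j - 1) v) w' else 0)"
   using snoc.IH[of n' w'] n j w snoc.prems by simp
  also have "... = single (take (j - 1) (v @ [x]) @ m # drop (j - 1) (v @ [x])) w"
   unfolding w(1) using j n by (auto simp: single_def)
  finally show ?thesis by simp
 qed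
qed

text \<open>Along a reduced word every move exchanges an ascending pair, so only the branch of
  \<open>hop\<close> that permutes letters occurs and it collects one factor \<open>q\<close> per
  letter.\<close>

lemma nws_row: "(u, v) : nws k ==> hops q u F [0..<Suc k] = q ^ length u * F v"
proof (induction k arbitrary: u v F)
 case (Suc k)
 then obtain u' v' j where h: "(u', v') : nws k" "j : {1..Suc (Suc k)}"
  "u = u' @ rev [j..<Suc (Suc k)]" "v = take (j - 1) v' @ Suc k # drop (j - 1) v'" by auto
 have p: "set u' <= {1..<Suc k}" "length v' = Suc k" "\<forall>x\<in>set v'. x < Suc k" using nws_props[OF h(1)] by auto
 have "hops q u F [0..<Suc (Suc k)] = hops q u' (%w. hops q (rev [j..<Suc (Suc k)]) F (w @ [Suc k])) [0..<Suc k]"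
  unfolding h(3) using hops_append_word[OF p(1), of "[0..<Suc k]"] by (simp add: hops_append)
 also have "... = q ^ length u' * hops q (rev [j..<Suc (Suc k)]) F (v' @ [Suc k])" by (rule Suc.IH[OF h(1)])
 also have "... = q ^ length u' * (q ^ (Suc (Suc k) - j) * F v)"
  using row_move[OF p(2,3), of j q F] h by simp
 finally show ?case using h(3) by (simp add: power_add del: upt_Suc)
qed simp

text \<open>The same moves read backwards, starting from the function supported on the sorted
  word.\<close>

lemma nws_column:
 "(u, v) : nws k ==> length w = Suc k ==> hops q (rev u) (single [0..<Suc k]) w = single v w"
proof (induction k arbitrary: u v w)
 case (Suc k)
 then obtain u' v' j where h: "(u', v') : nws k" "j : {1..Suc (Suc k)}"
  "u = u' @ rev [j..<Suc (Suc k)]" "v = take (j - 1) v' @ Suc k # drop (j - 1) v'" by auto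
 have p: "set (rev u') <= {1..<Suc k}" "length v' = Suc k" "\<forall>x\<in>set v'. x < Suc k"
  using nws_props[OF h(1)] by auto
 have "hops q (rev u) (single [0..<Suc (Suc k)]) w
   = hops q [j..<Suc (Suc k)] (hops q (rev u') (single ([0..<Suc k] @ [Suc k]))) w"
  unfolding h(3) by (simp add: hops_append del: upt_Suc) (simp add: upt_Suc)
 also have "... = hops q [j..<Suc (Suc k)] (single (v' @ [Suc k])) w"
 proof (rule hops_cong)
  fix x :: "nat list" assume "length x = length w"
  then obtain y b where x: "x = y @ [b]" "length y = Suc k"
   using Suc.prems by (auto simp: length_Suc_conv_rev)
  show "hops q (rev u') (single ([0..<Suc k] @ [Suc k])) x = single (v' @ [Suc k]) x"
   unfolding x(1) hops_single_snoc[OF p(1) x(2)] using Suc.IH[OF h(1) x(2)] by (auto simp: single_def)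
 qed
 also have "... = single v w"
  unfolding h(4) by (rule column_move) (use p h Suc.prems in auto)
 finally show ?case .
qed simp

section \<open>The symmetrizing trace of the Hecke algebra\<close>

lemma free_space_finsum_eval:
 assumes "!!i. i : I ==> f i : carrier (free_space S)"
 shows "(\<Oplus>_(free_space S)i\<in>I. f i) s = (\<Sum>i\<in>I. f i s)"
proof -
 interpret M: cspace "free_space S" by (rule cspace_free)
 show ?thesis using assms
 proof (induction I rule: infinite_finite_induct)
  case (insert i I)
  hence "f : I \<rightarrow> carrier (free_space S)" "f i : carrier (free_space S)" by auto
  thus ?case using insert by (simp add: M.finsum_insert free_space_simps(2))
 qed (simp_all add: free_space_simps(3))
qed

context hecke
begin

text \<open>The quantum trace of \<open>x\<close> on the words over \<open>r\<close> letters.\<close>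

definition qtr :: "nat => (nat list => complex) set => complex" where
 "qtr r x = (\<Sum>w\<in>words (Suc k) r. wt q r w * \<theta> r x (single w) w)"

text \<open>The coefficient of the sorted word: the canonical symmetrizing trace, one on the identity and
  zero on every other basis element.\<close>

definition \<tau> :: "(nat list => complex) set => complex" where
 "\<tau> x = \<theta> (Suc k) x (single [0..<Suc k]) [0..<Suc k]"

lemma base_word: "[0..<Suc k] : words (Suc k) (Suc k)"
 by (auto simp: words_def)

lemma \<theta>_linear:
 assumes "F : carrier (free_space (words (Suc k) r))"
 shows "x : carrier H ==> y : carrier H ==> \<theta> r (x \<oplus>_H y) F w = \<theta> r x F w + \<theta> r y F w"
  and "x : carrier H ==> \<theta> r (c \<odot>_H x) F w = c * \<theta> r x F w"
  and "\<theta> r \<zero>_H F w = 0"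
proof -
 interpret R: arep H "free_space (words (Suc k) r)" "\<theta> r" by (rule arep_\<theta>)
 show "x : carrier H ==> y : carrier H ==> \<theta> r (x \<oplus>_H y) F w = \<theta> r x F w + \<theta> r y F w"
  unfolding R.add_act[OF _ _ assms] free_space_simps ..
 show "x : carrier H ==> \<theta> r (c \<odot>_H x) F w = c * \<theta> r x F w"
  unfolding R.smult_act[OF _ assms] free_space_simps ..
 show "\<theta> r \<zero>_H F w = 0"
  unfolding R.zero_act[OF assms] free_space_simps ..
qed

lemma qtr_linear: "x : carrier H ==> y : carrier H ==> qtr r (x \<oplus>_H y) = qtr r x + qtr r y"
 "x : carrier H ==> qtr r (c \<odot>_H x) = c * qtr r x"
 "qtr r \<zero>_H = 0"
 unfolding qtr_def sum_distrib_left sum.distrib[symmetric]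
 by (auto intro!: sum.cong sum.neutral simp: \<theta>_linear single_in_free algebra_simps)

lemma \<tau>_linear: "x : carrier H ==> y : carrier H ==> \<tau> (x \<oplus>_H y) = \<tau> x + \<tau> y"
 "x : carrier H ==> \<tau> (c \<odot>_H x) = c * \<tau> x"
 "\<tau> \<zero>_H = 0"
 unfolding \<tau>_def using \<theta>_linear[OF single_in_free[OF base_word]] by blast+

lemma qtr_hw: "set u <= {1..k} ==> qtr r (hw u) = word_trace q (Suc k) r u"
 unfolding qtr_def word_trace_def
 by (rule sum.cong[OF refl]) (simp add: \<theta>_hw single_in_free)

lemma \<tau>_hw: "set u <= {1..k} ==> \<tau> (hw u) = ident_coeff q (Suc k) u"
 unfolding \<tau>_def ident_coeff_def by (simp only: \<theta>_hw single_in_free base_word)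

text \<open>On the span of the words the condition is linear in \<open>x\<close>, which allows a proof on
  words. The points \<open>q\<^sup>r / [r]\<close> come from the Markov property, each application of
  which trades a factor \<open>[r]\<close> for \<open>q\<^sup>r\<close>.\<close>

definition trace_ok :: "(nat list => complex) set => bool" where
 "trace_ok x \<longleftrightarrow> (EX p. degree p <= k & coeff p 0 = \<tau> x \<and>
   (ALL r. q_int q r ~= 0 --> qtr r x = q_int q r ^ Suc k * poly p (q ^ r / q_int q r)))"

lemma trace_ok_span:
 assumes S: "S <= carrier H" "carrier H = lspan H S" and ok: "!!x. x : S ==> trace_ok x"
  and x: "x : carrier H"
 shows "trace_ok x"
proof -
 have "VectorSpace.subspace Cx {x : carrier H. trace_ok x} H"
  unfolding H.subspace_iff
 proof (intro conjI ballI allI)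
  show "\<zero>_H : {x : carrier H. trace_ok x}"
   by (auto simp: trace_ok_def qtr_linear \<tau>_linear intro!: exI[of _ 0])
 next
  fix x y assume "x : {x : carrier H. trace_ok x}" "y : {x : carrier H. trace_ok x}"
  hence xy: "x : carrier H" "y : carrier H" "trace_ok x" "trace_ok y" by auto
  obtain p where p: "degree p <= k" "coeff p 0 = \<tau> x"
   "!!r. q_int q r ~= 0 ==> qtr r x = q_int q r ^ Suc k * poly p (q ^ r / q_int q r)"
   using xy(3) by (auto simp: trace_ok_def)
  obtain p' where p': "degree p' <= k" "coeff p' 0 = \<tau> y"
   "!!r. q_int q r ~= 0 ==> qtr r y = q_int q r ^ Suc k * poly p' (q ^ r / q_int q r)"
   using xy(4) by (auto simp: trace_ok_def)
  have "trace_ok (x \<oplus>_H y)"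
   unfolding trace_ok_def
   by (rule exI[of _ "p + p'"])
     (use p p' xy(1,2) in \<open>simp add: degree_add_le qtr_linear \<tau>_linear distrib_left\<close>)
  thus "x \<oplus>_H y : {x : carrier H. trace_ok x}" using xy by simp
 next
  fix c x assume "x : {x : carrier H. trace_ok x}"
  hence x: "x : carrier H" "trace_ok x" by auto
  obtain p where p: "degree p <= k" "coeff p 0 = \<tau> x"
   "!!r. q_int q r ~= 0 ==> qtr r x = q_int q r ^ Suc k * poly p (q ^ r / q_int q r)"
   using x(2) by (auto simp: trace_ok_def)
  have "trace_ok (c \<odot>_H x)"
   unfolding trace_ok_def
   by (rule exI[of _ "Polynomial.smult c p"])
     (use p x in \<open>simp add: qtr_linear \<tau>_linear order.trans[OF degree_smult_le]\<close>)
  thus "c \<odot>_H x : {x : carrier H. trace_ok x}" using x by simp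
 qed auto
 hence "lspan H S <= {x : carrier H. trace_ok x}"
  by (rule H.lspan_least) (use S ok in auto)
 thus ?thesis using x S(2) by blast
qed

end

text \<open>Induction on \<open>k\<close> over normal words. One more letter position multiplies the
  trace of a word without the new generator by \<open>[r]\<close>. A single occurrence of the new
  generator contributes \<open>q\<^sup>r\<close> instead, which raises the degree by one and makes the
  constant term vanish, in agreement with \<open>\<tau>\<close>.\<close>

lemma trace_polynomial: "\<forall>x\<in>carrier (hecke_algebra q k). hecke.trace_ok q k x"
proof (induction k)
 case 0
 interpret H0: hecke q 0 .
 have l: "lists {1..0::nat} = {[]}" by (auto simp: One_nat_def)
 have ok: "H0.trace_ok (H0.hw [])"
 proof -
  have t: "word_trace q 1 r [] = q_int q r" for r
  proof -
   have "words 0 r = {[]}" by (auto simp: words_def)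
   thus ?thesis
    unfolding word_trace_def using sum_words_snoc[of "%w. wt q r w * hops q [] (single w) w" 0 r]
    by (simp add: wt_def single_def q_int_rev One_nat_def)
  qed
  have "ident_coeff q 1 [] = 1" by (simp add: ident_coeff_def single_def)
  thus ?thesis
   unfolding H0.trace_ok_def using t
   by (intro exI[of _ 1]) (simp add: H0.qtr_hw H0.\<tau>_hw One_nat_def)
 qed
 show ?case
 proof
  fix x assume x: "x : carrier H0.H"
  have S: "H0.hw ` lists {1..0} <= carrier H0.H"
   unfolding l using H0.hw_closed[of "[]"] by simp
  have o: "H0.trace_ok y" if "y : H0.hw ` lists {1..0}" for y
   using that ok unfolding l by simp
  show "H0.trace_ok x"
   by (rule H0.trace_ok_span[OF S H0.words_span o x])
 qed
next
 case (Suc k)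
 interpret H: hecke q k .
 interpret HS: hecke q "Suc k" .
 have word: "EX p. degree p <= k & coeff p 0 = ident_coeff q (Suc k) u \<and>
   (ALL r. q_int q r ~= 0 --> word_trace q (Suc k) r u = q_int q r ^ Suc k * poly p (q ^ r / q_int q r))"
  if "set u <= {1..k}" for u
  using Suc.IH[rule_format, OF H.hw_closed[OF that]] H.qtr_hw[OF that] H.\<tau>_hw[OF that]
  unfolding H.trace_ok_def by simp
 have step: "HS.trace_ok (HS.hw w)" if "w : HS.step_words" for w
 proof -
  from that obtain as j where w: "w = as @ rev [j..<Suc (Suc k)]" "set as <= {1..<Suc k}" "j : {1..Suc (Suc k)}"
   unfolding HS.step_words_def by (elim CollectE exE conjE)
  have wl: "set w <= {1..Suc k}" by (rule HS.step_words_letters[OF that])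
  have as: "set as <= {1..k}" using w(2) by auto
  show ?thesis
  proof (cases "j = Suc (Suc k)")
   case True
   hence wa: "w = as" using w by simp
   obtain p where p: "degree p <= k" "coeff p 0 = ident_coeff q (Suc k) as"
    "!!r. q_int q r ~= 0 ==> word_trace q (Suc k) r as = q_int q r ^ Suc k * poly p (q ^ r / q_int q r)"
    using word[OF as] by blast
   show ?thesis
    unfolding HS.trace_ok_def HS.qtr_hw[OF wl] HS.\<tau>_hw[OF wl] unfolding wa
    by (rule exI[of _ p])
      (use p in \<open>simp add: word_trace_embed[OF w(2)] ident_coeff_embed[OF w(2)]\<close>)
  next
   case False
   hence j: "1 <= j" "j <= Suc k" using w by auto
   let ?bs = "rev [j..<Suc k]"
   have bs: "set ?bs <= {1..<Suc k}" using j by auto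
   have wa: "w = as @ Suc k # ?bs" using w(1) j by simp
   have ab: "set (as @ ?bs) <= {1..k}" using as bs by auto
   obtain p where p: "degree p <= k"
    "!!r. q_int q r ~= 0 ==> word_trace q (Suc k) r (as @ ?bs) = q_int q r ^ Suc k * poly p (q ^ r / q_int q r)"
    using word[OF ab] by blast
   have n: "1 <= Suc k" by simp
   show ?thesis
    unfolding HS.trace_ok_def HS.qtr_hw[OF wl] HS.\<tau>_hw[OF wl]
    unfolding wa word_trace_markov[OF w(2) bs n] ident_coeff_markov[OF w(2) bs n]
   proof (rule exI[of _ "pCons 0 p"], intro conjI allI impI)
    show "degree (pCons 0 p) <= Suc k" using p(1) by (simp add: degree_pCons_le order.trans[OF degree_pCons_le])
    show "coeff (pCons 0 p) 0 = 0" by simp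
    fix r assume r: "q_int q r ~= 0"
    show "q ^ r * word_trace q (Suc k) r (as @ ?bs)
      = q_int q r ^ Suc (Suc k) * poly (pCons 0 p) (q ^ r / q_int q r)"
     using p(2)[OF r] r by simp
   qed
  qed
 qed
 show ?case
 proof
  fix x assume x: "x : carrier HS.H"
  have S: "HS.hw ` HS.step_words <= carrier HS.H"
   by (rule image_subsetI, rule HS.hw_closed, erule HS.step_words_letters)
  have o: "HS.trace_ok y" if "y : HS.hw ` HS.step_words" for y
   using that by (elim imageE) (simp add: step)
  show "HS.trace_ok x"
   by (rule HS.trace_ok_span[OF S HS.step_words_span o x])
 qed
qed

lemma q_int_add: "q_int q (a + b) = q_int q a + q ^ a * q_int q b"
 by (induction b) (simp_all add: q_int_def algebra_simps power_add)

text \<open>The nodes \<open>q\<^sup>r / [r]\<close> for \<open>r = 1, ..., k + 1\<close> are distinct, so the traces determine \<open>\<tau>\<close>.\<close>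

lemma (in hecke) \<tau>_eq_0:
 assumes q: "q ~= 0" and nz: "!!r. r : {1..Suc k} ==> q_int q r ~= 0"
  and x: "x : carrier H" and tr: "!!r. qtr r x = 0"
 shows "\<tau> x = 0"
proof -
 obtain p where p: "degree p <= k" "coeff p 0 = \<tau> x"
  "!!r. q_int q r ~= 0 ==> qtr r x = q_int q r ^ Suc k * poly p (q ^ r / q_int q r)"
  using trace_polynomial[rule_format, OF x] unfolding trace_ok_def by blast
 define z where "z r = q ^ r / q_int q r" for r
 have lt: "z r ~= z s" if "r : {1..Suc k}" "s : {1..Suc k}" "r < s" for r s
 proof
  assume "z r = z s"
  hence e1: "q ^ r * q_int q s = q ^ s * q_int q r"
   using nz[OF that(1)] nz[OF that(2)] by (simp add: z_def field_simps)
  have e2: "q_int q s = q_int q (s - r) + q ^ (s - r) * q_int q r"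
   using q_int_add[of q "s - r" r] that by simp
  have e3: "q ^ r * q ^ (s - r) = q ^ s" using that by (simp flip: power_add)
  have "q ^ r * q_int q (s - r) + q ^ s * q_int q r = q ^ r * q_int q s"
   unfolding e2 by (simp only: distrib_left mult.assoc[symmetric] e3)
  hence "q ^ r * q_int q (s - r) = 0" using e1 by simp
  moreover have "q_int q (s - r) ~= 0" by (rule nz) (use that in auto)
  ultimately show False using q by simp
 qed
 have "inj_on z {1..Suc k}"
 proof (rule inj_onI, rule ccontr)
  fix r s assume "r : {1..Suc k}" "s : {1..Suc k}" "z r = z s" "r ~= s"
  thus False using lt[of r s] lt[of s r] by (cases "r < s") auto
 qed
 hence "card (z ` {1..Suc k}) = Suc k" by (simp add: card_image)
 moreover have "z ` {1..Suc k} <= {y. poly p y = 0}"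
 proof (clarify)
  fix r assume "r : {1..Suc k}"
  from nz[OF this] show "poly p (z r) = 0" using p(3)[of r] tr[of r] by (simp add: z_def)
 qed
 ultimately have "p = 0"
  using card_poly_roots_bound[of p] poly_roots_finite[of p] card_mono[of "{y. poly p y = 0}" "z ` {1..Suc k}"] p(1)
  by (cases "p = 0") auto
 thus ?thesis using p(2) by simp
qed

context hecke
begin

lemma wt_swp:
 assumes "1 <= i" "i < length w"
 shows "wt q r (swp i w) = wt q r w"
proof -
 obtain xs a b ys where w: "w = xs @ a # b # ys" "i = Suc (length xs)" using list_split2[OF assms] .
 show ?thesis unfolding w swp_split by (simp add: wt_def mult_ac)
qed

definition weigh :: "nat => (nat list => complex) => nat list => complex" where
 "weigh r F w = wt q r w * F w"

lemma weigh_closed: "F : carrier (free_space (words (Suc k) r)) ==> weigh r F : carrier (free_space (words (Suc k) r))"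
 by (simp add: word_functions finite_words weigh_def)

text \<open>A generator permutes two letters of a word, and the weight is symmetric in the
  letters.\<close>

lemma weigh_commute:
 assumes x: "x : carrier H" and F: "F : carrier (free_space (words (Suc k) r))"
 shows "\<theta> r x (weigh r F) = weigh r (\<theta> r x F)"
proof -
 interpret R: arep H "free_space (words (Suc k) r)" "\<theta> r" by (rule arep_\<theta>)
 have "\<forall>F\<in>carrier (free_space (words (Suc k) r)). \<theta> r x (weigh r F) = weigh r (\<theta> r x F)"
  using x
 proof (rule hecke_induct)
  show "\<forall>F\<in>carrier (free_space (words (Suc k) r)). \<theta> r \<one>_H (weigh r F) = weigh r (\<theta> r \<one>_H F)"
   by (auto simp only: R.one_act weigh_closed)
 next
  fix x y assume xy: "x : carrier H" "y : carrier H"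
   "\<forall>F\<in>carrier (free_space (words (Suc k) r)). \<theta> r x (weigh r F) = weigh r (\<theta> r x F)"
   "\<forall>F\<in>carrier (free_space (words (Suc k) r)). \<theta> r y (weigh r F) = weigh r (\<theta> r y F)"
  show "\<forall>F\<in>carrier (free_space (words (Suc k) r)). \<theta> r (x \<oplus>_H y) (weigh r F) = weigh r (\<theta> r (x \<oplus>_H y) F)"
  proof
   fix F assume F: "F : carrier (free_space (words (Suc k) r))"
   show "\<theta> r (x \<oplus>_H y) (weigh r F) = weigh r (\<theta> r (x \<oplus>_H y) F)"
    unfolding R.add_act[OF xy(1,2) F] R.add_act[OF xy(1,2) weigh_closed[OF F]]
    using xy(3,4) F by (simp add: weigh_def free_space_simps(2) fun_eq_iff algebra_simps)
  qed
 next
  fix c x assume x: "x : carrier H" "\<forall>F\<in>carrier (free_space (words (Suc k) r)). \<theta> r x (weigh r F) = weigh r (\<theta> r x F)"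
  show "\<forall>F\<in>carrier (free_space (words (Suc k) r)). \<theta> r (c \<odot>_H x) (weigh r F) = weigh r (\<theta> r (c \<odot>_H x) F)"
  proof
   fix F assume F: "F : carrier (free_space (words (Suc k) r))"
   show "\<theta> r (c \<odot>_H x) (weigh r F) = weigh r (\<theta> r (c \<odot>_H x) F)"
    unfolding R.smult_act[OF x(1) F] R.smult_act[OF x(1) weigh_closed[OF F]]
    using x(2) F by (simp add: weigh_def free_space_simps(4) fun_eq_iff algebra_simps)
  qed
 next
  fix i x assume i: "i : {1..k}" and x: "x : carrier H" "\<forall>F\<in>carrier (free_space (words (Suc k) r)). \<theta> r x (weigh r F) = weigh r (\<theta> r x F)"
  have hop: "hop q i (weigh r G) = weigh r (hop q i G)" if G: "G : carrier (free_space (words (Suc k) r))" for G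
  proof
   fix w
   show "hop q i (weigh r G) w = weigh r (hop q i G) w"
   proof (cases "length w = Suc k")
    case True
    thus ?thesis using wt_swp[of i w r] i by (simp add: hop_def Let_def weigh_def algebra_simps)
   next
    case False
    hence "w ~: words (Suc k) r" by (simp add: words_def)
    moreover have "hop q i (weigh r G) : carrier (free_space (words (Suc k) r))"
     "weigh r (hop q i G) : carrier (free_space (words (Suc k) r))"
     using i G by (auto intro!: hop_closed weigh_closed)
    ultimately show ?thesis by (simp add: word_functions finite_words)
   qed
  qed
  show "\<forall>F\<in>carrier (free_space (words (Suc k) r)). \<theta> r (T i \<otimes>_H x) (weigh r F) = weigh r (\<theta> r (T i \<otimes>_H x) F)"
  proof
   fix F assume F: "F : carrier (free_space (words (Suc k) r))"
   have xF: "\<theta> r x F : carrier (free_space (words (Suc k) r))" by (rule R.act_closed[OF x(1) F])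
   show "\<theta> r (T i \<otimes>_H x) (weigh r F) = weigh r (\<theta> r (T i \<otimes>_H x) F)"
    unfolding R.mult_act[OF T_closed[OF i] x(1) F] R.mult_act[OF T_closed[OF i] x(1) weigh_closed[OF F]]
     bspec[OF x(2) F] \<theta>_T[OF i xF] \<theta>_T[OF i weigh_closed[OF xF]] by (rule hop[OF xF])
  qed
 qed
 thus ?thesis using F by blast
qed

text \<open>The weight commutes with the action, so the weighted endomorphism has square zero as well and
  the quantum trace is its ordinary trace.\<close>

lemma qtr_square_zero:
 assumes x: "x : carrier H" and sq: "x \<otimes>_H x = \<zero>_H"
 shows "qtr r x = 0"
proof -
 let ?M = "free_space (words (Suc k) r)"
 interpret R: arep H ?M "\<theta> r" by (rule arep_\<theta>)
 let ?f = "%F. \<theta> r x (weigh r F)"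
 have "lin_map ?M ?M ?f"
 proof -
  have "weigh r (F \<oplus>_?M G) = weigh r F \<oplus>_?M weigh r G" "weigh r (c \<odot>_?M F) = c \<odot>_?M weigh r F" for F G c
   by (simp_all add: weigh_def fun_eq_iff free_space_simps(2,4) algebra_simps)
  thus ?thesis
   using R.V.cspace_axioms x weigh_closed
   by (simp add: lin_map_def lin_map_axioms_def module_hom_Cx_iff R.act_add R.act_smult)
 qed
 moreover have "?f (?f F) = (%_. 0)" if F: "F : carrier ?M" for F
 proof -
  have w: "weigh r F : carrier ?M" by (rule weigh_closed[OF F])
  have ww: "weigh r (weigh r F) : carrier ?M" by (rule weigh_closed[OF w])
  have "?f (?f F) = \<theta> r x (\<theta> r x (weigh r (weigh r F)))" unfolding weigh_commute[OF x w] ..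
  also have "... = \<theta> r (x \<otimes>_H x) (weigh r (weigh r F))" by (rule R.mult_act[OF x x ww, symmetric])
  also have "... = (%_. 0)" unfolding sq R.zero_act[OF ww] by (simp add: free_space_simps)
  finally show ?thesis .
 qed
 ultimately have "(\<Sum>w\<in>words (Suc k) r. ?f (single w) w) = 0"
  by (rule square_zero_trace[OF finite_words])
 moreover have "?f (single w) w = wt q r w * \<theta> r x (single w) w" if "w : words (Suc k) r" for w
  using weigh_commute[OF x single_in_free[OF that]] by (simp add: weigh_def)
 ultimately show ?thesis by (simp add: qtr_def)
qed

end

text \<open>Normal words of one algebra followed by descending words are the normal words of the
  next.\<close>

lemma nws_span: "carrier (hecke_algebra q k) = lspan (hecke_algebra q k) (hecke.hw q k ` fst ` nws k)"
proof (induction k)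
 case 0
 interpret H0: hecke q 0 .
 have "lists {1..0::nat} = {[]}" by (auto simp: One_nat_def)
 thus ?case using H0.words_span by simp
next
 case (Suc k)
 interpret H: hecke q k .
 interpret HS: hecke q "Suc k" .
 let ?G = "HS.hw ` fst ` nws (Suc k)"
 have G: "?G <= carrier HS.H"
 proof (clarify)
  fix u v assume "(u, v) : nws (Suc k)"
  hence "set u <= {1..Suc k}" using nws_props by blast
  thus "HS.hw (fst (u, v)) : carrier HS.H" using HS.hw_closed by simp
 qed
 obtain \<iota> where \<iota>: "\<iota> : algebra_hom H.H HS.H" "!!i. i : {1..k} ==> \<iota> (H.T i) = HS.T i"
 proof (rule H.hecke_hom_exists[OF HS.H.calg_axioms, of HS.T])
  show "HS.T i : carrier HS.H" if "i : {1..k}" for i using that by auto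
  show "HS.T i \<otimes>_HS.H HS.T i = (q - 1) \<odot>_HS.H HS.T i \<oplus>_HS.H q \<odot>_HS.H \<one>_HS.H" if "i : {1..k}" for i
   by (rule HS.T_quadratic) (use that in auto)
  show "HS.T i \<otimes>_HS.H HS.T (i + 1) \<otimes>_HS.H HS.T i = HS.T (i + 1) \<otimes>_HS.H HS.T i \<otimes>_HS.H HS.T (i + 1)"
   if "i : {1..k}" "i + 1 : {1..k}" for i
   by (rule HS.T_braid) (use that in auto)
  show "HS.T i \<otimes>_HS.H HS.T j = HS.T j \<otimes>_HS.H HS.T i" if "i : {1..k}" "j : {1..k}" "i + 2 <= j" for i j
   by (rule HS.T_commute) (use that in auto)
 next
  fix h assume "h : algebra_hom H.H HS.H" "!!i. i : {1..k} ==> h (H.T i) = HS.T i"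
  thus thesis by (rule that)
 qed
 interpret i: alg_map H.H HS.H \<iota>
  using \<iota> by (simp add: alg_map_def alg_map_axioms_def H.H.calg_axioms HS.H.calg_axioms)
 have \<iota>w: "\<iota> (H.hw u) = HS.hw u" if "set u <= {1..k}" for u
  using that by (induction u) (auto simp: H.hw_simps HS.hw_simps \<iota>)
 have s: "VectorSpace.subspace Cx (lspan HS.H ?G) HS.H" by (rule HS.H.subspace_lspan[OF G])
 have gen: "\<iota> x \<otimes>_HS.H HS.cw j : lspan HS.H ?G" if x: "x : carrier H.H" and j: "j : {1..Suc (Suc k)}" for x j
 proof -
  have jc: "HS.cw j : carrier HS.H" using j by auto
  have "VectorSpace.subspace Cx {x : carrier H.H. \<iota> x \<otimes>_HS.H HS.cw j : lspan HS.H ?G} H.H"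
   using s jc unfolding H.H.subspace_iff HS.H.subspace_iff by (auto simp: HS.H.l_distr HS.H.smult_mult)
  moreover have "H.hw ` fst ` nws k <= {x : carrier H.H. \<iota> x \<otimes>_HS.H HS.cw j : lspan HS.H ?G}"
  proof (clarify)
   fix u v assume uv: "(u, v) : nws k"
   have ul: "set u <= {1..k}" using nws_props[OF uv] by blast
   have ul': "set u <= {1..<Suc k}" using ul by auto
   have "(u @ rev [j..<Suc (Suc k)], take (j - 1) v @ Suc k # drop (j - 1) v) : nws (Suc k)"
    unfolding nws.simps by (rule image_eqI[of _ _ "((u, v), j)"]) (use uv j in auto)
   hence "u @ rev [j..<Suc (Suc k)] : fst ` nws (Suc k)" by (rule image_eqI[rotated]) simp
   hence "HS.hw (u @ rev [j..<Suc (Suc k)]) : ?G" by (rule imageI)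
   hence "HS.hw (u @ rev [j..<Suc (Suc k)]) : lspan HS.H ?G" by (rule subsetD[OF HS.H.lspan_incl])
   thus "H.hw (fst (u, v)) : carrier H.H & \<iota> (H.hw (fst (u, v))) \<otimes>_HS.H HS.cw j : lspan HS.H ?G"
    using HS.hw_step_word[OF ul' j] \<iota>w[OF ul] H.hw_closed[OF ul] by simp
  qed
  ultimately have "lspan H.H (H.hw ` fst ` nws k) <= {x : carrier H.H. \<iota> x \<otimes>_HS.H HS.cw j : lspan HS.H ?G}"
   by (rule H.H.lspan_least)
  thus ?thesis using x Suc.IH by blast
 qed
 have "HS.hw ` HS.step_words <= lspan HS.H ?G"
 proof (clarify)
  fix w assume "w : HS.step_words"
  then obtain as j where w: "w = as @ rev [j..<Suc (Suc k)]" "set as <= {1..<Suc k}" "j : {1..Suc (Suc k)}"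
   unfolding HS.step_words_def by (elim CollectE exE conjE)
  have as: "set as <= {1..k}" using w(2) by auto
  show "HS.hw w : lspan HS.H ?G"
   using gen[OF H.hw_closed[OF as] w(3)] HS.hw_step_word[OF w(2,3)] \<iota>w[OF as] w(1) by simp
 qed
 hence "lspan HS.H (HS.hw ` HS.step_words) <= lspan HS.H ?G" by (rule HS.H.lspan_least[OF s])
 thus ?case using HS.step_words_span HS.H.lspan_carrier[OF G] by blast
qed

context hecke
begin

lemma nws_letters: "p : nws k ==> set (fst p) <= {1..k}"
 using nws_props[of "fst p" "snd p" k] by simp

lemma nws_word: "p : nws k ==> snd p : words (Suc k) (Suc k)"
 using nws_props[of "fst p" "snd p" k] by (auto simp: words_def)

lemma hw_inj:
 assumes q: "q ~= 0" shows "inj_on (%p. hw (fst p)) (nws k)"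
proof (rule inj_onI)
 fix p p' assume p: "p : nws k" "p' : nws k" "hw (fst p) = hw (fst p')"
 have F: "single (snd p) : carrier (free_space (words (Suc k) (Suc k)))"
  by (rule single_in_free[OF nws_word[OF p(1)]])
 have "q ^ length (fst p) * single (snd p) (snd p) = q ^ length (fst p') * single (snd p) (snd p')"
  using nws_row[of "fst p" "snd p" k q "single (snd p)"] nws_row[of "fst p'" "snd p'" k q "single (snd p)"]
   \<theta>_hw[OF nws_letters[OF p(1)] F] \<theta>_hw[OF nws_letters[OF p(2)] F] p by (simp del: upt_Suc)
 hence "snd p' = snd p" using q by (simp add: single_def split: if_splits)
 thus "p = p'" using inj_onD[OF nws_inj _ p(1,2)] by simp
qed

lemma nws_expand:
 assumes q: "q ~= 0" and x: "x : carrier H"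
 obtains c where "x = (\<Oplus>_H p\<in>nws k. c p \<odot>_H hw (fst p))"
proof -
 let ?S = "(%p. hw (fst p)) ` nws k"
 have sub: "?S <= carrier H" using hw_closed[OF nws_letters] by auto
 have sp: "lspan H ?S = carrier H" using nws_span[of q k] by (simp add: image_image)
 obtain c where c: "x = (\<Oplus>_H b\<in>?S. c b \<odot>_H b)"
  by (rule H.coords[OF finite_imageI[OF nws_finite] sub sp x])
 have "(\<Oplus>_H b\<in>?S. c b \<odot>_H b) = (\<Oplus>_H p\<in>nws k. c (hw (fst p)) \<odot>_H hw (fst p))"
  by (rule H.add.finprod_reindex) (use hw_inj[OF q] sub in auto)
 with c show thesis by (intro that[of "%p. c (hw (fst p))"]) (simp only:)
qed

lemma row_functional:
 assumes p0: "p0 : nws k"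
 shows "\<theta> (Suc k) (\<Oplus>_H p\<in>nws k. c p \<odot>_H hw (fst p)) (single (snd p0)) [0..<Suc k] = c p0 * q ^ length (fst p0)"
proof -
 let ?M = "free_space (words (Suc k) (Suc k))"
 interpret R: arep H ?M "\<theta> (Suc k)" by (rule arep_\<theta>)
 have hc: "hw (fst p) : carrier H" if "p : nws k" for p by (rule hw_closed[OF nws_letters[OF that]])
 have F: "single (snd p0) : carrier ?M" by (rule single_in_free[OF nws_word[OF p0]])
 have "\<theta> (Suc k) (\<Oplus>_H p\<in>nws k. c p \<odot>_H hw (fst p)) (single (snd p0))
   = (\<Oplus>_?M p\<in>nws k. \<theta> (Suc k) (c p \<odot>_H hw (fst p)) (single (snd p0)))"
  by (rule R.finsum_act) (use F hc in auto)
 hence "\<theta> (Suc k) (\<Oplus>_H p\<in>nws k. c p \<odot>_H hw (fst p)) (single (snd p0)) [0..<Suc k]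
   = (\<Sum>p\<in>nws k. \<theta> (Suc k) (c p \<odot>_H hw (fst p)) (single (snd p0)) [0..<Suc k])"
  using free_space_finsum_eval[of "nws k" "%p. \<theta> (Suc k) (c p \<odot>_H hw (fst p)) (single (snd p0))" "words (Suc k) (Suc k)"]
   F hc R.act_closed by (simp del: upt_Suc)
 also have "... = (\<Sum>p\<in>nws k. if p = p0 then c p0 * q ^ length (fst p0) else 0)"
 proof (rule sum.cong[OF refl])
  fix p assume p: "p : nws k"
  have "\<theta> (Suc k) (c p \<odot>_H hw (fst p)) (single (snd p0)) [0..<Suc k]
    = c p * hops q (fst p) (single (snd p0)) [0..<Suc k]"
   by (simp only: \<theta>_linear(2)[OF F hc[OF p]] \<theta>_hw[OF nws_letters[OF p] F])
  also have "... = c p * (q ^ length (fst p) * single (snd p0) (snd p))"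
   using nws_row[of "fst p" "snd p" k q] p by (simp del: upt_Suc)
  also have "... = (if p = p0 then c p0 * q ^ length (fst p0) else 0)"
   using inj_onD[OF nws_inj _ p p0] by (auto simp: single_def)
  finally show "\<theta> (Suc k) (c p \<odot>_H hw (fst p)) (single (snd p0)) [0..<Suc k]
    = (if p = p0 then c p0 * q ^ length (fst p0) else 0)" .
 qed
 also have "... = c p0 * q ^ length (fst p0)" using p0 nws_finite by simp
 finally show ?thesis .
qed

lemma row_zero:
 assumes q: "q ~= 0" and x: "x : carrier H"
  and z: "!!p. p : nws k ==> \<theta> (Suc k) x (single (snd p)) [0..<Suc k] = 0"
 shows "x = \<zero>_H"
proof -
 obtain c where c: "x = (\<Oplus>_H p\<in>nws k. c p \<odot>_H hw (fst p))" by (rule nws_expand[OF q x])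
 have "c p = 0" if "p : nws k" for p
  using row_functional[OF that, of c] z[OF that] q unfolding c[symmetric] by simp
 thus ?thesis
  unfolding c by (intro H.add.finprod_one_eqI) (use hw_closed[OF nws_letters] in auto)
qed

text \<open>Multiplying by the reversed normal words turns \<open>\<tau>\<close> into the row
  functionals, which recover all coefficients up to powers of \<open>q\<close>.\<close>

lemma \<tau>_nondegenerate:
 assumes q: "q ~= 0" and x: "x : carrier H" and z: "!!h. h : carrier H ==> \<tau> (x \<otimes>_H h) = 0"
 shows "x = \<zero>_H"
proof (rule row_zero[OF q x])
 fix p assume p: "p : nws k"
 let ?M = "free_space (words (Suc k) (Suc k))"
 interpret R: arep H ?M "\<theta> (Suc k)" by (rule arep_\<theta>)
 have l: "set (rev (fst p)) <= {1..k}" using nws_letters[OF p] by simp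
 have e: "single [0..<Suc k] : carrier ?M" by (rule single_in_free[OF base_word])
 have s: "single (snd p) : carrier ?M" by (rule single_in_free[OF nws_word[OF p]])
 have h: "hw (rev (fst p)) : carrier H" by (rule hw_closed[OF l])
 have "\<theta> (Suc k) (hw (rev (fst p))) (single [0..<Suc k]) = single (snd p)"
 proof
  fix w
  show "\<theta> (Suc k) (hw (rev (fst p))) (single [0..<Suc k]) w = single (snd p) w"
  proof (cases "length w = Suc k")
   case True
   thus ?thesis unfolding \<theta>_hw[OF l e] using nws_column[of "fst p" "snd p" k w q] p by (simp del: upt_Suc)
  next
   case False
   hence "w ~: words (Suc k) (Suc k)" by (simp add: words_def)
   thus ?thesis using R.act_closed[OF h e] s by (simp add: word_functions finite_words del: upt_Suc)
  qed
 qed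
 hence "\<tau> (x \<otimes>_H hw (rev (fst p))) = \<theta> (Suc k) x (single (snd p)) [0..<Suc k]"
  unfolding \<tau>_def R.mult_act[OF x h e] by simp
 thus "\<theta> (Suc k) x (single (snd p)) [0..<Suc k] = 0" using z[OF h] by simp
qed

lemma hecke_basis:
 assumes q: "q ~= 0"
 shows "vectorspace.basis Cx H ((%p. hw (fst p)) ` nws k)"
proof -
 let ?B = "(%p. hw (fst p)) ` nws k"
 interpret VS: vectorspace Cx H by (rule H.vs)
 have sub: "?B <= carrier H" using hw_closed[OF nws_letters] by auto
 have fB: "finite ?B" by (rule finite_imageI[OF nws_finite])
 have "VS.lin_indpt ?B"
 proof (rule VS.finite_lin_indpt2[OF fB sub])
  fix a assume z: "VS.lincomb a ?B = \<zero>_H"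
  have "(\<Oplus>_H b\<in>?B. a b \<odot>_H b) = (\<Oplus>_H p\<in>nws k. a (hw (fst p)) \<odot>_H hw (fst p))"
   by (rule H.add.finprod_reindex) (use hw_inj[OF q] sub in auto)
  hence zero: "(\<Oplus>_H p\<in>nws k. a (hw (fst p)) \<odot>_H hw (fst p)) = \<zero>_H"
   using z by (simp add: VS.lincomb_def)
  show "\<forall>v\<in>?B. a v = \<zero>_Cx"
  proof
   fix v assume "v : ?B"
   then obtain p where p: "p : nws k" "v = hw (fst p)" by auto
   have "a (hw (fst p)) * q ^ length (fst p) = 0"
    using row_functional[OF p(1), of "%p. a (hw (fst p))"]
     \<theta>_linear(3)[OF single_in_free[OF nws_word[OF p(1)]], of "[0..<Suc k]"]
    unfolding zero by simp
   thus "a v = \<zero>_Cx" using q p by simp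
  qed
 qed
 moreover have "VS.span ?B = carrier H"
  using H.lspan_eq_span[OF sub] nws_span[of q k] by (simp add: image_image)
 ultimately show ?thesis unfolding VS.basis_def using sub by blast
qed

lemma hecke_fin_dim: "vectorspace.fin_dim Cx H"
proof -
 interpret VS: vectorspace Cx H by (rule H.vs)
 have sub: "(%p. hw (fst p)) ` nws k <= carrier H" using hw_closed[OF nws_letters] by auto
 have "VS.span ((%p. hw (fst p)) ` nws k) = carrier H"
  using H.lspan_eq_span[OF sub] nws_span[of q k] by (simp add: image_image)
 thus ?thesis
  unfolding VS.fin_dim_def by (intro exI conjI) (rule finite_imageI[OF nws_finite], rule sub)
qed

lemma hecke_dim: "q ~= 0 ==> vectorspace.dim Cx H = fact (Suc k)"
 using vectorspace.dim_basis[OF H.vs finite_imageI[OF nws_finite] hecke_basis]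
 by (simp add: card_image hw_inj nws_card del: fact_Suc)

end

section \<open>The Poincare polynomial\<close>

primrec swaps :: "nat list => nat => nat" where
 "swaps [] = id"
| "swaps (i # is) = adj_swap i \<circ> swaps is"

lemma swaps_foldr: "swaps is = foldr (\<circ>) (map adj_swap is) id"
 by (induction "is") (simp_all only: swaps.simps list.map foldr.simps o_apply id_apply)

lemma swaps_append: "swaps (is @ js) = swaps is \<circ> swaps js"
 by (induction "is") (simp_all add: fun_eq_iff)

lemma swaps_permutes: "set is <= {1..<N} ==> swaps is permutes {1..N}"
proof (induction "is")
 case (Cons i "is")
 have "adj_swap i permutes {1..N}" by (rule permutes_swap_id) (use Cons.prems in auto)
 moreover have "swaps is permutes {1..N}" using Cons by simp
 ultimately show ?case unfolding swaps.simps by (rule permutes_compose[rotated])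
qed (simp only: swaps.simps permutes_id)

definition inversions :: "nat => (nat => nat) => (nat \<times> nat) set" where
 "inversions N w = {(a, b). a : {1..N} & b : {1..N} & a < b & w b < w a}"

lemma finite_inversions: "finite (inversions N w)"
 by (rule finite_subset[of _ "{1..N} \<times> {1..N}"]) (auto simp: inversions_def)

lemma inversions_swap:
 assumes w: "w permutes {1..N}"
 shows "card (inversions N (adj_swap i \<circ> w)) <= Suc (card (inversions N w))"
proof -
 have "inversions N (adj_swap i \<circ> w) <= insert (inv_into UNIV w i, inv_into UNIV w (i + 1)) (inversions N w)"
 proof (rule subrelI)
  fix a b assume "(a, b) : inversions N (adj_swap i \<circ> w)"
  hence h: "a : {1..N}" "b : {1..N}" "a < b" "adj_swap i (w b) < adj_swap i (w a)"
   by (auto simp: inversions_def)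
  show "(a, b) : insert (inv_into UNIV w i, inv_into UNIV w (i + 1)) (inversions N w)"
  proof (cases "w b < w a")
   case True
   thus ?thesis using h by (simp add: inversions_def)
  next
   case False
   have "w a ~= w b" using permutes_inj[OF w] h(3) by (auto simp: inj_eq)
   hence "w a = i" "w b = i + 1"
    using h(4) False by (auto simp: Transposition.transpose_def split: if_splits)
   thus ?thesis using permutes_inverses(2)[OF w, of a] permutes_inverses(2)[OF w, of b] by simp
  qed
 qed
 hence "card (inversions N (adj_swap i \<circ> w)) <= card (insert (inv_into UNIV w i, inv_into UNIV w (i + 1)) (inversions N w))"
  by (rule card_mono[rotated]) (simp add: finite_inversions)
 also have "... <= Suc (card (inversions N w))" by (rule card_insert_le_m1) simp_all
 finally show ?thesis .
qed

lemma inversions_swaps: "set is <= {1..<N} ==> card (inversions N (swaps is)) <= length is"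
proof (induction "is")
 case Nil
 have "inversions N id = {}" by (auto simp: inversions_def)
 thus ?case unfolding swaps.simps by (simp only: card.empty le0)
next
 case (Cons i "is")
 have "set is <= {1..<N}" using Cons.prems by simp
 thus ?case using Cons.IH inversions_swap[OF swaps_permutes, of "is" N i]
  unfolding swaps.simps length_Cons by linarith
qed

text \<open>The cycle \<open>s\<^bsub>n-1\<^esub> ... s\<^sub>j\<close>, which moves \<open>j\<close> to
  \<open>n\<close>; these are the minimal coset representatives.\<close>

definition cyc :: "nat => nat => nat => nat" where
 "cyc n j a = (if a < j | n < a then a else if a = j then n else a - 1)"

lemma swaps_cyc: "j <= n ==> swaps (rev [j..<n]) = cyc n j"
proof (induction n)
 case (Suc n)
 show ?case
 proof (cases "j = Suc n")
  case False
  hence j: "j <= n" "rev [j..<Suc n] = n # rev [j..<n]" using Suc.prems by auto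
  have "swaps (rev [j..<Suc n]) = adj_swap n \<circ> cyc n j"
   unfolding j(2) swaps.simps Suc.IH[OF j(1)] ..
  also have "... = cyc (Suc n) j"
   using False Suc.prems by (auto simp: fun_eq_iff cyc_def Transposition.transpose_def)
  finally show ?thesis .
 qed (auto simp: cyc_def)
qed (auto simp: cyc_def)

lemma cyc_bij:
 "bij_betw (%(w, j). w \<circ> cyc (Suc N) j) ({w. w permutes {1..N}} \<times> {1..Suc N}) {w. w permutes {1..Suc N}}"
proof -
 let ?f = "%(w, j). w \<circ> cyc (Suc N) j" and ?A = "{w. w permutes {1..N}} \<times> {1..Suc N}"
 have cp: "cyc (Suc N) j permutes {1..Suc N}" if "j : {1..Suc N}" for j
  using swaps_permutes[of "rev [j..<Suc N]" "Suc N"] swaps_cyc[of j "Suc N"] that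
  by (simp del: upt_Suc)
 have inj: "inj_on ?f ?A"
 proof (rule inj_onI, clarify)
  fix w j w' j' assume h: "w permutes {1..N}" "j : {1..Suc N}" "w' permutes {1..N}" "j' : {1..Suc N}"
   "w \<circ> cyc (Suc N) j = w' \<circ> cyc (Suc N) j'"
  have f: "w (Suc N) = Suc N" "w' (Suc N) = Suc N" using h(1,3) by (auto simp: permutes_not_in)
  have "w' (cyc (Suc N) j' j) = w (cyc (Suc N) j j)" using fun_cong[OF h(5), of j] by simp
  also have "... = w' (Suc N)" using h(2) f by (simp add: cyc_def)
  finally have "cyc (Suc N) j' j = Suc N" using permutes_inj[OF h(3)] by (simp add: inj_eq)
  hence j: "j = j'" using h(2,4) by (auto simp: cyc_def split: if_splits)
  have "w x = w' x" for x
  proof -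
   obtain y where "x = cyc (Suc N) j y" using permutes_surj[OF cp[OF h(2)]] by (auto simp: surj_def)
   thus ?thesis using fun_cong[OF h(5), of y] j by simp
  qed
  thus "w = w' & j = j'" using j by auto
 qed
 have sub: "?f ` ?A <= {w. w permutes {1..Suc N}}"
 proof clarify
  fix w j assume "w permutes {1..N}" "j : {1..Suc N}"
  thus "w \<circ> cyc (Suc N) j permutes {1..Suc N}"
   using cp permutes_subset[of w "{1..N}" "{1..Suc N}"] by (intro permutes_compose) auto
 qed
 have "card (?f ` ?A) = card {w. w permutes {1..Suc N}}"
  unfolding card_image[OF inj] card_cartesian_product
  by (simp add: card_permutations[OF refl])
 hence "?f ` ?A = {w. w permutes {1..Suc N}}"
  by (intro card_subset_eq sub finite_permutations) simp_all
 thus ?thesis using inj by (simp add: bij_betw_def)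
qed

text \<open>The inversions of \<open>w\<close> persist, and the position \<open>j\<close> of the new
  largest value is inverted with every later position.\<close>

lemma inversions_cyc:
 assumes w: "w permutes {1..N}" and j: "j : {1..Suc N}"
 shows "card (inversions N w) + (Suc N - j) <= card (inversions (Suc N) (w \<circ> cyc (Suc N) j))"
proof -
 let ?d = "%a. if a < j then a else Suc a"
 let ?I = "map_prod ?d ?d ` inversions N w" and ?J = "{j} \<times> {Suc j..Suc N}"
 have c: "cyc (Suc N) j (?d a) = a" if "a : {1..N}" for a using that by (auto simp: cyc_def)
 have "?I <= inversions (Suc N) (w \<circ> cyc (Suc N) j)"
 proof (rule image_subsetI)
  fix p assume p: "p : inversions N w"
  obtain a b where ab: "p = (a, b)" by (cases p)
  have h: "a : {1..N}" "b : {1..N}" "a < b" "w b < w a" using p unfolding ab by (auto simp: inversions_def)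
  have "w (cyc (Suc N) j (?d b)) < w (cyc (Suc N) j (?d a))" unfolding c[OF h(1)] c[OF h(2)] by (rule h(4))
  thus "map_prod ?d ?d p : inversions (Suc N) (w \<circ> cyc (Suc N) j)"
   unfolding inversions_def ab using h by simp
 qed
 moreover have "?J <= inversions (Suc N) (w \<circ> cyc (Suc N) j)"
 proof clarify
  fix b assume b: "b : {Suc j..Suc N}"
  have "w (b - 1) : {1..N}" using permutes_in_image[OF w, of "b - 1"] b j by auto
  moreover have "w (Suc N) = Suc N" using w by (auto simp: permutes_not_in)
  ultimately show "(j, b) : inversions (Suc N) (w \<circ> cyc (Suc N) j)"
   using b j by (auto simp: inversions_def cyc_def)
 qed
 ultimately have "card (?I \<union> ?J) <= card (inversions (Suc N) (w \<circ> cyc (Suc N) j))"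
  by (rule card_mono[OF finite_inversions Un_least])
 moreover have "card (?I \<union> ?J) = card ?I + card ?J"
  by (rule card_Un_disjoint) (use finite_inversions in \<open>auto split: if_splits\<close>)
 moreover have "inj_on (map_prod ?d ?d) (inversions N w)"
  by (rule inj_onI) (auto split: if_splits)
 ultimately show ?thesis by (simp add: card_image card_cartesian_product)
qed

lemma reduced_word_exists:
 "w permutes {1..Suc k} ==> EX is. set is <= {1..k} & w = swaps is & length is = card (inversions (Suc k) w)"
proof (induction k arbitrary: w)
 case 0
 hence "w = swaps []" unfolding swaps.simps by (simp only: One_nat_def atLeastAtMost_singleton permutes_sing)
 moreover have "inversions (Suc 0) w = {}" by (auto simp: inversions_def)
 ultimately show ?case by (intro exI[of _ "[]"]) (simp only: card.empty list.size list.set empty_subsetI)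
next
 case (Suc k)
 obtain w' j where h: "w' permutes {1..Suc k}" "j : {1..Suc (Suc k)}" "w = w' \<circ> cyc (Suc (Suc k)) j"
 proof -
  have "w : (%(w, j). w \<circ> cyc (Suc (Suc k)) j) ` ({w. w permutes {1..Suc k}} \<times> {1..Suc (Suc k)})"
   unfolding bij_betw_imp_surj_on[OF cyc_bij] mem_Collect_eq by (rule Suc.prems)
  then obtain p where p: "w = (%(w, j). w \<circ> cyc (Suc (Suc k)) j) p" "p : {w. w permutes {1..Suc k}} \<times> {1..Suc (Suc k)}"
   by (rule imageE)
  show thesis
   by (rule that[of "fst p" "snd p"]) (use p in \<open>simp_all only: mem_Times_iff mem_Collect_eq case_prod_beta\<close>)
 qed
 obtain "is" where u: "set is <= {1..k}" "w' = swaps is" "length is = card (inversions (Suc k) w')"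
  using Suc.IH[OF h(1)] by blast
 let ?u = "is @ rev [j..<Suc (Suc k)]"
 have s: "set ?u <= {1..Suc k}" using u(1) h(2) by auto
 have w: "w = swaps ?u" unfolding swaps_append h(3) u(2) using h(2) swaps_cyc[of j "Suc (Suc k)"] by (simp only: atLeastAtMost_iff)
 have "length ?u <= card (inversions (Suc (Suc k)) w)" unfolding h(3) using inversions_cyc[OF h(1,2)] u(3) by (simp del: upt_Suc)
 moreover have "card (inversions (Suc (Suc k)) w) <= length ?u"
  unfolding w by (rule inversions_swaps) (use s in auto)
 ultimately show ?case using s w by (intro exI[of _ ?u]) simp
qed

lemma coxeter_length_inversions:
 assumes "w permutes {1..Suc k}" shows "coxeter_length k w = card (inversions (Suc k) w)"
 unfolding coxeter_length_def swaps_foldr[symmetric]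
proof (rule Least_equality)
 show "EX is. length is = card (inversions (Suc k) w) & set is <= {1..k} & w = swaps is"
  using reduced_word_exists[OF assms] by blast
 fix r assume "EX is. length is = r & set is <= {1..k} & w = swaps is"
 then obtain "is" where "length is = r" "set is <= {1..k}" "w = swaps is" by blast
 thus "card (inversions (Suc k) w) <= r" using inversions_swaps[of "is" "Suc k"] by (auto simp: atLeastLessThanSuc_atLeastAtMost)
qed

lemma inversions_cyc_eq:
 assumes w: "w permutes {1..N}" and j: "j : {1..Suc N}" and N: "N = Suc k"
 shows "card (inversions (Suc N) (w \<circ> cyc (Suc N) j)) = card (inversions N w) + (Suc N - j)"
proof (rule antisym[OF _ inversions_cyc[OF w j]])
 obtain "is" where u: "set is <= {1..k}" "w = swaps is" "length is = card (inversions N w)"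
  using reduced_word_exists w N by blast
 have letters: "set (is @ rev [j..<Suc N]) <= {1..<Suc N}" using u(1) j unfolding N by auto
 have "w \<circ> cyc (Suc N) j = swaps (is @ rev [j..<Suc N])" unfolding swaps_append u(2) using j swaps_cyc[of j "Suc N"] by (simp only: atLeastAtMost_iff)
 thus "card (inversions (Suc N) (w \<circ> cyc (Suc N) j)) <= card (inversions N w) + (Suc N - j)"
  using inversions_swaps[of "is @ rev [j..<Suc N]" "Suc N"] letters u(3) by (simp del: upt_Suc)
qed

text \<open>Factor each permutation as a smaller one times a cycle; lengths add.\<close>

lemma poincare_product: "poincare k q = (\<Prod>r=1..Suc k. q_int q r)"
proof (induction k)
 case 0
 have "{w :: nat => nat. w permutes {1..0 + 1}} = {id}"
  by (simp only: One_nat_def add_0 atLeastAtMost_singleton permutes_sing singleton_conv)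
 moreover have "inversions (Suc 0) id = {}" by (auto simp: inversions_def)
 hence "coxeter_length 0 id = 0"
  using coxeter_length_inversions[OF permutes_id, of 0] by (simp only: card.empty)
 ultimately have "poincare 0 q = 1" unfolding poincare_def by (simp only: power_0 sum.insert finite.emptyI empty_iff sum.empty) simp
 thus ?case by (simp add: q_int_def One_nat_def)
next
 case (Suc k)
 let ?N = "Suc k"
 have P: "poincare k q = (\<Sum>w | w permutes {1..Suc k}. q ^ card (inversions (Suc k) w))" for k
  unfolding poincare_def Suc_eq_plus1[symmetric]
  by (rule sum.cong[OF refl]) (simp only: mem_Collect_eq coxeter_length_inversions)
 have "poincare (Suc k) q = (\<Sum>(w, j)\<in>{w. w permutes {1..?N}} \<times> {1..Suc ?N}. q ^ card (inversions (Suc ?N) (w \<circ> cyc (Suc ?N) j)))"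
  unfolding P by (subst sum.reindex_bij_betw[OF cyc_bij, symmetric]) (simp add: case_prod_unfold)
 also have "... = (\<Sum>(w, j)\<in>{w. w permutes {1..?N}} \<times> {1..Suc ?N}. q ^ card (inversions ?N w) * q ^ (Suc ?N - j))"
  by (rule sum.cong[OF refl])
   (clarsimp simp only: mem_Times_iff mem_Collect_eq inversions_cyc_eq[OF _ _ refl] power_add split_paired_all prod.case fst_conv snd_conv)
 also have "... = poincare k q * (\<Sum>j\<in>{1..Suc ?N}. q ^ (Suc ?N - j))"
  unfolding P sum_product sum.cartesian_product by (rule sum.cong) auto
 also have "(\<Sum>j\<in>{1..Suc ?N}. q ^ (Suc ?N - j)) = q_int q (Suc ?N)"
  unfolding q_int_def
  by (rule sum.reindex_bij_witness[of _ "%a. Suc ?N - a" "%j. Suc ?N - j"]) auto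
 finally show ?case using Suc by (simp add: mult.commute)
qed

lemma poincare_nonzero: "poincare k q ~= 0 ==> r : {1..Suc k} ==> q_int q r ~= 0"
 unfolding poincare_product by (simp only: prod_zero_iff finite_atLeastAtMost) blast

section \<open>Semisimplicity of the Hecke algebra\<close>

text \<open>Among the nonzero left ideals inside \<open>J\<close>, one whose largest independent subset
  is as small as possible is minimal.\<close>

lemma minimal_left_ideal:
 assumes A: "calg A" and fd: "vectorspace.fin_dim Cx A" and J: "left_ideal A J" "J ~= {\<zero>_A}"
 obtains W where "left_ideal A W" "W <= J" "W ~= {\<zero>_A}"
  "!!W'. left_ideal A W' ==> W' <= W ==> W' ~= {\<zero>_A} ==> W' = W"
proof -
 interpret A: calg A by (rule A)
 interpret VS: vectorspace Cx A by (rule A.vs)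
 define ok where "ok W \<longleftrightarrow> left_ideal A W & W <= J & W ~= {\<zero>_A}" for W
 define indep where "indep W S \<longleftrightarrow> S <= W & VS.lin_indpt S" for W S
 define rk where "rk W = Max (card ` {S. indep W S})" for W
 have sub: "W <= carrier A" if "left_ideal A W" for W using that by (auto simp: left_ideal_def stable_subset_def)
 have fin: "finite (card ` {S. indep W S})" if "left_ideal A W" for W
 proof (rule finite_subset)
  show "card ` {S. indep W S} <= {..VS.dim}"
   using sub[OF that] VS.li_le_dim(2)[OF fd] by (auto simp: indep_def)
 qed simp
 have strict: "rk W' < rk W" if W: "left_ideal A W" and W': "left_ideal A W'" and ss: "W' \<subset> W" for W W'
 proof -
  have e: "indep W' {}" by (simp add: indep_def VS.lin_dep_def)
  hence "rk W' : card ` {S. indep W' S}" unfolding rk_def by (intro Max_in fin W') blast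
  then obtain S where S: "indep W' S" "rk W' = card S" by blast
  obtain x where x: "x : W" "x ~: W'" using ss by blast
  have Sc: "S <= carrier A" "VS.lin_indpt S" using S(1) sub[OF W'] by (auto simp: indep_def)
  have fS: "finite S" by (rule VS.li_le_dim(1)[OF fd Sc])
  have xS: "x ~: S" using S(1) x by (auto simp: indep_def)
  have "VectorSpace.subspace Cx W' A"
   using W' unfolding A.subspace_iff left_ideal_def stable_subset_def by blast
  hence "lspan A S <= W'" by (rule A.lspan_least) (use S(1) in \<open>simp add: indep_def\<close>)
  hence "x ~: VS.span S" using x A.lspan_eq_span[OF Sc(1)] by blast
  hence "VS.lin_indpt (S \<union> {x})"
   using VS.lin_dep_iff_in_span[OF Sc _ xS] x(1) sub[OF W] by blast
  hence "indep W (insert x S)" using S(1) ss x by (auto simp: indep_def)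
  hence "card (insert x S) <= rk W" unfolding rk_def by (intro Max_ge fin W) blast
  thus ?thesis using S(2) fS xS by simp
 qed
 have "ok J" using J by (simp add: ok_def)
 then obtain W where W: "ok W" "!!W'. ok W' ==> rk W <= rk W'"
  using arg_min_nat_lemma[of ok J rk] by blast
 show thesis
 proof (rule that[of W])
  show "left_ideal A W" "W <= J" "W ~= {\<zero>_A}" using W(1) by (auto simp: ok_def)
  fix W' assume W': "left_ideal A W'" "W' <= W" "W' ~= {\<zero>_A}"
  hence "ok W'" using W(1) by (auto simp: ok_def)
  hence "\<not> rk W' < rk W" using W(2) by fastforce
  thus "W' = W" using strict[OF _ W'(1)] W'(2) W(1) unfolding ok_def by blast
 qed
qed

text \<open>A minimal left ideal is an irreducible module. It is transported along a linear embedding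
  \<open>\<Theta>\<close>, so that its vectors have the type over which the completeness of the
  irreducible representations is assumed.\<close>

lemma left_ideal_rep:
 fixes \<Theta> :: "'a => 'w" and M :: "'w cspace"
 assumes A: "calg A" and M: "cspace M" and W: "left_ideal A W" "W ~= {\<zero>_A}"
  and minimal: "!!W'. left_ideal A W' ==> W' <= W ==> W' ~= {\<zero>_A} ==> W' = W"
  and \<Theta>: "lin_map A M \<Theta>" "inj_on \<Theta> (carrier A)"
 obtains X :: "'w cspace" and \<pi> where "irrep A X \<pi>" "carrier X = \<Theta> ` W" "\<zero>_X = \<Theta> \<zero>_A"
  "!!a x. a : carrier A ==> x : W ==> \<pi> a (\<Theta> x) = \<Theta> (a \<otimes>_A x)"
proof -
 interpret A: calg A by (rule A)
 interpret M: cspace M by (rule M)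
 interpret t: lin_map A M \<Theta> by (rule \<Theta>(1))
 have WA: "x : carrier A" if "x : W" for x using W(1) that by (auto simp: left_ideal_def stable_subset_def)
 have W0: "\<zero>_A : W" and Wadd: "!!x y. x : W ==> y : W ==> x \<oplus>_A y : W"
  and Wsm: "!!c x. x : W ==> c \<odot>_A x : W"
  and Wm: "!!a x. a : carrier A ==> x : W ==> a \<otimes>_A x : W"
  using W(1) by (auto simp: left_ideal_def stable_subset_def)
 define X where "X = M\<lparr>carrier := \<Theta> ` W\<rparr>"
 have Xs: "carrier X = \<Theta> ` W" "\<zero>_X = \<zero>_M" "!!x y. x \<oplus>_X y = x \<oplus>_M y" "!!c x. c \<odot>_X x = c \<odot>_M x"
  by (simp_all add: X_def)
 define \<pi> where "\<pi> a = (\<lambda>v\<in>\<Theta> ` W. \<Theta> (a \<otimes>_A the_inv_into W \<Theta> v))" for a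
 have injW: "inj_on \<Theta> W" by (rule inj_on_subset[OF \<Theta>(2)]) (use WA in blast)
 have \<pi>: "\<pi> a (\<Theta> x) = \<Theta> (a \<otimes>_A x)" if "x : W" for a x
  using that by (simp add: \<pi>_def the_inv_into_f_f[OF injW])
 have cX: "cspace X"
 proof (rule cspace.intro, rule cspace_criteria, unfold Xs)
  show "\<zero>_M : \<Theta> ` W" using t.zero W0 by (metis imageI)
 next
  fix v w assume "v : \<Theta> ` W" "w : \<Theta> ` W"
  then obtain x y where "x : W" "y : W" "v = \<Theta> x" "w = \<Theta> y" by blast
  thus "v \<oplus>_M w : \<Theta> ` W" using Wadd t.add[of x y] WA by (metis imageI)
 next
  fix c v assume "v : \<Theta> ` W"
  then obtain x where "x : W" "v = \<Theta> x" by blast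
  thus "c \<odot>_M v : \<Theta> ` W" using Wsm t.smult[of x c] WA by (metis imageI)
 qed (auto simp: WA M.a_ac M.smult_smult M.add_smult M.smult_add)
 have \<pi>c: "\<pi> a v : \<Theta> ` W" if "a : carrier A" "v : \<Theta> ` W" for a v
  using that \<pi> Wm by auto
 have ar: "arep A X \<pi>"
 proof (rule arepI[OF A cX], unfold Xs)
  fix a assume "a : carrier A" thus "\<pi> a : extensional (\<Theta> ` W)" by (simp add: \<pi>_def)
 next
  fix a v assume "a : carrier A" "v : \<Theta> ` W" thus "\<pi> a v : \<Theta> ` W" by (rule \<pi>c)
 next
  fix a v w assume a: "a : carrier A" and "v : \<Theta> ` W" "w : \<Theta> ` W"
  then obtain x y where x: "x : W" "y : W" "v = \<Theta> x" "w = \<Theta> y" by blast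
  show "\<pi> a (v \<oplus>_M w) = \<pi> a v \<oplus>_M \<pi> a w"
   using \<pi>[OF Wadd[OF x(1,2)], of a] \<pi>[OF x(1), of a] \<pi>[OF x(2), of a] a x WA[OF x(1)] WA[OF x(2)]
   by (simp add: A.r_distr)
 next
  fix a c v assume a: "a : carrier A" and "v : \<Theta> ` W"
  then obtain x where x: "x : W" "v = \<Theta> x" by blast
  show "\<pi> a (c \<odot>_M v) = c \<odot>_M \<pi> a v"
   using \<pi>[OF Wsm[OF x(1)], of a c] \<pi>[OF x(1), of a] a x WA[OF x(1)] by (simp add: A.mult_smult)
 next
  fix a b v assume a: "a : carrier A" "b : carrier A" and "v : \<Theta> ` W"
  then obtain x where x: "x : W" "v = \<Theta> x" by blast
  show "\<pi> (a \<oplus>_A b) v = \<pi> a v \<oplus>_M \<pi> b v"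
   using \<pi>[OF x(1)] a x WA[OF x(1)] by (simp add: A.l_distr)
  show "\<pi> (a \<otimes>_A b) v = \<pi> a (\<pi> b v)"
   using \<pi>[OF x(1)] \<pi>[OF Wm[OF a(2) x(1)]] a x WA[OF x(1)] by (simp add: A.m_assoc)
 next
  fix a c v assume a: "a : carrier A" and "v : \<Theta> ` W"
  then obtain x where x: "x : W" "v = \<Theta> x" by blast
  show "\<pi> (c \<odot>_A a) v = c \<odot>_M \<pi> a v"
   using \<pi>[OF x(1)] a x WA[OF x(1)] by (simp add: A.smult_mult)
 next
  fix v assume "v : \<Theta> ` W"
  then obtain x where x: "x : W" "v = \<Theta> x" by blast
  show "\<pi> \<one>_A v = v" using \<pi>[OF x(1)] x WA[OF x(1)] by simp
 qed
 have "irrep A X \<pi>"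
 proof (rule irrep.intro[OF ar], rule irrep_axioms.intro, unfold Xs)
  obtain x where x: "x : W" "x ~= \<zero>_A" using W W0 by blast
  have "\<Theta> x ~= \<Theta> \<zero>_A" using inj_onD[OF injW _ x(1) W0] x(2) by blast
  thus "\<Theta> ` W ~= {\<zero>_M}" using x(1) t.zero by auto
 next
  fix S assume "stable_subset A X \<pi> S"
  hence S: "S <= \<Theta> ` W" "\<zero>_M : S" "!!x y. x : S ==> y : S ==> x \<oplus>_M y : S"
   "!!c x. x : S ==> c \<odot>_M x : S" "!!a x. a : carrier A ==> x : S ==> \<pi> a x : S"
   unfolding stable_subset_def Xs by blast+
  define W' where "W' = {x : W. \<Theta> x : S}"
  have "left_ideal A W'"
   unfolding left_ideal_def stable_subset_def
  proof (intro conjI ballI allI)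
   show "W' <= carrier A" using WA by (auto simp: W'_def)
   show "\<zero>_A : W'" using W0 S(2) by (simp add: W'_def)
  next
   fix x y assume "x : W'" "y : W'"
   hence "x : W" "y : W" "\<Theta> x : S" "\<Theta> y : S" by (auto simp: W'_def)
   thus "x \<oplus>_A y : W'" using Wadd S(3) t.add[of x y] WA by (simp add: W'_def)
  next
   fix c x assume "x : W'"
   hence "x : W" "\<Theta> x : S" by (auto simp: W'_def)
   thus "c \<odot>_A x : W'" using Wsm S(4) t.smult[of x c] WA by (simp add: W'_def)
  next
   fix a x assume a: "a : carrier A" and "x : W'"
   hence x: "x : W" "\<Theta> x : S" by (auto simp: W'_def)
   thus "a \<otimes>_A x : W'" using Wm[OF a] S(5)[OF a x(2)] \<pi>[of x a] by (simp add: W'_def)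
  qed
  hence "W' = {\<zero>_A} | W' = W" using minimal[of W'] by (auto simp: W'_def)
  moreover have "S = \<Theta> ` W'" using S(1) by (auto simp: W'_def)
  ultimately show "S = {\<zero>_M} | S = \<Theta> ` W" by auto
 qed
 thus thesis by (rule that) (use \<pi> Xs in auto)
qed

text \<open>The row functionals of all permutations separate the elements.\<close>

lemma (in hecke) linear_embedding:
 assumes q: "q ~= 0"
 obtains \<Theta> :: "(nat list => complex) set => (nat => complex)" where
  "lin_map H (free_space UNIV) \<Theta>" "inj_on \<Theta> (carrier H)"
proof -
 obtain h where h: "bij_betw h {..<card (nws k)} (nws k)"
  using ex_bij_betw_nat_finite[OF nws_finite] by (auto simp: atLeast0LessThan)
 define \<Theta> where "\<Theta> x = (%m. if m < card (nws k) then \<theta> (Suc k) x (single (snd (h m))) [0..<Suc k] else 0)" for x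
 interpret M: cspace "free_space (UNIV :: nat set)" by (rule cspace_free)
 have hn: "h m : nws k" if "m < card (nws k)" for m using h that by (auto simp: bij_betw_def)
 have F: "single (snd (h m)) : carrier (free_space (words (Suc k) (Suc k)))" if "m < card (nws k)" for m
  by (rule single_in_free[OF nws_word[OF hn[OF that]]])
 have lin: "lin_map H (free_space UNIV) \<Theta>"
  unfolding lin_map_def lin_map_axioms_def module_hom_Cx_iff
 proof (intro conjI ballI allI)
  show "cspace H" "cspace (free_space (UNIV :: nat set))" by (rule H.cspace_axioms, rule cspace_free)
 next
  fix x show "\<Theta> x : carrier (free_space UNIV)"
   unfolding free_space_simps \<Theta>_def by (auto intro: finite_subset[of _ "{..<card (nws k)}"])
 next
  fix x y assume "x : carrier H" "y : carrier H"
  thus "\<Theta> (x \<oplus>_H y) = \<Theta> x \<oplus>_(free_space UNIV) \<Theta> y"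
   by (simp add: \<Theta>_def free_space_simps fun_eq_iff \<theta>_linear(1)[OF F] del: upt_Suc)
 next
  fix c x assume "x : carrier H"
  thus "\<Theta> (c \<odot>_H x) = c \<odot>_(free_space UNIV) \<Theta> x"
   by (simp add: \<Theta>_def free_space_simps fun_eq_iff \<theta>_linear(2)[OF F] del: upt_Suc)
 qed
 interpret t: lin_map H "free_space UNIV" \<Theta> by (rule lin)
 have ker: "x = \<zero>_H" if x: "x : carrier H" "\<Theta> x = (%_. 0)" for x
 proof (rule row_zero[OF q x(1)])
  fix p assume "p : nws k"
  then obtain m where m: "m < card (nws k)" "p = h m" using h by (auto simp: bij_betw_def)
  thus "\<theta> (Suc k) x (single (snd p)) [0..<Suc k] = 0"
   using fun_cong[OF x(2), of m] by (simp add: \<Theta>_def del: upt_Suc)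
 qed
 have "inj_on \<Theta> (carrier H)"
 proof (rule inj_onI)
  fix x y assume xy: "x : carrier H" "y : carrier H" "\<Theta> x = \<Theta> y"
  have c: "\<Theta> y : carrier (free_space UNIV)" using xy(2) by (rule t.closed)
  have "\<Theta> (x \<ominus>_H y) = \<zero>_(free_space UNIV)"
   unfolding t.diff[OF xy(1,2)] xy(3) using M.minus_eq_zero_iff[OF c c] by simp
  hence "x \<ominus>_H y = \<zero>_H"
   by (intro ker H.minus_closed xy) (simp add: free_space_simps)
  thus "x = y" using H.minus_eq_zero_iff[OF xy(1,2)] by blast
 qed
 thus thesis by (rule that[OF lin])
qed

text \<open>This is the argument with a minimal left ideal of square zero and the trace
  \<open>\<tau>\<close>.\<close>

lemma (in hecke) irreducibles_faithful:
 assumes complete: "complete_irreps TYPE(nat => complex) H \<Lambda> V rho"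
  and q: "q ~= 0" and nz: "!!r. r : {1..Suc k} ==> q_int q r ~= 0"
  and x: "x : carrier H" and kill: "!!i v. i : \<Lambda> ==> v : carrier (V i) ==> rho i x v = \<zero>_(V i)"
 shows "x = \<zero>_H"
proof (rule ccontr)
 assume x0: "x ~= \<zero>_H"
 have irr: "irrep H (V i) (rho i)" if "i : \<Lambda>" for i
  using complete that irreducible_rep_iff[OF H.calg_axioms] unfolding complete_irreps_def by blast
 define J where "J = {x : carrier H. \<forall>i\<in>\<Lambda>. \<forall>v\<in>carrier (V i). rho i x v = \<zero>_(V i)}"
 have LJ: "left_ideal H J"
  unfolding left_ideal_def stable_subset_def
 proof (intro conjI ballI allI)
  show "J <= carrier H" by (auto simp: J_def)
  show "\<zero>_H : J" using irr by (auto simp: J_def irrep_def arep.zero_act)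
 next
  fix x y assume "x : J" "y : J"
  hence xy: "x : carrier H" "y : carrier H"
   "!!i v. i : \<Lambda> ==> v : carrier (V i) ==> rho i x v = \<zero>_(V i) & rho i y v = \<zero>_(V i)"
   by (auto simp: J_def)
  have "rho i (x \<oplus>_H y) v = \<zero>_(V i)" if i: "i : \<Lambda>" and v: "v : carrier (V i)" for i v
  proof -
   interpret Vi: irrep H "V i" "rho i" by (rule irr[OF i])
   show ?thesis using xy(3)[OF i v] by (simp add: Vi.add_act[OF xy(1,2) v])
  qed
  thus "x \<oplus>_H y : J" using xy(1,2) by (simp add: J_def)
 next
  fix c x assume "x : J"
  hence x: "x : carrier H" "!!i v. i : \<Lambda> ==> v : carrier (V i) ==> rho i x v = \<zero>_(V i)"
   by (auto simp: J_def)
  have "rho i (c \<odot>_H x) v = \<zero>_(V i)" if i: "i : \<Lambda>" and v: "v : carrier (V i)" for i v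
  proof -
   interpret Vi: irrep H "V i" "rho i" by (rule irr[OF i])
   show ?thesis using x(2)[OF i v] by (simp add: Vi.smult_act[OF x(1) v])
  qed
  thus "c \<odot>_H x : J" using x(1) by (simp add: J_def)
 next
  fix a x assume "a : carrier H" "x : J"
  hence x: "a : carrier H" "x : carrier H" "!!i v. i : \<Lambda> ==> v : carrier (V i) ==> rho i x v = \<zero>_(V i)"
   by (auto simp: J_def)
  have "rho i (a \<otimes>_H x) v = \<zero>_(V i)" if i: "i : \<Lambda>" and v: "v : carrier (V i)" for i v
  proof -
   interpret Vi: irrep H "V i" "rho i" by (rule irr[OF i])
   show ?thesis using x(3)[OF i v] x(1) by (simp add: Vi.mult_act[OF x(1,2) v] Vi.act_zero)
  qed
  thus "a \<otimes>_H x : J" using x(1,2) by (simp add: J_def)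
 qed
 have J0: "J ~= {\<zero>_H}" using x x0 kill by (auto simp: J_def)
 obtain W where W: "left_ideal H W" "W <= J" "W ~= {\<zero>_H}"
  "!!W'. left_ideal H W' ==> W' <= W ==> W' ~= {\<zero>_H} ==> W' = W"
 proof (rule minimal_left_ideal[OF H.calg_axioms hecke_fin_dim LJ J0])
  fix W assume a: "left_ideal H W" "W <= J" "W ~= {\<zero>_H}"
   "!!W'. left_ideal H W' ==> W' <= W ==> W' ~= {\<zero>_H} ==> W' = W"
  show thesis by (rule that[OF a])
 qed
 obtain \<Theta> :: "(nat list => complex) set => (nat => complex)" where
  \<Theta>: "lin_map H (free_space UNIV) \<Theta>" "inj_on \<Theta> (carrier H)"
  by (rule linear_embedding[OF q])
 obtain X :: "(nat => complex) cspace" and \<pi> where X: "irrep H X \<pi>" "carrier X = \<Theta> ` W" "\<zero>_X = \<Theta> \<zero>_H"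
  "!!a x. a : carrier H ==> x : W ==> \<pi> a (\<Theta> x) = \<Theta> (a \<otimes>_H x)"
 proof (rule left_ideal_rep[OF H.calg_axioms cspace_free W(1,3,4) \<Theta>])
  fix X :: "(nat => complex) cspace" and \<pi>
  assume a: "irrep H X \<pi>" "carrier X = \<Theta> ` W" "\<zero>_X = \<Theta> \<zero>_H"
   "!!a x. a : carrier H ==> x : W ==> \<pi> a (\<Theta> x) = \<Theta> (a \<otimes>_H x)"
  show thesis by (rule that[OF a])
 qed
 interpret X: irrep H X \<pi> by (rule X(1))
 obtain i where i: "i : \<Lambda>" "equivalent_reps H (V i) (rho i) X \<pi>"
  using complete X(1) irreducible_rep_iff[OF H.calg_axioms, of X \<pi>] unfolding complete_irreps_def by blast
 obtain phi where phi: "intertwiner H (V i) (rho i) X \<pi> phi" "bij_betw phi (carrier (V i)) (carrier X)"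
  using i(2) unfolding equivalent_reps_iff by blast
 interpret Vi: irrep H "V i" "rho i" by (rule irr[OF i(1)])
 interpret phi: lin_map "V i" X phi
  using phi(1) by (simp add: intertwiner_def lin_map_def lin_map_axioms_def Vi.V.cspace_axioms X.V.cspace_axioms)
 have WH: "y : carrier H" if "y : W" for y using W(1) that by (auto simp: left_ideal_def stable_subset_def)
 have Wm: "a \<otimes>_H y : W" if "a : carrier H" "y : W" for a y
  using W(1) that by (auto simp: left_ideal_def stable_subset_def)
 have null: "a \<otimes>_H y = \<zero>_H" if a: "a : W" and y: "y : W" for a y
 proof -
  have "\<Theta> y : carrier X" unfolding X(2) using y by (rule imageI)
  then obtain v where v: "v : carrier (V i)" "\<Theta> y = phi v" using phi(2) unfolding bij_betw_def by blast
  have "a : J" using a W(2) by blast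
  hence "rho i a v = \<zero>_(V i)" using i(1) v(1) by (simp add: J_def)
  hence "\<pi> a (phi v) = \<zero>_X" using phi(1) WH[OF a] v(1) unfolding intertwiner_def by (metis phi.zero)
  hence "\<Theta> (a \<otimes>_H y) = \<Theta> \<zero>_H" using X(4)[OF WH[OF a] y] v(2) X(3) by simp
  thus ?thesis by (rule inj_onD[OF \<Theta>(2)]) (use WH[OF a] WH[OF y] in auto)
 qed
 have "y = \<zero>_H" if y: "y : W" for y
 proof (rule \<tau>_nondegenerate[OF q WH[OF y]])
  fix h assume h: "h : carrier H"
  have yh: "y \<otimes>_H h : carrier H" using WH[OF y] h by simp
  have "(y \<otimes>_H h) \<otimes>_H (y \<otimes>_H h) = (y \<otimes>_H (h \<otimes>_H y)) \<otimes>_H h"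
   using WH[OF y] h by (simp add: H.m_assoc)
  also have "... = \<zero>_H" using null[OF y Wm[OF h y]] h by simp
  finally show "\<tau> (y \<otimes>_H h) = 0" by (intro \<tau>_eq_0[OF q nz yh] qtr_square_zero[OF yh])
 qed
 hence "W <= {\<zero>_H}" by blast
 moreover have "\<zero>_H : W" using W(1) by (auto simp: left_ideal_def stable_subset_def)
 ultimately show False using W(3) by blast
qed

lemma (in hecke) hecke_matrix_units:
 assumes complete: "complete_irreps TYPE(nat => complex) H \<Lambda> V rho"
  and q: "q ~= 0" and nz: "poincare k q ~= 0"
 obtains B u b where "matrix_reps H \<Lambda> B u V rho b b" "(\<Sum>i\<in>\<Lambda>. (card (B i))\<^sup>2) = fact (Suc k)"
proof -
 interpret F: irrep_family H \<Lambda> V rho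
 proof (rule irrep_family.intro[OF H.calg_axioms], rule irrep_family_axioms.intro)
  show "irrep H (V i) (rho i)" if "i : \<Lambda>" for i
   using complete that irreducible_rep_iff[OF H.calg_axioms] unfolding complete_irreps_def by blast
  show "\<not> equivalent_reps H (V i) (rho i) (V j) (rho j)" if "i : \<Lambda>" "j : \<Lambda>" "i ~= j" for i j
   using complete that unfolding complete_irreps_def by blast
  show "vectorspace.fin_dim Cx H" by (rule hecke_fin_dim)
 qed
 show thesis
 proof (rule F.matrix_units_exist)
  fix x assume x: "x : carrier H" and k: "!!i v. i : \<Lambda> ==> v : carrier (V i) ==> rho i x v = \<zero>_(V i)"
  show "x = \<zero>_H" by (rule irreducibles_faithful[OF complete q poincare_nonzero[OF nz] x k])
 next
  fix B u b assume R: "matrix_reps H \<Lambda> B u V rho b b"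
  have "(\<Sum>i\<in>\<Lambda>. (card (B i))\<^sup>2) = fact (Suc k)"
   using matrix_reps.dimension[OF R] hecke_dim[OF q] by simp
  thus thesis by (rule that[OF R])
 qed
qed

section \<open>Binary words and the generators of the type A algebra\<close>

lemma swap_eval: "(sw i d) a = (if a = i then d (i + 1) else if a = i + 1 then d i else d a)"
 by (simp add: act_def Transposition.transpose_def)

lemma swap_eval_Suc: "(Transposition.transpose i (Suc i) \<triangleright> d) a = (if a = i then d (Suc i) else if a = Suc i then d i else d a)"
 by (simp add: act_def Transposition.transpose_def)

lemma swap_swap: "(sw i (sw i d)) = d"
 by (rule ext) (simp add: swap_eval)

lemma swap_commute: "i + 2 <= j | j + 2 <= i ==> (sw i (sw j d)) = (sw j (sw i d))"
 by (rule ext) (auto simp: swap_eval)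

lemma swap_braid: "(sw i (sw (i + 1) (sw i d)))
  = adj_swap (i + 1) \<triangleright> (sw i (sw (i + 1) d))"
 by (rule ext) (auto simp: swap_eval)

lemma swap_fixed: "(sw i d) = d \<longleftrightarrow> d i = d (i + 1)"
 by (auto simp: swap_eval fun_eq_iff)

text \<open>For a letter \<open>x\<close> of \<open>d\<close> in position \<open>i\<close>, \<open>cnt x
  d i\<close> is its rank among the equal letters.\<close>

primrec cnt :: "nat => (nat => nat) => nat => nat" where
 "cnt x d 0 = 0"
| "cnt x d (Suc i) = cnt x d i + (if d (Suc i) = x then 1 else 0)"

lemma cnt_below: "(!!a. 1 <= a ==> a <= i ==> d a = d' a) ==> cnt x d i = cnt x d' i"
 by (induction i) auto

lemma cnt_swap:
 assumes "1 <= k" "i ~= k" shows "cnt x (sw k d) i = cnt x d i"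
proof (cases "i < k")
 case True
 thus ?thesis by (intro cnt_below) (simp add: swap_eval)
next
 case False
 hence "Suc k <= i" using assms by simp
 thus ?thesis
 proof (induction rule: dec_induct)
  case base
  obtain k' where k: "k = Suc k'" using assms by (cases k) auto
  have "cnt x (sw k d) k' = cnt x d k'" by (rule cnt_below) (simp add: swap_eval_Suc k Suc_eq_plus1[symmetric])
  moreover have "(sw k d) (Suc k') = d (Suc (Suc k'))" "(sw k d) (Suc (Suc k')) = d (Suc k')"
   unfolding swap_eval by (simp_all add: k Suc_eq_plus1[symmetric])
  ultimately show ?case unfolding k by simp
 qed (simp add: swap_eval)
qed

lemma cnt_mono: "i <= j ==> cnt x d i <= cnt x d j"
 by (induction rule: dec_induct) auto

lemma cnt_le: "cnt x d i <= i"
 by (induction i) auto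

lemma cnt_all: "(!!a. 1 <= a ==> a <= i ==> d a = x) ==> cnt x d i = i"
 by (induction i) auto

lemma cnt_none: "i <= j ==> (!!a. i < a ==> a <= j ==> d a ~= x) ==> cnt x d j = cnt x d i"
 by (induction rule: dec_induct) auto

lemma Dset_binary: "d : Dset m n ==> a : {1..m+n+2} ==> d a = 0 | d a = 1"
 by (auto simp: Dset_def PiE_iff)

lemma Dset_sum_cnt:
 assumes d: "d : Dset m n" and i: "i <= m + n + 2"
 shows "cnt 1 d i = (\<Sum>a\<in>{1..i}. d a)" "cnt 0 d i + cnt 1 d i = i"
proof -
 have "cnt 1 d i = (\<Sum>a\<in>{1..i}. d a) & cnt 0 d i + cnt 1 d i = i"
  using i
 proof (induction i)
  case (Suc i)
  thus ?case using Dset_binary[OF d, of "Suc i"] by (auto simp: One_nat_def)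
 qed simp
 thus "cnt 1 d i = (\<Sum>a\<in>{1..i}. d a)" "cnt 0 d i + cnt 1 d i = i" by blast+
qed

lemma Dset_cnt:
 assumes d: "d : Dset m n"
 shows "cnt 0 d (m + n + 2) = m + 1" "cnt 1 d (m + n + 2) = n + 1"
 using Dset_sum_cnt[OF d order.refl] d by (simp_all add: Dset_def)

lemma Dset_swap:
 assumes d: "d : Dset m n" and i: "i : {1..m+n+1}"
 shows "(sw i d) : Dset m n"
proof -
 have p: "adj_swap i permutes {1..m+n+2}" by (rule permutes_swap_id) (use i in auto)
 have e: "(sw i d) = d \<circ> adj_swap i" by (simp add: act_def)
 have "(\<Sum>a\<in>{1..m+n+2}. (sw i d) a) = (\<Sum>a\<in>{1..m+n+2}. d a)"
  unfolding e by (rule sum.permute[OF p, symmetric])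
 moreover have "(sw i d) : {1..m+n+2} \<rightarrow>\<^sub>E {0, 1}"
 proof (rule PiE_I)
  fix a assume "a : {1..m+n+2}"
  thus "(sw i d) a : {0, 1}" using d i by (auto simp: swap_eval Dset_def PiE_iff)
 next
  fix a assume "a ~: {1..m+n+2}"
  thus "(sw i d) a = undefined" using d i by (auto simp: swap_eval Dset_def PiE_iff extensional_def)
 qed
 ultimately show ?thesis using d by (simp add: Dset_def)
qed

lemma cnt_range:
 assumes d: "d : Dset m n" and i: "i : {1..m+n+1}" and x: "d i = x" "d (i + 1) = x"
 shows "cnt x d i : {1..if x = 0 then m else n}"
proof -
 obtain i' where i': "i = Suc i'" using i by (cases i) auto
 have "cnt x d (Suc i) <= cnt x d (m + n + 2)" by (rule cnt_mono) (use i in auto)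
 moreover have "x = 0 | x = 1" using Dset_binary[OF d, of i] i x by auto
 moreover have "1 <= cnt x d i" using x by (simp add: i')
 moreover have "cnt x d (Suc i) = Suc (cnt x d i)" using x by (simp add: Suc_eq_plus1[symmetric])
 ultimately show ?thesis using Dset_cnt[OF d] by auto
qed

lemma cnt_far:
 assumes "i + 2 <= j" "d (i + 1) = x" "d j = x" shows "cnt x d i + 2 <= cnt x d j"
proof -
 obtain j' where j: "j = Suc j'" using assms by (cases j) auto
 have "cnt x d (Suc i) <= cnt x d j'" by (rule cnt_mono) (use assms j in simp)
 thus ?thesis using assms by (simp add: j Suc_eq_plus1[symmetric])
qed

definition base :: "nat => nat => nat => nat" where
 "base m n = (\<lambda>i\<in>{1..m+n+2}. if i <= m + 1 then 0 else 1)"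

lemma base_in: "base m n : Dset m n"
proof -
 have "(\<Sum>i\<in>{1..m+n+2}. base m n i) = (\<Sum>i\<in>{1..m+n+2}. if i : {m+2..m+n+2} then 1 else 0)"
  by (rule sum.cong) (auto simp: base_def)
 also have "... = card ({1..m+n+2} \<inter> {m+2..m+n+2})" by (simp only: sum.inter_restrict[symmetric] finite_atLeastAtMost card_eq_sum)
 also have "{1..m+n+2} \<inter> {m+2..m+n+2} = {m+2..m+n+2}" by auto
 finally show ?thesis by (auto simp: Dset_def base_def)
qed

definition desc :: "nat => nat => (nat => nat) => nat => bool" where
 "desc m n d k \<longleftrightarrow> k : {1..m+n+1} & d k = 1 & d (k + 1) = 0"

text \<open>A word without descents is increasing, and the number of ones determines it.\<close>

lemma no_desc_base:
 assumes d: "d : Dset m n" and nd: "!!k. \<not> desc m n d k"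
 shows "d = base m n"
proof
 have zeros: "d a = 0" if "d i = 0" "1 <= a" "a <= i" "i <= m + n + 2" for a i
  using that
 proof (induction i)
  case (Suc i)
  show ?case
  proof (cases "a = Suc i")
   case False
   hence i: "1 <= i" using Suc.prems by simp
   hence "d i = 0" using nd[of i] Suc.prems Dset_binary[OF d, of i] by (auto simp: desc_def Suc_eq_plus1[symmetric])
   thus ?thesis using Suc False by simp
  qed (use Suc in simp)
 qed simp
 fix i show "d i = base m n i"
 proof (cases "i : {1..m+n+2}")
  case i: True
  show ?thesis
  proof (cases "i <= m + 1")
   case True
   have "d i ~= 1"
   proof
    assume "d i = 1"
    have "d a ~= 0" if "i - 1 < a" "a <= m + n + 2" for a
    proof
     assume "d a = 0"
     hence "d i = 0" by (rule zeros[of a i]) (use that i in auto)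
     thus False using \<open>d i = 1\<close> by simp
    qed
    hence "cnt 0 d (m + n + 2) = cnt 0 d (i - 1)" by (intro cnt_none) (use i in auto)
    thus False using Dset_cnt[OF d] cnt_le[of 0 d "i - 1"] True i by simp
   qed
   thus ?thesis using Dset_binary[OF d i] i True by (auto simp: base_def)
  next
   case False
   have "d i ~= 0"
   proof
    assume "d i = 0"
    hence "cnt 0 d i = i" using zeros[of i] i by (intro cnt_all) auto
    thus False using cnt_mono[of i "m + n + 2" 0 d] Dset_cnt[OF d] False i by simp
   qed
   thus ?thesis using Dset_binary[OF d i] i False by (auto simp: base_def)
  qed
 next
  case False
  thus ?thesis using d by (auto simp: base_def Dset_def PiE_iff extensional_def)
 qed
qed

text \<open>A statistic that drops by one when a descent is removed; it serves as fuel for the recursion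
  along a sorting path.\<close>

definition height :: "nat => nat => (nat => nat) => nat" where
 "height m n d = (\<Sum>i\<in>{1..m+n+2}. cnt 1 d i)"

lemma height_swap:
 assumes k: "desc m n d k"
 shows "height m n d = Suc (height m n (sw k d))"
proof -
 have kI: "1 <= k" "k : {1..m+n+2}" and dk: "d k = 1" "d (k + 1) = 0" using k by (auto simp: desc_def)
 obtain k' where k': "k = Suc k'" using kI by (cases k) auto
 have "cnt 1 d k = Suc (cnt 1 (sw k d) k)"
  using cnt_swap[OF kI(1), of k' 1 d] dk by (simp add: k' swap_eval_Suc Suc_eq_plus1[symmetric])
 thus ?thesis
  unfolding height_def sum.remove[OF finite_atLeastAtMost kI(2)]
  by (simp add: cnt_swap[OF kI(1)])
qed

lemma base_no_desc: "\<not> desc m n (base m n) k"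
 by (auto simp: desc_def base_def split: if_splits)

lemma finite_Dset: "finite (Dset m n)"
 by (rule finite_subset[of _ "{1..m+n+2} \<rightarrow>\<^sub>E {0, 1}"]) (auto simp: Dset_def intro!: finite_PiE)

lemma typeA_presentation: "presentation (A_gens m n) (A_relations q m n)"
proof
 fix x y
 let ?F = "free_algebra (A_gens m n)"
 interpret F: calg ?F by (rule calg_free_algebra)
 have E: "free_gen (GenE d) : carrier ?F" if "d : Dset m n" for d
  by (rule free_gen_closed) (use that in \<open>simp add: A_gens_def\<close>)
 have T: "free_gen (GenT i d) : carrier ?F" if "d : Dset m n" "i : {1..m+n+1}" for i d
  by (rule free_gen_closed) (use that in \<open>simp add: A_gens_def\<close>)
 have s: "(\<Oplus>_?F d\<in>Dset m n. free_gen (GenE d)) : carrier ?F" by (rule F.finsum_closed) (use E in auto)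
 assume "(x, y) : A_relations q m n"
 thus "x : carrier ?F & y : carrier ?F"
  unfolding A_relations_def Let_def
  by (elim UnE CollectE exE conjE Pair_inject insertE emptyE)
    (simp_all only: E T s Dset_swap F.m_closed F.a_closed F.minus_closed F.smult_closed F.one_closed F.zero_closed simp_thms)
qed

locale typeA =
 fixes q :: complex and m n :: nat
begin

abbreviation "A \<equiv> A_algebra q m n"
abbreviation "D \<equiv> Dset m n"
abbreviation "N1 \<equiv> {1..m+n+1}"
abbreviation "E \<equiv> A_E q m n"
abbreviation "T \<equiv> A_T q m n"
abbreviation "d0 \<equiv> base m n"

sublocale Pr: presentation "A_gens m n" "A_relations q m n" by (rule typeA_presentation)

lemma A_eq: "A = presented_algebra (A_gens m n) (A_relations q m n)" by (simp add: A_algebra_def)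

sublocale A: calg A using Pr.calg_presented by (simp add: A_eq)

lemma E_closed [simp, intro]: "d : D ==> E d : carrier A"
 using Pr.gen_closed[of "GenE d"] by (simp add: A_E_def A_eq A_gens_def)

lemma T_closed [simp, intro]: "i : N1 ==> d : D ==> T i d : carrier A"
 using Pr.gen_closed[of "GenT i d"] by (simp add: A_T_def A_eq A_gens_def)

lemma proj_E: "Pr.proj (free_gen (GenE d)) = E d" and proj_T: "Pr.proj (free_gen (GenT i d)) = T i d"
 by (simp_all add: A_E_def A_T_def presented_gen_def)

lemma free_closed: "d : D ==> free_gen (GenE d) : carrier Pr.F"
 "i : N1 ==> d : D ==> free_gen (GenT i d) : carrier Pr.F"
 by (rule free_gen_closed, simp add: A_gens_def)+

sublocale pr: alg_map Pr.F A "%x. Pr.proj x"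
 using Pr.pr.alg_map_axioms by (simp add: A_eq)

lemma E_mult: "d : D ==> d' : D ==> E d \<otimes>_A E d' = (if d = d' then E d else \<zero>_A)"
proof -
 assume d: "d : D" "d' : D"
 have "(free_gen (GenE d) \<otimes>_Pr.F free_gen (GenE d'), if d = d' then free_gen (GenE d) else \<zero>_Pr.F) : A_relations q m n"
  unfolding A_relations_def Let_def using d by (cases "d = d'") auto
 from Pr.proj_rel[OF this] show ?thesis
  using pr.mult[OF free_closed(1)[OF d(1)] free_closed(1)[OF d(2)]] by (auto simp: proj_E A_eq)
qed

lemma E_sum: "(\<Oplus>_A d\<in>D. E d) = \<one>_A"
proof -
 have "(\<Oplus>_Pr.F d\<in>D. free_gen (GenE d), \<one>_Pr.F) : A_relations q m n"
  unfolding A_relations_def Let_def by simp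
 from Pr.proj_rel[OF this] show ?thesis
  using pr.finsum[of D "%d. free_gen (GenE d)"] pr.one free_closed(1) by (simp add: proj_E)
qed

lemma T_corner:
 assumes "i : N1" "d : D"
 shows "E (sw i d) \<otimes>_A T i d = T i d" "T i d \<otimes>_A E d = T i d"
proof -
 note c = free_closed(2)[OF assms] free_closed(1)[OF assms(2)] free_closed(1)[OF Dset_swap[OF assms(2,1)]]
 note c' = E_closed[OF Dset_swap[OF assms(2,1)]] T_closed[OF assms] E_closed[OF assms(2)]
 have "(free_gen (GenE (sw i d)) \<otimes>_Pr.F free_gen (GenT i d) \<otimes>_Pr.F free_gen (GenE d), free_gen (GenT i d)) : A_relations q m n"
  unfolding A_relations_def Let_def
  by (rule UnI1, rule UnI1, rule UnI1, rule UnI1, rule UnI1, rule UnI1, rule UnI2, rule CollectI, rule exI[of _ i], rule exI[of _ d]) (simp only: assms simp_thms)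
 from Pr.proj_rel[OF this] have e: "E (sw i d) \<otimes>_A T i d \<otimes>_A E d = T i d"
  using c by (simp only: pr.mult Pr.F.m_closed proj_E proj_T)
 have "E (sw i d) \<otimes>_A (E (sw i d) \<otimes>_A T i d \<otimes>_A E d) = E (sw i d) \<otimes>_A T i d \<otimes>_A E d"
  using c' E_mult[OF Dset_swap[OF assms(2,1)] Dset_swap[OF assms(2,1)]] by (simp flip: A.m_assoc)
 thus "E (sw i d) \<otimes>_A T i d = T i d" unfolding e .
 have "E (sw i d) \<otimes>_A T i d \<otimes>_A E d \<otimes>_A E d = E (sw i d) \<otimes>_A T i d \<otimes>_A E d"
  using c' E_mult[OF assms(2,2)] by (simp add: A.m_assoc)
 thus "T i d \<otimes>_A E d = T i d" unfolding e .
qed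

lemma T_quadratic:
 assumes i: "i : N1" "d : D" "d i = d (i + 1)"
 shows "T i d \<otimes>_A T i d = (q - 1) \<odot>_A T i d \<oplus>_A q \<odot>_A E d"
proof -
 have fix_d: "(sw i d) = d" using i(3) by (simp only: swap_fixed)
 note c = free_closed(2)[OF i(1,2)] free_closed(1)[OF i(2)]
 have "((free_gen (GenT i d) \<ominus>_Pr.F q \<odot>_Pr.F free_gen (GenE d)) \<otimes>_Pr.F (free_gen (GenT i d) \<oplus>_Pr.F free_gen (GenE d)), \<zero>_Pr.F) : A_relations q m n"
  unfolding A_relations_def Let_def
  by (rule UnI1, rule UnI1, rule UnI1, rule UnI2, rule CollectI, rule exI[of _ i], rule exI[of _ d]) (simp only: i(1,2) fix_d simp_thms)
 from Pr.proj_rel[OF this] have "(T i d \<ominus>_A q \<odot>_A E d) \<otimes>_A (T i d \<oplus>_A E d) = \<zero>_A"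
  using c by (simp add: proj_E proj_T A_eq)
 hence "T i d \<otimes>_A T i d \<ominus>_A ((q - 1) \<odot>_A T i d \<oplus>_A q \<odot>_A E d) = \<zero>_A"
  using A.quadratic_form[of "T i d" "E d" q] i T_corner[OF i(1,2)] E_mult[OF i(2,2)] fix_d by simp
 thus ?thesis using i by (subst (asm) A.minus_eq_zero_iff) auto
qed

lemma T_inverse:
 assumes i: "i : N1" "d : D" "d i ~= d (i + 1)"
 shows "T i (sw i d) \<otimes>_A T i d = E d"
proof -
 have n: "(sw i d) ~= d" using i(3) by (simp only: swap_fixed not_False_eq_True)
 note c = free_closed(2)[OF i(1,2)] free_closed(2)[OF i(1) Dset_swap[OF i(2,1)]]
 have "(free_gen (GenT i (sw i d)) \<otimes>_Pr.F free_gen (GenT i d), free_gen (GenE d)) : A_relations q m n"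
  unfolding A_relations_def Let_def
  by (rule UnI1, rule UnI1, rule UnI2, rule CollectI, rule exI[of _ i], rule exI[of _ d]) (simp only: i(1,2) n simp_thms not_False_eq_True)
 from Pr.proj_rel[OF this] show ?thesis using c by (simp only: pr.mult proj_E proj_T)
qed

lemma T_braid:
 assumes i: "i : N1" "j : N1" "d : D" "i = j + 1 | j = i + 1"
 shows "T i (sw j (sw i d)) \<otimes>_A T j (sw i d) \<otimes>_A T i d
    = T j (sw i (sw j d)) \<otimes>_A T i (sw j d) \<otimes>_A T j d"
proof -
 have a: "\<bar>int i - int j\<bar> = 1" using i(4) by auto
 have "(free_gen (GenT i (sw j (sw i d))) \<otimes>_Pr.F free_gen (GenT j (sw i d)) \<otimes>_Pr.F free_gen (GenT i d),
   free_gen (GenT j (sw i (sw j d))) \<otimes>_Pr.F free_gen (GenT i (sw j d)) \<otimes>_Pr.F free_gen (GenT j d)) : A_relations q m n"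
  unfolding A_relations_def Let_def
  by (rule UnI1, rule UnI2, rule CollectI, rule exI[of _ i], rule exI[of _ j], rule exI[of _ d]) (simp only: i(1-3) a simp_thms)
 from Pr.proj_rel[OF this] show ?thesis
  by (simp only: pr.mult Pr.F.m_closed proj_T free_closed i Dset_swap)
qed

lemma T_commute:
 assumes i: "i : N1" "j : N1" "d : D" "i + 2 <= j | j + 2 <= i"
 shows "T i (sw j d) \<otimes>_A T j d = T j (sw i d) \<otimes>_A T i d"
proof -
 have a: "\<bar>int i - int j\<bar> \<ge> 2" using i(4) by auto
 have "(free_gen (GenT i (sw j d)) \<otimes>_Pr.F free_gen (GenT j d),
   free_gen (GenT j (sw i d)) \<otimes>_Pr.F free_gen (GenT i d)) : A_relations q m n"
  unfolding A_relations_def Let_def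
  by (rule UnI2, rule CollectI, rule exI[of _ i], rule exI[of _ j], rule exI[of _ d]) (simp only: i(1-3) a simp_thms)
 from Pr.proj_rel[OF this] show ?thesis
  by (simp only: pr.mult Pr.F.m_closed proj_T free_closed i Dset_swap)
qed

section \<open>Transport along paths of binary words\<close>

text \<open>A path from the sorted word to \<open>d\<close>: remove some descent of \<open>d\<close> and
  continue; the first argument bounds the number of steps.\<close>

primrec Xf :: "nat => (nat => nat) => (agen list => complex) set" where
 "Xf 0 d = E d"
| "Xf (Suc c) d = (let k = (SOME k. desc m n d k) in
   if desc m n d k then T k (sw k d) \<otimes>_A Xf c (sw k d) else E d)"

primrec Yf :: "nat => (nat => nat) => (agen list => complex) set" where
 "Yf 0 d = E d"
| "Yf (Suc c) d = (let k = (SOME k. desc m n d k) in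
   if desc m n d k then Yf c (sw k d) \<otimes>_A T k d else E d)"

definition X where "X d = Xf (height m n d) d"
definition Y where "Y d = Yf (height m n d) d"

lemma X_step:
 assumes "desc m n d j"
 obtains k where "desc m n d k" "X d = T k (sw k d) \<otimes>_A X (sw k d)"
  "Y d = Y (sw k d) \<otimes>_A T k d"
proof -
 define k where "k = (SOME k. desc m n d k)"
 have k: "desc m n d k" using assms someI[of "desc m n d" j] by (simp add: k_def)
 show thesis
  by (rule that[of k, OF k])
    (simp_all add: X_def Y_def height_swap[OF k] Let_def flip: k_def, simp_all add: k)
qed

lemma X_base: "X d0 = E d0" "Y d0 = E d0"
proof -
 have "Xf c d0 = E d0" "Yf c d0 = E d0" for c by (cases c; simp add: base_no_desc Let_def)+
 thus "X d0 = E d0" "Y d0 = E d0" by (simp_all add: X_def Y_def)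
qed

lemma height_induct [consumes 1, case_names base step]:
 assumes d: "d : D" and base: "Q d0"
  and step: "!!d k. d : D ==> desc m n d k ==>
    (!!d'. d' : D ==> height m n d' < height m n d ==> Q d') ==>
    X d = T k (sw k d) \<otimes>_A X (sw k d) ==> Y d = Y (sw k d) \<otimes>_A T k d ==> Q d"
 shows "Q d"
 using d
proof (induction "height m n d" arbitrary: d rule: less_induct)
 case less
 show ?case
 proof (cases "EX k. desc m n d k")
  case True
  then obtain j where "desc m n d j" by blast
  thus ?thesis
  proof (rule X_step)
   fix k assume k: "desc m n d k" "X d = T k (sw k d) \<otimes>_A X (sw k d)"
    "Y d = Y (sw k d) \<otimes>_A T k d"
   show "Q d" by (rule step[OF less.prems k(1) less.hyps k(2,3)])
  qed
 next
  case False
  hence "d = d0" using no_desc_base[OF less.prems] by blast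
  thus ?thesis using base by simp
 qed
qed

lemma desc_swap:
 assumes "desc m n d k" "d : D"
 shows "k : N1" "(sw k d) : D" "d k ~= d (k + 1)" "height m n (sw k d) < height m n d"
proof -
 show "k : N1" "d k ~= d (k + 1)" using assms(1) by (auto simp: desc_def)
 thus "(sw k d) : D" by (intro Dset_swap assms(2))
 show "height m n (sw k d) < height m n d" using height_swap[OF assms(1)] by simp
qed

lemma XY:
 assumes "d : D"
 shows X_closed: "X d : carrier A" and Y_closed: "Y d : carrier A"
  and X_left: "E d \<otimes>_A X d = X d" and X_right: "X d \<otimes>_A E d0 = X d"
  and Y_right: "Y d \<otimes>_A E d = Y d" and Y_left: "E d0 \<otimes>_A Y d = Y d"
  and YX: "Y d \<otimes>_A X d = E d0" and XY_E: "X d \<otimes>_A Y d = E d"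
proof -
 have "X d : carrier A & Y d : carrier A & E d \<otimes>_A X d = X d & X d \<otimes>_A E d0 = X d \<and>
  Y d \<otimes>_A E d = Y d & E d0 \<otimes>_A Y d = Y d & Y d \<otimes>_A X d = E d0 & X d \<otimes>_A Y d = E d"
  using assms
 proof (induction rule: height_induct)
  case base
  thus ?case using E_mult[OF base_in base_in] base_in by (simp add: X_base)
 next
  case (step d k)
  define e where "e = (sw k d)"
  note k = desc_swap[OF step(2,1), folded e_def]
  have ee: "(sw k e) = d" by (simp only: e_def swap_swap)
  have nk: "e k ~= e (k + 1)" using k(3) by (auto simp: e_def swap_eval)
  note IH = step.IH[OF k(2,4)]
  have IH': "X e : carrier A" "Y e : carrier A" "E e \<otimes>_A X e = X e" "X e \<otimes>_A E d0 = X e"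
   "Y e \<otimes>_A E e = Y e" "E d0 \<otimes>_A Y e = Y e" "Y e \<otimes>_A X e = E d0" "X e \<otimes>_A Y e = E e"
   using IH by blast+
  note c = T_closed[OF k(1,2)] T_closed[OF k(1) step(1)] E_closed[OF k(2)] E_closed[OF step(1)]
   E_closed[OF base_in]
  have XY: "X d = T k e \<otimes>_A X e" "Y d = Y e \<otimes>_A T k d" using step(3,4) by (simp_all add: e_def)
  have inv1: "T k e \<otimes>_A T k d = E d" using T_inverse[OF k(1) step(1) k(3)] by (simp add: e_def)
  have inv2: "T k d \<otimes>_A T k e = E e" using T_inverse[OF k(1,2) nk] by (simp only: ee)
  have corner: "E d \<otimes>_A T k e = T k e" "T k e \<otimes>_A E e = T k e" "E e \<otimes>_A T k d = T k d" "T k d \<otimes>_A E d = T k d"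
   using T_corner[OF k(1,2)] T_corner[OF k(1) step(1)] by (simp_all only: ee e_def[symmetric])
  have "Y d \<otimes>_A X d = Y e \<otimes>_A (T k d \<otimes>_A T k e) \<otimes>_A X e"
   unfolding XY using c IH'(1,2) by (simp add: A.m_assoc)
  hence 1: "Y d \<otimes>_A X d = E d0" using IH' inv2 by simp
  have "X d \<otimes>_A Y d = T k e \<otimes>_A (X e \<otimes>_A Y e) \<otimes>_A T k d"
   unfolding XY using c IH'(1,2) by (simp add: A.m_assoc)
  hence 2: "X d \<otimes>_A Y d = E d" using IH' inv1 corner by simp
  have 3: "E d \<otimes>_A X d = X d" "E d0 \<otimes>_A Y d = Y d"
   unfolding XY using c IH'(1,2) corner IH'(6) by (simp_all flip: A.m_assoc)
  have 4: "X d \<otimes>_A E d0 = X d" "Y d \<otimes>_A E d = Y d"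
   unfolding XY using c IH'(1,2) corner IH'(4) by (simp_all add: A.m_assoc)
  show ?case using 1 2 3 4 c IH'(1,2) by (simp add: XY)
 qed
 thus "X d : carrier A" "Y d : carrier A" "E d \<otimes>_A X d = X d" "X d \<otimes>_A E d0 = X d"
  "Y d \<otimes>_A E d = Y d" "E d0 \<otimes>_A Y d = Y d" "Y d \<otimes>_A X d = E d0" "X d \<otimes>_A Y d = E d" by blast+
qed

text \<open>Two distinct descents are never adjacent, so the corresponding arrows commute and any descent
  may be removed first.\<close>

lemma X_desc:
 assumes "d : D" "desc m n d i"
 shows "X d = T i (sw i d) \<otimes>_A X (sw i d)"
 using assms
proof (induction arbitrary: i rule: height_induct)
 case base
 thus ?case by (simp add: base_no_desc)
next
 case (step d k)
 note k = desc_swap[OF step(2,1)] and i = desc_swap[OF step.prems step(1)]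
 show ?case
 proof (cases "i = k")
  case True thus ?thesis using step(3) by simp
 next
  case False
  hence far: "i + 2 <= k | k + 2 <= i"
  proof -
   have "i ~= k + 1" "k ~= i + 1" using step(2) step.prems by (auto simp: desc_def)
   thus ?thesis using False by linarith
  qed
  have di: "desc m n (sw k d) i" "desc m n (sw i d) k"
   using step(2) step.prems far unfolding desc_def by (auto simp: swap_eval)
  define e where "e = (sw i (sw k d))"
  have e': "(sw k (sw i d)) = e" using swap_commute[OF far] by (simp only: e_def)
  have eD: "e : D" unfolding e_def by (intro Dset_swap k(1,2) i(1))
  have se: "(sw i e) = (sw k d)" "(sw k e) = (sw i d)"
   by (simp only: e_def swap_swap) (simp only: e'[symmetric] swap_swap)
  have "X d = T k (sw k d) \<otimes>_A (T i e \<otimes>_A X e)"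
   using step(3) step.IH[OF k(2,4) di(1)] by (simp only: e_def)
  also have "... = T k (sw i e) \<otimes>_A T i e \<otimes>_A X e"
   unfolding se using k(1,2) i(1) eD X_closed[OF eD] by (simp add: A.m_assoc)
  also have "... = T i (sw k e) \<otimes>_A T k e \<otimes>_A X e"
   using T_commute[OF i(1) k(1) eD far] by simp
  also have "... = T i (sw i d) \<otimes>_A (T k e \<otimes>_A X e)"
   unfolding se using k(1) i(1,2) eD X_closed[OF eD] by (simp add: A.m_assoc)
  also have "T k e \<otimes>_A X e = X (sw i d)"
   using step.IH[OF i(2,4) di(2)] by (simp only: e')
  finally show ?thesis .
 qed
qed

text \<open>The loop generators at the sorted word, numbered within the block of zeros (\<open>x =
  0\<close>) or of ones (\<open>x = 1\<close>).\<close>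

definition G :: "nat => nat => (agen list => complex) set" where "G x c = T (if x = 0 then c else m + 1 + c) d0"

lemma base_cnt: "i : {1..m+n+2} ==> (if d0 i = 0 then cnt (d0 i) d0 i else m + 1 + cnt (d0 i) d0 i) = i"
proof -
 assume i: "i : {1..m+n+2}"
 have z: "cnt 0 d0 j = j" if "j <= m + 1" for j by (rule cnt_all) (use that in \<open>auto simp: base_def\<close>)
 show ?thesis
 proof (cases "i <= m + 1")
  case True thus ?thesis using i z by (auto simp: base_def)
 next
  case False
  have "cnt 0 d0 i = cnt 0 d0 (m + 1)" by (rule cnt_none) (use False i in \<open>auto simp: base_def\<close>)
  thus ?thesis using Dset_sum_cnt(2)[OF base_in, of i m n] z[of "m + 1"] i False by (auto simp: base_def)
 qed
qed

text \<open>For distinct letters this is the freedom in choosing a descent, applied to \<open>d\<close>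
  or to the word with the two letters exchanged. For equal letters, induct on a descent \<open>k\<close>
  of \<open>d\<close>: if it is far from \<open>i\<close>, commute; if it is adjacent, remove two
  descents and apply the braid relation, which moves the loop from position \<open>i\<close> to position
  \<open>k\<close>. The rank of the letter is unchanged in both cases.\<close>

lemma T_X:
 assumes "d : D" "i : N1"
 shows "T i d \<otimes>_A X d = (if d i ~= d (i + 1) then X (sw i d) else X d \<otimes>_A G (d i) (cnt (d i) d i))"
proof (cases "d i = d (i + 1)")
 case False
 note s = Dset_swap[OF assms]
 consider "desc m n d i" | "desc m n (sw i d) i"
  using False assms(2) Dset_binary[OF assms(1), of i] Dset_binary[OF assms(1), of "i + 1"]
  unfolding desc_def by (auto simp: swap_eval)
 hence "T i d \<otimes>_A X d = X (sw i d)"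
 proof cases
  case 1
  have "T i d \<otimes>_A X d = T i (sw i (sw i d)) \<otimes>_A T i (sw i d) \<otimes>_A X (sw i d)"
   unfolding X_desc[OF assms(1) 1] swap_swap using assms s X_closed[OF s] by (simp add: A.m_assoc)
  also have "T i (sw i (sw i d)) \<otimes>_A T i (sw i d) = E (sw i d)"
   by (rule T_inverse[OF assms(2) s]) (use False in \<open>simp add: swap_eval\<close>)
  finally show ?thesis using X_left[OF s] by simp
 next
  case 2
  show ?thesis using X_desc[OF s 2] by (simp only: swap_swap)
 qed
 thus ?thesis using False by simp
next
 case True
 have "T i d \<otimes>_A X d = X d \<otimes>_A G (d i) (cnt (d i) d i)"
  using assms True
 proof (induction arbitrary: i rule: height_induct)
  case base
  have "G (d0 i) (cnt (d0 i) d0 i) = T i d0" unfolding G_def using base_cnt[of i] base(1) by simp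
  moreover have "(sw i d0) = d0" using base(2) by (simp only: swap_fixed)
  ultimately show ?case using T_corner[OF base(1) base_in] by (simp add: X_base)
 next
  case (step d k)
  note k = desc_swap[OF step(2,1)] and i = step.prems(1)
  define e where "e = (sw k d)"
  have e: "e : D" "(sw k e) = d" "height m n e < height m n d" using k by (simp_all only: e_def swap_swap)
  have Xd: "X d = T k e \<otimes>_A X e" using step(3) by (simp add: e_def)
  have k1: "1 <= k" using k(1) by simp
  have Gc: "G (d i) (cnt (d i) d i) : carrier A"
   unfolding G_def using cnt_range[OF step(1) i refl step.prems(2)[symmetric]] base_in by (intro T_closed) (auto split: if_splits)
  have fix_i: "(sw i d) = d" using step.prems(2) by (simp only: swap_fixed)
  show ?case
  proof (cases "i + 2 <= k | k + 2 <= i")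
   case far: True
   have ei: "e i = d i" "e (i + 1) = d (i + 1)" "cnt x e i = cnt x d i" for x
    using far cnt_swap[OF k1, of i x d] by (auto simp: e_def swap_eval)
   have fix_e: "(sw i e) = e" using step.prems(2) ei by (simp only: swap_fixed)
   have "T i d \<otimes>_A X d = T i (sw k e) \<otimes>_A T k e \<otimes>_A X e"
    unfolding Xd e(2) using step(1) i k(1) e(1) X_closed[OF e(1)] by (simp add: A.m_assoc)
   also have "... = T k e \<otimes>_A (T i e \<otimes>_A X e)"
    unfolding T_commute[OF i k(1) e(1) far] fix_e using i k(1) e(1) X_closed[OF e(1)] by (simp add: A.m_assoc)
   also have "T i e \<otimes>_A X e = X e \<otimes>_A G (d i) (cnt (d i) d i)"
    using step.IH[OF e(1,3) i] step.prems(2) by (simp only: ei)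
   also have "T k e \<otimes>_A (X e \<otimes>_A G (d i) (cnt (d i) d i)) = X d \<otimes>_A G (d i) (cnt (d i) d i)"
    unfolding Xd using Gc k(1) e(1) X_closed[OF e(1)] by (simp add: A.m_assoc)
   finally show ?thesis .
  next
   case False
   have "i ~= k" using k(3) step.prems(2) by auto
   hence near: "i = k + 1 | k = i + 1" using False by linarith
   define f where "f = (sw i e)"
   have dk: "d k = 1" "d (k + 1) = 0" using step(2) by (auto simp: desc_def)
   have di: "desc m n e i"
    using near step.prems dk i unfolding desc_def e_def by (auto simp: swap_eval)
   note fi = desc_swap[OF di e(1), folded f_def]
   have f: "f : D" "(sw i f) = e" "height m n f < height m n d"
    using fi e(3) by (simp_all only: f_def swap_swap)
   have fk: "f k = d i" "f (k + 1) = d i"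
    using near step.prems(2) dk by (auto simp: f_def e_def swap_eval)
   have cf: "cnt (d i) f k = cnt (d i) d i"
    using near
   proof
    assume ik: "i = k + 1"
    obtain k' where k': "k = Suc k'" using k1 by (cases k) auto
    have "cnt 0 f k' = cnt 0 d k'"
     unfolding f_def e_def using cnt_swap[of i k' 0 "(sw k d)"] cnt_swap[OF k1, of k' 0 d] ik k' by simp
    thus ?thesis using ik k' dk fk by (simp add: Suc_eq_plus1[symmetric])
   next
    assume ki: "k = i + 1"
    obtain i' where i': "i = Suc i'" using i by (cases i) auto
    have "cnt 1 f i' = cnt 1 d i'"
     unfolding f_def e_def using cnt_swap[of i i' 1 "(sw k d)"] cnt_swap[OF k1, of i' 1 d] ki i' by simp
    moreover have "f i = 0" using ki dk by (simp add: f_def e_def swap_eval)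
    moreover have "d i = 1" using ki dk step.prems(2) by simp
    ultimately show ?thesis using ki i' fk by (simp add: Suc_eq_plus1[symmetric])
   qed
   have fix_f: "(sw k f) = f" using fk by (simp only: swap_fixed)
   have Xe: "X e = T i f \<otimes>_A X f" using X_desc[OF e(1) di] by (simp only: f_def)
   have "T i d \<otimes>_A X d = T i (sw k (sw i f)) \<otimes>_A T k (sw i f) \<otimes>_A T i f \<otimes>_A X f"
    unfolding Xd Xe f(2) e(2) using step(1) i k(1) e(1) f(1) X_closed[OF f(1)] by (simp add: A.m_assoc)
   also have "... = T k e \<otimes>_A T i f \<otimes>_A (T k f \<otimes>_A X f)"
    unfolding T_braid[OF i k(1) f(1) near] unfolding fix_f f(2) using i k(1) e(1) f(1) X_closed[OF f(1)] by (simp add: A.m_assoc)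
   also have "T k f \<otimes>_A X f = X f \<otimes>_A G (d i) (cnt (d i) d i)"
    using step.IH[OF f(1,3) k(1)] fk by (simp only: cf)
   also have "T k e \<otimes>_A T i f \<otimes>_A (X f \<otimes>_A G (d i) (cnt (d i) d i)) = X d \<otimes>_A G (d i) (cnt (d i) d i)"
    unfolding Xd Xe using Gc i k(1) e(1) f(1) X_closed[OF f(1)] by (simp add: A.m_assoc)
   finally show ?thesis .
  qed
 qed
 thus ?thesis using True by simp
qed

end

section \<open>Corner algebras and recognition of matrix units\<close>

lemma cspace_closed_subset:
 assumes "cspace V" and sub: "carrier W <= carrier V"
  and s: "\<zero>_W = \<zero>_V" "!!x y. x \<oplus>_W y = x \<oplus>_V y" "!!c x. c \<odot>_W x = c \<odot>_V x"
  and closed: "\<zero>_V : carrier W" "!!x y. x : carrier W ==> y : carrier W ==> x \<oplus>_V y : carrier W"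
   "!!c x. x : carrier W ==> c \<odot>_V x : carrier W"
 shows "cspace W"
proof -
 interpret V: cspace V by (rule assms(1))
 have m: "x : carrier V" if "x : carrier W" for x using that sub by blast
 show ?thesis
  by (rule cspace.intro, rule cspace_criteria)
    (simp_all add: s closed m V.a_ac V.smult_smult V.add_smult V.smult_add)
qed

lemma (in calg) corner_calg:
 assumes e: "e : carrier A" "e \<otimes>_A e = e"
 shows "calg (A\<lparr>carrier := {x : carrier A. e \<otimes>_A x = x & x \<otimes>_A e = x}, one := e\<rparr>)" (is "calg ?B")
proof (rule calg_criteria)
 show "cspace ?B"
  by (rule cspace_closed_subset[OF cspace_axioms]) (use e in \<open>auto simp: l_distr r_distr smult_mult mult_smult\<close>)
qed (use e in \<open>auto simp: l_distr r_distr smult_mult mult_smult m_assoc, auto simp: m_assoc[symmetric]\<close>)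

text \<open>The sum of the diagonal units fixes every unit from the left, hence every element, hence it
  is the identity.\<close>

lemma matrix_units_from_span:
 assumes A: "calg A" and fin: "finite L" "!!l. l : L ==> finite (I l)"
  and u_closed: "!!l a b. l : L ==> a : I l ==> b : I l ==> u l a b : carrier A"
  and u_mult: "!!l m a b c d. l : L ==> m : L ==> a : I l ==> b : I l ==> c : I m ==> d : I m ==>
      u l a b \<otimes>_A u m c d = (if l = m & b = c then u l a d else \<zero>_A)"
  and u_span: "!!W. W <= carrier A ==> \<zero>_A : W ==> (!!x y. x : W ==> y : W ==> x \<oplus>_A y : W) ==>
      (!!c x. x : W ==> c \<odot>_A x : W) ==>
      (!!l a b. l : L ==> a : I l ==> b : I l ==> u l a b : W) ==> carrier A <= W"
 shows "matrix_units A L I u"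
proof (rule matrix_units.intro[OF A], rule matrix_units_axioms.intro[OF fin u_closed u_mult _ u_span])
 interpret calg A by (rule A)
 let ?e = "\<Oplus>_A l\<in>L. \<Oplus>_A a\<in>I l. u l a a"
 have ic: "(\<Oplus>_A a\<in>I l. u l a a) : carrier A" if "l : L" for l
  by (rule finsum_closed) (use that u_closed in auto)
 have ec: "?e : carrier A" by (rule finsum_closed) (use ic in auto)
 have "carrier A <= {x : carrier A. ?e \<otimes>_A x = x}"
 proof (rule u_span)
  fix l a b assume l: "l : L" and a: "a : I l" and b: "b : I l"
  note c = u_closed[OF l a b]
  have "(\<Oplus>_A a'\<in>I m. u m a' a') \<otimes>_A u l a b = (if m = l then u l a b else \<zero>_A)" if m: "m : L" for m
  proof -
   have "(\<Oplus>_A a'\<in>I m. u m a' a') \<otimes>_A u l a b = (\<Oplus>_A a'\<in>I m. u m a' a' \<otimes>_A u l a b)"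
    by (rule finsum_mult) (use c m u_closed in auto)
   also have "... = (\<Oplus>_A a'\<in>I m. if m = l & a' = a then u l a b else \<zero>_A)"
    by (rule add.finprod_cong') (use m l a b c u_mult in auto)
   also have "... = (if m = l then u l a b else \<zero>_A)"
   proof (cases "m = l")
    case True
    hence "(\<Oplus>_A a'\<in>I m. if m = l & a' = a then u l a b else \<zero>_A) = (if m = l & a = a then u l a b else \<zero>_A)"
     by (intro finsum_single fin) (use m l a c in auto)
    thus ?thesis by simp
   qed (simp add: add.finprod_one_eqI)
   finally show ?thesis .
  qed
  note inner = this
  have "?e \<otimes>_A u l a b = (\<Oplus>_A m\<in>L. (\<Oplus>_A a'\<in>I m. u m a' a') \<otimes>_A u l a b)"
   by (rule finsum_mult) (use c ic in auto)
  also have "... = (\<Oplus>_A m\<in>L. if m = l then u l a b else \<zero>_A)"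
   by (rule add.finprod_cong') (use c inner in auto)
  also have "... = (if l = l then u l a b else \<zero>_A)"
   by (rule finsum_single) (use fin l c in auto)
  finally show "u l a b : {x : carrier A. ?e \<otimes>_A x = x}" using c by simp
 qed (use ec in \<open>auto simp: r_distr mult_smult\<close>)
 hence "?e \<otimes>_A \<one>_A = \<one>_A" using one_closed by blast
 thus "?e = \<one>_A" using ec by simp
qed

section \<open>The corner at the base word\<close>

context typeA
begin

definition lim :: "nat => nat" where "lim x = (if x = 0 then m else n)"
definition pos :: "nat => nat => nat" where "pos x c = (if x = 0 then c else m + 1 + c)"

lemma G_pos: "G x c = T (pos x c) d0"
 by (simp add: G_def pos_def)

lemma pos_in: "c : {1..lim x} ==> pos x c : N1"
 by (auto simp: lim_def pos_def split: if_splits)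

lemma pos_fixed: "c : {1..lim x} ==> d0 (pos x c) = d0 (pos x c + 1)"
 by (auto simp: lim_def pos_def base_def split: if_splits)

lemma pos_swap: "c : {1..lim x} ==> (sw (pos x c) d0) = d0"
 using pos_fixed by (simp only: swap_fixed)

lemma G_closed: "c : {1..lim x} ==> G x c : carrier A"
 unfolding G_pos using pos_in base_in by (rule T_closed)

lemma G_corner: "c : {1..lim x} ==> E d0 \<otimes>_A G x c = G x c & G x c \<otimes>_A E d0 = G x c"
 unfolding G_pos using T_corner[OF pos_in base_in] pos_swap by simp

lemma G_commute: "c : {1..lim x} ==> c' : {1..lim y} ==> (if x = y then c + 2 <= c' | c' + 2 <= c else (x = 0) ~= (y = 0)) ==>
  G x c \<otimes>_A G y c' = G y c' \<otimes>_A G x c"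
 unfolding G_pos using T_commute[OF pos_in[of c x] pos_in[of c' y] base_in] pos_swap[of c x] pos_swap[of c' y]
 by (auto simp: pos_def lim_def split: if_splits)

definition B where "B = A\<lparr>carrier := {x : carrier A. E d0 \<otimes>_A x = x & x \<otimes>_A E d0 = x}, one := E d0\<rparr>"

lemma B_simps: "x : carrier B \<longleftrightarrow> x : carrier A & E d0 \<otimes>_A x = x & x \<otimes>_A E d0 = x"
 "\<one>_B = E d0" "\<zero>_B = \<zero>_A" "x \<oplus>_B y = x \<oplus>_A y" "x \<otimes>_B y = x \<otimes>_A y" "c \<odot>_B x = c \<odot>_A x"
 by (simp_all add: B_def)

lemma calg_B: "calg B"
 unfolding B_def using E_mult[OF base_in base_in] base_in by (intro A.corner_calg) auto

abbreviation "HH x \<equiv> hecke_algebra q (lim x)"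
abbreviation "HT x \<equiv> hecke_T q (lim x)"

lemma calg_HH: "calg (HH x)"
proof -
 interpret h: hecke q "lim x" .
 show ?thesis by (rule h.H.calg_axioms)
qed

lemma phi_ex: "EX h. h : algebra_hom (HH x) B & (\<forall>c\<in>{1..lim x}. h (HT x c) = G x c)"
proof -
 interpret h: hecke q "lim x" .
 show ?thesis
 proof (rule h.hecke_hom_exists[OF calg_B, of "G x"])
  fix i assume i: "i : {1..lim x}"
  show "G x i : carrier B" using G_closed[OF i] G_corner[OF i] by (simp add: B_simps)
  show "G x i \<otimes>_B G x i = (q - 1) \<odot>_B G x i \<oplus>_B q \<odot>_B \<one>_B"
   unfolding B_simps G_pos by (rule T_quadratic[OF pos_in[OF i] base_in pos_fixed[OF i]])
 next
  fix i assume i: "i : {1..lim x}" "i + 1 : {1..lim x}"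
  show "G x i \<otimes>_B G x (i + 1) \<otimes>_B G x i = G x (i + 1) \<otimes>_B G x i \<otimes>_B G x (i + 1)"
   unfolding B_simps G_pos
   using T_braid[OF pos_in[OF i(1)] pos_in[OF i(2)] base_in] pos_swap[OF i(1)] pos_swap[OF i(2)]
   by (simp add: pos_def)
 next
  fix i j assume "i : {1..lim x}" "j : {1..lim x}" "i + 2 <= j"
  thus "G x i \<otimes>_B G x j = G x j \<otimes>_B G x i" unfolding B_simps by (intro G_commute) auto
 next
  fix h assume "h : algebra_hom (HH x) B" "!!i. i : {1..lim x} ==> h (HT x i) = G x i"
  thus "EX h. h : algebra_hom (HH x) B & (\<forall>c\<in>{1..lim x}. h (HT x c) = G x c)"
   by (intro exI[of _ h] conjI ballI)
 qed
qed

text \<open>The map of the Hecke algebra of the block of zeros (\<open>x = 0\<close>) or ones (\<open>x =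
  1\<close>) to the corner algebra at the sorted word.\<close>

definition phi where "phi x = (SOME h. h : algebra_hom (HH x) B & (\<forall>c\<in>{1..lim x}. h (HT x c) = G x c))"

lemma phi_map: "alg_map (HH x) B (phi x)"
 and phi_T: "c : {1..lim x} ==> phi x (HT x c) = G x c"
 using someI_ex[OF phi_ex, of x]
 by (simp_all add: phi_def[symmetric] alg_map_def alg_map_axioms_def calg_HH calg_B)

lemma phi_simps:
 shows phi_closed: "a : carrier (HH x) ==> phi x a : carrier A"
  and phi_left: "a : carrier (HH x) ==> E d0 \<otimes>_A phi x a = phi x a"
  and phi_right: "a : carrier (HH x) ==> phi x a \<otimes>_A E d0 = phi x a"
  and phi_mult: "a : carrier (HH x) ==> b : carrier (HH x) ==> phi x (a \<otimes>_(HH x) b) = phi x a \<otimes>_A phi x b"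
  and phi_add: "a : carrier (HH x) ==> b : carrier (HH x) ==> phi x (a \<oplus>_(HH x) b) = phi x a \<oplus>_A phi x b"
  and phi_smult: "a : carrier (HH x) ==> phi x (c \<odot>_(HH x) a) = c \<odot>_A phi x a"
  and phi_one: "phi x \<one>_(HH x) = E d0" and phi_zero: "phi x \<zero>_(HH x) = \<zero>_A"
proof -
 interpret f: alg_map "HH x" B "phi x" by (rule phi_map)
 show "a : carrier (HH x) ==> phi x a : carrier A" "a : carrier (HH x) ==> E d0 \<otimes>_A phi x a = phi x a"
  "a : carrier (HH x) ==> phi x a \<otimes>_A E d0 = phi x a"
  using f.closed[of a] by (simp_all add: B_simps)
 show "a : carrier (HH x) ==> b : carrier (HH x) ==> phi x (a \<otimes>_(HH x) b) = phi x a \<otimes>_A phi x b"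
  "a : carrier (HH x) ==> b : carrier (HH x) ==> phi x (a \<oplus>_(HH x) b) = phi x a \<oplus>_A phi x b"
  "a : carrier (HH x) ==> phi x (c \<odot>_(HH x) a) = c \<odot>_A phi x a"
  "phi x \<one>_(HH x) = E d0" "phi x \<zero>_(HH x) = \<zero>_A"
  using f.mult[of a b] f.add[of a b] f.smult[of a c] f.one f.zero by (simp_all add: B_simps)
qed

lemma phi_centralizes:
 assumes y: "y : carrier A" "E d0 \<otimes>_A y = y" "y \<otimes>_A E d0 = y"
  and c: "!!c. c : {1..lim x} ==> G x c \<otimes>_A y = y \<otimes>_A G x c"
  and a: "a : carrier (HH x)"
 shows "phi x a \<otimes>_A y = y \<otimes>_A phi x a"
proof -
 interpret h: hecke q "lim x" .
 show ?thesis
  using a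
 proof (rule h.hecke_induct)
  show "phi x \<one>_(HH x) \<otimes>_A y = y \<otimes>_A phi x \<one>_(HH x)" using y by (simp add: phi_one)
 next
  fix i a assume h: "i : {1..lim x}" "a : carrier (HH x)" "phi x a \<otimes>_A y = y \<otimes>_A phi x a"
  have "phi x (HT x i \<otimes>_(HH x) a) \<otimes>_A y = G x i \<otimes>_A (phi x a \<otimes>_A y)"
   using h(1,2) y(1) by (simp add: phi_mult phi_T A.m_assoc G_closed phi_closed del: atLeastAtMost_iff)
  also have "... = (G x i \<otimes>_A y) \<otimes>_A phi x a"
   unfolding h(3) using h(1,2) y(1) by (simp add: A.m_assoc G_closed phi_closed del: atLeastAtMost_iff)
  also have "... = y \<otimes>_A phi x (HT x i \<otimes>_(HH x) a)"
   unfolding c[OF h(1)] using h(1,2) y(1) by (simp add: phi_mult phi_T A.m_assoc G_closed phi_closed del: atLeastAtMost_iff)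
  finally show "phi x (HT x i \<otimes>_(HH x) a) \<otimes>_A y = y \<otimes>_A phi x (HT x i \<otimes>_(HH x) a)" .
 qed (simp_all add: phi_add phi_smult phi_closed y A.l_distr A.r_distr A.smult_mult A.mult_smult)
qed

lemma phi_commute:
 assumes a: "a : carrier (HH 0)" and b: "b : carrier (HH 1)"
 shows "phi 0 a \<otimes>_A phi 1 b = phi 1 b \<otimes>_A phi 0 a"
proof (rule phi_centralizes[OF _ _ _ _ a])
 fix c assume c: "c : {1..lim 0}"
 have "phi 1 b \<otimes>_A G 0 c = G 0 c \<otimes>_A phi 1 b"
 proof (rule phi_centralizes[OF _ _ _ _ b])
  fix c' assume "c' : {1..lim 1}"
  thus "G 1 c' \<otimes>_A G 0 c = G 0 c \<otimes>_A G 1 c'" using c by (intro G_commute) auto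
 qed (use G_closed[OF c] G_corner[OF c] in auto)
 thus "G 0 c \<otimes>_A phi 1 b = phi 1 b \<otimes>_A G 0 c" by simp
qed (use b in \<open>auto simp: phi_simps\<close>)

definition Z where "Z d a b d' = X d \<otimes>_A (phi 0 a \<otimes>_A (phi 1 b \<otimes>_A Y d'))"

lemma Z_closed: "d : D ==> d' : D ==> a : carrier (HH 0) ==> b : carrier (HH 1) ==> Z d a b d' : carrier A"
 unfolding Z_def by (intro A.m_closed X_closed Y_closed phi_closed)

lemma E_X: "e : D ==> d : D ==> E e \<otimes>_A X d = (if e = d then X d else \<zero>_A)"
 using X_left[of d] E_mult[of e d] X_closed[of d] A.m_assoc[of "E e" "E d" "X d"] by (auto split: if_splits)

lemma T_X_other: "i : N1 ==> e : D ==> d : D ==> e ~= d ==> T i e \<otimes>_A X d = \<zero>_A"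
 using T_corner(2)[of i e] E_X[of e d] X_closed[of d] A.m_assoc[of "T i e" "E e" "X d"] by auto

lemma Y_X: "d : D ==> e : D ==> Y d \<otimes>_A X e = (if d = e then E d0 else \<zero>_A)"
 using YX[of d] Y_right[of d] E_X[of d e] X_closed[of e] Y_closed[of d] A.m_assoc[of "Y d" "E d" "X e"] by auto

lemma Z_mult:
 assumes h: "d : D" "d' : D" "e : D" "e' : D" and a: "a : carrier (HH 0)" "a' : carrier (HH 0)"
  and b: "b : carrier (HH 1)" "b' : carrier (HH 1)"
 shows "Z d a b d' \<otimes>_A Z e a' b' e' = (if d' = e then Z d (a \<otimes>_(HH 0) a') (b \<otimes>_(HH 1) b') e' else \<zero>_A)"
proof -
 note c = X_closed[OF h(1)] Y_closed[OF h(2)] X_closed[OF h(3)] Y_closed[OF h(4)]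
  phi_closed[OF a(1)] phi_closed[OF a(2)] phi_closed[OF b(1)] phi_closed[OF b(2)]
 let ?r = "phi 0 a' \<otimes>_A (phi 1 b' \<otimes>_A Y e')"
 have "Z d a b d' \<otimes>_A Z e a' b' e' = X d \<otimes>_A (phi 0 a \<otimes>_A (phi 1 b \<otimes>_A ((Y d' \<otimes>_A X e) \<otimes>_A ?r)))"
  unfolding Z_def using c by (simp add: A.m_assoc)
 also have "... = (if d' = e then Z d (a \<otimes>_(HH 0) a') (b \<otimes>_(HH 1) b') e' else \<zero>_A)"
 proof (cases "d' = e")
  case True
  have "E d0 \<otimes>_A ?r = ?r" using c phi_left[OF a(2)] base_in by (simp flip: A.m_assoc)
  moreover have "phi 1 b \<otimes>_A ?r = phi 0 a' \<otimes>_A (phi 1 b \<otimes>_A (phi 1 b' \<otimes>_A Y e'))"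
   using c phi_commute[OF a(2) b(1)] by (simp flip: A.m_assoc)
  ultimately show ?thesis
   unfolding Z_def Y_X[OF h(2,3)] phi_mult[OF a] phi_mult[OF b] using True c by (simp add: A.m_assoc)
 next
  case False
  thus ?thesis using c by (simp add: Y_X[OF h(2,3)])
 qed
 finally show ?thesis .
qed

text \<open>A generator either moves the index \<open>d\<close>, or kills the element, or is carried by
  \<open>X d\<close> to a loop that is absorbed in \<open>a\<close> or \<open>b\<close>.\<close>

lemma Z_left_mult:
 assumes s: "s : A_gens m n" and d: "d : D" "d' : D" and a: "a : carrier (HH 0)" and b: "b : carrier (HH 1)"
 shows "presented_gen (A_gens m n) (A_relations q m n) s \<otimes>_A Z d a b d' \<in>
  insert \<zero>_A {Z d a b d' | d a b d'. d : D & d' : D & a : carrier (HH 0) & b : carrier (HH 1)}" (is "?g \<otimes>_A _ : insert _ ?S")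
proof -
 interpret h0: hecke q "lim 0" .
 interpret h1: hecke q "lim 1" .
 note c = X_closed[OF d(1)] Y_closed[OF d(2)] phi_closed[OF a] phi_closed[OF b]
 let ?r = "phi 0 a \<otimes>_A (phi 1 b \<otimes>_A Y d')"
 have rc: "?r : carrier A" using c by simp
 have ZS: "Z d a b d' : ?S" if "d : D" "d' : D" "a : carrier (HH 0)" "b : carrier (HH 1)" for d a b d'
  using that by (intro CollectI exI conjI) (rule refl)
 have assoc: "g \<otimes>_A Z d a b d' = (g \<otimes>_A X d) \<otimes>_A ?r" if "g : carrier A" for g
  unfolding Z_def using that c(1) rc by (simp add: A.m_assoc)
 have "s : {GenE d |d. d : D} \<union> {GenT i d |i d. i : N1 & d : D}" using s by (simp only: A_gens_def)
 then consider (E') e where "e : D" "s = GenE e" | (T') i e where "i : N1" "e : D" "s = GenT i e"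
  by (elim UnE CollectE exE conjE) (rule that; assumption)+
 then consider (E) e where "e : D" "?g = E e" | (T) i e where "i : N1" "e : D" "?g = T i e"
 proof cases
  case E' thus thesis by (intro that(1)) (simp_all only: A_E_def)
 next
  case T' thus thesis by (intro that(2)) (simp_all only: A_T_def)
 qed
 thus ?thesis
 proof cases
  case E
  show ?thesis
   unfolding E(2) assoc[OF E_closed[OF E(1)]] E_X[OF E(1) d(1)]
   using ZS[OF d a b] rc unfolding Z_def by simp
 next
  case T
  have *: "T i e \<otimes>_A Z d a b d' = (T i e \<otimes>_A X d) \<otimes>_A ?r" by (rule assoc[OF T_closed[OF T(1,2)]])
  show ?thesis
  proof (cases "e = d")
   case False
   thus ?thesis unfolding T(3) * T_X_other[OF T(1,2) d(1) False] using rc by simp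
  next
   case True
   show ?thesis
   proof (cases "d i = d (i + 1)")
    case False
    have "T i e \<otimes>_A Z d a b d' = Z (sw i d) a b d'"
     unfolding * unfolding True T_X[OF d(1) T(1)] using False by (simp add: Z_def)
    thus ?thesis unfolding T(3) using ZS[OF Dset_swap[OF d(1) T(1)] d(2) a b] by simp
   next
    case eq: True
    define x where "x = d i"
    define j where "j = cnt x d i"
    have x01: "x = 0 | x = 1" unfolding x_def by (rule Dset_binary[OF d(1)]) (use T(1) in auto)
    have j: "j : {1..lim x}" unfolding j_def lim_def by (rule cnt_range[OF d(1) T(1)]) (use eq x_def in auto)
    note Gc = G_closed[OF j]
    have TX: "T i d \<otimes>_A X d = X d \<otimes>_A G x j"
     unfolding T_X[OF d(1) T(1)] x_def j_def using eq by simp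
    have X: "T i e \<otimes>_A Z d a b d' = X d \<otimes>_A (G x j \<otimes>_A ?r)"
     unfolding * unfolding True TX using Gc c(1) rc by (simp add: A.m_assoc)
    show ?thesis
     using x01
    proof
     assume x0: "x = 0"
     have j0: "j : {1..lim 0}" using j x0 by simp
     have t: "HT 0 j \<otimes>_(HH 0) a : carrier (HH 0)" by (rule h0.H.m_closed[OF h0.T_closed[OF j0] a])
     have "T i e \<otimes>_A Z d a b d' = Z d (HT 0 j \<otimes>_(HH 0) a) b d'"
      unfolding X unfolding x0 Z_def phi_mult[OF h0.T_closed[OF j0] a] phi_T[OF j0]
      using c G_closed[OF j0] by (simp add: A.m_assoc)
     thus ?thesis unfolding T(3) using ZS[OF d t b] by simp
    next
     assume x1: "x = 1"
     have j1: "j : {1..lim 1}" using j x1 by simp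
     have t: "HT 1 j \<otimes>_(HH 1) b : carrier (HH 1)" by (rule h1.H.m_closed[OF h1.T_closed[OF j1] b])
     have "G 1 j \<otimes>_A phi 0 a = phi 0 a \<otimes>_A G 1 j"
      using phi_commute[OF a h1.T_closed[OF j1]] phi_T[OF j1] by simp
     hence "G 1 j \<otimes>_A ?r = phi 0 a \<otimes>_A (G 1 j \<otimes>_A (phi 1 b \<otimes>_A Y d'))"
      using c G_closed[OF j1] by (simp flip: A.m_assoc)
     hence "T i e \<otimes>_A Z d a b d' = Z d a (HT 1 j \<otimes>_(HH 1) b) d'"
      unfolding X unfolding x1 Z_def phi_mult[OF h1.T_closed[OF j1] b] phi_T[OF j1]
      using c G_closed[OF j1] by (simp add: A.m_assoc)
     thus ?thesis unfolding T(3) using ZS[OF d a t] by simp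
    qed
   qed
  qed
 qed
qed

lemma Z_span:
 assumes W: "VectorSpace.subspace Cx W A"
  and ZW: "!!d a b d'. d : D ==> d' : D ==> a : carrier (HH 0) ==> b : carrier (HH 1) ==> Z d a b d' : W"
  and x: "x : carrier A"
 shows "x : W"
proof -
 let ?S = "{Z d a b d' | d a b d'. d : D & d' : D & a : carrier (HH 0) & b : carrier (HH 1)}"
 interpret h0: hecke q "lim 0" .
 interpret h1: hecke q "lim 1" .
 have S: "?S <= carrier A"
 proof
  fix x assume "x : ?S"
  thus "x : carrier A" by (elim CollectE exE conjE) (simp only: Z_closed)
 qed
 note s = A.subspace_lspan[OF S]
 have s': "\<zero>_A : lspan A ?S" "!!x y. x : lspan A ?S ==> y : lspan A ?S ==> x \<oplus>_A y : lspan A ?S"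
  "!!c x. x : lspan A ?S ==> c \<odot>_A x : lspan A ?S"
  using s unfolding A.subspace_iff by (elim conjE, simp)+
 have "x : carrier Pr.P" using x by (simp add: A_eq)
 hence "x : lspan A ?S"
 proof (rule Pr.presented_induct)
  have "E d : lspan A ?S" if d: "d : D" for d
  proof -
   have "Z d \<one>_(HH 0) \<one>_(HH 1) d = E d"
    unfolding Z_def phi_one using Y_left[OF d] XY_E[OF d] by simp
   moreover have "Z d \<one>_(HH 0) \<one>_(HH 1) d : ?S"
    by (intro CollectI exI[of _ d] exI[of _ "\<one>_(HH 0)"] exI[of _ "\<one>_(HH 1)"] conjI refl d h0.H.one_closed h1.H.one_closed)
   ultimately have "E d : ?S" by (simp only:)
   thus ?thesis by (rule subsetD[OF A.lspan_incl])
  qed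
  hence "(\<Oplus>_A d\<in>D. E d) : lspan A ?S" by (intro A.finsum_in_subset[OF A.lspan_carrier[OF S] s'(1,2)])
  thus "\<one>_Pr.P : lspan A ?S" unfolding E_sum by (simp only: A_eq)
 next
  fix g x assume g: "g : A_gens m n" and x: "x : carrier Pr.P" "x : lspan A ?S"
  let ?g = "presented_gen (A_gens m n) (A_relations q m n) g"
  have gc: "?g : carrier A" using Pr.gen_closed[OF g] by (simp only: A_eq)
  have "VectorSpace.subspace Cx {y : carrier A. ?g \<otimes>_A y : lspan A ?S} A"
   unfolding A.subspace_iff using s' gc by (simp add: A.r_distr A.mult_smult Collect_mono_iff subset_iff del: mem_Collect_eq) (simp add: A.r_distr A.mult_smult)
  moreover have "?S <= {y : carrier A. ?g \<otimes>_A y : lspan A ?S}"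
  proof
   fix y assume y: "y : ?S"
   then obtain d a b d' where h: "y = Z d a b d'" "d : D" "d' : D" "a : carrier (HH 0)" "b : carrier (HH 1)"
    by (elim CollectE exE conjE)
   have "?g \<otimes>_A y : insert \<zero>_A ?S" unfolding h(1) by (rule Z_left_mult[OF g h(2-5)])
   hence "?g \<otimes>_A y : lspan A ?S" using s'(1) subsetD[OF A.lspan_incl] by (elim insertE) (simp_all only:)
   thus "y : {y : carrier A. ?g \<otimes>_A y : lspan A ?S}" using subsetD[OF S y] by (intro CollectI conjI)
  qed
  ultimately have "lspan A ?S <= {y : carrier A. ?g \<otimes>_A y : lspan A ?S}" by (rule A.lspan_least)
  from subsetD[OF this x(2)] show "?g \<otimes>_Pr.P x : lspan A ?S" unfolding mem_Collect_eq A_eq by (rule conjunct2)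
 next
  fix x y assume "x : lspan A ?S" "y : lspan A ?S"
  thus "x \<oplus>_Pr.P y : lspan A ?S" unfolding A_eq[symmetric] by (rule s'(2))
 next
  fix c x assume "x : lspan A ?S"
  thus "c \<odot>_Pr.P x : lspan A ?S" unfolding A_eq[symmetric] by (rule s'(3))
 qed
 moreover have "lspan A ?S <= W"
 proof (rule A.lspan_least[OF W], rule subsetI)
  fix x assume "x : ?S"
  thus "x : W" by (elim CollectE exE conjE) (simp only: ZW)
 qed
 ultimately show ?thesis by (rule subsetD[rotated])
qed

definition unit where "unit u v = (%(l, k) (d, a, c) (d', b, e). Z d (u l a b) (v k c e) d')"

lemma typeA_matrix_units:
 assumes U: "matrix_units (HH 0) Lm Bm u" and V: "matrix_units (HH 1) Ln Bn v"
 shows "matrix_units A (Lm \<times> Ln) (%(l, k). D \<times> Bm l \<times> Bn k) (unit u v)"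
proof (rule matrix_units_from_span[OF A.calg_axioms])
 interpret U: matrix_units "HH 0" Lm Bm u by (rule U)
 interpret V: matrix_units "HH 1" Ln Bn v by (rule V)
 show "finite (Lm \<times> Ln)" using U.fin V.fin by simp
 show "finite ((%(l, k). D \<times> Bm l \<times> Bn k) p)" if "p : Lm \<times> Ln" for p
  using that U.fin V.fin finite_Dset by auto
 show "unit u v p a b : carrier A" if "p : Lm \<times> Ln" "a : (%(l, k). D \<times> Bm l \<times> Bn k) p" "b : (%(l, k). D \<times> Bm l \<times> Bn k) p" for p a b
  using that by (auto simp: unit_def intro!: Z_closed)
 have Z0: "Z d \<zero>_(HH 0) b d' = \<zero>_A" if "d : D" "d' : D" "b : carrier (HH 1)" for d d' b
  unfolding Z_def phi_zero using that X_closed Y_closed phi_closed by simp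
 have Z1: "Z d a \<zero>_(HH 1) d' = \<zero>_A" if "d : D" "d' : D" "a : carrier (HH 0)" for d d' a
  unfolding Z_def phi_zero using that X_closed Y_closed phi_closed by simp
 show "unit u v p a b \<otimes>_A unit u v p' c d = (if p = p' & b = c then unit u v p a d else \<zero>_A)"
  if h: "p : Lm \<times> Ln" "p' : Lm \<times> Ln" "a : (%(l, k). D \<times> Bm l \<times> Bn k) p" "b : (%(l, k). D \<times> Bm l \<times> Bn k) p"
   "c : (%(l, k). D \<times> Bm l \<times> Bn k) p'" "d : (%(l, k). D \<times> Bm l \<times> Bn k) p'" for p p' a b c d
 proof -
  obtain l k where p: "p = (l, k)" "l : Lm" "k : Ln" using h(1) by blast
  obtain l' k' where p': "p' = (l', k')" "l' : Lm" "k' : Ln" using h(2) by blast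
  obtain a1 a2 a3 where a: "a = (a1, a2, a3)" "a1 : D" "a2 : Bm l" "a3 : Bn k" using h(3) p by auto
  obtain b1 b2 b3 where b: "b = (b1, b2, b3)" "b1 : D" "b2 : Bm l" "b3 : Bn k" using h(4) p by auto
  obtain c1 c2 c3 where c: "c = (c1, c2, c3)" "c1 : D" "c2 : Bm l'" "c3 : Bn k'" using h(5) p' by auto
  obtain d1 d2 d3 where d: "d = (d1, d2, d3)" "d1 : D" "d2 : Bm l'" "d3 : Bn k'" using h(6) p' by auto
  note uc = U.u_closed[OF p(2) a(3) b(3)] U.u_closed[OF p'(2) c(3) d(3)]
   V.u_closed[OF p(3) a(4) b(4)] V.u_closed[OF p'(3) c(4) d(4)]
  have "unit u v p a b \<otimes>_A unit u v p' c d = (if b1 = c1 then Z a1 (u l a2 b2 \<otimes>_(HH 0) u l' c2 d2) (v k a3 b3 \<otimes>_(HH 1) v k' c3 d3) d1 else \<zero>_A)"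
   unfolding unit_def p(1) p'(1) a(1) b(1) c(1) d(1) prod.case
   by (rule Z_mult[OF a(2) b(2) c(2) d(2) uc])
  also have "... = (if p = p' & b = c then unit u v p a d else \<zero>_A)"
   unfolding U.u_mult[OF p(2) p'(2) a(3) b(3) c(3) d(3)] V.u_mult[OF p(3) p'(3) a(4) b(4) c(4) d(4)]
   using p p' a b c d by (auto simp: unit_def Z0 Z1)
  finally show ?thesis .
 qed
 fix W assume W: "W <= carrier A" "\<zero>_A : W" "!!x y. x : W ==> y : W ==> x \<oplus>_A y : W"
  "!!c x. x : W ==> c \<odot>_A x : W"
  "!!p a b. p : Lm \<times> Ln ==> a : (%(l, k). D \<times> Bm l \<times> Bn k) p ==> b : (%(l, k). D \<times> Bm l \<times> Bn k) p ==> unit u v p a b : W"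
 have Ws: "VectorSpace.subspace Cx W A" unfolding A.subspace_iff using W(1-4) by blast
 have "Z d a b d' : W" if d: "d : D" "d' : D" and a: "a : carrier (HH 0)" and b: "b : carrier (HH 1)" for d d' a b
 proof -
  have zc: "X d : carrier A" "Y d' : carrier A" by (rule X_closed[OF d(1)], rule Y_closed[OF d(2)])
  have Zadd: "Z d (x \<oplus>_(HH 0) y) w d' = Z d x w d' \<oplus>_A Z d y w d'" "Z d (c \<odot>_(HH 0) x) w d' = c \<odot>_A Z d x w d'"
   if "x : carrier (HH 0)" "y : carrier (HH 0)" "w : carrier (HH 1)" for x y w c
   unfolding Z_def using that zc by (simp_all add: phi_simps A.l_distr A.r_distr A.smult_mult A.mult_smult)
  have Zadd': "Z d w (x \<oplus>_(HH 1) y) d' = Z d w x d' \<oplus>_A Z d w y d'" "Z d w (c \<odot>_(HH 1) x) d' = c \<odot>_A Z d w x d'"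
   if "x : carrier (HH 1)" "y : carrier (HH 1)" "w : carrier (HH 0)" for x y w c
   unfolding Z_def using that zc by (simp_all add: phi_simps A.l_distr A.r_distr A.smult_mult A.mult_smult)
  have 1: "Z d (u l x y) (v k s t) d' : W" if "l : Lm" "x : Bm l" "y : Bm l" "k : Ln" "s : Bn k" "t : Bn k" for l x y k s t
   using W(5)[of "(l, k)" "(d, x, s)" "(d', y, t)"] d that by (simp add: unit_def)
  have 2: "carrier (HH 0) <= {a : carrier (HH 0). Z d a (v k s t) d' : W}" if k: "k : Ln" "s : Bn k" "t : Bn k" for k s t
   by (rule U.u_span) (use 1 k W(2-4) d in \<open>auto simp: Z0 Zadd\<close>)
  have 3: "carrier (HH 1) <= {b : carrier (HH 1). Z d a b d' : W}"
   by (rule V.u_span) (use a W(2-4) d subsetD[OF 2 a] in \<open>auto simp: Z1 Zadd'\<close>)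
  show ?thesis using subsetD[OF 3 b] by blast
 qed
 thus "carrier A <= W" using Z_span[OF Ws] by blast
qed

end

section \<open>The sorting permutations\<close>

lemma cnt_card: "cnt x d i = card {a : {1..i}. d a = x}"
proof (induction i)
 case (Suc i)
 have "{a : {1..Suc i}. d a = x} = (if d (Suc i) = x then insert (Suc i) {a : {1..i}. d a = x} else {a : {1..i}. d a = x})"
  by (auto simp: le_Suc_eq)
 thus ?case using Suc by simp
qed simp

text \<open>The common form of the two defining conditions of \<open>\<tau>\<^sub>+\<close> and
  \<open>\<tau>\<^sub>-\<close>, for the letter \<open>x\<close> that comes first.\<close>

definition sorts :: "nat => nat => (nat => nat) => nat => nat => (nat => nat) => bool" where
 "sorts N K d x y \<tau> \<longleftrightarrow> \<tau> permutes {1..N} & (\<forall>i\<in>{1..K}. d (\<tau> i) = x) & (\<forall>i\<in>{K+1..N}. d (\<tau> i) = y) \<and>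
   strict_mono_on {1..K} \<tau> & strict_mono_on {K+1..N} \<tau>"

text \<open>Up to position \<open>\<tau> j\<close> the letters of the same kind are exactly the images of
  the arguments of the block up to \<open>j\<close>, by monotonicity.\<close>

lemma sorts_cnt:
 assumes s: "sorts N K d x y \<tau>" and xy: "x ~= y" and K: "K <= N" and j: "j : {1..N}"
 shows "j = (if d (\<tau> j) = x then cnt x d (\<tau> j) else K + cnt y d (\<tau> j))"
proof -
 have p: "\<tau> permutes {1..N}" and x: "!!i. i : {1..K} ==> d (\<tau> i) = x" and y: "!!i. i : {K+1..N} ==> d (\<tau> i) = y"
  and m: "strict_mono_on {1..K} \<tau>" "strict_mono_on {K+1..N} \<tau>" using s by (auto simp: sorts_def)
 have block: "cnt z d (\<tau> j) = j - lo" if b: "strict_mono_on {lo+1..hi} \<tau>" "j : {lo+1..hi}" "hi <= N"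
   and z: "!!i. i : {1..N} ==> d (\<tau> i) = z \<longleftrightarrow> i : {lo+1..hi}" for z lo hi
 proof -
  have "{a : {1..\<tau> j}. d a = z} = \<tau> ` {lo+1..j}"
  proof
   show "\<tau> ` {lo+1..j} <= {a : {1..\<tau> j}. d a = z}"
   proof (rule image_subsetI)
    fix i assume i: "i : {lo+1..j}"
    have "\<tau> i <= \<tau> j" by (rule strict_mono_on_leD[OF b(1)]) (use i b(2) in auto)
    moreover have "\<tau> i : {1..N}" using permutes_in_image[OF p, of i] i b(2,3) by auto
    moreover have "d (\<tau> i) = z" using z[of i] i b(2,3) by auto
    ultimately show "\<tau> i : {a : {1..\<tau> j}. d a = z}" by simp
   qed
  next
   show "{a : {1..\<tau> j}. d a = z} <= \<tau> ` {lo+1..j}"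
   proof
    fix a assume a: "a : {a : {1..\<tau> j}. d a = z}"
    have "\<tau> j : {1..N}" using permutes_in_image[OF p, of j] j by simp
    hence "a : \<tau> ` {1..N}" using a permutes_image[OF p] by auto
    then obtain i where i: "i : {1..N}" "a = \<tau> i" by blast
    hence il: "i : {lo+1..hi}" using z[of i] a by simp
    have "i <= j"
    proof (rule ccontr)
     assume "\<not> i <= j"
     hence "\<tau> j < \<tau> i" by (intro strict_mono_onD[OF b(1) b(2) il]) simp
     thus False using a i by simp
    qed
    thus "a : \<tau> ` {lo+1..j}" using i il by auto
   qed
  qed
  moreover have "inj_on \<tau> {lo+1..j}" using permutes_inj_on[OF p] .
  ultimately show ?thesis unfolding cnt_card by (simp add: card_image)
 qed
 show ?thesis
 proof (cases "j <= K")
  case True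
  have "cnt x d (\<tau> j) = j - 0"
  proof (rule block[of 0 K])
   fix i assume "i : {1..N}"
   thus "d (\<tau> i) = x \<longleftrightarrow> i : {0+1..K}" using x[of i] y[of i] xy by fastforce
  qed (use m K True j in auto)
  thus ?thesis using x[of j] True j by simp
 next
  case False
  have "cnt y d (\<tau> j) = j - K"
  proof (rule block[of K N])
   fix i assume "i : {1..N}"
   thus "d (\<tau> i) = y \<longleftrightarrow> i : {K+1..N}" using x[of i] y[of i] xy by fastforce
  qed (use m K False j in auto)
  thus ?thesis using y[of j] xy False j by simp
 qed
qed

text \<open>The map sending a position to the rank of its letter, shifted for the second kind of letter,
  is a permutation whose inverse satisfies the conditions; the ranks determine any solution.\<close>

lemma sorting_permutation:
 assumes bin: "!!a. a : {1..N} ==> d a = x | d a = y" and xy: "x ~= y" and K: "cnt x d N = K"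
  and i: "i : {1..N}" "d i = x"
 shows "inv_into UNIV (THE \<tau>. sorts N K d x y \<tau>) i = cnt x d i"
proof -
 define \<kappa> where "\<kappa> a = (if a : {1..N} then if d a = x then cnt x d a else K + cnt y d a else a)" for a
 have KN: "K <= N" using cnt_le[of x d N] K by simp
 have total: "cnt x d a + cnt y d a = a" if "a <= N" for a
  using that
 proof (induction a)
  case (Suc a) thus ?case using bin[of "Suc a"] xy by auto
 qed simp
 have pos: "1 <= cnt (d a) d a" if "a : {1..N}" for a using that by (cases a) auto
 have strict: "cnt z d a < cnt z d b" if "a < b" "d b = z" for a b z
 proof -
  obtain b' where b: "b = Suc b'" using \<open>a < b\<close> by (cases b) auto
  thus ?thesis using cnt_mono[of a b' z d] that by simp
 qed
 have cmp: "cnt z d a < cnt z d b \<longleftrightarrow> a < b" if "d a = z" "d b = z" for a b z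
  using strict[of a b z] strict[of b a z] that by (metis less_asym less_irrefl linorder_neqE_nat)
 have \<kappa>x: "\<kappa> a : {1..K}" if "a : {1..N}" "d a = x" for a
  using that pos[OF that(1)] cnt_mono[of a N x d] K by (simp add: \<kappa>_def)
 have \<kappa>y: "\<kappa> a : {K+1..N}" if "a : {1..N}" "d a = y" for a
  using that pos[OF that(1)] cnt_mono[of a N y d] K total[of N] xy by (simp add: \<kappa>_def)
 have inj: "inj_on \<kappa> {1..N}"
 proof (rule inj_onI)
  fix a b assume h: "a : {1..N}" "b : {1..N}" "\<kappa> a = \<kappa> b"
  have "d a = d b"
  proof (rule ccontr)
   assume "d a ~= d b"
   hence "d a = x & d b = y | d a = y & d b = x" using bin[OF h(1)] bin[OF h(2)] by auto
   thus False using \<kappa>x[OF h(1)] \<kappa>x[OF h(2)] \<kappa>y[OF h(1)] \<kappa>y[OF h(2)] h(3) by auto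
  qed
  hence "cnt (d a) d a = cnt (d a) d b" using h bin[OF h(1)] by (auto simp: \<kappa>_def split: if_splits)
  thus "a = b" using cmp[of a "d a" b] cmp[of b "d a" a] \<open>d a = d b\<close> by (metis less_irrefl linorder_neqE_nat)
 qed
 have sub: "\<kappa> ` {1..N} <= {1..N}" using \<kappa>x \<kappa>y bin KN by fastforce
 have bij: "bij_betw \<kappa> {1..N} {1..N}" unfolding bij_betw_def using inj endo_inj_surj[OF _ sub inj] by simp
 have perm: "\<kappa> permutes {1..N}" by (rule bij_imp_permutes[OF bij]) (auto simp: \<kappa>_def)
 let ?t = "inv_into UNIV \<kappa>"
 have tp: "?t permutes {1..N}" by (rule permutes_inv[OF perm])
 have t: "?t j : {1..N}" "\<kappa> (?t j) = j" if "j : {1..N}" for j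
  using permutes_in_image[OF tp, of j] permutes_inverses(1)[OF perm] that by auto
 have tx: "d (?t j) = x" if "j : {1..K}" for j
 proof (rule ccontr)
  assume "d (?t j) ~= x"
  have jN: "j : {1..N}" using that KN by auto
  from bin[OF t(1)[OF this]] have dj: "d (?t j) = y" using \<open>d (?t j) ~= x\<close> by blast
  show False using \<kappa>y[OF t(1)[OF jN] dj] t(2)[OF jN] that by auto
 qed
 have ty: "d (?t j) = y" if "j : {K+1..N}" for j
 proof (rule ccontr)
  assume "d (?t j) ~= y"
  have jN: "j : {1..N}" using that KN by auto
  from bin[OF t(1)[OF this]] have dj: "d (?t j) = x" using \<open>d (?t j) ~= y\<close> by blast
  show False using \<kappa>x[OF t(1)[OF jN] dj] t(2)[OF jN] that by auto
 qed
 have "sorts N K d x y ?t"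
  unfolding sorts_def
 proof (intro conjI ballI tp tx ty)
  show "strict_mono_on {1..K} ?t"
  proof (rule strict_mono_onI)
   fix a b assume h: "a : {1..K}" "b : {1..K}" "a < b"
   have "cnt x d (?t a) = a" "cnt x d (?t b) = b" using t[of a] t[of b] tx[OF h(1)] tx[OF h(2)] h KN by (auto simp: \<kappa>_def)
   thus "?t a < ?t b" using cmp[OF tx[OF h(1)] tx[OF h(2)]] h(3) by simp
  qed
  show "strict_mono_on {K+1..N} ?t"
  proof (rule strict_mono_onI)
   fix a b assume h: "a : {K+1..N}" "b : {K+1..N}" "a < b"
   have "K + cnt y d (?t a) = a" "K + cnt y d (?t b) = b" using t[of a] t[of b] ty[OF h(1)] ty[OF h(2)] h KN xy by (auto simp: \<kappa>_def)
   thus "?t a < ?t b" using cmp[OF ty[OF h(1)] ty[OF h(2)]] h(3) by simp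
  qed
 qed
 moreover have uniq: "\<tau> = ?t" if s: "sorts N K d x y \<tau>" for \<tau>
 proof
  fix j
  have p: "\<tau> permutes {1..N}" using s by (simp add: sorts_def)
  show "\<tau> j = ?t j"
  proof (cases "j : {1..N}")
   case True
   have tj: "\<tau> j : {1..N}" using permutes_in_image[OF p] True by simp
   have "\<kappa> (\<tau> j) = j" using sorts_cnt[OF s xy KN True] tj by (simp add: \<kappa>_def)
   thus ?thesis using permutes_inverses(2)[OF perm, of "\<tau> j"] by simp
  next
   case False thus ?thesis using permutes_not_in[OF p False] permutes_not_in[OF tp False] by simp
  qed
 qed
 ultimately have "(THE \<tau>. sorts N K d x y \<tau>) = ?t" by (rule the_equality)
 thus ?thesis using i permutes_inv_inv[OF perm] by (simp add: \<kappa>_def)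
qed

lemma tau_inverse:
 assumes d: "d : Dset m n" and i: "i : {1..m+n+2}"
 shows "d i = 0 ==> inv_into UNIV (tau_plus m n d) i = cnt 0 d i"
  and "d i = 1 ==> inv_into UNIV (tau_minus m n d) i = cnt 1 d i"
proof -
 have e: "m + 2 = m + 1 + 1" "n + 2 = n + 1 + 1" by simp_all
 have p: "tau_plus m n d = (THE \<tau>. sorts (m + n + 2) (m + 1) d 0 1 \<tau>)"
  unfolding tau_plus_def sorts_def e(1) ..
 have m: "tau_minus m n d = (THE \<tau>. sorts (m + n + 2) (n + 1) d 1 0 \<tau>)"
  unfolding tau_minus_def sorts_def e(2) ..
 have bin: "d a = 0 | d a = 1" "d a = 1 | d a = 0" if "a : {1..m+n+2}" for a
  by (rule Dset_binary[OF d that], rule disj_commute[THEN iffD1, OF Dset_binary[OF d that]])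
 show "d i = 0 ==> inv_into UNIV (tau_plus m n d) i = cnt 0 d i"
  unfolding p by (rule sorting_permutation[OF bin(1) _ Dset_cnt(1)[OF d] i]) simp_all
 show "d i = 1 ==> inv_into UNIV (tau_minus m n d) i = cnt 1 d i"
  unfolding m by (rule sorting_permutation[OF bin(2) _ Dset_cnt(2)[OF d] i]) simp_all
qed

section \<open>The representations on words with values in a tensor product\<close>

locale box = typeA q m n + L: arep "hecke_algebra q m" V l + R: arep "hecke_algebra q n" U r
 for q m n and V :: "'v cspace" and l and U :: "'u cspace" and r
begin

sublocale tp: tensor_pair V U by (rule tensor_pair.intro[OF L.V.cspace_axioms R.V.cspace_axioms])

abbreviation "W \<equiv> tensor V U"
abbreviation "EW \<equiv> End_alg (tensor V U)"
abbreviation "C \<equiv> box_space m n V U"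
abbreviation "EC \<equiv> End_alg (box_space m n V U)"
abbreviation "EV \<equiv> End_alg V"
abbreviation "EU \<equiv> End_alg U"

sublocale EW: calg EW by (rule tp.T.calg_End)

sublocale C: cspace C unfolding box_space_def by (rule cspace_dsum[OF finite_Dset tp.T.cspace_axioms])
sublocale EC: calg EC by (rule C.calg_End)

lemma C_carrier: "carrier C = (\<Pi>\<^sub>E d\<in>D. carrier W)"
 unfolding box_space_def by (rule dsum_carrier[OF finite_Dset])

lemma C_eval: "v : carrier C ==> d : D ==> v d : carrier W"
 by (auto simp: C_carrier)

lemma C_simps: "x \<oplus>_C y = (\<lambda>d\<in>D. x d \<oplus>_W y d)" "c \<odot>_C x = (\<lambda>d\<in>D. c \<odot>_W x d)" "\<zero>_C = (\<lambda>d\<in>D. \<zero>_W)"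
 by (simp_all add: box_space_def)

definition inc where "inc d t = (\<lambda>e\<in>D. if e = d then t else \<zero>_W)"

lemma inc_closed: "t : carrier W ==> inc d t : carrier C"
 by (auto simp: inc_def C_carrier)

lemma inc_eval: "d : D ==> d' : D ==> inc d t d' = (if d = d' then t else \<zero>_W)"
 by (simp add: inc_def)

lemma inc_linear: "s : carrier W ==> t : carrier W ==> inc d (s \<oplus>_W t) = inc d s \<oplus>_C inc d t"
 "t : carrier W ==> inc d (c \<odot>_W t) = c \<odot>_C inc d t" "inc d \<zero>_W = \<zero>_C"
 by (auto simp: inc_def C_simps fun_eq_iff)

definition blk where "blk d' f d = (\<lambda>v\<in>carrier C. inc d' (f (v d)))"

lemma box_block_blk: "box_block m n V U d' f d = blk d' f d"
 by (auto simp: box_block_def blk_def inc_def dsum_incl_def dsum_proj_def fun_eq_iff)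

lemma EW_closed: "f : carrier EW ==> t : carrier W ==> f t : carrier W"
 by (simp add: End_carrier_iff)

lemma blk_closed:
 assumes "f : carrier EW" "d : D" shows "blk d' f d : carrier EC"
 unfolding End_carrier_iff
proof (intro conjI ballI allI)
 show "blk d' f d : extensional (carrier C)" by (simp add: blk_def)
 fix v assume v: "v : carrier C"
 note vd = C_eval[OF v assms(2)]
 show "blk d' f d v : carrier C" using v inc_closed[OF EW_closed[OF assms(1) vd]] by (simp add: blk_def)
 show "blk d' f d (c \<odot>_C v) = c \<odot>_C blk d' f d v" for c
  using v assms vd inc_linear(2)[OF EW_closed[OF assms(1) vd]] C.smult_closed[OF v, of c]
  by (simp add: blk_def End_carrier_iff) (simp add: C_simps)
 fix w assume w: "w : carrier C"
 note wd = C_eval[OF w assms(2)]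
 have "(v \<oplus>_C w) d = v d \<oplus>_W w d" using assms(2) by (simp add: C_simps)
 thus "blk d' f d (v \<oplus>_C w) = blk d' f d v \<oplus>_C blk d' f d w"
  using v w assms(1) vd wd inc_linear(1)[OF EW_closed[OF assms(1) vd] EW_closed[OF assms(1) wd]]
  by (simp add: blk_def End_carrier_iff)
qed

lemma blk_id: "d : D ==> blk d' id d = blk d' \<one>_EW d"
 using C_eval by (auto simp: blk_def fun_eq_iff)

lemma blk_mult:
 assumes "f : carrier EW" "g : carrier EW" "d : D" "e : D" "e' : D"
 shows "blk d' f e' \<otimes>_EC blk e g d = (if e = e' then blk d' (f \<otimes>_EW g) d else \<zero>_EC)"
proof (rule End_eqI)
 show "blk d' f e' \<otimes>_EC blk e g d : carrier EC" by (rule EC.m_closed[OF blk_closed blk_closed]) (use assms in auto)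
 show "(if e = e' then blk d' (f \<otimes>_EW g) d else \<zero>_EC) : carrier EC"
  using blk_closed[OF EW.m_closed[OF assms(1,2)] assms(3)] EC.zero_closed by (simp del: End_alg_simps)
 fix v assume v: "v : carrier C"
 note vd = C_eval[OF v assms(3)]
 have "(blk d' f e' \<otimes>_EC blk e g d) v = inc d' (f (inc e (g (v d)) e'))"
  using v inc_closed[OF EW_closed[OF assms(2) vd], of e] by (simp add: blk_def compose_def)
 also have "... = inc d' (f (if e = e' then g (v d) else \<zero>_W))"
  by (simp add: inc_eval[OF assms(4,5)])
 also have "... = (if e = e' then blk d' (f \<otimes>_EW g) d else \<zero>_EC) v"
 proof (cases "e = e'")
  case True thus ?thesis using v vd by (simp add: blk_def compose_def)
 next
  case False
  have "f (0 \<odot>_W \<zero>_W) = 0 \<odot>_W f \<zero>_W" using assms(1) tp.T.zero_closed unfolding End_carrier_iff by blast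
  hence "f \<zero>_W = \<zero>_W" using EW_closed[OF assms(1) tp.T.zero_closed] by simp
  thus ?thesis using False v by (simp add: inc_linear(3))
 qed
 finally show "(blk d' f e' \<otimes>_EC blk e g d) v = (if e = e' then blk d' (f \<otimes>_EW g) d else \<zero>_EC) v" .
qed

lemma blk_linear:
 assumes "f : carrier EW" "g : carrier EW" "d : D"
 shows "blk d' (f \<oplus>_EW g) d = blk d' f d \<oplus>_EC blk d' g d"
  and "blk d' (c \<odot>_EW f) d = c \<odot>_EC blk d' f d"
proof -
 have e: "inc d' (f (v d) \<oplus>_W g (v d)) = inc d' (f (v d)) \<oplus>_C inc d' (g (v d))"
  "inc d' (c \<odot>_W f (v d)) = c \<odot>_C inc d' (f (v d))" if "v : carrier C" for v
  using inc_linear EW_closed assms C_eval[OF that assms(3)] by auto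
 show "blk d' (f \<oplus>_EW g) d = blk d' f d \<oplus>_EC blk d' g d"
  "blk d' (c \<odot>_EW f) d = c \<odot>_EC blk d' f d"
  using e C_eval[OF _ assms(3)] by (auto simp: blk_def fun_eq_iff)
qed

lemma blk_sum: "(\<Oplus>_EC d\<in>D. blk d \<one>_EW d) = \<one>_EC" (is "?p = _")
proof (rule End_eqI)
 have c: "blk d \<one>_EW d : carrier EC" if "d : D" for d using that by (intro blk_closed EW.one_closed)
 show p: "?p : carrier EC" by (rule EC.finsum_closed) (use c in auto)
 show "\<one>_EC : carrier EC" by (rule EC.one_closed)
 fix v assume v: "v : carrier C"
 have ev: "blk d \<one>_EW d w d = w d" if "w : carrier C" "d : D" for w d
  using C_eval[OF that] that by (simp add: blk_def inc_eval)
 have pv: "?p v : carrier C" using p v by (simp add: End_carrier_iff)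
 have "?p v d = v d" if d: "d : D" for d
 proof -
  have "blk d \<one>_EW d \<otimes>_EC ?p = (\<Oplus>_EC e\<in>D. blk d \<one>_EW d \<otimes>_EC blk e \<one>_EW e)"
   by (rule EC.mult_finsum) (use c d in auto)
  also have "... = blk d \<one>_EW d \<otimes>_EC blk d \<one>_EW d"
  proof (rule EC.finsum_single[of D d "%e. blk d \<one>_EW d \<otimes>_EC blk e \<one>_EW e", OF finite_Dset d EC.m_closed[OF c[OF d] c[OF d]]])
   fix e assume "e : D" "e ~= d"
   thus "blk d \<one>_EW d \<otimes>_EC blk e \<one>_EW e = \<zero>_EC"
    using blk_mult[OF EW.one_closed EW.one_closed \<open>e : D\<close> \<open>e : D\<close> d] by (simp del: End_alg_simps)
  qed
  also have "... = blk d \<one>_EW d"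
   using blk_mult[OF EW.one_closed EW.one_closed d d d] EW.l_one[OF EW.one_closed] by (simp del: End_alg_simps)
  finally have "(blk d \<one>_EW d \<otimes>_EC ?p) v = blk d \<one>_EW d v" by (rule fun_cong)
  moreover have "(blk d \<one>_EW d \<otimes>_EC ?p) v = blk d \<one>_EW d (?p v)"
   using v by (simp only: End_alg_simps(4) compose_eq)
  ultimately show ?thesis using ev[OF pv d] ev[OF v d] by simp
 qed
 hence "?p v = v" using pv v unfolding C_carrier by (intro PiE_ext)
 thus "?p v = \<one>_EC v" using v by (simp only: End_alg_simps(1) restrict_apply' )
qed

text \<open>The two commuting actions of the Hecke algebras on the tensor product.\<close>

definition t where "t x a = (if x = (0::nat) then tensor_map V U (l a) \<one>_EU else tensor_map V U \<one>_EV (r a))"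

lemma t_map: "x = 0 | x = 1 ==> alg_map (HH x) EW (t x)"
proof -
 have "alg_map (hecke_algebra q m) EW (%a. tensor_map V U (l a) \<one>_EU)"
  unfolding alg_map_def alg_map_axioms_def
 proof (intro conjI L.A.calg_axioms EW.calg_axioms algebra_homI)
  show "tensor_map V U (l \<one>_(hecke_algebra q m)) \<one>_EU = \<one>_EW" unfolding L.one by (rule tp.tensor_map_one)
 qed (simp_all only: tp.tensor_map_spec(1) L.closed R.B.one_closed R.B.l_one L.add L.mult L.smult tp.tensor_map_mult tp.tensor_map_bilinear(1)[OF _ R.B.one_closed _ R.B.one_closed] tp.tensor_map_bilinear(3)[OF _ R.B.one_closed L.B.one_closed R.B.one_closed])
 moreover have "alg_map (hecke_algebra q n) EW (%a. tensor_map V U \<one>_EV (r a))"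
  unfolding alg_map_def alg_map_axioms_def
 proof (intro conjI R.A.calg_axioms EW.calg_axioms algebra_homI)
  show "tensor_map V U \<one>_EV (r \<one>_(hecke_algebra q n)) = \<one>_EW" unfolding R.one by (rule tp.tensor_map_one)
 qed (simp_all only: tp.tensor_map_spec(1) R.closed L.B.one_closed L.B.l_one R.add R.mult R.smult tp.tensor_map_mult tp.tensor_map_bilinear(2)[OF L.B.one_closed _ L.B.one_closed] tp.tensor_map_bilinear(4)[OF L.B.one_closed _ L.B.one_closed R.B.one_closed])
 ultimately show "x = 0 | x = 1 ==> alg_map (HH x) EW (t x)" by (auto simp: t_def[abs_def] lim_def)
qed

lemma t_commute:
 assumes a: "a : carrier (HH 0)" and b: "b : carrier (HH 1)"
 shows "t 0 a \<otimes>_EW t 1 b = tensor_map V U (l a) (r b)" "t 1 b \<otimes>_EW t 0 a = tensor_map V U (l a) (r b)"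
proof -
 have c: "l a : carrier EV" "r b : carrier EU" using L.closed[of a] R.closed[of b] a b by (simp_all only: lim_def refl if_True zero_neq_one if_False one_neq_zero)
 show "t 0 a \<otimes>_EW t 1 b = tensor_map V U (l a) (r b)" "t 1 b \<otimes>_EW t 0 a = tensor_map V U (l a) (r b)"
  unfolding t_def if_True refl using tp.tensor_map_mult[OF c(1) R.B.one_closed L.B.one_closed c(2)]
   tp.tensor_map_mult[OF L.B.one_closed c(2) c(1) R.B.one_closed] L.B.l_one[OF c(1)] L.B.r_one[OF c(1)] R.B.l_one[OF c(2)] R.B.r_one[OF c(2)]
  by (simp_all del: End_alg_simps)
qed

definition g where "g x c = t x (HT x c)"

text \<open>The component of \<open>T i d\<close> on the summand \<open>d\<close>; the rank of the letter
  selects the Hecke generator.\<close>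

definition f where "f i d = (if d i ~= d (i + 1) then \<one>_EW else g (d i) (cnt (d i) d i))"

lemma g_closed: "x = 0 | x = 1 ==> c : {1..lim x} ==> g x c : carrier EW"
proof -
 interpret h: hecke q "lim x" .
 assume "x = 0 | x = 1" "c : {1..lim x}"
 thus ?thesis unfolding g_def by (intro lin_map.closed[OF alg_map_lin[OF t_map]] h.T_closed)
qed

lemma f_range:
 assumes "d : D" "i : N1" "d i = d (i + 1)"
 shows "(d i = 0 | d i = 1) & cnt (d i) d i : {1..lim (d i)}"
 using cnt_range[OF assms(1,2) refl assms(3)[symmetric]] Dset_binary[OF assms(1), of i] assms(2) by (auto simp: lim_def)

lemma f_closed: "d : D ==> i : N1 ==> f i d : carrier EW"
 unfolding f_def using EW.one_closed f_range g_closed by (simp del: End_alg_simps) 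

lemma g_quadratic:
 assumes x: "x = 0 | x = 1" and c: "c : {1..lim x}"
 shows "g x c \<otimes>_EW g x c = (q - 1) \<odot>_EW g x c \<oplus>_EW q \<odot>_EW \<one>_EW"
proof -
 interpret h: hecke q "lim x" .
 interpret t: alg_map "HH x" EW "t x" by (rule t_map[OF x])
 note Tc = h.T_closed[OF c]
 have "t x (HT x c \<otimes>_(HH x) HT x c) = t x ((q - 1) \<odot>_(HH x) HT x c \<oplus>_(HH x) q \<odot>_(HH x) \<one>_(HH x))"
  by (simp only: h.T_quadratic[OF c])
 thus ?thesis
  by (simp only: g_def t.mult[OF Tc Tc] t.add[OF h.H.smult_closed[OF Tc] h.H.smult_closed[OF h.H.one_closed]]
    t.smult[OF Tc] t.smult[OF h.H.one_closed] t.one)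
qed

lemma g_braid:
 assumes x: "x = 0 | x = 1" and c: "c : {1..lim x}" "c + 1 : {1..lim x}"
 shows "g x c \<otimes>_EW g x (c + 1) \<otimes>_EW g x c = g x (c + 1) \<otimes>_EW g x c \<otimes>_EW g x (c + 1)"
proof -
 interpret h: hecke q "lim x" .
 interpret t: alg_map "HH x" EW "t x" by (rule t_map[OF x])
 note Tc = h.T_closed[OF c(1)] h.T_closed[OF c(2)]
 have "t x (HT x c \<otimes>_(HH x) HT x (c + 1) \<otimes>_(HH x) HT x c) = t x (HT x (c + 1) \<otimes>_(HH x) HT x c \<otimes>_(HH x) HT x (c + 1))"
  by (simp only: h.T_braid[OF c])
 thus ?thesis by (simp only: g_def t.mult h.H.m_closed Tc)
qed

lemma g_commute:
 assumes x: "x = 0 | x = 1" "y = 0 | y = 1" and c: "c : {1..lim x}" "c' : {1..lim y}"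
  and far: "x = y ==> c + 2 <= c' | c' + 2 <= c"
 shows "g x c \<otimes>_EW g y c' = g y c' \<otimes>_EW g x c"
proof (cases "x = y")
 case True
 interpret h: hecke q "lim x" .
 interpret t: alg_map "HH x" EW "t x" by (rule t_map[OF x(1)])
 have c': "c' : {1..lim x}" using c(2) True by simp
 note Tc = h.T_closed[OF c(1)] h.T_closed[OF c']
 have "t x (HT x c \<otimes>_(HH x) HT x c') = t x (HT x c' \<otimes>_(HH x) HT x c)"
  by (simp only: h.T_commute[OF c(1) c' far[OF True]])
 thus ?thesis by (simp only: g_def t.mult Tc True[symmetric])
next
 case False
 interpret h0: hecke q "lim 0" .
 interpret h1: hecke q "lim 1" .
 from False x consider "x = 0" "y = 1" | "x = 1" "y = 0" by auto
 thus ?thesis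
 proof cases
  case 1
  thus ?thesis using t_commute[OF h0.T_closed h1.T_closed, of c c'] c by (simp only: g_def)
 next
  case 2
  thus ?thesis using t_commute[OF h0.T_closed h1.T_closed, of c' c] c by (simp only: g_def)
 qed
qed

lemma f_Suc: "f (Suc p) e = (if e (Suc p) ~= e (Suc (Suc p)) then \<one>_EW else g (e (Suc p)) (Suc (cnt (e (Suc p)) e p)))"
 by (simp add: f_def Suc_eq_plus1[symmetric] del: End_alg_simps)

text \<open>If the three letters are equal this is the braid relation of a Hecke algebra. Otherwise
  exactly one factor on each side is not the identity, and it is the same one because ranks do not change
  when different letters are exchanged.\<close>

lemma f_braid:
 assumes d: "d : D" and i: "i : N1" "i + 1 : N1"
 shows "f i (sw (i + 1) (sw i d)) \<otimes>_EW f (i + 1) (sw i d) \<otimes>_EW f i d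
    = f (i + 1) (sw i (sw (i + 1) d)) \<otimes>_EW f i (sw (i + 1) d) \<otimes>_EW f (i + 1) d"
proof -
 obtain p where p: "i = Suc p" using i by (cases i) auto
 let ?a = "d (Suc p)" and ?b = "d (Suc (Suc p))" and ?c = "d (Suc (Suc (Suc p)))"
 let ?s = "adj_swap i" and ?s' = "adj_swap (i + 1)"
 have cn: "cnt x (?s \<triangleright> e) p = cnt x e p" "cnt x (?s' \<triangleright> e) p = cnt x e p" for x e
  by (rule cnt_swap; use p in simp)+
 have ev: "(?s \<triangleright> e) (Suc p) = e (Suc (Suc p))" "(?s \<triangleright> e) (Suc (Suc p)) = e (Suc p)"
  "(?s \<triangleright> e) (Suc (Suc (Suc p))) = e (Suc (Suc (Suc p)))" "(?s' \<triangleright> e) (Suc p) = e (Suc p)"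
  "(?s' \<triangleright> e) (Suc (Suc p)) = e (Suc (Suc (Suc p)))" "(?s' \<triangleright> e) (Suc (Suc (Suc p))) = e (Suc (Suc p))" for e
  unfolding swap_eval p by (simp_all add: Suc_eq_plus1[symmetric])
 have ii: "i + 1 = Suc (Suc p)" using p by simp
 have bin: "?a = 0 | ?a = 1" "?b = 0 | ?b = 1" "?c = 0 | ?c = 1"
  by (rule Dset_binary[OF d]; use i p in auto)+
 have rab: "Suc (cnt ?a d p) : {1..lim ?a}" if "?a = ?b"
  using f_range[OF d i(1)] that unfolding p by (simp add: Suc_eq_plus1[symmetric])
 have rbc: "Suc (cnt ?b d (Suc p)) : {1..lim ?b}" if "?b = ?c"
  using f_range[OF d i(2)] that unfolding ii by (simp add: Suc_eq_plus1[symmetric])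
 have rac: "Suc (cnt ?a d p) : {1..lim ?a}" if "?a = ?c" "?b ~= ?c"
  using f_range[OF Dset_swap[OF d i(2)] i(1)] that ev(4-6)[of d] cn(2)[of _ d] unfolding p by (simp add: Suc_eq_plus1[symmetric])
 note fs = f_Suc ev cn cnt.simps
 show ?thesis
 proof -
  have F: "f i = f (Suc p)" "f (i + 1) = f (Suc (Suc p))" by (simp only: p, simp only: ii)
  consider "?a = ?b" "?b = ?c" | "?a = ?b" "?b ~= ?c" | "?a ~= ?b" "?b = ?c" | "?a = ?c" "?a ~= ?b"
   using bin by fastforce
  thus "f i (?s' \<triangleright> ?s \<triangleright> d) \<otimes>_EW f (i + 1) (?s \<triangleright> d) \<otimes>_EW f i d
    = f (i + 1) (?s \<triangleright> ?s' \<triangleright> d) \<otimes>_EW f i (?s' \<triangleright> d) \<otimes>_EW f (i + 1) d"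
  proof cases
   case 1
   have r: "Suc (cnt ?a d p) : {1..lim ?a}" "Suc (cnt ?a d p) + 1 : {1..lim ?a}"
    using rab rbc 1 by simp_all
   show ?thesis unfolding F fs using 1 g_braid[OF bin(1) r] by (simp del: End_alg_simps)
  next
   case 2
   have gc: "g ?a (Suc (cnt ?a d p)) : carrier EW" by (rule g_closed[OF bin(1) rab[OF 2(1)]])
   show ?thesis unfolding F fs using 2 gc EW.one_closed EW.l_one[OF EW.one_closed] EW.l_one[OF gc] EW.r_one[OF gc] by (simp del: End_alg_simps)
  next
   case 3
   have "Suc (cnt ?b d p) : {1..lim ?b}" using rbc[OF 3(2)] 3(1) by simp
   hence gc: "g ?b (Suc (cnt ?b d p)) : carrier EW" by (rule g_closed[OF bin(2)])
   show ?thesis unfolding F fs using 3 gc EW.one_closed EW.l_one[OF EW.one_closed] EW.l_one[OF gc] EW.r_one[OF gc] by (simp del: End_alg_simps)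
  next
   case 4
   have gc: "g ?a (Suc (cnt ?a d p)) : carrier EW" by (rule g_closed[OF bin(1) rac]) (use 4 in simp_all)
   show ?thesis unfolding F fs using 4 gc EW.one_closed EW.l_one[OF EW.one_closed] EW.l_one[OF gc] EW.r_one[OF gc] by (simp del: End_alg_simps)
  qed
 qed
qed

lemma f_far:
 assumes d: "d : D" and i: "i : N1" "j : N1" and far: "i + 2 <= j | j + 2 <= i"
 shows "f i (sw j d) = f i d" "f i d \<otimes>_EW f j d = f j d \<otimes>_EW f i d"
proof -
 have "(sw j d) i = d i" "(sw j d) (i + 1) = d (i + 1)" using far by (auto simp: swap_eval)
 moreover have "cnt x (sw j d) i = cnt x d i" for x by (rule cnt_swap) (use i far in auto)
 ultimately show "f i (sw j d) = f i d" by (simp only: f_def)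
 show "f i d \<otimes>_EW f j d = f j d \<otimes>_EW f i d"
 proof (cases "d i ~= d (i + 1) | d j ~= d (j + 1)")
  case True
  hence "f i d = \<one>_EW | f j d = \<one>_EW" unfolding f_def using if_P by metis
  thus ?thesis
   using EW.l_one[OF f_closed[OF d i(1)]] EW.r_one[OF f_closed[OF d i(1)]]
    EW.l_one[OF f_closed[OF d i(2)]] EW.r_one[OF f_closed[OF d i(2)]] by (elim disjE) (simp_all only:)
 next
  case False
  hence e: "d i = d (i + 1)" "d j = d (j + 1)" by auto
  note ri = f_range[OF d i(1) e(1)] and rj = f_range[OF d i(2) e(2)]
  have "g (d i) (cnt (d i) d i) \<otimes>_EW g (d j) (cnt (d j) d j) = g (d j) (cnt (d j) d j) \<otimes>_EW g (d i) (cnt (d i) d i)"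
  proof (rule g_commute)
   assume "d i = d j"
   thus "cnt (d i) d i + 2 <= cnt (d j) d j | cnt (d j) d j + 2 <= cnt (d i) d i"
    using far cnt_far[of i j d "d i"] cnt_far[of j i d "d j"] e by auto
  qed (use ri rj in blast)+
  thus ?thesis using e by (simp only: f_def not_True_eq_False simp_thms if_False)
 qed
qed

abbreviation "val \<equiv> (%s. case s of GenE d => blk d \<one>_EW d | GenT i d => blk (sw i d) (f i d) d)"

lemma box_T_blk:
 assumes "d : D" "i : N1"
 shows "box_T q m n V l U r i d = blk (sw i d) (f i d) d"
proof (cases "d i = d (i + 1)")
 case False
 thus ?thesis using blk_id[OF assms(1)] by (simp add: box_T_def f_def box_block_blk del: End_alg_simps)
next
 case True
 have s: "(sw i d) = d" using True by (simp only: swap_fixed)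
 have i: "i : {1..m+n+2}" using assms(2) by auto
 from Dset_binary[OF assms(1) i] show ?thesis
 proof
  assume z: "d i = 0"
  have "box_T q m n V l U r i d = blk d (tensor_map V U (l (hecke_T q m (cnt 0 d i))) \<one>_EU) d"
   unfolding box_T_def box_block_blk using tau_inverse(1)[OF assms(1) i z] True z by (simp del: End_alg_simps)
  also have "... = blk (sw i d) (f i d) d"
   unfolding s f_def g_def t_def using True z by (simp add: lim_def del: End_alg_simps)
  finally show ?thesis .
 next
  assume z: "d i = 1"
  have "box_T q m n V l U r i d = blk d (tensor_map V U \<one>_EV (r (hecke_T q n (cnt 1 d i)))) d"
   unfolding box_T_def box_block_blk using tau_inverse(2)[OF assms(1) i z] True z by (simp del: End_alg_simps)
  also have "... = blk (sw i d) (f i d) d"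
   unfolding s f_def g_def t_def using True z by (simp add: lim_def del: End_alg_simps)
  finally show ?thesis .
 qed
qed

end

context box
begin

lemma val_closed: "s : A_gens m n ==> val s : carrier EC"
 unfolding A_gens_def by (elim UnE CollectE exE conjE) (simp_all only: agen.case blk_closed EW.one_closed f_closed)

lemma box_relations:
 assumes h: "alg_map Pr.F EC h" and gen: "!!s. s : A_gens m n ==> h (free_gen s) = val s"
  and R: "(x, y) : A_relations q m n"
 shows "h x = h y"
proof -
 interpret h: alg_map Pr.F EC h by (rule h)
 let ?E = "%d. free_gen (GenE d)" and ?T = "%i d. free_gen (GenT i d)" and ?s = adj_swap
 have hE: "h (?E d) = blk d \<one>_EW d" if "d : D" for d
  using gen[of "GenE d"] that by (simp add: A_gens_def del: End_alg_simps)
 have hT: "h (?T i d) = blk (?s i \<triangleright> d) (f i d) d" if "i : N1" "d : D" for i d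
  using gen[of "GenT i d"] that by (simp add: A_gens_def del: End_alg_simps)
 note fc = free_closed and one = EW.one_closed
 have bm: "blk d' a e \<otimes>_EC blk e b d = blk d' (a \<otimes>_EW b) d" if "a : carrier EW" "b : carrier EW" "d : D" "e : D" for d' a e b d
  using blk_mult[OF that(1,2,3,4,4)] by simp
 from R consider
   (a) d where "d : D" "x = ?E d \<otimes>_Pr.F ?E d" "y = ?E d"
  | (b) i d where "i : N1" "d : D" "x = ?E (?s i \<triangleright> d) \<otimes>_Pr.F ?T i d \<otimes>_Pr.F ?E d" "y = ?T i d"
  | (c) "x = (\<Oplus>_Pr.F d\<in>D. ?E d)" "y = \<one>_Pr.F"
  | (d) d d' where "d : D" "d' : D" "d ~= d'" "x = ?E d \<otimes>_Pr.F ?E d'" "y = \<zero>_Pr.F"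
  | (e) i d where "i : N1" "d : D" "?s i \<triangleright> d = d"
    "x = (?T i d \<ominus>_Pr.F q \<odot>_Pr.F ?E d) \<otimes>_Pr.F (?T i d \<oplus>_Pr.F ?E d)" "y = \<zero>_Pr.F"
  | (f) i d where "i : N1" "d : D" "?s i \<triangleright> d ~= d" "x = ?T i (?s i \<triangleright> d) \<otimes>_Pr.F ?T i d" "y = ?E d"
  | (g) i j d where "i : N1" "j : N1" "d : D" "\<bar>int i - int j\<bar> = 1"
    "x = ?T i (?s j \<triangleright> ?s i \<triangleright> d) \<otimes>_Pr.F ?T j (?s i \<triangleright> d) \<otimes>_Pr.F ?T i d"
    "y = ?T j (?s i \<triangleright> ?s j \<triangleright> d) \<otimes>_Pr.F ?T i (?s j \<triangleright> d) \<otimes>_Pr.F ?T j d"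
  | (h) i j d where "i : N1" "j : N1" "d : D" "\<bar>int i - int j\<bar> \<ge> 2"
    "x = ?T i (?s j \<triangleright> d) \<otimes>_Pr.F ?T j d" "y = ?T j (?s i \<triangleright> d) \<otimes>_Pr.F ?T i d"
  unfolding A_relations_def Let_def
  by (elim UnE CollectE exE conjE Pair_inject insertE emptyE) (rule that; assumption)+
 thus ?thesis
 proof cases
  case a
  show ?thesis unfolding a(2,3) h.mult[OF fc(1) fc(1), OF a(1) a(1)] hE[OF a(1)] bm[OF one one a(1) a(1)] EW.l_one[OF one] ..
 next
  case b
  note s = Dset_swap[OF b(2,1)] and F = f_closed[OF b(2,1)]
  have "h x = blk (?s i \<triangleright> d) \<one>_EW (?s i \<triangleright> d) \<otimes>_EC blk (?s i \<triangleright> d) (f i d) d \<otimes>_EC blk d \<one>_EW d"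
   unfolding b(3) by (simp only: h.mult Pr.F.m_closed fc s b(1,2) hE hT)
  also have "... = blk (?s i \<triangleright> d) (f i d) d"
   by (simp only: bm one F s b(2) EW.l_one EW.r_one EW.m_closed)
  finally show ?thesis unfolding b(4) hT[OF b(1,2)] .
 next
  case c
  have "h x = (\<Oplus>_EC d\<in>D. h (?E d))" unfolding c(1) by (rule h.finsum) (rule fc(1))
  also have "... = (\<Oplus>_EC d\<in>D. blk d \<one>_EW d)"
   by (rule EC.add.finprod_cong') (auto simp: hE blk_closed[OF one] simp del: End_alg_simps)
  finally show ?thesis unfolding blk_sum c(2) h.one .
 next
  case d
  show ?thesis unfolding d(4,5) h.mult[OF fc(1)[OF d(1)] fc(1)[OF d(2)]] hE[OF d(1)] hE[OF d(2)] h.zero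
   using blk_mult[OF one one d(2) d(2) d(1)] d(3) by (simp del: End_alg_simps)
 next
  case e
  have eq: "d i = d (i + 1)" using e(3) by (simp only: swap_fixed)
  note F = f_closed[OF e(2,1)] and r = f_range[OF e(2,1) eq]
  have fg: "f i d = g (d i) (cnt (d i) d i)" using eq by (simp add: f_def)
  have c: "blk d (f i d) d : carrier EC" "blk d \<one>_EW d : carrier EC" by (rule blk_closed[OF F e(2)], rule blk_closed[OF one e(2)])
  have "blk d (f i d) d \<otimes>_EC blk d (f i d) d = blk d ((q - 1) \<odot>_EW f i d \<oplus>_EW q \<odot>_EW \<one>_EW) d"
   unfolding bm[OF F F e(2,2)] unfolding fg using g_quadratic r by metis
  also have "... = (q - 1) \<odot>_EC blk d (f i d) d \<oplus>_EC q \<odot>_EC blk d \<one>_EW d"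
   by (simp only: blk_linear(1)[OF EW.smult_closed[OF F] EW.smult_closed[OF one] e(2)] blk_linear(2)[OF F F e(2)] blk_linear(2)[OF one one e(2)])
  finally have qd: "blk d (f i d) d \<otimes>_EC blk d (f i d) d = (q - 1) \<odot>_EC blk d (f i d) d \<oplus>_EC q \<odot>_EC blk d \<one>_EW d" .
  have id: "blk d (f i d) d \<otimes>_EC blk d \<one>_EW d = blk d (f i d) d" "blk d \<one>_EW d \<otimes>_EC blk d (f i d) d = blk d (f i d) d"
   "blk d \<one>_EW d \<otimes>_EC blk d \<one>_EW d = blk d \<one>_EW d"
   by (simp_all only: bm one F e(2) EW.l_one EW.r_one)
  have hm: "h (a \<ominus>_Pr.F b) = h a \<ominus>_EC h b" if "a : carrier Pr.F" "b : carrier Pr.F" for a b using that by (rule h.diff)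
  have "h x = (blk d (f i d) d \<ominus>_EC q \<odot>_EC blk d \<one>_EW d) \<otimes>_EC (blk d (f i d) d \<oplus>_EC blk d \<one>_EW d)"
   unfolding e(4) using fc(1)[OF e(2)] fc(2)[OF e(1,2)]
   by (simp only: h.mult hm h.add h.smult Pr.F.minus_closed Pr.F.a_closed Pr.F.smult_closed hE[OF e(2)] hT[OF e(1,2)] e(3))
  also have "... = \<zero>_EC"
   using EC.quadratic_form[OF c id, of q] unfolding qd
   using EC.minus_eq_zero_iff[OF EC.a_closed[OF EC.smult_closed[OF c(1)] EC.smult_closed[OF c(2)]] EC.a_closed[OF EC.smult_closed[OF c(1)] EC.smult_closed[OF c(2)]]]
   by (simp only:)
  finally show ?thesis unfolding e(5) h.zero .
 next
  case f
  note s = Dset_swap[OF f(2,1)]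
  have n: "d i ~= d (i + 1)" using f(3) by (simp only: swap_fixed not_False_eq_True)
  have n': "(?s i \<triangleright> d) i ~= (?s i \<triangleright> d) (i + 1)" using n by (auto simp: swap_eval)
  have "h x = blk (?s i \<triangleright> ?s i \<triangleright> d) \<one>_EW (?s i \<triangleright> d) \<otimes>_EC blk (?s i \<triangleright> d) \<one>_EW d"
   unfolding f(4) h.mult[OF fc(2)[OF f(1) s] fc(2)[OF f(1,2)]] hT[OF f(1) s] hT[OF f(1,2)]
   by (simp only: f_def if_P[OF n] if_P[OF n'])
  also have "... = h y" unfolding f(5) hE[OF f(2)] swap_swap bm[OF one one f(2) s] EW.l_one[OF one] ..
  finally show ?thesis .
 next
  case g
  have br: "h (?T i (?s j \<triangleright> ?s i \<triangleright> d) \<otimes>_Pr.F ?T j (?s i \<triangleright> d) \<otimes>_Pr.F ?T i d)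
   = blk (?s i \<triangleright> ?s j \<triangleright> ?s i \<triangleright> d) (f i (?s j \<triangleright> ?s i \<triangleright> d) \<otimes>_EW f j (?s i \<triangleright> d) \<otimes>_EW f i d) d"
   if ij: "i : N1" "j : N1" for i j
  proof -
   note s = Dset_swap[OF g(3) ij(1)] and s' = Dset_swap[OF Dset_swap[OF g(3) ij(1)] ij(2)]
   have "h (?T i (?s j \<triangleright> ?s i \<triangleright> d) \<otimes>_Pr.F ?T j (?s i \<triangleright> d) \<otimes>_Pr.F ?T i d)
    = blk (?s i \<triangleright> ?s j \<triangleright> ?s i \<triangleright> d) (f i (?s j \<triangleright> ?s i \<triangleright> d)) (?s j \<triangleright> ?s i \<triangleright> d) \<otimes>_EC
     blk (?s j \<triangleright> ?s i \<triangleright> d) (f j (?s i \<triangleright> d)) (?s i \<triangleright> d) \<otimes>_EC blk (?s i \<triangleright> d) (f i d) d"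
    by (simp only: h.mult Pr.F.m_closed fc s s' ij g(3) hT)
   also have "... = blk (?s i \<triangleright> ?s j \<triangleright> ?s i \<triangleright> d) (f i (?s j \<triangleright> ?s i \<triangleright> d) \<otimes>_EW f j (?s i \<triangleright> d) \<otimes>_EW f i d) d"
    by (simp only: bm f_closed EW.m_closed s s' ij g(3))
   finally show ?thesis .
  qed
  from g(4) consider "j = i + 1" | "i = j + 1" by linarith
  thus ?thesis
  proof cases
   case 1
   show ?thesis unfolding g(5,6) br[OF g(1,2)] br[OF g(2,1)] using f_braid[OF g(3,1)] g(2) swap_braid[of i d] unfolding 1 by (simp only:)
  next
   case 2
   show ?thesis unfolding g(5,6) br[OF g(1,2)] br[OF g(2,1)] using f_braid[OF g(3,2)] g(1) swap_braid[of j d] unfolding 2 by (simp only:)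
  qed
 next
  case h
  have far: "i + 2 <= j | j + 2 <= i" using h(4) by linarith
  have far': "j + 2 <= i | i + 2 <= j" using far by blast
  have pr: "h (?T i (?s j \<triangleright> d) \<otimes>_Pr.F ?T j d) = blk (?s i \<triangleright> ?s j \<triangleright> d) (f i d \<otimes>_EW f j d) d"
   if ij: "i : N1" "j : N1" "i + 2 <= j | j + 2 <= i" for i j
   by (simp only: h.mult fc Dset_swap ij(1,2) h(3) hT f_far(1)[OF h(3) ij] bm f_closed)
  show ?thesis
   unfolding h(5,6) pr[OF h(1,2) far] pr[OF h(2,1) far'] f_far(2)[OF h(3,1,2) far] swap_commute[OF far] ..
 qed
qed

abbreviation "rho \<equiv> box_rep q m n V l U r"

lemma box_rep_spec:
 "rho : algebra_hom A EC" "d : D ==> rho (E d) = blk d \<one>_EW d"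
 "d : D ==> i : N1 ==> rho (T i d) = blk (sw i d) (f i d) d"
proof -
 let ?P = "%h. h : algebra_hom A EC & h : extensional (carrier A) \<and>
  (\<forall>d\<in>D. h (E d) = box_block m n V U d id d) \<and>
  (\<forall>d\<in>D. \<forall>i\<in>N1. h (T i d) = box_T q m n V l U r i d)"
 have bE: "box_block m n V U d id d = blk d \<one>_EW d" if "d : D" for d
  unfolding box_block_blk by (rule blk_id[OF that])
 have gens: "A_E q m n d = presented_gen (A_gens m n) (A_relations q m n) (GenE d)"
  "A_T q m n i d = presented_gen (A_gens m n) (A_relations q m n) (GenT i d)" for i d by (simp_all add: A_E_def A_T_def)
 obtain h where h: "h : algebra_hom Pr.P EC" "!!s. s : A_gens m n ==> h (presented_gen (A_gens m n) (A_relations q m n) s) = val s"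
 proof (rule Pr.presented_hom_exists[where g = val, OF EC.calg_axioms val_closed box_relations])
  fix h assume "h : algebra_hom Pr.P EC" "!!s. s : A_gens m n ==> h (presented_gen (A_gens m n) (A_relations q m n) s) = val s"
  thus thesis by (rule that)
 qed
 interpret h: alg_map A EC h
  using h(1) by (simp add: A_eq[symmetric] alg_map_def alg_map_axioms_def A.calg_axioms EC.calg_axioms)
 define h' where "h' = restrict h (carrier A)"
 have ex: "?P h'"
 proof (intro conjI ballI)
  show "h' : algebra_hom A EC"
   by (rule algebra_homI) (simp_all add: h'_def h.mult h.add h.smult h.one del: End_alg_simps)
  show "h' : extensional (carrier A)" by (simp add: h'_def)
 next
  fix d assume d: "d : D"
  have g: "GenE d : A_gens m n" using d by (simp add: A_gens_def)
  have "h' (E d) = h (E d)" unfolding h'_def by (rule restrict_apply'[OF E_closed[OF d]])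
  thus "h' (E d) = box_block m n V U d id d"
   using h(2)[OF g] unfolding gens[symmetric] bE[OF d] by (simp only: agen.case)
 next
  fix d i assume d: "d : D" "i : N1"
  have g: "GenT i d : A_gens m n" using d by (simp add: A_gens_def)
  have "h' (T i d) = h (T i d)" unfolding h'_def by (rule restrict_apply'[OF T_closed[OF d(2,1)]])
  thus "h' (T i d) = box_T q m n V l U r i d"
   using h(2)[OF g] unfolding gens[symmetric] box_T_blk[OF d] by (simp only: agen.case)
 qed
 have uniq: "h1 = h2" if h1: "?P h1" and h2: "?P h2" for h1 h2
 proof (rule extensionalityI[of _ "carrier A"])
  show "h1 : extensional (carrier A)" "h2 : extensional (carrier A)" using h1 h2 by blast+
  fix x assume x: "x : carrier A"
  have s: "h1 (presented_gen (A_gens m n) (A_relations q m n) s) = h2 (presented_gen (A_gens m n) (A_relations q m n) s)"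
   if "s : A_gens m n" for s
  proof -
   have "s : {GenE d |d. d : D} \<union> {GenT i d |i d. i : N1 & d : D}" using that by (simp only: A_gens_def)
   thus ?thesis
    using h1 h2 by (elim UnE CollectE exE conjE) (simp_all only: gens[symmetric])
  qed
  show "h1 x = h2 x"
  proof (rule Pr.presented_hom_unique[of h1 EC h2 x])
   show "h1 : algebra_hom Pr.P EC" "h2 : algebra_hom Pr.P EC" "x : carrier Pr.P"
    using h1 h2 x unfolding A_eq by blast+
  qed (rule EC.calg_axioms, rule s)
 qed
 have "?P (THE h. ?P h)" by (rule theI[of ?P, OF ex uniq[OF _ ex]])
 hence P: "?P rho" unfolding box_rep_def .
 thus "rho : algebra_hom A EC" by blast
 show "rho (E d) = blk d \<one>_EW d" if "d : D" using P that bE[OF that] by simp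
 show "rho (T i d) = blk (sw i d) (f i d) d" if "d : D" "i : N1"
  using P that box_T_blk[OF that] by simp
qed

lemma arep_box: "arep A C rho"
 using box_rep_spec(1) representation_iff[OF A.calg_axioms, of C rho] C.vs by (simp add: representation_def)

sublocale rho: alg_map A EC rho
 using box_rep_spec(1) by (simp add: alg_map_def alg_map_axioms_def A.calg_axioms EC.calg_axioms)

lemma rho_G:
 assumes x: "x = 0 | x = 1" and c: "c : {1..lim x}"
 shows "rho (G x c) = blk d0 (g x c) d0"
proof -
 note p = pos_in[OF c]
 have i: "pos x c : {1..m+n+2}" using p by auto
 have dx: "d0 (pos x c) = x" using c x by (auto simp: pos_def base_def lim_def)
 have "cnt x d0 (pos x c) = c" using base_cnt[OF i] x unfolding dx by (auto simp: pos_def)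
 hence "f (pos x c) d0 = g x c" using pos_fixed[OF c] dx by (simp add: f_def)
 thus ?thesis unfolding G_pos box_rep_spec(3)[OF base_in p] pos_swap[OF c] by simp
qed

text \<open>Both sides are multiplicative, so generators suffice.\<close>

lemma rho_phi:
 assumes x: "x = 0 | x = 1" and a: "a : carrier (HH x)"
 shows "rho (phi x a) = blk d0 (t x a) d0"
proof -
 interpret h: hecke q "lim x" .
 interpret t: alg_map "HH x" EW "t x" by (rule t_map[OF x])
 note bm = blk_mult[OF _ _ base_in base_in base_in, of _ _ d0, unfolded if_P[OF refl]]
 show ?thesis
  using a
 proof (rule h.hecke_induct)
  show "rho (phi x \<one>_(HH x)) = blk d0 (t x \<one>_(HH x)) d0" unfolding phi_one t.one by (rule box_rep_spec(2)[OF base_in])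
 next
  fix y z assume h: "y : carrier (HH x)" "z : carrier (HH x)" "rho (phi x y) = blk d0 (t x y) d0" "rho (phi x z) = blk d0 (t x z) d0"
  show "rho (phi x (y \<oplus>_(HH x) z)) = blk d0 (t x (y \<oplus>_(HH x) z)) d0"
   unfolding phi_add[OF h(1,2)] rho.add[OF phi_closed[OF h(1)] phi_closed[OF h(2)]] h(3,4) t.add[OF h(1,2)]
   by (rule blk_linear(1)[OF t.closed[OF h(1)] t.closed[OF h(2)] base_in, symmetric])
 next
  fix c y assume h: "y : carrier (HH x)" "rho (phi x y) = blk d0 (t x y) d0"
  show "rho (phi x (c \<odot>_(HH x) y)) = blk d0 (t x (c \<odot>_(HH x) y)) d0"
   unfolding phi_smult[OF h(1)] rho.smult[OF phi_closed[OF h(1)]] h(2) t.smult[OF h(1)]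
   by (rule blk_linear(2)[OF t.closed[OF h(1)] t.closed[OF h(1)] base_in, symmetric])
 next
  fix i y assume h: "i : {1..lim x}" "y : carrier (HH x)" "rho (phi x y) = blk d0 (t x y) d0"
  note Tc = h.T_closed[OF h(1)]
  show "rho (phi x (HT x i \<otimes>_(HH x) y)) = blk d0 (t x (HT x i \<otimes>_(HH x) y)) d0"
   unfolding phi_mult[OF Tc h(2)] rho.mult[OF phi_closed[OF Tc] phi_closed[OF h(2)]] unfolding phi_T[OF h(1)] rho_G[OF x h(1)] h(3)
    t.mult[OF Tc h(2)] g_def by (rule bm[OF t.closed[OF Tc] t.closed[OF h(2)]])
 qed
qed

lemma rho_corner:
 assumes a: "a : carrier (HH 0)" and b: "b : carrier (HH 1)"
 shows "rho (phi 0 a \<otimes>_A phi 1 b) = blk d0 (tensor_map V U (l a) (r b)) d0"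
proof -
 interpret t0: alg_map "HH 0" EW "t 0" by (rule t_map) simp
 interpret t1: alg_map "HH 1" EW "t 1" by (rule t_map) simp
 note p = rho_phi[of 0, OF _ a] rho_phi[of 1, OF _ b]
 show ?thesis
  unfolding rho.mult[OF phi_closed[OF a] phi_closed[OF b]] t_commute(1)[OF a b, symmetric]
  using p blk_mult[OF t0.closed[OF a] t1.closed[OF b] base_in base_in base_in, of d0] by simp
qed

lemma Z_base: "a : carrier (HH 0) ==> b : carrier (HH 1) ==> Z d0 a b d0 = phi 0 a \<otimes>_A phi 1 b"
 unfolding Z_def X_base by (simp add: phi_right phi_left phi_closed base_in A.m_assoc[symmetric])

lemma rho_Z_base:
 "a : carrier (HH 0) ==> b : carrier (HH 1) ==> v : carrier C ==>
  rho (Z d0 a b d0) v = inc d0 (tensor_map V U (l a) (r b) (v d0))"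
 by (simp only: Z_base rho_corner blk_def restrict_apply')

lemma rho_Z_zero:
 assumes a: "a : carrier (HH 0)" and b: "b : carrier (HH 1)" and d: "d : D"
  and z: "l a = \<zero>_EV | r b = \<zero>_EU" and v: "v : carrier C"
 shows "rho (Z d a b d) v = \<zero>_C"
proof -
 have ac: "l a : carrier EV" "r b : carrier EU" using L.closed[of a] R.closed[of b] a b by (simp_all add: lim_def del: End_alg_simps)
 have tz: "tensor_map V U (l a) (r b) = \<zero>_EW"
  using z
 proof
  assume z: "l a = \<zero>_EV"
  have "tensor_map V U (0 \<odot>_EV l a) (r b) = 0 \<odot>_EW tensor_map V U (l a) (r b)"
   by (rule tp.tensor_map_bilinear(3)[OF ac ac])
  thus ?thesis using ac z L.B.zero_smult[OF ac(1)] EW.zero_smult[OF tp.tensor_map_spec(1)[OF ac]] by (simp only:)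
 next
  assume z: "r b = \<zero>_EU"
  have "tensor_map V U (l a) (0 \<odot>_EU r b) = 0 \<odot>_EW tensor_map V U (l a) (r b)"
   by (rule tp.tensor_map_bilinear(4)[OF ac ac])
  thus ?thesis using ac z R.B.zero_smult[OF ac(2)] EW.zero_smult[OF tp.tensor_map_spec(1)[OF ac]] by (simp only:)
 qed
 have "blk d0 (0 \<odot>_EW \<zero>_EW) d0 = 0 \<odot>_EC blk d0 \<zero>_EW d0"
  by (rule blk_linear(2)[OF EW.zero_closed EW.zero_closed base_in])
 hence "blk d0 \<zero>_EW d0 = \<zero>_EC"
  using EC.zero_smult[OF blk_closed[OF EW.zero_closed base_in]] EW.zero_smult[OF EW.zero_closed] by (simp only:)
 hence c: "rho (phi 0 a \<otimes>_A phi 1 b) = \<zero>_EC" unfolding rho_corner[OF a b] tz .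
 note cl = X_closed[OF d] Y_closed[OF d] phi_closed[OF a] phi_closed[OF b]
 have "Z d a b d = X d \<otimes>_A ((phi 0 a \<otimes>_A phi 1 b) \<otimes>_A Y d)" unfolding Z_def using cl by (simp add: A.m_assoc)
 hence "rho (Z d a b d) = \<zero>_EC"
  using cl rho.closed[OF cl(1)] rho.closed[OF cl(2)] by (simp only: rho.mult A.m_closed c EC.l_null EC.r_null)
 thus ?thesis using v by simp
qed

end

section \<open>The structure theorem\<close>

text \<open>A rank-one projection onto \<open>u\<close> provides a functional \<open>c\<close> with
  \<open>c u = 1\<close>, and the bilinear map \<open>(v, y) \<mapsto> c(y) v\<close> does not kill
  \<open>(v, u)\<close>.\<close>

lemma (in tensor_pair) pt_nonzero:
 assumes v: "v : carrier V" "v ~= \<zero>_V" and u: "u : carrier U" "u ~= \<zero>_U"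
  and p: "p : carrier (End_alg U)" "p u = u" "!!y. y : carrier U ==> EX c. p y = c \<odot>_U u"
 shows "pt v u ~= \<zero>_(tensor V U)"
proof
 assume z: "pt v u = \<zero>_(tensor V U)"
 define c where "c y = (SOME c. p y = c \<odot>_U u)" for y
 have c: "p y = c y \<odot>_U u" if "y : carrier U" for y
  unfolding c_def by (rule someI_ex[OF p(3)[OF that]])
 have cu: "a = b" if "a \<odot>_U u = b \<odot>_U u" for a b
 proof -
  have "(a + (-1) * b) \<odot>_U u = a \<odot>_U u \<ominus>_U b \<odot>_U u"
   using u by (simp only: U.add_smult U.minus_smult U.smult_closed U.smult_smult)
  also have "... = \<zero>_U" unfolding that using u by (subst U.minus_eq_zero_iff) auto
  finally have "(a - b) \<odot>_U u = \<zero>_U" by simp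
  thus ?thesis using U.smult_eq_zero_iff[OF u(1)] u(2) by simp
 qed
 have cadd: "c (y \<oplus>_U y') = c y + c y'" if y: "y : carrier U" "y' : carrier U" for y y'
 proof (rule cu)
  have "p (y \<oplus>_U y') = p y \<oplus>_U p y'" using p(1) y by (simp add: End_carrier_iff)
  thus "c (y \<oplus>_U y') \<odot>_U u = (c y + c y') \<odot>_U u" using c y u by (simp add: U.add_smult)
 qed
 have csm: "c (a \<odot>_U y) = a * c y" if y: "y : carrier U" for y a
 proof (rule cu)
  have "p (a \<odot>_U y) = a \<odot>_U p y" using p(1) y by (simp add: End_carrier_iff)
  thus "c (a \<odot>_U y) \<odot>_U u = (a * c y) \<odot>_U u" using c y u by (simp add: U.smult_smult)
 qed
 have c1: "c u = 1" by (rule cu) (use c[OF u(1)] p(2) u in simp)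
 show False
 proof (rule tensor_universal[OF V.cspace_axioms, of "%v y. c y \<odot>_V v"])
  fix h assume h: "lin_map (tensor V U) V h" "!!v y. v : carrier V ==> y : carrier U ==> h (pt v y) = c y \<odot>_V v"
  have "h (pt v u) = v" using h(2)[OF v(1) u(1)] c1 v by simp
  moreover have "h (pt v u) = \<zero>_V" unfolding z by (rule lin_map.zero[OF h(1)])
  ultimately show False using v(2) by simp
 qed (simp_all add: cadd csm V.smult_add V.add_smult V.smult_smult mult.commute)
qed

lemma card_Dset: "card (Dset m n) = (m + n + 2) choose (n + 1)"
proof -
 let ?S = "{B. B <= {1..m+n+2} & card B = n + 1}"
 have "bij_betw (%d. {i : {1..m+n+2}. d i = 1}) (Dset m n) ?S"
 proof (rule bij_betw_byWitness[where f' = "%B. \<lambda>i\<in>{1..m+n+2}. if i : B then 1 else 0"])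
  show "\<forall>d\<in>Dset m n. (\<lambda>i\<in>{1..m+n+2}. if i : {i : {1..m+n+2}. d i = 1} then 1 else 0) = d"
  proof
   fix d assume d: "d : Dset m n"
   show "(\<lambda>i\<in>{1..m+n+2}. if i : {i : {1..m+n+2}. d i = 1} then 1 else 0) = d"
   proof
    fix i show "(\<lambda>i\<in>{1..m+n+2}. if i : {i : {1..m+n+2}. d i = 1} then 1 else 0) i = d i"
    proof (cases "i : {1..m+n+2}")
     case True thus ?thesis using Dset_binary[OF d True] by (simp only: restrict_apply' mem_Collect_eq simp_thms) auto
    next
     case False thus ?thesis using d by (simp only: restrict_apply if_False) (auto simp: Dset_def PiE_iff extensional_def)
    qed
   qed
  qed
  show "\<forall>B\<in>?S. {i : {1..m+n+2}. (\<lambda>i\<in>{1..m+n+2}. if i : B then 1 else 0) i = (1::nat)} = B" by (auto split: if_splits)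
  show "(%d. {i : {1..m+n+2}. d i = 1}) ` Dset m n <= ?S"
  proof (rule image_subsetI)
   fix d assume d: "d : Dset m n"
   show "{i : {1..m+n+2}. d i = 1} : ?S"
    using cnt_card[of 1 d "m + n + 2"] Dset_cnt(2)[OF d] by (intro CollectI conjI) (auto simp only: mem_Collect_eq)
  qed
  show "(%B. \<lambda>i\<in>{1..m+n+2}. if i : B then 1 else 0) ` ?S <= Dset m n"
  proof (rule image_subsetI)
   fix B assume B: "B : ?S"
   have "(\<Sum>i\<in>{1..m+n+2}. if i : B then 1 else 0) = card ({1..m+n+2} \<inter> B)"
    by (simp only: sum.inter_restrict[symmetric] finite_atLeastAtMost card_eq_sum)
   also have "{1..m+n+2} \<inter> B = B" using B by blast
   finally show "(\<lambda>i\<in>{1..m+n+2}. if i : B then 1 else 0) : Dset m n" using B by (simp add: Dset_def)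
  qed
 qed
 thus ?thesis using n_subsets[of "{1..m+n+2}" "n + 1"] bij_betw_same_card by fastforce
qed

text \<open>At the sorted word a diagonal unit acts as the tensor product of two rank-one projections; a
  unit of another block has a vanishing tensor factor.\<close>

lemma (in typeA) typeA_matrix_reps:
 assumes M: "matrix_reps (hecke_algebra q m) \<Lambda>m Bm u V l bm bm"
  and N: "matrix_reps (hecke_algebra q n) \<Lambda>n Bn v U r bn bn"
 shows "matrix_reps A (\<Lambda>m \<times> \<Lambda>n) (%(a, b). D \<times> Bm a \<times> Bn b) (unit u v)
  (%(a, b). box_space m n (V a) (U b)) (%(a, b). box_rep q m n (V a) (l a) (U b) (r b))
  (%(a, b). box.inc m n (V a) (U b) d0 (pure_tensor (V a) (U b) (bm a) (bn b))) (%(a, b). (d0, bm a, bn b))"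
proof (rule matrix_reps.intro[OF typeA_matrix_units])
 let ?C = "%(a, b). box_space m n (V a) (U b)"
 let ?R = "%(a, b). box_rep q m n (V a) (l a) (U b) (r b)"
 let ?w = "%(a, b). box.inc m n (V a) (U b) d0 (pure_tensor (V a) (U b) (bm a) (bn b))"
 let ?z = "%(a, b). (d0, bm a, bn b)"
 let ?I = "%(a, b). D \<times> Bm a \<times> Bn b"
 have e: "HH 0 = hecke_algebra q m" "HH 1 = hecke_algebra q n" by (simp_all add: lim_def)
 interpret M: matrix_reps "hecke_algebra q m" \<Lambda>m Bm u V l bm bm by (rule M)
 interpret N: matrix_reps "hecke_algebra q n" \<Lambda>n Bn v U r bn bn by (rule N)
 show "matrix_units (HH 0) \<Lambda>m Bm u" "matrix_units (HH 1) \<Lambda>n Bn v"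
  unfolding e by (rule M.matrix_units_axioms, rule N.matrix_units_axioms)
 have box: "box q m n (V a) (l a) (U b) (r b)" if "a : \<Lambda>m" "b : \<Lambda>n" for a b
  using M.reps[OF that(1)] N.reps[OF that(2)] by (rule box.intro)
 have um: "u a x y : carrier (HH 0)" if "a : \<Lambda>m" "x : Bm a" "y : Bm a" for a x y
  unfolding e using that by (rule M.u_closed)
 have vn: "v b x y : carrier (HH 1)" if "b : \<Lambda>n" "x : Bn b" "y : Bn b" for b x y
  unfolding e using that by (rule N.u_closed)
 show "matrix_reps_axioms A (\<Lambda>m \<times> \<Lambda>n) ?I (unit u v)
  ?C ?R
  ?w ?z"
 proof (rule matrix_reps_axioms.intro)
  fix p assume "p : \<Lambda>m \<times> \<Lambda>n"
  then obtain a b where p: "p = (a, b)" and ab: "a : \<Lambda>m" "b : \<Lambda>n" by blast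
  interpret box q m n "V a" "l a" "U b" "r b" by (rule box[OF ab])
  let ?t = "tensor_map (V a) (U b) (l a (u a (bm a) (bm a))) (r b (v b (bn b) (bn b)))"
  note ma = um[OF ab(1) M.z[OF ab(1)] M.z[OF ab(1)]] and nb = vn[OF ab(2) N.z[OF ab(2)] N.z[OF ab(2)]]
  note pc = tp.pt_closed[OF M.w(1)[OF ab(1)] N.w(1)[OF ab(2)]]
  have lc: "l a (u a (bm a) (bm a)) : carrier EV" using ma unfolding e by (rule L.closed)
  have rc: "r b (v b (bn b) (bn b)) : carrier EU" using nb unfolding e by (rule R.closed)
  have un: "unit u v (a, b) (d0, bm a, bn b) (d0, bm a, bn b) = Z d0 (u a (bm a) (bm a)) (v b (bn b) (bn b)) d0"
   by (simp add: unit_def)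
  have act: "rho (unit u v (a, b) (d0, bm a, bn b) (d0, bm a, bn b)) x = inc d0 (?t (x d0))"
   if "x : carrier C" for x
   unfolding un by (rule rho_Z_base[OF ma nb that])
  show "arep A (?C p) (?R p)"
   unfolding p prod.case by (rule arep_box)
  show "?z p : ?I p"
   unfolding p prod.case using base_in M.z[OF ab(1)] N.z[OF ab(2)] by simp
  show "?w p : carrier (?C p)"
   unfolding p prod.case by (rule inc_closed[OF pc])
  have nz: "tp.pt (bm a) (bn b) ~= \<zero>_W"
   by (rule tp.pt_nonzero[OF M.w[OF ab(1)] N.w[OF ab(2)] rc N.fix_w[OF ab(2)] N.rank_one[OF ab(2)]])
  show "?w p ~= \<zero>_(?C p)"
   unfolding p prod.case
  proof
   assume "inc d0 (tp.pt (bm a) (bn b)) = \<zero>_C"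
   from fun_cong[OF this, of d0] show False using nz base_in by (simp add: inc_eval C_simps)
  qed
  show "?R p (unit u v p (?z p) (?z p))
    (?w p)
   = ?w p"
   unfolding p prod.case act[OF inc_closed[OF pc]] inc_eval[OF base_in base_in] if_P[OF refl]
    tp.tensor_map_spec(2)[OF lc rc M.w(1)[OF ab(1)] N.w(1)[OF ab(2)]] M.fix_w[OF ab(1)] N.fix_w[OF ab(2)] ..
  fix x assume "x : carrier (?C p)"
  hence x: "x : carrier C" unfolding p prod.case .
  have "EX c. ?t y = c \<odot>_W tp.pt (bm a) (bn b)"
   if "y : carrier W" for y
   using that
  proof (induction rule: tp.tensor_induct)
   case (pure s t)
   obtain c c' where c: "l a (u a (bm a) (bm a)) s = c \<odot>_(V a) bm a" "r b (v b (bn b) (bn b)) t = c' \<odot>_(U b) bn b"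
    using M.rank_one[OF ab(1) pure(1)] N.rank_one[OF ab(2) pure(2)] by blast
   have "?t (tp.pt s t) = (c * c') \<odot>_W tp.pt (bm a) (bn b)"
    unfolding tp.tensor_map_spec(2)[OF lc rc pure] c
    using M.w(1)[OF ab(1)] N.w(1)[OF ab(2)] by (simp add: tp.pt_smult_left tp.pt_smult_right tp.T.smult_smult mult.commute)
   thus ?case by (rule exI)
  next
   case (add y z)
   then obtain c c' where c: "?t y = c \<odot>_W tp.pt (bm a) (bn b)"
    "?t z = c' \<odot>_W tp.pt (bm a) (bn b)" by blast
   have "?t (y \<oplus>_W z) = (c + c') \<odot>_W tp.pt (bm a) (bn b)"
    using tp.tensor_map_spec(1)[OF lc rc] add(1,2) pc unfolding End_carrier_iff by (simp add: c tp.T.add_smult)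
   thus ?case by (rule exI)
  qed
  from this[OF C_eval[OF x base_in]] obtain c where
   "?t (x d0) = c \<odot>_W tp.pt (bm a) (bn b)" by blast
  hence "rho (unit u v (a, b) (d0, bm a, bn b) (d0, bm a, bn b)) x = c \<odot>_C inc d0 (tp.pt (bm a) (bn b))"
   unfolding act[OF x] by (simp only: inc_linear(2)[OF pc])
  thus "EX c. ?R p (unit u v p (?z p) (?z p)) x
   = c \<odot>_(?C p) ?w p"
   unfolding p prod.case by (rule exI)
 next
  fix p p' i x assume "p : \<Lambda>m \<times> \<Lambda>n" "p' : \<Lambda>m \<times> \<Lambda>n" and ne: "p ~= p'"
   and i: "i : ?I p'" and x: "x : carrier (?C p)"
  then obtain a b a' b' where p: "p = (a, b)" "p' = (a', b')" and ab: "a : \<Lambda>m" "b : \<Lambda>n" "a' : \<Lambda>m" "b' : \<Lambda>n" by blast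
  obtain d s t where dst: "i = (d, s, t)" "d : D" "s : Bm a'" "t : Bn b'" using i unfolding p by auto
  interpret box q m n "V a" "l a" "U b" "r b" by (rule box[OF ab(1,2)])
  note ma = um[OF ab(3) dst(3,3)] and nb = vn[OF ab(4) dst(4,4)]
  have "l a (u a' s s) = \<zero>_EV | r b (v b' t t) = \<zero>_EU"
  proof (cases "a = a'")
   case True
   hence "b ~= b'" using ne p by simp
   have "r b (v b' t t) = \<zero>_EU"
   proof (rule End_eqI)
    show "r b (v b' t t) : carrier EU" using nb unfolding e by (rule R.closed)
    show "\<zero>_EU : carrier EU" by (rule R.B.zero_closed)
    fix y assume "y : carrier (U b)"
    thus "r b (v b' t t) y = \<zero>_EU y" using N.other[OF ab(2,4) \<open>b ~= b'\<close> dst(4)] by simp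
   qed
   thus ?thesis ..
  next
   case False
   have "l a (u a' s s) = \<zero>_EV"
   proof (rule End_eqI)
    show "l a (u a' s s) : carrier EV" using ma unfolding e by (rule L.closed)
    show "\<zero>_EV : carrier EV" by (rule L.B.zero_closed)
    fix y assume "y : carrier (V a)"
    thus "l a (u a' s s) y = \<zero>_EV y" using M.other[OF ab(1,3) False dst(3)] by simp
   qed
   thus ?thesis ..
  qed
  moreover have "x : carrier C" using x unfolding p prod.case .
  ultimately have "rho (Z d (u a' s s) (v b' t t) d) x = \<zero>_C" by (rule rho_Z_zero[OF ma nb dst(2)])
  thus "?R p (unit u v p' i i) x = \<zero>_(?C p)"
   unfolding p dst(1) unit_def prod.case .
 qed
qed

theorem theorem2p6:
  fixes m n :: nat and q :: complex
    and \<Lambda>\<^sub>m :: "'l set" and V :: "'l \<Rightarrow> 'v cspace"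
    and l :: "'l \<Rightarrow> (nat list \<Rightarrow> complex) set \<Rightarrow> 'v \<Rightarrow> 'v"
    and \<Lambda>\<^sub>n :: "'k set" and U :: "'k \<Rightarrow> 'u cspace"
    and r :: "'k \<Rightarrow> (nat list \<Rightarrow> complex) set \<Rightarrow> 'u \<Rightarrow> 'u"
  assumes "complete_irreps TYPE(nat \<Rightarrow> complex) (hecke_algebra q m) \<Lambda>\<^sub>m V l"
    and "complete_irreps TYPE(nat \<Rightarrow> complex) (hecke_algebra q n) \<Lambda>\<^sub>n U r"
    and "q * poincare m q * poincare n q \<noteq> 0"
  shows "let A = A_algebra q m n;
             \<Lambda> = \<Lambda>\<^sub>m \<times> \<Lambda>\<^sub>n;
             C = (\<lambda>(a, b). box_space m n (V a) (U b));
             \<rho> = (\<lambda>(a, b). box_rep q m n (V a) (l a) (U b) (r b))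
         in (\<lambda>x. \<lambda>p\<in>\<Lambda>. \<rho> p x) \<in> algebra_iso A (dsum \<Lambda> (\<lambda>p. End_alg (C p))) \<and>
            vectorspace.fin_dim Cx A \<and>
            real (vectorspace.dim Cx A) = (fact (m + n + 2))\<^sup>2 / (fact (m + 1) * fact (n + 1)) \<and>
            semisimple_algebra A \<and>
            complete_irreps TYPE('w) A \<Lambda> C \<rho>"
proof -
 have q: "q ~= 0" and nz: "poincare m q ~= 0" "poincare n q ~= 0" using assms(3) by auto
 interpret hm: hecke q m .
 interpret hn: hecke q n .
 interpret typeA q m n .
 obtain Bm u bm where M: "matrix_reps (hecke_algebra q m) \<Lambda>\<^sub>m Bm u V l bm bm" "(\<Sum>i\<in>\<Lambda>\<^sub>m. (card (Bm i))\<^sup>2) = fact (Suc m)"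
  by (rule hm.hecke_matrix_units[OF assms(1) q nz(1)])
 obtain Bn v bn where N: "matrix_reps (hecke_algebra q n) \<Lambda>\<^sub>n Bn v U r bn bn" "(\<Sum>i\<in>\<Lambda>\<^sub>n. (card (Bn i))\<^sup>2) = fact (Suc n)"
  by (rule hn.hecke_matrix_units[OF assms(2) q nz(2)])
 note R = typeA_matrix_reps[OF M(1) N(1)]
 have "vectorspace.dim Cx A = (\<Sum>p\<in>\<Lambda>\<^sub>m \<times> \<Lambda>\<^sub>n. (card ((%(a, b). D \<times> Bm a \<times> Bn b) p))\<^sup>2)"
  by (rule matrix_reps.dimension[OF R])
 also have "... = (\<Sum>p\<in>\<Lambda>\<^sub>m \<times> \<Lambda>\<^sub>n. (card D)\<^sup>2 * ((card (Bm (fst p)))\<^sup>2 * (card (Bn (snd p)))\<^sup>2))"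
  by (rule sum.cong) (auto simp: card_cartesian_product power_mult_distrib)
 also have "... = (card D)\<^sup>2 * ((\<Sum>a\<in>\<Lambda>\<^sub>m. (card (Bm a))\<^sup>2) * (\<Sum>b\<in>\<Lambda>\<^sub>n. (card (Bn b))\<^sup>2))"
  unfolding sum_product sum.cartesian_product case_prod_beta unfolding sum_distrib_left ..
 also have "... = (card D)\<^sup>2 * (fact (m + 1) * fact (n + 1))" using M(2) N(2) by (simp only: Suc_eq_plus1)
 finally have dim: "vectorspace.dim Cx A = (card D)\<^sup>2 * (fact (m + 1) * fact (n + 1))" .
 have "real (card D) = fact (m + n + 2) / (fact (n + 1) * fact (m + n + 2 - (n + 1)))"
  unfolding card_Dset by (rule binomial_fact) simp
 moreover have "m + n + 2 - (n + 1) = m + 1" by simp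
 ultimately have "real (card D) = fact (m + n + 2) / (fact (n + 1) * fact (m + 1))" by (simp only:)
 hence "real (vectorspace.dim Cx A) = (fact (m + n + 2) / (fact (n + 1) * fact (m + 1)))\<^sup>2 * (fact (m + 1) * fact (n + 1))"
  unfolding dim by (simp only: of_nat_mult of_nat_power of_nat_fact)
 also have "... = (fact (m + n + 2))\<^sup>2 / (fact (m + 1) * fact (n + 1))"
 proof -
  have "(x / (b * a))\<^sup>2 * (a * b) = x\<^sup>2 / (a * b)" if "a ~= 0" "b ~= 0" for x a b :: real
   using that by (simp add: field_simps power2_eq_square)
  thus ?thesis by (simp only: fact_nonzero not_False_eq_True)
 qed
 finally have "real (vectorspace.dim Cx A) = (fact (m + n + 2))\<^sup>2 / (fact (m + 1) * fact (n + 1))" .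
 thus ?thesis
  unfolding Let_def
  using matrix_reps.joint_iso[OF R] matrix_reps.fin_dim[OF R] matrix_units.semisimple[OF matrix_reps.axioms(1)[OF R]]
   matrix_reps.complete[OF R, where 'w = 'w]
  by (intro conjI)
qed

end
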